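(* The line scheme $\mathbb L\subseteq \mathbb G(1,3)\subseteq\mathbb P^5$ of $A$ is a reduced curve of degree $20$. It is the union of 3 disjoint quartic elliptic curves $E_j\cong E/\langle \xi_j\rangle$, $j=1,2,3$, and 4 disjoint plane conics $C_0,C_1,C_2,C_3$, $$\mathbb L \;=\; \big(E_1\sqcup E_2\sqcup E_3\big)\;\bigcup\;\big(C_0\sqcup C_1\sqcup C_2\sqcup C_3\big),$$ having the property that $|C_i\cap E_j|=2$ for all $(i,j)\in\{0,1,2,3\}\times\{1,2,3\}$.
   Context: Let $k$ be an algebraically closed field of characteristic $\neq 2,3$. Let $\alpha_1,\alpha_2,\alpha_3\in k\setminus\{0,1,-1\}$ satisfy $\alpha_1+\alpha_2+\alpha_3+\alpha_1\alpha_2\alpha_3=0$; write $\alpha=\alpha_1$, $\beta=\alpha_2$, $\gamma=\alpha_3$, and fix $\mathbf i\in k$ with $\mathbf i^2=-1$. $A$ is the graded $k$-algebra generated by $y_0,y_1,y_2,y_3$ in degree one subject to the six relations $y_0y_i-y_iy_0=\alpha_i(y_jy_k-y_ky_j)$ and $y_0y_i+y_iy_0=y_jy_k+y_ky_j$, where $(i,j,k)$ runs over the cyclic permutations of $(1,2,3)$. (It equals $(S\otimes M_2(k))^\Gamma$ for the 4-dimensional Sklyanin algebra $S$ generated by $x_0,\dots,x_3$ and $\Gamma=(\mathbb Z/2)^2$.) $E\subseteq\mathbb P^3$, with homogeneous coordinates $x_0,\dots,x_3$, is the elliptic curve $x_0^2+x_1^2+x_2^2+x_3^2=x_0^2-\beta\gamma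 x_1^2-\gamma x_2^2+\beta x_3^2=0$. Its identity $o$ is a point of $E\cap\{x_0=0\}$, and four points of $E$ are coplanar (with multiplicity) iff their sum is $o$. The 2-torsion subgroup is $E[2]=\{o=\xi_0,\xi_1,\xi_2,\xi_3\}$, where for $p=(\lambda_0,\lambda_1,\lambda_2,\lambda_3)\in E$: $p+\xi_1=(\lambda_0,\lambda_1,-\lambda_2,-\lambda_3)$, $p+\xi_2=(\lambda_0,-\lambda_1,\lambda_2,-\lambda_3)$, $p+\xi_3=(\lambda_0,-\lambda_1,-\lambda_2,\lambda_3)$. This $\mathbb P^3$ is identified with $\mathbb P(A_1^* )$ via $x_0=y_0$, $x_1=\mathbf i y_1$, $x_2=\mathbf i y_2$, $x_3=y_3$. A line module for $A$ is a graded left $A$-module $L=AL_0$ with Hilbert series $(1-t)^{-2}$. Each is isomorphic to $A/AU$ for a unique 2-dimensional subspace $U\subseteq A_1$, equivalently for a unique line $\{U=0\}$ in $\mathbb P(A_1^* )\cong\mathbb P^3$. The line scheme $\mathbb L$ of $A$ (Shelton–Vancliff) is the fine moduli space of line modules: it represents the functor sending a commutative $k$-algebra $R$ to the set of isomorphism classes of graded $R\otimes A$-modules $L$ generated by $L_0\cong R$ with each $L_n$ projective over $R$ of rank $n+1$. It is a closed subscheme of the Grassmannian $\mathbb G(1,3)$ of lines in $\mathbb P(A_1^* )$; concretely, it is the locus of those 2-dimensional $U\subseteq A_1$ for which the multiplication map $A_1\otimes U\to A_2$ is not injective, with its determinantal scheme structure. The degree of a closed subscheme of $\mathbb G(1,3)$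 is its degree in the Plücker $\mathbb P^5$. Plücker coordinates: the line $\sum\lambda_jy_j=\sum\lambda_j'y_j=0$ has coordinates $z_{rs}=\lambda_r\lambda_s'-\lambda_r'\lambda_s$. $E_j\subseteq\mathbb G(1,3)$ is the image of the closed immersion $E/\langle\xi_j\rangle\to\mathbb G(1,3)$ sending $p+\langle \xi_j\rangle$ to the secant line through $p$ and $p+\xi_j$. The $C_j$ are the intersections of $\mathbb G(1,3)$ with planes: $C_0$: $z_{23}+\alpha z_{01}=z_{13}-\beta z_{02}=z_{12}+\gamma z_{03}=0$; $C_1$: $z_{23}-\alpha z_{01}=z_{13}+z_{02}=z_{12}+z_{03}=0$; $C_2$: $z_{23}+z_{01}=z_{13}+\beta z_{02}=z_{12}-z_{03}=0$; $C_3$: $z_{23}-z_{01}=z_{13}-z_{02}=z_{12}-\gamma z_{03}=0$.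
   Formalization: For E_3 the identification of coordinates is taken to be x_0=y_0, x_1=i y_1, x_2=y_2, x_3=i y_3; with the stated identification the secant lines through p and p+ξ_3 do not all lie in the line scheme, for any admissible parameters. *)

theory Defs
  imports
    "HOL-Analysis.Analysis"
    "HOL-Library.Poly_Mapping"
    "HOL-Computational_Algebra.Computational_Algebra"
begin

section \<open>Polynomials and ideals\<close>

type_synonym ('x, 'k) mpoly = "('x \<Rightarrow>\<^sub>0 nat) \<Rightarrow>\<^sub>0 'k"

text \<open>
  Constants are defined for arbitrary exponent monoids, since they also serve the free algebra below.
\<close>

definition Const :: "'k::zero \<Rightarrow> 'm::zero \<Rightarrow>\<^sub>0 'k" where
  "Const c = Poly_Mapping.single 0 c"

definition Var :: "'x \<Rightarrow> ('x, 'k::zero_neq_one) mpoly" where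
  "Var x = Poly_Mapping.single (Poly_Mapping.single x 1) 1"

abbreviation scale :: "'k::semiring_1 \<Rightarrow> ('m::monoid_add \<Rightarrow>\<^sub>0 'k) \<Rightarrow> ('m \<Rightarrow>\<^sub>0 'k)" where
  "scale c f \<equiv> Const c * f"

definition aeval :: "('k::zero \<Rightarrow> 'r::comm_ring_1) \<Rightarrow> ('x \<Rightarrow> 'r) \<Rightarrow> ('x, 'k) mpoly \<Rightarrow> 'r" where
  "aeval c g f = (\<Sum>m\<in>Poly_Mapping.keys f. c (Poly_Mapping.lookup f m) *
     (\<Prod>x\<in>Poly_Mapping.keys m. g x ^ Poly_Mapping.lookup m x))"

definition peval :: "'k^'x \<Rightarrow> ('x, 'k::comm_ring_1) mpoly \<Rightarrow> 'k" where
  "peval v f = aeval (\<lambda>c. c) (\<lambda>x. v $ x) f"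

definition psubst :: "('x \<Rightarrow> ('y, 'k) mpoly) \<Rightarrow> ('x, 'k::comm_ring_1) mpoly \<Rightarrow> ('y, 'k) mpoly" where
  "psubst g f = aeval Const g f"

definition partial :: "'x \<Rightarrow> ('x, 'k::comm_ring_1) mpoly \<Rightarrow> ('x, 'k) mpoly" where
  "partial x f = (\<Sum>m\<in>Poly_Mapping.keys f.
     Poly_Mapping.single (m - Poly_Mapping.single x 1)
       (of_nat (Poly_Mapping.lookup m x) * Poly_Mapping.lookup f m))"

definition homogeneous :: "nat \<Rightarrow> ('x, 'k::zero) mpoly \<Rightarrow> bool" where
  "homogeneous d f \<longleftrightarrow>
     (\<forall>m\<in>Poly_Mapping.keys f. (\<Sum>x\<in>Poly_Mapping.keys m. Poly_Mapping.lookup m x) = d)"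

definition ideal_gen :: "'r::comm_ring_1 set \<Rightarrow> 'r set" where
  "ideal_gen G = module.span (*) G"

section \<open>Points of projective space\<close>

text \<open>
  A point of projective space is the set of its non-zero homogeneous coordinate vectors.
\<close>

definition proj_point :: "'k::field^'x \<Rightarrow> ('k^'x) set" where
  "proj_point v = {c *s v |c. c \<noteq> 0}"

definition proj_space :: "('k::field^'x) set set" where
  "proj_space = {proj_point v |v. v \<noteq> 0}"

text \<open>
  Vanishing on \<^emph>\<open>all\<close> representatives: over an infinite field this means that every homogeneous
  component vanishes at the point.
\<close>

definition vanishes :: "('x, 'k::field) mpoly \<Rightarrow> ('k^'x) set \<Rightarrow> bool" where
  "vanishes f P \<longleftrightarrow> (\<forall>v\<in>P. peval v f = 0)"

definition zeros :: "('x, 'k::field) mpoly set \<Rightarrow> ('k^'x) set set" where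
  "zeros F = {P \<in> proj_space. \<forall>f\<in>F. vanishes f P}"

definition vanishing_ideal :: "('k::field^'x) set set \<Rightarrow> ('x, 'k) mpoly set" where
  "vanishing_ideal X = {f. \<forall>P\<in>X. vanishes f P}"

definition zariski_closed :: "('k::field^'x) set set \<Rightarrow> bool" where
  "zariski_closed X \<longleftrightarrow> (\<exists>F. X = zeros F)"

definition irreducible_closed :: "('k::field^'x) set set \<Rightarrow> bool" where
  "irreducible_closed X \<longleftrightarrow> zariski_closed X \<and> X \<noteq> {} \<and>
     (\<forall>Y Z. zariski_closed Y \<and> zariski_closed Z \<and> X = Y \<union> Z \<longrightarrow> X = Y \<or> X = Z)"

definition irreducible_component :: "('k::field^'x) set set \<Rightarrow> ('k^'x) set set \<Rightarrow> bool" where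
  "irreducible_component X Z \<longleftrightarrow> Z \<subseteq> X \<and> irreducible_closed Z \<and>
     (\<forall>Y. irreducible_closed Y \<and> Z \<subseteq> Y \<and> Y \<subseteq> X \<longrightarrow> Y = Z)"

section \<open>Closed subschemes of projective space\<close>

text \<open>
  A closed subscheme is given by a homogeneous ideal; two homogeneous ideals give the same
  subscheme iff their saturations by the irrelevant ideal agree.  The scheme-theoretic union
  corresponds to the intersection of ideals, and a closed set with its reduced structure to its
  vanishing ideal.
\<close>

definition saturation :: "('x, 'k::field) mpoly set \<Rightarrow> ('x, 'k) mpoly set" where
  "saturation I = {f. \<forall>x. \<exists>N. Var x ^ N * f \<in> I}"

definition subscheme :: "('x, 'k::field) mpoly set \<Rightarrow> ('x, 'k) mpoly set \<Rightarrow> bool" where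
  "subscheme I J \<longleftrightarrow> saturation J \<subseteq> saturation I"

definition same_subscheme :: "('x, 'k::field) mpoly set \<Rightarrow> ('x, 'k) mpoly set \<Rightarrow> bool" where
  "same_subscheme I J \<longleftrightarrow> saturation I = saturation J"

text \<open>
  Reducedness is tested on the standard affine charts: the coordinate ring of the chart where \<open>x\<close>
  is invertible is the quotient by \<open>I\<close> and \<open>x - 1\<close>.
\<close>

definition reduced_scheme :: "('x, 'k::field) mpoly set \<Rightarrow> bool" where
  "reduced_scheme I \<longleftrightarrow>
     (\<forall>x f n. f ^ n \<in> ideal_gen (insert (Var x - 1) I) \<longrightarrow> f \<in> ideal_gen (insert (Var x - 1) I))"

definition hilbert_function :: "('x, 'k::field) mpoly set \<Rightarrow> nat \<Rightarrow> nat" where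
  "hilbert_function I d =
     vector_space.dim scale {f :: ('x, 'k) mpoly. homogeneous d f} -
     vector_space.dim scale {f \<in> I. homogeneous d f}"

definition hilbert_poly :: "('x, 'k::field) mpoly set \<Rightarrow> rat poly" where
  "hilbert_poly I =
     (THE p. \<forall>\<^sub>F d in sequentially. poly p (of_nat d) = of_nat (hilbert_function I d))"

text \<open>The dimension of a non-empty closed subscheme is the degree of its Hilbert polynomial.\<close>

definition scheme_dim :: "('x, 'k::field) mpoly set \<Rightarrow> nat" where
  "scheme_dim I = degree (hilbert_poly I)"

definition scheme_degree :: "('x, 'k::field) mpoly set \<Rightarrow> rat" where
  "scheme_degree I = fact (scheme_dim I) * lead_coeff (hilbert_poly I)"

definition is_curve :: "('x::finite, 'k::field) mpoly set \<Rightarrow> bool" where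
  "is_curve I \<longleftrightarrow> zeros I \<noteq> {} \<and>
     (\<forall>Z. irreducible_component (zeros I) Z \<longrightarrow> scheme_dim (vanishing_ideal Z) = 1)"

text \<open>The Jacobian criterion.\<close>

definition nonsingular :: "('k::field^'x::finite) set set \<Rightarrow> bool" where
  "nonsingular X \<longleftrightarrow> (\<forall>P\<in>X. \<forall>v\<in>P.
     vec.dim {(\<chi> x. peval v (partial x f)) |f. f \<in> vanishing_ideal X} +
       scheme_dim (vanishing_ideal X) + 1 = CARD('x))"

text \<open>
  For a curve with Hilbert polynomial \<open>p\<close> the arithmetic genus is \<open>1 - p(0)\<close>; for a
  nonsingular irreducible curve it is the genus.
\<close>

definition elliptic_curve :: "('k::field^'x::finite) set set \<Rightarrow> bool" where
  "elliptic_curve X \<longleftrightarrow> irreducible_closed X \<and> scheme_dim (vanishing_ideal X) = 1 \<and>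
     nonsingular X \<and> 1 - poly (hilbert_poly (vanishing_ideal X)) 0 = 1"

text \<open>An irreducible curve of degree two in a plane \<open>\<Lambda> = 0\<close>.\<close>

definition plane_conic :: "('x::finite, 'k::field) mpoly set \<Rightarrow> bool" where
  "plane_conic I \<longleftrightarrow> irreducible_closed (zeros I) \<and>
     (\<exists>\<Lambda> q. (\<forall>l\<in>\<Lambda>. homogeneous 1 l) \<and> \<not> module.dependent scale \<Lambda> \<and>
        finite \<Lambda> \<and> card \<Lambda> + 3 = CARD('x) \<and>
        homogeneous 2 q \<and> q \<notin> ideal_gen \<Lambda> \<and> same_subscheme I (ideal_gen (insert q \<Lambda>)))"

section \<open>Varieties as spaces with functions\<close>

text \<open>
  Functions on an open set \<open>U\<close> are represented by total functions of which only the values on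
  \<open>U\<close> matter.
\<close>

record ('p, 'k) fspace =
  points :: "'p set"
  opens :: "'p set set"
  regular :: "'p set \<Rightarrow> ('p \<Rightarrow> 'k) set"

definition zariski_open_in :: "('k::field^'x) set set \<Rightarrow> ('k^'x) set set \<Rightarrow> bool" where
  "zariski_open_in X U \<longleftrightarrow> (\<exists>Z. zariski_closed Z \<and> U = X - Z)"

definition variety :: "('k::field^'x) set set \<Rightarrow> (('k^'x) set, 'k) fspace" where
  "variety X = \<lparr>points = X, opens = {U. zariski_open_in X U},
     regular = (\<lambda>U. {f. \<forall>P\<in>U. \<exists>V g h d. zariski_open_in X V \<and> P \<in> V \<and> V \<subseteq> U \<and>
       homogeneous d g \<and> homogeneous d h \<and>
       (\<forall>Q\<in>V. \<forall>v\<in>Q. peval v h \<noteq> 0 \<and> f Q = peval v g / peval v h)})\<rparr>"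

text \<open>
  The quotient by an involution \<open>\<tau>\<close>: orbits with the quotient topology and the invariant
  functions.
\<close>

definition quotient :: "('p, 'k) fspace \<Rightarrow> ('p \<Rightarrow> 'p) \<Rightarrow> ('p set, 'k) fspace" where
  "quotient X \<tau> = \<lparr>points = (\<lambda>p. {p, \<tau> p}) ` points X,
     opens = {W. W \<subseteq> (\<lambda>p. {p, \<tau> p}) ` points X \<and> \<Union>W \<in> opens X},
     regular = (\<lambda>W. {f. (\<lambda>p. f {p, \<tau> p}) \<in> regular X (\<Union>W)})\<rparr>"

definition fspace_iso :: "('p, 'k) fspace \<Rightarrow> ('q, 'k) fspace \<Rightarrow> ('p \<Rightarrow> 'q) \<Rightarrow> bool" where
  "fspace_iso X Y h \<longleftrightarrow> bij_betw h (points X) (points Y) \<and>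
     (\<forall>U. U \<subseteq> points X \<longrightarrow> (U \<in> opens X \<longleftrightarrow> h ` U \<in> opens Y)) \<and>
     (\<forall>U\<in>opens X. \<forall>f. f \<in> regular Y (h ` U) \<longleftrightarrow> f \<circ> h \<in> regular X U)"

section \<open>The algebra \<open>A\<close>\<close>

text \<open>
  The free algebra on generators indexed by \<open>'g\<close> is the monoid algebra of words over \<open>'g\<close>.
\<close>

datatype 'g word = Word "'g list"

instantiation word :: (type) monoid_add
begin

definition zero_word :: "'a word" where
  "zero_word = Word []"

fun plus_word :: "'a word \<Rightarrow> 'a word \<Rightarrow> 'a word" where
  "plus_word (Word u) (Word v) = Word (u @ v)"

instance
proof
  fix a b c :: "'a word"
  show "a + b + c = a + (b + c)"
    by (cases a; cases b; cases c) simp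
  show "0 + a = a" "a + 0 = a"
    by (cases a; simp add: zero_word_def)+
qed

end

type_synonym ('g, 'k) free_algebra = "'g word \<Rightarrow>\<^sub>0 'k"

definition gen :: "'g \<Rightarrow> ('g, 'k::zero_neq_one) free_algebra" where
  "gen j = Poly_Mapping.single (Word [j]) 1"

inductive_set two_sided_ideal :: "'r::ring_1 set \<Rightarrow> 'r set" for G where
  zero: "0 \<in> two_sided_ideal G"
| add: "x \<in> two_sided_ideal G \<Longrightarrow> y \<in> two_sided_ideal G \<Longrightarrow> x + y \<in> two_sided_ideal G"
| mult: "g \<in> G \<Longrightarrow> a * g * b \<in> two_sided_ideal G"

text \<open>Generators are indexed by the four-element type \<open>4\<close>, whose elements are \<open>0, 1, 2, 3\<close>.\<close>

definition A_relations :: "'k::field \<Rightarrow> 'k \<Rightarrow> 'k \<Rightarrow> (4, 'k) free_algebra set" where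
  "A_relations \<alpha> \<beta> \<gamma> = (\<Union>(a, i, j, k) \<in> {(\<alpha>, 1, 2, 3), (\<beta>, 2, 3, 1), (\<gamma>, 3, 1, 2)}.
     {gen 0 * gen i - gen i * gen 0 - scale a (gen j * gen k - gen k * gen j),
      gen 0 * gen i + gen i * gen 0 - (gen j * gen k + gen k * gen j)})"

definition A_ideal :: "'k::field \<Rightarrow> 'k \<Rightarrow> 'k \<Rightarrow> (4, 'k) free_algebra set" where
  "A_ideal \<alpha> \<beta> \<gamma> = two_sided_ideal (A_relations \<alpha> \<beta> \<gamma>)"

text \<open>Linear functionals on \<open>A\<close>, as functionals on the free algebra that kill the relations.\<close>

definition A_functionals :: "'k::field \<Rightarrow> 'k \<Rightarrow> 'k \<Rightarrow> ((4, 'k) free_algebra \<Rightarrow> 'k) set" where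
  "A_functionals \<alpha> \<beta> \<gamma> =
     {\<phi>. Vector_Spaces.linear scale (*) \<phi> \<and> (\<forall>f\<in>A_ideal \<alpha> \<beta> \<gamma>. \<phi> f = 0)}"

section \<open>The line scheme\<close>

datatype pl = Z01 | Z02 | Z03 | Z12 | Z13 | Z23

lemma UNIV_pl: "(UNIV :: pl set) = {Z01, Z02, Z03, Z12, Z13, Z23}"
  using pl.exhaust by blast

instance pl :: finite
  by standard (simp add: UNIV_pl)

fun pl_index :: "pl \<Rightarrow> 4 \<times> 4" where
  "pl_index Z01 = (0, 1)"
| "pl_index Z02 = (0, 2)"
| "pl_index Z03 = (0, 3)"
| "pl_index Z12 = (1, 2)"
| "pl_index Z13 = (1, 3)"
| "pl_index Z23 = (2, 3)"

definition pluecker :: "(4 \<Rightarrow> 'r) \<Rightarrow> (4 \<Rightarrow> 'r) \<Rightarrow> pl \<Rightarrow> 'r::comm_ring_1" where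
  "pluecker l l' e = (case pl_index e of (r, s) \<Rightarrow> l r * l' s - l' r * l s)"

definition grassmannian :: "(pl, 'k::field) mpoly set" where
  "grassmannian = ideal_gen {Var Z01 * Var Z23 - Var Z02 * Var Z13 + Var Z03 * Var Z12}"

text \<open>
  The subspace \<open>U\<close> of \<open>A\<^sub>1\<close> spanned by \<open>u\<^sub>0 = \<Sum>\<^sub>j \<lambda>\<^sub>j y\<^sub>j\<close> and \<open>u\<^sub>1 = \<Sum>\<^sub>j \<lambda>'\<^sub>j y\<^sub>j\<close> is described by
  indeterminates \<open>Var (0, j) = \<lambda>\<^sub>j\<close> and \<open>Var (1, j) = \<lambda>'\<^sub>j\<close>.  The multiplication map sends the basis
  element \<open>y\<^sub>r \<otimes> u\<^sub>s\<close> of \<open>A\<^sub>1 \<otimes> U\<close> to \<open>\<Sum>\<^sub>j Var (s, j) y\<^sub>r y\<^sub>j\<close>.  Its \<open>8 \<times> 8\<close> minors with respect to a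
  basis of \<open>A\<^sub>2\<close> generate the same ideal as the determinants below, in which the rows are given by
  eight arbitrary functionals and the columns by the pairs \<open>(r, s)\<close>.
\<close>

definition line_minors :: "'k::field \<Rightarrow> 'k \<Rightarrow> 'k \<Rightarrow> (2 \<times> 4, 'k) mpoly set" where
  "line_minors \<alpha> \<beta> \<gamma> =
     {det (\<chi> a c. \<Sum>j\<in>UNIV. Const (\<phi> a (gen (fst c) * gen j)) * Var (snd c, j)) |
       \<phi> :: 4 \<times> 2 \<Rightarrow> (4, 'k) free_algebra \<Rightarrow> 'k. \<forall>a. \<phi> a \<in> A_functionals \<alpha> \<beta> \<gamma>}"

definition generic_pluecker :: "pl \<Rightarrow> (2 \<times> 4, 'k::field) mpoly" where
  "generic_pluecker = pluecker (\<lambda>j. Var (0, j)) (\<lambda>j. Var (1, j))"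

text \<open>
  The space of \<open>2 \<times> 4\<close> matrices of rank two is a \<open>GL\<^sub>2\<close>-torsor over the Grassmannian (hence
  faithfully flat), and is covered by the open sets where one Pluecker coordinate is invertible.
  A form in the Pluecker coordinates therefore vanishes on the determinantal subscheme iff, after
  inverting any \<open>z\<^sub>r\<^sub>s\<close>, its pullback to matrices lies in the ideal of the minors.
\<close>

definition line_scheme :: "'k::field \<Rightarrow> 'k \<Rightarrow> 'k \<Rightarrow> (pl, 'k) mpoly set" where
  "line_scheme \<alpha> \<beta> \<gamma> =
     {f. \<forall>e. \<exists>N. generic_pluecker e ^ N * psubst generic_pluecker f
                   \<in> ideal_gen (line_minors \<alpha> \<beta> \<gamma>)}"

section \<open>The elliptic curves and the conics\<close>

definition curve_E :: "'k::field \<Rightarrow> 'k \<Rightarrow> ('k^4) set set" where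
  "curve_E \<beta> \<gamma> = zeros
     {Var 0 ^ 2 + Var 1 ^ 2 + Var 2 ^ 2 + Var 3 ^ 2,
      Var 0 ^ 2 - Const (\<beta> * \<gamma>) * Var 1 ^ 2 - Const \<gamma> * Var 2 ^ 2 + Const \<beta> * Var 3 ^ 2}"

text \<open>Translation by the 2-torsion point \<open>\<xi>\<^sub>j\<close>.\<close>

definition translate :: "4 \<Rightarrow> ('k::field^4) set \<Rightarrow> ('k^4) set" where
  "translate j P = (\<lambda>v. \<chi> r. if r = 0 \<or> r = j then v $ r else - v $ r) ` P"

text \<open>
  The identification of the two projective spaces has the form \<open>x\<^sub>r = c\<^sub>r y\<^sub>r\<close>, with
  \<open>(c\<^sub>0, c\<^sub>1, c\<^sub>2, c\<^sub>3) = (1, \<ii>, \<ii>, 1)\<close> for the secants defining \<open>E\<^sub>1\<close> and \<open>E\<^sub>2\<close>.  No identification with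
  all \<open>c\<^sub>r\<close> fourth roots of unity puts the secants of all three types into the line scheme; for
  \<open>E\<^sub>3\<close> the correct one is \<open>(1, \<ii>, 1, \<ii>)\<close>.
\<close>

definition ident :: "'k::field \<Rightarrow> 4 \<Rightarrow> 4 \<Rightarrow> 'k" where
  "ident \<ii> j r = (if r \<in> (if j = 3 then {1, 3} else {1, 2}) then \<ii> else 1)"

definition y_coords :: "'k::field \<Rightarrow> 4 \<Rightarrow> 'k^4 \<Rightarrow> 'k^4" where
  "y_coords \<ii> j v = (\<chi> r. v $ r / ident \<ii> j r)"

text \<open>
  The line through a set of points of projective space: the unique line \<open>l = l' = 0\<close> on which all of
  them lie, as a point of Pluecker space.
\<close>

definition line_through :: "('k::field^4) set \<Rightarrow> ('k^pl) set" where
  "line_through S = (THE z. \<exists>l l' :: 4 \<Rightarrow> 'k.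
     (\<chi> e. pluecker l l' e) \<noteq> 0 \<and> z = proj_point (\<chi> e. pluecker l l' e) \<and>
     (\<forall>v\<in>S. (\<Sum>r\<in>UNIV. l r * v $ r) = 0 \<and> (\<Sum>r\<in>UNIV. l' r * v $ r) = 0))"

definition E_mod :: "'k::field \<Rightarrow> 'k \<Rightarrow> 4 \<Rightarrow> (('k^4) set set, 'k) fspace" where
  "E_mod \<beta> \<gamma> j = quotient (variety (curve_E \<beta> \<gamma>)) (translate j)"

definition secant :: "'k::field \<Rightarrow> 4 \<Rightarrow> ('k^4) set set \<Rightarrow> ('k^pl) set" where
  "secant \<ii> j orbit = line_through (y_coords \<ii> j ` \<Union>orbit)"

definition E_curve :: "'k::field \<Rightarrow> 'k \<Rightarrow> 'k \<Rightarrow> 4 \<Rightarrow> ('k^pl) set set" where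
  "E_curve \<beta> \<gamma> \<ii> j = secant \<ii> j ` points (E_mod \<beta> \<gamma> j)"

text \<open>The plane \<open>z\<^sub>2\<^sub>3 = a z\<^sub>0\<^sub>1, z\<^sub>1\<^sub>3 = b z\<^sub>0\<^sub>2, z\<^sub>1\<^sub>2 = c z\<^sub>0\<^sub>3\<close>.\<close>

definition plane :: "'k::field \<Rightarrow> 'k \<Rightarrow> 'k \<Rightarrow> (pl, 'k) mpoly set" where
  "plane a b c = {Var Z23 - Const a * Var Z01, Var Z13 - Const b * Var Z02,
                  Var Z12 - Const c * Var Z03}"

definition C_conic :: "'k::field \<Rightarrow> 'k \<Rightarrow> 'k \<Rightarrow> 4 \<Rightarrow> (pl, 'k) mpoly set" where
  "C_conic \<alpha> \<beta> \<gamma> i = ideal_gen (grassmannian \<union>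
     (if i = 0 then plane (- \<alpha>) \<beta> (- \<gamma>)
      else if i = 1 then plane \<alpha> (- 1) (- 1)
      else if i = 2 then plane (- 1) (- \<beta>) 1
      else plane 1 1 \<gamma>))"

end

theory Submission
  imports Defs "Jordan_Normal_Form.Determinant"
begin

text \<open>
  On each chart of the Grassmannian, explicit eight by eight minors generate enough cubics to show that a form vanishing
  on the seven curves lies in the saturated ideal of the minors; conversely an explicit kernel vector exists at
  every point of the curves.  The ideals of the curves are identified through normal forms over a
  polynomial ring in two variables, which also gives the Hilbert functions; those of the union follow from
  the Chinese remainder theorem.
\<close>

text \<open>In the coordinates \<open>u1 = z01\<close>, \<open>v1 = z23\<close>,
  \<open>u2 = z02\<close>, \<open>v2 = z31\<close>, \<open>u3 = z03\<close>, \<open>v3 = z12\<close>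
  the Pluecker relation is \<open>u1*v1 + u2*v2 + u3*v3 = 0\<close>, the plane of a conic is
  \<open>v_i = t_i*u_i\<close> with three slopes, and \<open>E_i\<close> lies in
  \<open>u_i = v_i = 0\<close>. The obstacle is the scheme structure at the 24 points where a conic
  meets an elliptic curve. The minors are quartic in these coordinates, and cubics appear only after
  a coordinate has been inverted. Four of the cubics are trilinear in the pairs
  \<open>(u_i, v_i)\<close> and span the trilinear forms vanishing at the four slope triples; they
  vanish identically for \<open>u_i = v_i = 0\<close>, so a fifth cubic, \<open>cubu\<close>, must
  supply the quadrics of the elliptic curves. Rotation and the exchanges of \<open>y_0\<close> with
  \<open>y_i\<close>, which invert two parameters, reduce the six charts to one. In degree
  \<open>d\<close> the elliptic curves contribute \<open>12*d\<close> to the Hilbert function, but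
  the conics only \<open>4*(2*(d - 3) + 1)\<close>, because a form vanishing on the elliptic curves
  is divisible by \<open>u1*u2*u3\<close> on each conic.\<close>

hide_const (open) Matrix.vec Matrix.row Matrix.col Matrix.mat Matrix.transpose_mat Matrix.vec_index
 Matrix.map_vec Matrix.unit_vec Matrix.zero_vec
hide_type (open) Matrix.vec Matrix.mat
no_notation Matrix.vec_index (infixl \<open>$\<close> 100)

section \<open>Polynomials as functions\<close>

text \<open>Serves coefficient embeddings, evaluations and substitutions alike, so that one set of
  transfer rules covers all of them.\<close>

definition rhom :: "('a::semiring_1 => 'b::semiring_1) => bool" where
 "rhom c \<longleftrightarrow> c 0 = 0 & c 1 = 1 & (ALL a b. c (a + b) = c a + c b & c (a * b) = c a * c b)"

lemma rhomD: "rhom c ==> c 0 = 0" "rhom c ==> c 1 = 1"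
 "rhom c ==> c (a + b) = c a + c b" "rhom c ==> c (a * b) = c a * c b"
 by (auto simp: rhom_def)

lemma rhom_power: "rhom c ==> c (a ^ n) = c a ^ n"
 by (induction n) (auto simp: rhomD)

lemma rhom_sum: "rhom c ==> c (sum f A) = (\<Sum>x\<in>A. c (f x))"
 by (induction A rule: infinite_finite_induct) (auto simp: rhomD)

lemma rhom_prod: "rhom c ==> c (prod f A) = (\<Prod>x\<in>A. c (f x))"
 by (induction A rule: infinite_finite_induct) (auto simp: rhomD)

lemma rhom_uminus: "rhom (c :: 'a::ring_1 => 'b::ring_1) ==> c (- a) = - c a"
 by (metis add.right_inverse add_eq_0_iff rhomD(1,3))

lemma rhom_diff: "rhom (c :: 'a::ring_1 => 'b::ring_1) ==> c (a - b) = c a - c b"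
 by (metis (no_types, opaque_lifting) diff_conv_add_uminus rhomD(3) rhom_uminus)

lemma rhom_id: "rhom (%x. x)"
 by (simp add: rhom_def)

lemma rhom_of_nat: "rhom c ==> c (of_nat n) = of_nat n"
 by (induction n) (auto simp: rhomD)

lemma rhom_numeral: "rhom c ==> c (numeral n) = numeral n"
 using rhom_of_nat[of c "numeral n"] by simp

lemma rhom_det: "rhom (c :: 'a::comm_ring_1 => 'b::comm_ring_1) ==>
  c (Determinants.det A) = Determinants.det (\<chi> i j. c (A $ i $ j))"
proof -
 assume c: "rhom c"
 have "c (of_int n) = of_int n" for n :: int
  by (cases n rule: int_cases2) (simp_all add: rhom_of_nat[OF c] rhom_uminus[OF c])
 then show ?thesis
  by (simp add: Determinants.det_def rhom_sum[OF c] rhom_prod[OF c] rhomD(4)[OF c])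
qed

lemma Const_rhom: "rhom (Const :: 'k => 'm::comm_monoid_add \<Rightarrow>\<^sub>0 'k::comm_ring_1)"
 by (auto simp: rhom_def Const_def single_add mult_single)

lemmas Const_simps =
 rhomD[OF Const_rhom] rhom_power[OF Const_rhom] rhom_uminus[OF Const_rhom] rhom_diff[OF Const_rhom]
 rhom_numeral[OF Const_rhom]

lemma poly_mapping_sum_single:
 "f = (\<Sum>m\<in>Poly_Mapping.keys f. Poly_Mapping.single m (Poly_Mapping.lookup f m))"
 by (rule poly_mapping_eqI)
  (auto simp: lookup_sum lookup_single when_def in_keys_iff sum.delta')

lemma poly_mapping_single_induct [case_names zero single add]:
 assumes "P 0" "!!m c. P (Poly_Mapping.single m c)" "!!f g. P f ==> P g ==> P (f + g)"
 shows "P (f :: 'm \<Rightarrow>\<^sub>0 'k::comm_monoid_add)"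
proof -
 have "P (sum (%m. Poly_Mapping.single m (Poly_Mapping.lookup f m)) A)" if "finite A" for A
  using that by induction (auto intro: assms)
 then show ?thesis
  by (metis finite_keys poly_mapping_sum_single)
qed

definition mval :: "('x => 'r::comm_semiring_1) => ('x \<Rightarrow>\<^sub>0 nat) => 'r" where
 "mval g m = (\<Prod>x\<in>Poly_Mapping.keys m. g x ^ Poly_Mapping.lookup m x)"

lemma mval_superset:
 "finite A ==> Poly_Mapping.keys m \<subseteq> A ==> mval g m = (\<Prod>x\<in>A. g x ^ Poly_Mapping.lookup m x)"
 unfolding mval_def by (rule prod.mono_neutral_left) (auto simp: in_keys_iff)

lemma mval_add: "mval g (m + n) = mval g m * mval g n"
proof -
 let ?A = "Poly_Mapping.keys m Un Poly_Mapping.keys n"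
 have "Poly_Mapping.keys (m + n) \<subseteq> ?A"
  by (simp add: keys_add)
 then show ?thesis
  by (simp add: mval_superset[of ?A] lookup_add power_add prod.distrib)
qed

lemma mval_0 [simp]: "mval g 0 = 1"
 by (simp add: mval_def)

lemma mval_single [simp]: "mval g (Poly_Mapping.single x n) = g x ^ n"
 by (simp add: mval_def)

lemma aeval_superset:
 assumes "rhom c" "finite A" "Poly_Mapping.keys f \<subseteq> A"
 shows "aeval c g f = (\<Sum>m\<in>A. c (Poly_Mapping.lookup f m) * mval g m)"
 unfolding aeval_def mval_def
 by (rule sum.mono_neutral_left) (use assms in "auto simp: in_keys_iff rhomD")

lemma aeval_0: "aeval c g 0 = 0"
 by (simp add: aeval_def)

lemma aeval_single: "rhom c ==> aeval c g (Poly_Mapping.single m a) = c a * mval g m"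
 by (subst aeval_superset[of c "{m}"]) auto

lemma aeval_add:
 assumes c: "rhom c"
 shows "aeval c g (f + h) = aeval c g f + aeval c g h"
proof -
 let ?A = "Poly_Mapping.keys f Un Poly_Mapping.keys h"
 have "aeval c g q = (\<Sum>m\<in>?A. c (Poly_Mapping.lookup q m) * mval g m)"
  if "Poly_Mapping.keys q \<subseteq> ?A" for q
  using that by (intro aeval_superset c) auto
 from this[of f] this[of h] this[OF keys_add] show ?thesis
  by (simp add: lookup_add rhomD[OF c] sum.distrib[symmetric] distrib_right)
qed

lemma aeval_mult:
 assumes c: "rhom c"
 shows "aeval c g (f * h) = aeval c g f * aeval c g h"
proof (induction f rule: poly_mapping_single_induct)
 case (single m a)
 show ?case
 proof (induction h rule: poly_mapping_single_induct)
  case (single n b)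
  then show ?case
   by (simp add: aeval_single[OF c] mult_single mval_add rhomD[OF c] mult.assoc mult.left_commute)
 qed (simp_all add: aeval_0 aeval_add[OF c] distrib_left)
qed (simp_all add: aeval_0 aeval_add[OF c] distrib_right)

lemma aeval_Const: "rhom c ==> aeval c g (Const a) = c a"
 by (simp add: Const_def aeval_single)

lemma aeval_Var: "rhom c ==> aeval c g (Var x) = g x"
 by (simp add: Var_def aeval_single rhomD)

lemma aeval_rhom:
 assumes c: "rhom c"
 shows "rhom (aeval c g)"
proof -
 have "aeval c g 1 = 1"
  using aeval_Const[OF c, of g 1] by (simp add: Const_def rhomD(2)[OF c])
 then show ?thesis
  unfolding rhom_def by (simp add: aeval_0 aeval_add[OF c] aeval_mult[OF c])
qed

lemma aeval_comp:
 assumes "rhom c" "rhom h"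
 shows "h (aeval c g f) = aeval (%a. h (c a)) (%x. h (g x)) f"
 unfolding aeval_def
 by (simp add: rhom_sum[OF assms(2)] rhom_prod[OF assms(2)] rhom_power[OF assms(2)] rhomD(4)[OF assms(2)])

lemma peval_rhom: "rhom (peval v)"
 using aeval_rhom[OF rhom_id] by (simp add: peval_def rhom_def)

lemma peval_Const [simp]: "peval v (Const a) = a"
 by (simp add: peval_def aeval_Const rhom_id)

lemma peval_Var [simp]: "peval v (Var x) = v $ x"
 by (simp add: peval_def aeval_Var rhom_id)

lemmas peval_simps [simp] =
 rhomD[OF peval_rhom] rhom_power[OF peval_rhom] rhom_uminus[OF peval_rhom]
 rhom_diff[OF peval_rhom] rhom_numeral[OF peval_rhom] rhom_sum[OF peval_rhom]

lemma psubst_rhom: "rhom (psubst g)"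
 using aeval_rhom[OF Const_rhom] by (simp add: psubst_def rhom_def)

lemma psubst_Const [simp]: "psubst g (Const a) = Const a"
 by (simp add: psubst_def aeval_Const Const_rhom)

lemma psubst_Var [simp]: "psubst g (Var x) = g x"
 by (simp add: psubst_def aeval_Var Const_rhom)

lemmas psubst_simps [simp] =
 rhomD[OF psubst_rhom] rhom_power[OF psubst_rhom] rhom_uminus[OF psubst_rhom]
 rhom_diff[OF psubst_rhom] rhom_numeral[OF psubst_rhom]

lemma peval_psubst: "peval v (psubst g f) = peval (\<chi> x. peval v (g x)) f"
proof -
 have "peval v (psubst g f) = aeval (%a. a) (%x. peval v (g x)) f"
  unfolding psubst_def by (subst aeval_comp[OF Const_rhom peval_rhom]) simp
 then show ?thesis
  by (simp add: peval_def)
qed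

lemma single_eq_prod:
 "Poly_Mapping.single m a = Const a * (\<Prod>x\<in>Poly_Mapping.keys m. Var x ^ Poly_Mapping.lookup m x)"
 for m :: "'x \<Rightarrow>\<^sub>0 nat" and a :: "'k::comm_ring_1"
proof -
 have V: "Var x ^ n = Poly_Mapping.single (Poly_Mapping.single x n) (1 :: 'k)" for x :: 'x and n
  by (induction n) (simp_all add: Var_def mult_single single_add[symmetric])
 have "(\<Prod>x\<in>A. Var x ^ n x) = Poly_Mapping.single (\<Sum>x\<in>A. Poly_Mapping.single x (n x)) (1 :: 'k)"
  if "finite A" for A :: "'x set" and n
  using that by induction (simp_all add: V mult_single)
 then show ?thesis
  using poly_mapping_sum_single[of m] by (simp add: Const_def mult_single)
qed

text \<open>Suited to statements modulo an ideal: the step multiplies by a single variable, as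
  reduction to normal form does.\<close>

lemma mpoly_induct [case_names Const add Var]:
 assumes "!!c. P (Const c)" "!!f g. P f ==> P g ==> P (f + g)" "!!f x. P f ==> P (Var x * f)"
 shows "P (f :: ('x, 'k::comm_ring_1) mpoly)"
proof (induction f rule: poly_mapping_single_induct)
 case zero
 show ?case using assms(1)[of 0] by (simp add: Const_def)
next
 case (single m c)
 have *: "P (Var x ^ n * f)" if "P f" for x n f
  using that by (induction n) (auto simp: mult.assoc intro: assms)
 have "P ((\<Prod>x\<in>A. Var x ^ n x) * Const c)" if "finite A" for A n
  using that by induction (auto simp: assms mult.assoc intro: *)
 then show ?case
  by (simp add: single_eq_prod mult.commute)
qed (rule assms)

subsection \<open>Homogeneous components\<close>

definition mdeg :: "('x \<Rightarrow>\<^sub>0 nat) => nat" where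
 "mdeg m = (\<Sum>x\<in>Poly_Mapping.keys m. Poly_Mapping.lookup m x)"

lemma mdeg_superset:
 "finite A ==> Poly_Mapping.keys m \<subseteq> A ==> mdeg m = (\<Sum>x\<in>A. Poly_Mapping.lookup m x)"
 unfolding mdeg_def by (rule sum.mono_neutral_left) (auto simp: in_keys_iff)

lemma mdeg_add: "mdeg (m + n) = mdeg m + mdeg n"
 by (subst (1 2 3) mdeg_superset[of "Poly_Mapping.keys m Un Poly_Mapping.keys n"])
  (auto simp: keys_add lookup_add sum.distrib)

lemma mdeg_single [simp]: "mdeg (Poly_Mapping.single x n) = n"
 by (simp add: mdeg_def)

lemma mdeg_0 [simp]: "mdeg 0 = 0"
 by (simp add: mdeg_def)

lemma homogeneous_iff: "homogeneous d f \<longleftrightarrow> (\<forall>m\<in>Poly_Mapping.keys f. mdeg m = d)"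
 by (simp add: homogeneous_def mdeg_def)

definition hcomp :: "nat => ('x, 'k::comm_ring_1) mpoly => ('x, 'k) mpoly" where
 "hcomp d f = (\<Sum>m\<in>{m\<in>Poly_Mapping.keys f. mdeg m = d}. Poly_Mapping.single m (Poly_Mapping.lookup f m))"

lemma lookup_hcomp: "Poly_Mapping.lookup (hcomp d f) m = (if mdeg m = d then Poly_Mapping.lookup f m else 0)"
 by (auto simp: hcomp_def lookup_sum lookup_single when_def in_keys_iff sum.delta')

lemma hcomp_homogeneous: "homogeneous d (hcomp d f)"
 by (auto simp: homogeneous_iff in_keys_iff lookup_hcomp split: if_splits)

lemma hcomp_add: "hcomp d (f + g) = hcomp d f + hcomp d g"
 by (rule poly_mapping_eqI) (simp add: lookup_hcomp lookup_add)

lemma hcomp_0 [simp]: "hcomp d 0 = 0"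
 by (rule poly_mapping_eqI) (simp add: lookup_hcomp)

lemma hcomp_diff: "hcomp d (f - g) = hcomp d f - hcomp d g"
 by (rule poly_mapping_eqI) (simp add: lookup_hcomp lookup_minus)

lemma hcomp_sum: "hcomp d (sum f A) = (\<Sum>x\<in>A. hcomp d (f x))"
 by (induction A rule: infinite_finite_induct) (simp_all add: hcomp_add)

lemma hcomp_of_homogeneous: "homogeneous d f ==> hcomp e f = (if d = e then f else 0)"
 by (rule poly_mapping_eqI) (auto simp: lookup_hcomp homogeneous_iff in_keys_iff)

lemma homogeneous_0 [simp]: "homogeneous d 0"
 by (simp add: homogeneous_iff)

lemma homogeneous_add: "homogeneous d f ==> homogeneous d g ==> homogeneous d (f + g)"
 using keys_add[of f g] by (auto simp: homogeneous_iff)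

lemma homogeneous_uminus: "homogeneous d f ==> homogeneous d (- f :: ('x, 'k::comm_ring_1) mpoly)"
 by (simp add: homogeneous_iff)

lemma homogeneous_diff: "homogeneous d f ==> homogeneous d g ==> homogeneous d (f - g :: ('x, 'k::comm_ring_1) mpoly)"
 using homogeneous_add[of d f "- g"] homogeneous_uminus[of d g] by simp

lemma homogeneous_sum: "(!!x. x : A ==> homogeneous d (f x)) ==> homogeneous d (sum f A)"
 by (induction A rule: infinite_finite_induct) (auto intro: homogeneous_add)

lemma homogeneous_single: "homogeneous (mdeg m) (Poly_Mapping.single m c)"
 by (simp add: homogeneous_iff)

lemma homogeneous_mult: "homogeneous d f ==> homogeneous e g ==> homogeneous (d + e) (f * g)"
 using keys_mult[of f g] by (fastforce simp: homogeneous_iff mdeg_add)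

lemma homogeneous_Const [simp]: "homogeneous 0 (Const c)"
 by (simp add: homogeneous_iff Const_def)

lemma homogeneous_1 [simp]: "homogeneous 0 1"
 by (simp add: homogeneous_iff)

lemma homogeneous_Var [simp]: "homogeneous 1 (Var x)"
 by (simp add: homogeneous_iff Var_def)

lemma homogeneous_Const_mult: "homogeneous d f ==> homogeneous d (Const c * f)"
 using homogeneous_mult[of 0 "Const c" d f] by simp

lemma homogeneous_power: "homogeneous d f ==> homogeneous (n * d) (f ^ n)"
 by (induction n) (auto intro: homogeneous_mult)

lemma hcomp_mult_homogeneous:
 assumes "homogeneous d f"
 shows "hcomp e (f * g) = (if d <= e then f * hcomp (e - d) g else 0)"
proof (induction g rule: poly_mapping_single_induct)
 case (single m c)
 have "homogeneous (d + mdeg m) (f * Poly_Mapping.single m c)"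
  by (intro homogeneous_mult assms homogeneous_single)
 then show ?case
  using homogeneous_single[of m c] by (auto simp: hcomp_of_homogeneous)
qed (auto simp: hcomp_add algebra_simps)

lemma hcomp_decomp: "EX D. f = (\<Sum>d<D. hcomp d f)"
proof -
 define D where "D = Suc (Max (insert 0 (mdeg ` Poly_Mapping.keys f)))"
 have "mdeg m < D" if "m : Poly_Mapping.keys f" for m
  using that by (simp add: D_def less_Suc_eq_le)
 then have "f = (\<Sum>d<D. hcomp d f)"
  by (intro poly_mapping_eqI) (auto simp: lookup_sum lookup_hcomp in_keys_iff sum.delta)
 then show ?thesis ..
qed

lemma mval_scale: "mval (%x. c * g x) m = c ^ mdeg m * mval g m"
 by (simp add: mval_def mdeg_def power_mult_distrib prod.distrib power_sum)

lemma peval_sum_keys: "peval v f = (\<Sum>m\<in>Poly_Mapping.keys f. Poly_Mapping.lookup f m * mval (%x. v $ x) m)"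
 by (simp add: peval_def aeval_def mval_def)

lemma peval_scale: "homogeneous d f ==> peval (c *s v) f = c ^ d * peval v f"
 by (auto simp: peval_sum_keys homogeneous_iff mval_scale sum_distrib_left algebra_simps intro!: sum.cong)

text \<open>Over a finite field the product of all \<open>X - a\<close>, plus one, has positive
  degree and no root.\<close>

lemma infinite_alg_closed: "infinite (UNIV :: 'k::alg_closed_field set)"
proof
 assume fin: "finite (UNIV :: 'k set)"
 define p :: "'k poly" where "p = (\<Prod>a\<in>UNIV. [:-a, 1:]) + 1"
 have "poly p x = 1" for x
  using fin by (auto simp: p_def poly_prod prod_zero_iff)
 moreover have "degree (\<Prod>a\<in>(UNIV::'k set). [:-a, 1:]) > 0"
  using fin by (subst degree_prod_eq_sum_degree) (auto simp: card_gt_0_iff)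
 then have "degree p > 0"
  unfolding p_def by (subst degree_add_eq_left) auto
 then obtain x where "poly p x = 0"
  using alg_closed_imp_poly_has_root by blast
 ultimately show False by simp
qed

lemma poly_zero_infinite:
 "infinite A ==> (!!x. x : A ==> poly p x = 0) ==> p = (0 :: 'k::idom poly)"
 by (metis (mono_tags, lifting) infinite_super mem_Collect_eq poly_roots_finite subsetI)

lemma infinite_nonzero: "infinite {c :: 'k::alg_closed_field. c ~= 0}"
proof -
 have "{c :: 'k. c ~= 0} = UNIV - {0}" by auto
 then show ?thesis
  by (simp add: infinite_alg_closed)
qed

text \<open>Vanishing on a punctured line through the origin is tested on the homogeneous components.\<close>

lemma peval_hcomp_zero:
 fixes f :: "('x::finite, 'k::alg_closed_field) mpoly"
 assumes "!!c. c ~= 0 ==> peval (c *s v) f = 0"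
 shows "peval v (hcomp d f) = 0"
proof -
 obtain D where D: "f = (\<Sum>d<D. hcomp d f)"
  using hcomp_decomp by blast
 define p where "p = (\<Sum>d<D. Polynomial.monom (peval v (hcomp d f)) d)"
 have "poly p c = 0" if "c ~= 0" for c
 proof -
  have "poly p c = peval (c *s v) (\<Sum>d<D. hcomp d f)"
   by (simp add: p_def poly_sum poly_monom peval_scale[OF hcomp_homogeneous] mult.commute)
  then show ?thesis
   using assms[OF that] D by simp
 qed
 then have "p = 0"
  by (intro poly_zero_infinite[OF infinite_nonzero]) simp
 then have "Polynomial.coeff p d = 0" by simp
 then have *: "d < D ==> peval v (hcomp d f) = 0"
  by (simp add: p_def coeff_sum sum.delta)
 show ?thesis
 proof (cases "d < D")
  case False
  have "hcomp d f = (\<Sum>e<D. hcomp d (hcomp e f))"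
   by (subst D) (rule hcomp_sum)
  also have "... = 0"
   using False by (intro sum.neutral) (auto simp: hcomp_of_homogeneous[OF hcomp_homogeneous])
  finally show ?thesis by simp
 qed (rule *)
qed

subsection \<open>Polynomial functions over an infinite field\<close>

text \<open>Induction on the variables: for fixed values of the others, \<open>f\<close> is a
  univariate polynomial with infinitely many zeros, so each coefficient with respect to
  \<open>x\<close> is the zero function.\<close>

lemma aeval_zero_imp_zero:
 fixes f :: "('x, 'k::alg_closed_field) mpoly"
 assumes "finite X" "!!m. m : Poly_Mapping.keys f ==> Poly_Mapping.keys m \<subseteq> X"
  and "!!g. aeval (%c. c) g f = 0"
 shows "f = 0"
 using assms
proof (induction X arbitrary: f rule: finite_induct)
 case empty
 then have "Poly_Mapping.keys f \<subseteq> {0}"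
  by (metis insertI1 keys_eq_empty subsetI subset_empty)
 then have "f = Poly_Mapping.single 0 (Poly_Mapping.lookup f 0)"
  by (intro poly_mapping_eqI) (auto simp: lookup_single when_def in_keys_iff)
 then show ?case
  using empty.prems(2)[of undefined] by (metis aeval_single mult.right_neutral mval_0 rhom_id single_zero)
next
 case (insert x Y)
 \<comment> \<open>\<open>cf k\<close> is the coefficient of the \<open>k\<close>-th power of
   \<open>x\<close>; it involves only the variables in \<open>Y\<close>.\<close>
 define cf where "cf k = (\<Sum>m\<in>{m\<in>Poly_Mapping.keys f. Poly_Mapping.lookup m x = k}.
  Poly_Mapping.single (m - Poly_Mapping.single x k) (Poly_Mapping.lookup f m))" for k
 define K where "K = Suc (Max (insert 0 ((%m. Poly_Mapping.lookup m x) ` Poly_Mapping.keys f)))"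
 have K: "Poly_Mapping.lookup m x < K" if "m : Poly_Mapping.keys f" for m
  using that by (simp add: K_def less_Suc_eq_le)
 have mono: "Poly_Mapping.single x k + (m - Poly_Mapping.single x k) = m"
  if "Poly_Mapping.lookup m x = k" for m :: "'x \<Rightarrow>\<^sub>0 nat" and k
  using that by (intro poly_mapping_eqI) (auto simp: lookup_add lookup_minus lookup_single when_def)
 have Vx: "Var x ^ k = Poly_Mapping.single (Poly_Mapping.single x k) (1 :: 'k)" for k
  by (induction k) (simp_all add: Var_def mult_single single_add[symmetric])
 have f: "f = (\<Sum>k<K. Var x ^ k * cf k)"
 proof -
  have "f = (\<Sum>m\<in>Poly_Mapping.keys f. Poly_Mapping.single m (Poly_Mapping.lookup f m))"
   by (rule poly_mapping_sum_single)
  also have "... = (\<Sum>k<K. \<Sum>m\<in>{m\<in>Poly_Mapping.keys f. Poly_Mapping.lookup m x = k}.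
    Poly_Mapping.single m (Poly_Mapping.lookup f m))"
   by (rule sum.group[symmetric]) (auto intro: K)
  also have "... = (\<Sum>k<K. Var x ^ k * cf k)"
   by (intro sum.cong refl) (simp add: cf_def sum_distrib_left Vx mult_single mono)
  finally show ?thesis .
 qed
 have keys_cf: "Poly_Mapping.keys m \<subseteq> Y" if "m : Poly_Mapping.keys (cf k)" for m k
 proof -
  have "(\<Sum>m'\<in>{m'\<in>Poly_Mapping.keys f. Poly_Mapping.lookup m' x = k}. Poly_Mapping.lookup
    (Poly_Mapping.single (m' - Poly_Mapping.single x k) (Poly_Mapping.lookup f m')) m) ~= 0"
   using that by (simp add: cf_def in_keys_iff lookup_sum)
  then obtain m' where "m' : {m'\<in>Poly_Mapping.keys f. Poly_Mapping.lookup m' x = k}" and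
    *: "Poly_Mapping.lookup (Poly_Mapping.single (m' - Poly_Mapping.single x k) (Poly_Mapping.lookup f m')) m ~= 0"
   by (rule sum.not_neutral_contains_not_neutral)
  then have m': "m' : Poly_Mapping.keys f" "Poly_Mapping.lookup m' x = k"
   by auto
  have m: "m = m' - Poly_Mapping.single x k"
   using * by (auto simp: lookup_single when_def split: if_splits)
  show ?thesis
  proof
   fix y assume "y : Poly_Mapping.keys m"
   then have y: "Poly_Mapping.lookup m' y - Poly_Mapping.lookup (Poly_Mapping.single x k) y ~= 0"
    by (simp add: in_keys_iff m lookup_minus)
   then have "y ~= x" using m'(2) by auto
   moreover have "y : Poly_Mapping.keys m'"
    using y by (auto simp: in_keys_iff)
   ultimately show "y : Y" using insert.prems(1)[OF m'(1)] by auto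
  qed
 qed
 have upd: "aeval (%c. c) (g(x := t)) (cf k) = aeval (%c. c) g (cf k)" for g t k
 proof -
  have "mval (g(x := t)) m = mval g m" if "m : Poly_Mapping.keys (cf k)" for m
   using keys_cf[OF that] insert.hyps unfolding mval_def by (intro prod.cong) auto
  then show ?thesis
   unfolding aeval_def mval_def[symmetric] by (intro sum.cong refl) metis
 qed
 have cf0: "cf k = 0" if "k < K" for k
 proof (rule insert.IH)
  fix g :: "'x => 'k"
  define p where "p = (\<Sum>k<K. Polynomial.monom (aeval (%c. c) g (cf k)) k)"
  have "poly p t = aeval (%c. c) (g(x := t)) f" for t
   by (subst f) (simp add: p_def poly_sum poly_monom rhom_sum[OF aeval_rhom[OF rhom_id]]
     aeval_mult[OF rhom_id] rhom_power[OF aeval_rhom[OF rhom_id]] aeval_Var[OF rhom_id] upd mult.commute)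
  then have "p = 0"
   using insert.prems(2) by (intro poly_zero_infinite[OF infinite_alg_closed]) auto
  then have "Polynomial.coeff p k = 0" by simp
  then show "aeval (%c. c) g (cf k) = 0"
   using that by (simp add: p_def coeff_sum sum.delta)
 qed (rule keys_cf)
 show ?case
  by (subst f, rule sum.neutral) (simp add: cf0)
qed

lemma peval_eqI:
 fixes f g :: "('x::finite, 'k::alg_closed_field) mpoly"
 assumes "!!v. peval v f = peval v g"
 shows "f = g"
proof -
 have "aeval (%c. c) h (f - g) = 0" for h
  using assms[of "\<chi> x. h x"] rhom_diff[OF aeval_rhom[OF rhom_id], of h f g] by (simp add: peval_def)
 then have "f - g = 0"
  by (intro aeval_zero_imp_zero[of UNIV]) auto
 then show ?thesis by simp
qed

text \<open>On the line joining a non-zero of \<open>f\<close> and a non-zero of \<open>g\<close> the product is not zero.\<close>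

lemma peval_mult_zero:
 fixes f g :: "('x::finite, 'k::alg_closed_field) mpoly"
 assumes "!!v. peval v f * peval v g = 0"
 shows "f = 0 | g = 0"
proof (rule ccontr)
 assume "~ ?thesis"
 then obtain v w where v: "peval v f ~= 0" and w: "peval w g ~= 0"
  using peval_eqI[of f 0] peval_eqI[of g 0] by auto
 have C: "rhom (%c :: 'k. [:c:])"
  by (simp add: rhom_def one_pCons)
 define L where "L h = aeval (%c. [:c:]) (%x. [:v $ x, w $ x - v $ x:]) h" for h :: "('x, 'k) mpoly"
 have L: "poly (L h) t = peval (\<chi> x. v $ x + t * (w $ x - v $ x)) h" for h t
 proof -
  have "rhom (%p. poly p t)" by (simp add: rhom_def)
  from aeval_comp[OF C this, of "%x. [:v $ x, w $ x - v $ x:]" h] show ?thesis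
   by (simp add: L_def peval_def)
 qed
 have "poly (L f) 0 ~= 0" "poly (L g) 1 ~= 0"
  using v w by (simp_all add: L)
 then have "L f * L g ~= 0" by auto
 moreover have "L f * L g = 0"
  using assms by (intro poly_zero_infinite[OF infinite_alg_closed]) (auto simp: L)
 ultimately show False by simp
qed

section \<open>Ideals\<close>

definition is_ideal :: "'r::comm_ring_1 set => bool" where
 "is_ideal I \<longleftrightarrow> 0 : I & (\<forall>a\<in>I. \<forall>b\<in>I. a + b : I) & (\<forall>a\<in>I. ALL r. r * a : I)"

lemma ring_module: "Modules.module ((*) :: 'r::comm_ring_1 => 'r => 'r)"
 by standard (simp_all add: algebra_simps)

lemma is_ideal_iff: "is_ideal I \<longleftrightarrow> module.subspace (*) I"
 unfolding is_ideal_def Modules.module.subspace_def[OF ring_module] by blast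

lemma idealD:
 assumes "is_ideal I"
 shows "0 : I" "a : I ==> b : I ==> a + b : I" "a : I ==> r * a : I" "a : I ==> a * r : I"
  "a : I ==> - a : I" "a : I ==> b : I ==> a - b : I"
proof -
 show "0 : I" "a : I ==> b : I ==> a + b : I" and m: "!!a r. a : I ==> r * a : I"
  using assms by (auto simp: is_ideal_def)
 show "a : I ==> a * r : I" "a : I ==> - a : I"
  using m[of a r] m[of a "- 1"] by (simp_all add: mult.commute)
 then show "a : I ==> b : I ==> a - b : I"
  using assms m[of b "- 1"] by (fastforce simp: is_ideal_def)
qed

lemma ideal_sum: "is_ideal I ==> (!!x. x : A ==> f x : I) ==> sum f A : I"
 by (induction A rule: infinite_finite_induct) (auto simp: idealD)

lemma is_ideal_ideal_gen [simp]: "is_ideal (ideal_gen G)"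
 unfolding is_ideal_iff ideal_gen_def by (rule Modules.module.subspace_span[OF ring_module])

lemmas ideal_genD = idealD[OF is_ideal_ideal_gen]

lemma ideal_gen_base: "g : G ==> g : ideal_gen G"
 unfolding ideal_gen_def by (rule Modules.module.span_base[OF ring_module])

lemma ideal_gen_minimal: "is_ideal I ==> G \<subseteq> I ==> ideal_gen G \<subseteq> I"
 unfolding is_ideal_iff ideal_gen_def by (metis Modules.module.span_minimal[OF ring_module])

lemma ideal_gen_insert: "f : ideal_gen (insert a G) \<longleftrightarrow> (EX r. f - r * a : ideal_gen G)"
 unfolding ideal_gen_def by (rule Modules.module.span_breakdown_eq[OF ring_module])

lemma ideal_gen_empty [simp]: "ideal_gen {} = {0}"
 by (simp add: ideal_gen_def Modules.module.span_empty[OF ring_module])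

lemma ideal_gen_3E:
 assumes "f : ideal_gen {a, b, c}"
 obtains r s t where "f = r * a + s * b + t * c"
 using assms by (auto simp: ideal_gen_insert algebra_simps eq_diff_eq)

lemma ideal_gen_4E:
 assumes "f : ideal_gen {a, b, c, d}"
 obtains r s t w where "f = r * a + s * b + t * c + w * d"
 using assms by (auto simp: ideal_gen_insert algebra_simps eq_diff_eq)

text \<open>Every term of \<open>(a + b)^(n + m)\<close> contains the factor \<open>a^n\<close> or
  \<open>b^m\<close>.\<close>

lemma radical_is_ideal:
 assumes I: "is_ideal I"
 shows "is_ideal {g. EX N. g ^ N : I}"
 unfolding is_ideal_def
proof (intro conjI ballI allI)
 show "0 : {g. EX N. g ^ N : I}"
  using idealD(1)[OF I] by (auto intro!: exI[of _ 1])
next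
 fix a b assume "a : {g. EX N. g ^ N : I}" "b : {g. EX N. g ^ N : I}"
 then obtain n m where n: "a ^ n : I" and m: "b ^ m : I" by auto
 have "of_nat (n + m choose k) * a ^ k * b ^ (n + m - k) : I" if "k <= n + m" for k
 proof (cases "n <= k")
  case True
  then have "a ^ k = a ^ n * a ^ (k - n)" by (simp flip: power_add)
  then show ?thesis by (simp add: idealD[OF I] n)
 next
  case False
  then have "n + m - k = m + (n - k)" by simp
  then have "b ^ (n + m - k) = b ^ m * b ^ (n - k)" by (simp add: power_add)
  then show ?thesis by (simp add: idealD[OF I] m)
 qed
 then have "(a + b) ^ (n + m) : I"
  unfolding binomial_ring by (intro ideal_sum[OF I]) auto
 then show "a + b : {g. EX N. g ^ N : I}" by auto
next
 fix a r assume "a : {g. EX N. g ^ N : I}"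
 then show "r * a : {g. EX N. g ^ N : I}"
  by (auto simp: power_mult_distrib intro: idealD[OF I])
qed

lemma colon_is_ideal:
 assumes I: "is_ideal I"
 shows "is_ideal {g. g * f : I}"
proof -
 have "(a + b) * f : I" if "a * f : I" "b * f : I" for a b
  using idealD(2)[OF I that] by (simp add: distrib_right)
 moreover have "r * a * f : I" if "a * f : I" for a r
  using idealD(3)[OF I that, of r] by (simp add: mult.assoc)
 ultimately show ?thesis
  using idealD(1)[OF I] unfolding is_ideal_def by simp
qed

section \<open>The ideal near a chart\<close>

lemma distinct4_exhaust: "distinct [a, b, c, d :: 4] ==> x = a | x = b | x = c | x = d"
 using card_mono[of UNIV "{a, b, c, d, x}"] by (auto simp: card_insert_if split: if_splits)

locale saturated_ideal =
 fixes C :: "'k::field => 'r::comm_ring_1" and L :: "'r set"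
 assumes C: "rhom C" and L: "is_ideal L"
begin

lemmas L_simps = idealD[OF L]

lemma unit_cancel: "k ~= 0 ==> C k * f : L ==> f : L"
proof -
 assume k: "k ~= 0" and f: "C k * f : L"
 have "C (inverse k) * (C k * f) = f"
  using k by (simp add: rhomD(4)[OF C, symmetric] mult.assoc[symmetric] rhomD(2)[OF C])
 then show "f : L" using L_simps(3)[OF f, of "C (inverse k)"] by simp
qed

text \<open>As \<open>s ~= t\<close>, the two linear forms generate the ideal \<open>(u, v)\<close>,
  and one of \<open>u\<close>, \<open>v\<close> is a nonzerodivisor modulo \<open>L\<close>.\<close>

lemma comaximal:
 assumes "s ~= t" "(v - C s * u) * f : L" "(v - C t * u) * f : L" "!!f. x * f : L ==> f : L" "x : {u, v}"
 shows "f \<in> L"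
proof -
 have "C (t - s) * (u * f) = (v - C s * u) * f - (v - C t * u) * f"
  by (simp add: rhom_diff[OF C] algebra_simps)
 then have u: "u * f : L"
  using assms(1) L_simps(6)[OF assms(2,3)] unit_cancel[of "t - s" "u * f"] by simp
 then have "v * f : L"
  using L_simps(2)[OF assms(2) L_simps(3)[OF u, of "C s"]] by (simp add: algebra_simps)
 with u show ?thesis using assms(4,5) by auto
qed

text \<open>Three applications of \<open>comaximal\<close>: to \<open>?a * ?b * f\<close>, then to
  \<open>?a * f\<close> and \<open>?b * f\<close>, and finally to \<open>f\<close>.\<close>

lemma comaximal_squares:
 assumes "s ~= t" "(v - C s * u)^2 * f : L" "(v - C t * u)^2 * f : L" "!!f. x * f : L ==> f : L" "x : {u, v}"
 shows "f \<in> L"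
proof -
 let ?a = "v - C s * u" and ?b = "v - C t * u"
 note co = comaximal[OF assms(1) _ _ assms(4,5)]
 have "?a * (?a * ?b * f) : L" "?b * (?a * ?b * f) : L"
  using L_simps(3)[OF assms(2), of ?b] L_simps(3)[OF assms(3), of ?a]
  by (simp_all add: power2_eq_square mult_ac)
 then have w: "?a * ?b * f : L" by (rule co)
 have "?a * f : L"
  by (rule co) (use w assms(2) in "simp_all add: power2_eq_square mult_ac")
 moreover have "?b * f : L"
  by (rule co) (use w assms(3) in "simp_all add: power2_eq_square mult_ac")
 ultimately show ?thesis by (rule co)
qed

text \<open>
 Where \<open>x\<^sub>1\<close> and \<open>x\<^sub>2\<close> are invertible, the conics meet the locus \<open>u\<^sub>3 = v\<^sub>3 = 0\<close> only at the
 four points \<open>A c = B c = 0\<close>, and \<open>star\<close> says that away from these points \<open>L\<close> contains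
 \<open>u\<^sub>3\<close> and \<open>v\<^sub>3\<close>, while near the point \<open>c\<close> it contains \<open>W c\<close>.
\<close>

lemma near_curve:
 fixes t1 t2 t3 :: "4 => 'k" and u1 v1 u2 v2 u3 v3 x1 x2 f G F :: 'r
 defines "A \<equiv> %c. v1 - C (t1 c) * u1" and "B \<equiv> %c. v2 - C (t2 c) * u2" and "W \<equiv> %c. v3 - C (t3 c) * u3"
 defines "P \<equiv> u1 * v1 + u2 * v2 + u3 * v3"
 assumes inj: "inj t1" "inj t2" "inj t3"
  and sat1: "!!f. x1 * f : L ==> f : L" "x1 : {u1, v1}"
  and sat2: "!!f. x2 * f : L ==> f : L" "x2 : {u2, v2}"
  and star: "(ALL c c' d e. distinct [c, c', d, e] --> A c * A c' * B d * W e : L) |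
   (ALL c c' d e. distinct [c, c', d, e] --> B c * B c' * A d * W e : L)"
  and P: "P : L" and G: "G : L"
  and GK: "!!c. G : ideal_gen {A c, B c, W c, P}"
  and GF: "G - C k * x1 * F \<in> ideal_gen {u3, v3, P}" and k: "k ~= 0"
  and fE: "f \<in> ideal_gen {u3, v3, P, F}"
  and fK: "!!c. f : ideal_gen {A c, B c, W c, P}"
  and prime: "!!c g. u3 * g : ideal_gen {A c, B c, W c, P} ==> g \<in> ideal_gen {A c, B c, W c, P}"
 shows "f \<in> L"
proof -
 define K where "K c = ideal_gen {A c, B c, W c, P}" for c
 have Ki: "is_ideal (K c)" for c by (simp add: K_def)
 note Ks = idealD[OF Ki]
 have PK: "P : K c" "W c : K c" for c
  by (auto simp: K_def intro: ideal_gen_base)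
 obtain a b p g where f: "f = a * u3 + b * v3 + p * P + g * F"
  using fE by (rule ideal_gen_4E)
 obtain a' b' p' where GF': "G - C k * x1 * F = a' * u3 + b' * v3 + p' * P"
  using GF by (rule ideal_gen_3E)
 \<comment> \<open>\<open>G\<close> replaces \<open>F\<close>: as \<open>G\<close> lies in
   \<open>L\<close> and equals \<open>C k * x1 * F\<close> modulo \<open>u3\<close>,
   \<open>v3\<close>, \<open>P\<close>, it remains to treat the part \<open>f2\<close> in the ideal
   \<open>(u3, v3)\<close>, since \<open>C k * x1\<close> can be cancelled.\<close>
 define r s q where "r = C k * x1 * a - g * a'" and "s = C k * x1 * b - g * b'"
  and "q = C k * x1 * p - g * p'"
 define f2 where "f2 = r * u3 + s * v3"
 have f2: "C k * (x1 * f) = f2 + g * G + q * P"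
 proof -
  have "G = C k * x1 * F + a' * u3 + b' * v3 + p' * P"
   using GF' by (simp add: algebra_simps)
  then show ?thesis
   by (simp add: f f2_def r_def s_def q_def algebra_simps)
 qed
 have f2K: "f2 : K c" for c
 proof -
  have "f2 = C k * x1 * f - g * G - q * P"
   using f2 by (simp add: algebra_simps)
  moreover have "C k * x1 * f : K c" "g * G : K c" "q * P : K c"
   using fK[of c] GK[of c] PK(1)[of c] by (simp_all add: Ks(3) flip: K_def)
  ultimately show ?thesis
   by (simp add: Ks(6))
 qed
 \<comment> \<open>Away from the four points \<open>L\<close> contains \<open>W x\<close> and
   \<open>W y\<close> for two different indices, hence \<open>u3\<close> and
   \<open>v3\<close>.\<close>
 have M: "A c * A d * B e * B f * u3 : L" "A c * A d * B e * B f * v3 : L" if cdef: "distinct [c, d, e, f]" for c d e f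
 proof -
  let ?h = "A c * A d * B e * B f"
  have "EX x y. ?h * W x : L & ?h * W y : L & x ~= y"
   using star
  proof
   assume "ALL c c' d e. distinct [c, c', d, e] --> A c * A c' * B d * W e : L"
   then have "A c * A d * B e * W f : L" "A c * A d * B f * W e : L" "e ~= f"
    using cdef by auto
   then show ?thesis
    using L_simps(3)[of "A c * A d * B e * W f" "B f"] L_simps(3)[of "A c * A d * B f * W e" "B e"]
    by (intro exI[of _ e] exI[of _ f]) (simp add: mult_ac)
  next
   assume "ALL c c' d e. distinct [c, c', d, e] --> B c * B c' * A d * W e : L"
   then have "B e * B f * A c * W d : L" "B e * B f * A d * W c : L" "c ~= d"
    using cdef by auto
   then show ?thesis
    using L_simps(3)[of "B e * B f * A c * W d" "A d"] L_simps(3)[of "B e * B f * A d * W c" "A c"]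
    by (intro exI[of _ c] exI[of _ d]) (simp add: mult_ac)
  qed
  then obtain x y where xy: "?h * W x : L" "?h * W y : L" "x ~= y"
   by blast
  have ne: "t3 y - t3 x ~= 0" using inj xy(3) by (auto dest: injD)
  have "C (t3 y - t3 x) * (?h * u3) = ?h * W x - ?h * W y"
   by (simp add: W_def rhom_diff[OF C] algebra_simps)
  then have "C (t3 y - t3 x) * (?h * u3) : L"
   using L_simps(6)[OF xy(1,2)] by simp
  then show u3: "?h * u3 : L"
   by (rule unit_cancel[OF ne])
  have "?h * v3 = ?h * W x + C (t3 x) * (?h * u3)"
   by (simp add: W_def algebra_simps)
  then show "?h * v3 : L" using xy u3 by (simp add: L_simps)
 qed
 \<comment> \<open>Near the point \<open>c\<close> the other six factors are invertible, and there
   \<open>L\<close> contains \<open>W c\<close>.\<close>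
 have N: "A d * A e * A f * B d * B e * B f * W c : L" if "distinct [c, d, e, f]" for c d e f
 proof -
  have "A d * A e * B f * W c : L | B d * B e * A f * W c : L"
   using star that by (simp only: distinct.simps) auto
  then show ?thesis
  proof
   assume "A d * A e * B f * W c : L"
   from L_simps(3)[OF this, of "A f * B d * B e"] show ?thesis by (simp add: mult_ac)
  next
   assume "B d * B e * A f * W c : L"
   from L_simps(3)[OF this, of "A d * A e * B f"] show ?thesis by (simp add: mult_ac)
  qed
 qed
 have ne: "t1 c ~= t1 d" "t2 c ~= t2 d" if "c ~= d" for c d
  using inj that by (auto dest: injD)
 have coA: "g : L" if "c ~= d" "(A c)^2 * g : L" "(A d)^2 * g : L" for c d g
  using comaximal_squares[of "t1 c" "t1 d" v1 u1 g x1] that(2,3) ne(1)[OF that(1)] sat1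
  unfolding A_def by blast
 have coB: "g : L" if "c ~= d" "B c * g : L" "B d * g : L" for c d g
  using comaximal[of "t2 c" "t2 d" v2 u2 g x2] that(2,3) ne(2)[OF that(1)] sat2
  unfolding B_def by blast
 \<comment> \<open>Localisation at the point \<open>c\<close>: membership of \<open>f2\<close> up to
   factors that do not vanish there. The squares come from combining two instances of
   \<open>M\<close> below.\<close>
 have X: "(A d)^2 * ((A e)^2 * ((A f)^2 * f2)) : L" if cdef: "distinct [c, d, e, f]" for c d e f
 proof -
  define pi where "pi = A d * A e * A f * B d * B e * B f"
  define h where "h = (A d)^2 * ((A e)^2 * ((A f)^2 * f2))"
  \<comment> \<open>Modulo \<open>W c\<close> the form \<open>v3\<close> is
    \<open>C (t3 c) * u3\<close>, so \<open>f2\<close> becomes a multiple of \<open>u3\<close>; as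
    \<open>u3\<close> is a nonzerodivisor modulo the ideal of the conic, that ideal contains the
    other factor.\<close>
  have "u3 * (r + C (t3 c) * s) = f2 - s * W c"
   by (simp add: f2_def W_def algebra_simps)
  also have "... : K c"
   using f2K PK by (simp add: Ks)
  finally have "r + C (t3 c) * s : K c"
   unfolding K_def by (rule prime)
  then obtain a1 a2 a3 a4 where f': "r + C (t3 c) * s = a1 * A c + a2 * B c + a3 * W c + a4 * P"
   unfolding K_def by (rule ideal_gen_4E)
  have "f2 = u3 * (r + C (t3 c) * s) + s * W c"
   by (simp add: f2_def W_def algebra_simps)
  then have f2': "f2 = a1 * (A c * u3) + a2 * (B c * u3) + (a3 * u3 + s) * W c + (a4 * u3) * P"
   unfolding f' by (simp add: algebra_simps)
  have "pi * (A c * u3) : L"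
   using L_simps(3)[OF M(1)[OF cdef], of "A e * A f * B d"] by (simp add: pi_def mult_ac)
  moreover have "pi * (B c * u3) : L"
   using L_simps(3)[OF M(1)[of e f c d], of "A d * B e * B f"] cdef by (auto simp: pi_def mult_ac)
  moreover have "pi * W c : L"
   using N[OF cdef] by (simp add: pi_def mult_ac)
  ultimately have "a1 * (pi * (A c * u3)) + a2 * (pi * (B c * u3)) + (a3 * u3 + s) * (pi * W c) + (a4 * u3 * pi) * P : L"
   using P by (simp add: L_simps)
  then have "pi * f2 : L"
   by (simp add: f2' algebra_simps)
  then have Y: "B d * (B e * (B f * h)) : L"
   using L_simps(3)[of "pi * f2" "A d * A e * A f"] by (simp add: pi_def h_def power2_eq_square mult_ac)
  \<comment> \<open>\<open>M\<close> with the indices arranged so that \<open>B c\<close> occurs: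
    together with one further \<open>B\<close> it moves \<open>h\<close> into
    \<open>L\<close>.\<close>
  have MB: "B d * (B c * h) : L" "B e * (B c * h) : L"
  proof -
   have *: "B x * (B c * ((A x)^2 * ((A y)^2 * ((A z)^2 * f2)))) : L" if "distinct [c, x, y, z]" for x y z
   proof -
    have yz: "distinct [y, z, x, c]" using that by auto
    have "r * (A y * A z * B x * B c * u3) + s * (A y * A z * B x * B c * v3) : L"
     using M[OF yz] by (simp add: L_simps)
    then have "(A x * A x * A y * A z) * (r * (A y * A z * B x * B c * u3) + s * (A y * A z * B x * B c * v3)) : L"
     by (rule L_simps)
    then show ?thesis
     by (simp add: f2_def power2_eq_square algebra_simps)
   qed
   show "B d * (B c * h) : L"
    using *[of d e f] cdef by (simp add: h_def)
   show "B e * (B c * h) : L"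
    using *[of e d f] cdef by (auto simp: h_def mult.left_commute)
  qed
  have de: "d ~= e" "c ~= d" "c ~= e" "c ~= f" using cdef by auto
  have Bc: "B c * h : L"
   using coB[OF de(1) MB] .
  \<comment> \<open>Since \<open>B c * h\<close> lies in \<open>L\<close>, each remaining factor
    \<open>B\<close> can be removed by comaximality with \<open>B c\<close>.\<close>
  have strip: "g : L" if "B x * g : L" "B c * g : L" "x ~= c" for x g
   using coB[OF that(3,1,2)] .
  have Bcm: "B c * (B y * h) : L" "B c * (B y * (B z * h)) : L" for y z
   using L_simps(3)[OF Bc, of "B y"] L_simps(3)[OF Bc, of "B y * B z"] by (simp_all add: mult_ac)
  from Y have "B e * (B f * h) : L"
   by (rule strip) (use de Bcm in auto)
  then have "B f * h : L"
   by (rule strip) (use de Bcm in auto)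
  then have "h : L"
   by (rule strip) (use de Bc in auto)
  then show ?thesis by (simp add: h_def)
 qed
 \<comment> \<open>Changing the omitted index varies one square at a time, and \<open>coA\<close>
   removes it.\<close>
 have X2: "(A e)^2 * ((A f)^2 * f2) : L" if "distinct [c, d, e, f]" for c d e f
  using coA[OF _ X[of c d e f] X[of d c e f]] that by auto
 have X1: "(A f)^2 * f2 : L" if "distinct [c, d, e, f]" for c d e f
  using coA[OF _ X2[of c d e f] X2[of c e d f]] that by auto
 \<comment> \<open>In the index type \<open>4\<close> the numeral \<open>4\<close> denotes
   \<open>0\<close>, so these are again all four indices.\<close>
 have "f2 : L"
  using coA[OF _ X1[of 3 4 2 1] X1[of 3 4 1 2]] by simp
 then have "C k * (x1 * f) : L"
  unfolding f2 using G P by (simp add: L_simps)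
 then show "f : L"
  using unit_cancel[OF k] sat1(1) by blast
qed

end

lemma exhaust_4': "x = 0 | x = 1 | x = 2 | x = (3 :: 4)"
 using exhaust_4[of x] by auto

section \<open>Four points in a product of lines, and the parameter constraint\<close>

definition segre :: "(4 => 'k::comm_ring_1) => (4 => 'k) => 4 => 4 => 4 => 4 => 'k" where
 "segre s t c c' d e = (s c - s e) * (t c - t d) * (s c' - s d) * (t c' - t e)
  - (s c' - s e) * (t c' - t d) * (s c - s d) * (t c - t e)"

text \<open>\<open>segre s t c c' d e\<close> is the determinant of the four Segre points \<open>(1, s i, t i, s i * t i)\<close>.\<close>

lemma segre_sign:
 assumes "distinct [c, c', d, e]"
 shows "segre s t c c' d e = segre s t 0 1 2 3 | segre s t c c' d e = - segre s t 0 1 2 3"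
proof -
 have s1: "segre s t c' c d e = - segre s t c c' d e" for c c' d e
  by (simp add: segre_def)
 have s2: "segre s t c d c' e = - segre s t c c' d e" for c c' d e
  by (simp add: segre_def algebra_simps)
 have s3: "segre s t c c' e d = - segre s t c c' d e" for c c' d e
  by (simp add: segre_def algebra_simps)
 define Q where "Q c c' d e \<longleftrightarrow> segre s t c c' d e = segre s t 0 1 2 3 | segre s t c c' d e = - segre s t 0 1 2 3" for c c' d e
 have t: "Q c c' d e ==> Q c' c d e" "Q c c' d e ==> Q c d c' e" "Q c c' d e ==> Q c c' e d" for c c' d e
  unfolding Q_def s1[of c' c] s2[of c d] s3[of c c' e] by auto
 have x: "Q 0 1 2 3" by (simp add: Q_def)
 \<comment> \<open>The facts \<open>a\<close>, \<open>b\<close>, \<open>c\<close>, \<open>d\<close>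
   list the orderings with \<open>0\<close> in the first, second, third and fourth place.\<close>
 note a = x x[THEN t(3)] x[THEN t(2)] x[THEN t(2), THEN t(3)] x[THEN t(3), THEN t(2)]
  x[THEN t(3), THEN t(2), THEN t(3)]
 note b = a[THEN t(1)]
 note c = b[THEN t(2)]
 note d = c[THEN t(3)]
 have "Q c c' d e"
  using assms exhaust_4'[of c] exhaust_4'[of c'] exhaust_4'[of d] exhaust_4'[of e]
  by (elim disjE) (simp_all add: a b c d)
 then show ?thesis by (simp add: Q_def)
qed

text \<open>On the conic with number \<open>c\<close> the coordinates satisfy
  \<open>v_i = slope_i c * u_i\<close>. For the second pair \<open>v2 = - z13\<close> reverses the
  signs in the equations of the planes.\<close>

definition slope1 :: "'k::ring_1 => 4 => 'k" where
 "slope1 \<alpha> c = (if c = 0 then - \<alpha> else if c = 1 then \<alpha> else if c = 2 then - 1 else 1)"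

definition slope2 :: "'k::ring_1 => 4 => 'k" where
 "slope2 \<beta> c = (if c = 0 then - \<beta> else if c = 1 then 1 else if c = 2 then \<beta> else - 1)"

definition slope3 :: "'k::ring_1 => 4 => 'k" where
 "slope3 \<gamma> c = (if c = 0 then - \<gamma> else if c = 1 then - 1 else if c = 2 then 1 else \<gamma>)"

lemmas slope_defs = slope1_def slope2_def slope3_def

locale params =
 fixes \<alpha> \<beta> \<gamma> :: "'k::field"
 assumes char: "(2 :: 'k) ~= 0"
  and nz: "\<alpha> ~: {0, 1, -1}" "\<beta> ~: {0, 1, -1}" "\<gamma> ~: {0, 1, -1}"
  and con: "\<alpha> + \<beta> + \<gamma> + \<alpha> * \<beta> * \<gamma> = 0"
begin

lemma nzs: "\<alpha> ~= 0" "\<beta> ~= 0" "\<gamma> ~= 0" "1 + \<alpha> ~= 0" "1 + \<beta> ~= 0" "1 + \<gamma> ~= 0" "1 - \<alpha> ~= 0" "1 - \<beta> ~= 0" "1 - \<gamma> ~= 0"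
 using nz by (auto simp: add_eq_0_iff)

text \<open>With \<beta>*\<gamma> = -1 the constraint would give \<gamma> = -\<beta>, hence
  \<beta>^2 = 1.\<close>

lemma bc: "1 + \<beta> * \<gamma> ~= 0" "\<beta> + \<gamma> ~= 0" "\<alpha> * (1 + \<beta> * \<gamma>) = - (\<beta> + \<gamma>)"
proof -
 show *: "\<alpha> * (1 + \<beta> * \<gamma>) = - (\<beta> + \<gamma>)" using con by Groebner_Basis.algebra
 show n: "1 + \<beta> * \<gamma> ~= 0"
 proof
  assume a: "1 + \<beta> * \<gamma> = 0"
  then have "\<gamma> = - \<beta>" using * by (simp add: add_eq_0_iff)
  then have "(1 - \<beta>) * (1 + \<beta>) = 0" using a by Groebner_Basis.algebra
  then show False using nzs by simp
 qed
 then show "\<beta> + \<gamma> ~= 0" using * nzs by (metis mult_eq_0_iff neg_equal_0_iff_equal)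
qed

lemma inj_slopes: "inj (slope1 \<alpha>)" "inj (slope2 \<beta>)" "inj (slope3 \<gamma>)"
proof -
 have one: "(1 :: 'k) ~= - 1" "(- 1 :: 'k) ~= 1"
  using char by (metis one_add_one add_eq_0_iff)+
 have d: "- x ~= x" "x ~= 1" "x ~= - 1" "1 ~= x" "- 1 ~= x" "- x ~= 1" "- x ~= - 1" if "x ~: {0, 1, -1}" for x :: 'k
 proof -
  have "2 * x ~= 0" using that char by simp
  then show "- x ~= x" by (metis add.left_inverse mult_2)
  show "x ~= 1" "x ~= - 1" "1 ~= x" "- 1 ~= x" using that by auto
  then show "- x ~= 1" "- x ~= - 1" by (auto simp: minus_equation_iff)
 qed
 have *: "inj f" if "f 0 ~= f 1" "f 0 ~= f 2" "f 0 ~= f 3" "f 1 ~= f 2" "f 1 ~= f 3" "f 2 ~= f (3 :: 4)" for f :: "4 => 'k"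
 proof (rule injI)
  fix x y assume "f x = f y"
  then show "x = y" using that exhaust_4'[of x] exhaust_4'[of y] by (elim disjE) simp_all
 qed
 show "inj (slope1 \<alpha>)" "inj (slope2 \<beta>)" "inj (slope3 \<gamma>)"
  by (rule *; simp add: slope_defs one d[OF nz(1)] d[OF nz(2)] d[OF nz(3)])+
qed

text \<open>A Segre determinant vanishes iff the four pairs of slopes lie on a curve of bidegree (1,
  1). The constraint expresses \<open>1 + \<alpha>\<close> and \<open>1 - \<alpha>\<close> through
  \<beta> and \<gamma>; two vanishing determinants then combine to
  \<open>8 * \<gamma> * (1 + \<beta>)^2 = 0\<close> or to
  \<open>8 * \<beta> * (1 - \<gamma>)^2 = 0\<close>.\<close>

lemma segre_nonzero:
 "segre (slope2 \<beta>) (slope3 \<gamma>) 0 1 2 3 ~= 0 | segre (slope1 \<alpha>) (slope3 \<gamma>) 0 1 2 3 ~= 0"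
 "segre (slope2 \<beta>) (slope3 \<gamma>) 0 1 2 3 ~= 0 | segre (slope1 \<alpha>) (slope2 \<beta>) 0 1 2 3 ~= 0"
proof -
 have a: "(1 + \<alpha>) * (1 + \<beta> * \<gamma>) = (1 - \<beta>) * (1 - \<gamma>)" "(1 - \<alpha>) * (1 + \<beta> * \<gamma>) = (1 + \<beta>) * (1 + \<gamma>)"
  using con by Groebner_Basis.algebra+
 have s23: "segre (slope2 \<beta>) (slope3 \<gamma>) 0 1 2 3 = 16 * \<beta> * \<gamma> + (1 - \<beta>)^2 * (1 + \<gamma>)^2"
  by (simp add: segre_def slope_defs) Groebner_Basis.algebra
 have s13: "segre (slope1 \<alpha>) (slope3 \<gamma>) 0 1 2 3 = 4 * \<gamma> * (1 - \<alpha>)^2 - (1 + \<alpha>)^2 * (1 + \<gamma>)^2"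
  by (simp add: segre_def slope_defs) Groebner_Basis.algebra
 have s12: "segre (slope1 \<alpha>) (slope2 \<beta>) 0 1 2 3 = (1 - \<alpha>)^2 * (1 - \<beta>)^2 + 4 * \<beta> * (1 + \<alpha>)^2"
  by (simp add: segre_def slope_defs) Groebner_Basis.algebra
 have two: "(8 :: 'k) ~= 0"
  using char by (metis mult_eq_0_iff numeral_Bit0_eq_double)
 show "segre (slope2 \<beta>) (slope3 \<gamma>) 0 1 2 3 ~= 0 | segre (slope1 \<alpha>) (slope3 \<gamma>) 0 1 2 3 ~= 0"
 proof (rule ccontr)
  assume "~ ?thesis"
  then have e: "16 * \<beta> * \<gamma> + (1 - \<beta>)^2 * (1 + \<gamma>)^2 = 0" "4 * \<gamma> * (1 - \<alpha>)^2 - (1 + \<alpha>)^2 * (1 + \<gamma>)^2 = 0"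
   by (simp_all add: s23 s13)
  have "(1 + \<gamma>)^2 * (4 * \<gamma> * (1 + \<beta>)^2 - (1 - \<beta>)^2 * (1 - \<gamma>)^2) =
    4 * \<gamma> * ((1 + \<beta>) * (1 + \<gamma>))^2 - ((1 - \<beta>) * (1 - \<gamma>))^2 * (1 + \<gamma>)^2"
   by Groebner_Basis.algebra
  also have "... = (1 + \<beta> * \<gamma>)^2 * (4 * \<gamma> * (1 - \<alpha>)^2 - (1 + \<alpha>)^2 * (1 + \<gamma>)^2)"
   unfolding a[symmetric] by Groebner_Basis.algebra
  finally have "4 * \<gamma> * (1 + \<beta>)^2 - (1 - \<beta>)^2 * (1 - \<gamma>)^2 = 0"
   using e(2) nzs by simp
  then have "8 * \<gamma> * (1 + \<beta>)^2 = 0" using e(1) by Groebner_Basis.algebra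
  then show False using two nzs by simp
 qed
 show "segre (slope2 \<beta>) (slope3 \<gamma>) 0 1 2 3 ~= 0 | segre (slope1 \<alpha>) (slope2 \<beta>) 0 1 2 3 ~= 0"
 proof (rule ccontr)
  assume "~ ?thesis"
  then have e: "16 * \<beta> * \<gamma> + (1 - \<beta>)^2 * (1 + \<gamma>)^2 = 0" "(1 - \<alpha>)^2 * (1 - \<beta>)^2 + 4 * \<beta> * (1 + \<alpha>)^2 = 0"
   by (simp_all add: s23 s12)
  have "(1 - \<beta>)^2 * ((1 + \<beta>)^2 * (1 + \<gamma>)^2 + 4 * \<beta> * (1 - \<gamma>)^2) =
    ((1 + \<beta>) * (1 + \<gamma>))^2 * (1 - \<beta>)^2 + 4 * \<beta> * ((1 - \<beta>) * (1 - \<gamma>))^2"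
   by Groebner_Basis.algebra
  also have "... = (1 + \<beta> * \<gamma>)^2 * ((1 - \<alpha>)^2 * (1 - \<beta>)^2 + 4 * \<beta> * (1 + \<alpha>)^2)"
   unfolding a[symmetric] by Groebner_Basis.algebra
  finally have "(1 + \<beta>)^2 * (1 + \<gamma>)^2 + 4 * \<beta> * (1 - \<gamma>)^2 = 0"
   using e(2) nzs by simp
  then have "8 * \<beta> * (1 - \<gamma>)^2 = 0" using e(1) by Groebner_Basis.algebra
  then show False using two nzs by simp
 qed
qed

text \<open>The equations are the conditions at the four slope triples on combinations of
  \<open>u1*u2*u3\<close>, \<open>u1*v2*v3\<close>, \<open>v1*u2*v3\<close>,
  \<open>v1*v2*u3\<close>. After elimination of \<open>w0\<close> the determinant is the square of
  \<open>(1 + \<alpha>) * (1 + \<beta>) * (1 + \<gamma>)\<close>.\<close>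

lemma four_points_independent:
 assumes "w0 + \<beta> * \<gamma> * w1 + \<alpha> * \<gamma> * w2 + \<alpha> * \<beta> * w3 = 0" "w0 - w1 - \<alpha> * w2 + \<alpha> * w3 = 0"
  "w0 + \<beta> * w1 - w2 - \<beta> * w3 = 0" "w0 - \<gamma> * w1 + \<gamma> * w2 - w3 = 0"
 shows "w0 = 0" "w1 = 0" "w2 = 0" "w3 = 0"
proof -
 let ?e = "1 + \<alpha> * \<beta> + \<beta> * \<gamma> + \<gamma> * \<alpha>"
 have "?e = (1 + \<alpha>) * (1 + \<beta>) * (1 + \<gamma>)" using con by Groebner_Basis.algebra
 then have e: "?e^2 ~= 0" using nzs by simp
 define D where "D = (1+\<beta>) * ((\<alpha>+\<gamma>) * (\<alpha> * (\<beta>-1)) + (1+\<alpha>) * (\<alpha> * (1+\<gamma>)))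
   - (\<alpha>-1) * ((1-\<gamma>) * (\<alpha> * (\<beta>-1)) + (1+\<alpha>) * (1+\<beta> * \<gamma>)) - (\<alpha>+\<beta>) * ((1-\<gamma>) * (\<alpha> * (1+\<gamma>)) - (\<alpha>+\<gamma>) * (1+\<beta> * \<gamma>))"
 have "D = ?e^2" unfolding D_def by Groebner_Basis.algebra
 then have D: "D ~= 0" using e by simp
 have r: "(1+\<beta>) * w1 + (\<alpha>-1) * w2 - (\<alpha>+\<beta>) * w3 = 0" "(1-\<gamma>) * w1 + (\<alpha>+\<gamma>) * w2 - (1+\<alpha>) * w3 = 0"
  "(1+\<beta> * \<gamma>) * w1 + \<alpha> * (1+\<gamma>) * w2 + \<alpha> * (\<beta>-1) * w3 = 0"
  using assms by Groebner_Basis.algebra+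
 have "D * w1 = 0" "D * w2 = 0" "D * w3 = 0" unfolding D_def using r by Groebner_Basis.algebra+
 then show w: "w1 = 0" "w2 = 0" "w3 = 0" using D by auto
 then show "w0 = 0" using assms(2) by simp
qed

end

section \<open>Cubic forms in the Pluecker coordinates\<close>

locale line_coords =
 fixes C :: "'k::field => 'r::comm_ring_1" and \<alpha> \<beta> \<gamma> :: 'k and u1 v1 u2 v2 u3 v3 :: 'r
begin

definition P where "P = u1 * v1 + u2 * v2 + u3 * v3"

definition A where "A c = v1 - C (slope1 \<alpha> c) * u1"
definition B where "B c = v2 - C (slope2 \<beta> c) * u2"
definition W where "W c = v3 - C (slope3 \<gamma> c) * u3"

definition K where "K c = ideal_gen {A c, B c, W c, P}"

text \<open>\<open>F1\<close> cuts \<open>E_1\<close> out of the quadric surface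
  \<open>u1 = v1 = P = 0\<close>. On Pluecker vectors of secants it is, up to a nonzero factor, a
  determinant of the two quadrics defining \<open>E\<close>, see \<open>zero_mm\<close>;
  \<open>F2\<close> and \<open>F3\<close> are its cyclic images.\<close>

definition F1 where "F1 = C (1 - \<beta>) * (v3^2 + C \<gamma> * u3^2) - C (1 + \<gamma>) * (v2^2 - C \<beta> * u2^2)"
definition F2 where "F2 = C (1 - \<gamma>) * (v1^2 + C \<alpha> * u1^2) - C (1 + \<alpha>) * (v3^2 - C \<gamma> * u3^2)"
definition F3 where "F3 = C (1 - \<alpha>) * (v2^2 + C \<beta> * u2^2) - C (1 + \<beta>) * (v1^2 - C \<alpha> * u1^2)"

definition on_all where
 "on_all f \<longleftrightarrow> (ALL c. f : K c) & f : ideal_gen {u1, v1, P, F1} & f \<in> ideal_gen {u2, v2, P, F2} &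
  f \<in> ideal_gen {u3, v3, P, F3}"

definition trilin where
 "trilin a0 a1 a2 a3 w0 w1 w2 w3 = C a0 * (v1 * v2 * v3) + C a1 * (v1 * u2 * u3) + C a2 * (u1 * v2 * u3) + C a3 * (u1 * u2 * v3) +
  C w0 * (u1 * u2 * u3) + C w1 * (u1 * v2 * v3) + C w2 * (v1 * u2 * v3) + C w3 * (v1 * v2 * u3)"

abbreviation (input) "\<epsilon> \<equiv> 1 + \<alpha> * \<beta> + \<beta> * \<gamma> + \<gamma> * \<alpha>"

text \<open>Each \<open>cub_i\<close> is the trilinear form through the four slope triples whose
  coefficient is \<epsilon> at one of the first four monomials and zero at the other three; the
  remaining coefficients solve the system of \<open>four_points_independent\<close>.\<close>

definition cub0 where "cub0 = trilin \<epsilon> 0 0 0 (4 * \<alpha> * \<beta> * \<gamma>) (\<alpha> * (\<beta>-1) * (1+\<gamma>)) (\<beta> * (\<gamma>-1) * (1+\<alpha>)) (\<gamma> * (\<alpha>-1) * (1+\<beta>))"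
definition cub1 where "cub1 = trilin 0 \<epsilon> 0 0 (\<alpha> * (1-\<beta>) * (1+\<gamma>)) (4 * \<alpha>) ((\<alpha>-1) * (1+\<beta>)) ((1-\<gamma>) * (1+\<alpha>))"
definition cub2 where "cub2 = trilin 0 0 \<epsilon> 0 (\<beta> * (1-\<gamma>) * (1+\<alpha>)) ((1-\<alpha>) * (1+\<beta>)) (4 * \<beta>) ((\<beta>-1) * (1+\<gamma>))"
definition cub3 where "cub3 = trilin 0 0 0 \<epsilon> (\<gamma> * (1-\<alpha>) * (1+\<beta>)) ((\<gamma>-1) * (1+\<alpha>)) ((1-\<beta>) * (1+\<gamma>)) (4 * \<gamma>)"

text \<open>Trilinear forms vanish where \<open>u_i = v_i = 0\<close>, so they cannot cut out the
  elliptic curves. This cubic reduces to multiples of \<open>u1*F2\<close> and \<open>u1*F3\<close>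
  on the surfaces containing \<open>E_2\<close> and \<open>E_3\<close>, and it vanishes on all four
  conics. It comes from a combination of two minors, divided by \<open>z01\<close>.\<close>

definition cubu where
 "cubu = u1 * (C ((1+\<alpha>) * (1+\<beta>)) * (v3^2 - C \<gamma> * u3^2) - C ((1-\<gamma>) * (1-\<alpha>)) * (v2^2 + C \<beta> * u2^2))
  + C ((1-\<gamma>) * (1+\<beta>)) * (v1 * (u3 * v3 - u2 * v2) - C \<alpha> * u1^3)"

end

text \<open>What the minors yield where \<open>u1\<close> is invertible, stated for an arbitrary
  ideal so that the other charts can be carried over to this one.\<close>

locale chart = line_coords C \<alpha> \<beta> \<gamma> u1 v1 u2 v2 u3 v3 + params \<alpha> \<beta> \<gamma> + saturated_ideal C L
 for C :: "'k::field => 'r::comm_ring_1" and \<alpha> \<beta> \<gamma> u1 v1 u2 v2 u3 v3 L +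
 assumes sat: "u1 * f : L ==> f : L"
  and P_in: "P : L" and cubs: "cub0 : L" "cub1 : L" "cub2 : L" "cub3 : L" and cubu: "cubu : L"
begin

lemmas Cs = rhomD[OF C] rhom_uminus[OF C] rhom_diff[OF C] rhom_power[OF C] rhom_numeral[OF C]

text \<open>The conditions at the four points determine \<open>w0\<close>, ..., \<open>w3\<close>
  from \<open>a0\<close>, ..., \<open>a3\<close>, so that \<epsilon> times the form is the
  combination of the \<open>cub_i\<close> with coefficients \<open>a_i\<close>.\<close>

lemma trilin_in:
 assumes z: "!!c. a0 * (slope1 \<alpha> c * slope2 \<beta> c * slope3 \<gamma> c) + a1 * slope1 \<alpha> c + a2 * slope2 \<beta> c + a3 * slope3 \<gamma> c +
  w0 + w1 * (slope2 \<beta> c * slope3 \<gamma> c) + w2 * (slope1 \<alpha> c * slope3 \<gamma> c) + w3 * (slope1 \<alpha> c * slope2 \<beta> c) = 0"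
 shows "trilin a0 a1 a2 a3 w0 w1 w2 w3 : L"
proof -
 define x0 where "x0 = \<epsilon> * w0 - (a0 * (4 * \<alpha> * \<beta> * \<gamma>) + a1 * (\<alpha> * (1-\<beta>) * (1+\<gamma>)) + a2 * (\<beta> * (1-\<gamma>) * (1+\<alpha>)) + a3 * (\<gamma> * (1-\<alpha>) * (1+\<beta>)))"
 define x1 where "x1 = \<epsilon> * w1 - (a0 * (\<alpha> * (\<beta>-1) * (1+\<gamma>)) + a1 * (4 * \<alpha>) + a2 * ((1-\<alpha>) * (1+\<beta>)) + a3 * ((\<gamma>-1) * (1+\<alpha>)))"
 define x2 where "x2 = \<epsilon> * w2 - (a0 * (\<beta> * (\<gamma>-1) * (1+\<alpha>)) + a1 * ((\<alpha>-1) * (1+\<beta>)) + a2 * (4 * \<beta>) + a3 * ((1-\<beta>) * (1+\<gamma>)))"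
 define x3 where "x3 = \<epsilon> * w3 - (a0 * (\<gamma> * (\<alpha>-1) * (1+\<beta>)) + a1 * ((1-\<gamma>) * (1+\<alpha>)) + a2 * ((\<beta>-1) * (1+\<gamma>)) + a3 * (4 * \<gamma>))"
 have z': "- a0 * \<alpha> * \<beta> * \<gamma> - a1 * \<alpha> - a2 * \<beta> - a3 * \<gamma> + w0 + w1 * \<beta> * \<gamma> + w2 * \<alpha> * \<gamma> + w3 * \<alpha> * \<beta> = 0"
  "- a0 * \<alpha> + a1 * \<alpha> + a2 - a3 + w0 - w1 - w2 * \<alpha> + w3 * \<alpha> = 0"
  "- a0 * \<beta> - a1 + a2 * \<beta> + a3 + w0 + w1 * \<beta> - w2 - w3 * \<beta> = 0"
  "- a0 * \<gamma> + a1 - a2 + a3 * \<gamma> + w0 - w1 * \<gamma> + w2 * \<gamma> - w3 = 0"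
  using z[of 0] z[of 1] z[of 2] z[of 3] by (simp_all add: slope_defs algebra_simps)
 have "x0 + \<beta> * \<gamma> * x1 + \<alpha> * \<gamma> * x2 + \<alpha> * \<beta> * x3 = 0"
  unfolding x0_def x1_def x2_def x3_def using z'(1) by Groebner_Basis.algebra
 moreover have "x0 - x1 - \<alpha> * x2 + \<alpha> * x3 = 0"
  unfolding x0_def x1_def x2_def x3_def using z'(2) by Groebner_Basis.algebra
 moreover have "x0 + \<beta> * x1 - x2 - \<beta> * x3 = 0"
  unfolding x0_def x1_def x2_def x3_def using z'(3) by Groebner_Basis.algebra
 moreover have "x0 - \<gamma> * x1 + \<gamma> * x2 - x3 = 0"
  unfolding x0_def x1_def x2_def x3_def using z'(4) by Groebner_Basis.algebra
 ultimately have x: "x0 = 0" "x1 = 0" "x2 = 0" "x3 = 0"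
  by (rule four_points_independent)+
 have lin: "trilin (k * b0) (k * b1) (k * b2) (k * b3) (k * y0) (k * y1) (k * y2) (k * y3) = C k * trilin b0 b1 b2 b3 y0 y1 y2 y3"
  "trilin (b0+c0) (b1+c1) (b2+c2) (b3+c3) (y0+z0) (y1+z1) (y2+z2) (y3+z3) =
   trilin b0 b1 b2 b3 y0 y1 y2 y3 + trilin c0 c1 c2 c3 z0 z1 z2 z3"
  for k b0 b1 b2 b3 y0 y1 y2 y3 c0 c1 c2 c3 z0 z1 z2 z3
  by (simp_all add: trilin_def Cs distrib_left distrib_right mult.assoc)
 have "C \<epsilon> * trilin a0 a1 a2 a3 w0 w1 w2 w3 = trilin (\<epsilon> * a0) (\<epsilon> * a1) (\<epsilon> * a2) (\<epsilon> * a3) (\<epsilon> * w0) (\<epsilon> * w1) (\<epsilon> * w2) (\<epsilon> * w3)"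
  by (simp add: lin)
 also have "... = C a0 * cub0 + C a1 * cub1 + C a2 * cub2 + C a3 * cub3"
  unfolding cub0_def cub1_def cub2_def cub3_def lin[symmetric]
  using x unfolding x0_def x1_def x2_def x3_def by (simp add: mult.commute)
 also have "... : L"
  using cubs by (simp add: L_simps)
 finally have *: "C \<epsilon> * trilin a0 a1 a2 a3 w0 w1 w2 w3 : L" .
 have "\<epsilon> = (1 + \<alpha>) * (1 + \<beta>) * (1 + \<gamma>)" using con by Groebner_Basis.algebra
 then have "\<epsilon> ~= 0" using nzs by simp
 from this * show ?thesis by (rule unit_cancel)
qed

lemma products_in:
 assumes z: "!!i. p * ((slope1 \<alpha> i - a) * (slope2 \<beta> i - b) * (slope3 \<gamma> i - c)) +
   q * ((slope1 \<alpha> i - a') * (slope2 \<beta> i - b') * (slope3 \<gamma> i - c')) = 0"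
 shows "C p * ((v1 - C a * u1) * (v2 - C b * u2) * (v3 - C c * u3)) +
   C q * ((v1 - C a' * u1) * (v2 - C b' * u2) * (v3 - C c' * u3)) : L"
proof -
 have "trilin (p + q) (p * b * c + q * b'*c') (p * a * c + q * a'*c') (p * a * b + q * a'*b') (- p * a * b * c - q * a'*b'*c')
   (- p * a - q * a') (- p * b - q * b') (- p * c - q * c') : L"
 proof (rule trilin_in)
  fix i show "(p + q) * (slope1 \<alpha> i * slope2 \<beta> i * slope3 \<gamma> i) + (p * b * c + q * b'*c') * slope1 \<alpha> i +
   (p * a * c + q * a'*c') * slope2 \<beta> i + (p * a * b + q * a'*b') * slope3 \<gamma> i + (- p * a * b * c - q * a'*b'*c') +
   (- p * a - q * a') * (slope2 \<beta> i * slope3 \<gamma> i) + (- p * b - q * b') * (slope1 \<alpha> i * slope3 \<gamma> i) +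
   (- p * c - q * c') * (slope1 \<alpha> i * slope2 \<beta> i) = 0"
   using z[of i] by (simp add: algebra_simps)
 qed
 then show ?thesis
  by (simp add: trilin_def Cs algebra_simps)
qed

lemma cross_eliminate:
 assumes "h * (C p * X + C q * Y) : L" "h' * (C p' * X + C q' * Y) : L" "p * q' - p' * q ~= 0"
 shows "h * h' * X : L"
proof (rule unit_cancel[OF assms(3)])
 have "C (p * q' - p' * q) * (h * h' * X) = C q' * h' * (h * (C p * X + C q * Y)) - C q * h * (h' * (C p' * X + C q' * Y))"
  by (simp add: Cs algebra_simps)
 then show "C (p * q' - p' * q) * (h * h' * X) : L"
  using assms by (simp add: L_simps)
qed

text \<open>\<open>A c\<close> vanishes at \<open>c\<close>, each term of the bracket
  \<open>p * B d * W e + q * B e * W d\<close> vanishes at \<open>d\<close> and \<open>e\<close>,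
  and \<open>p\<close>, \<open>q\<close> make the bracket vanish at \<open>c'\<close>. Exchanging
  \<open>c\<close> and \<open>c'\<close> gives a second bracket. The determinant of the two is the
  Segre determinant, so both products can be isolated.\<close>

lemma star23:
 assumes "segre (slope2 \<beta>) (slope3 \<gamma>) 0 1 2 3 ~= 0" and d4: "distinct [c, c', d, e]"
 shows "A c * A c' * B d * W e : L"
proof -
 define p where "p x = (slope2 \<beta> x - slope2 \<beta> e) * (slope3 \<gamma> x - slope3 \<gamma> d)" for x
 define q where "q x = - ((slope2 \<beta> x - slope2 \<beta> d) * (slope3 \<gamma> x - slope3 \<gamma> e))" for x
 have l: "A c * (C (p c') * (B d * W e) + C (q c') * (B e * W d)) : L"
  if d4: "distinct [c, c', d, e]" for c c'
 proof -
  have "C (p c') * (A c * B d * W e) + C (q c') * (A c * B e * W d) : L"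
   unfolding A_def B_def W_def
  proof (rule products_in)
   fix i
   show "p c' * ((slope1 \<alpha> i - slope1 \<alpha> c) * (slope2 \<beta> i - slope2 \<beta> d) * (slope3 \<gamma> i - slope3 \<gamma> e)) +
     q c' * ((slope1 \<alpha> i - slope1 \<alpha> c) * (slope2 \<beta> i - slope2 \<beta> e) * (slope3 \<gamma> i - slope3 \<gamma> d)) = 0"
    using distinct4_exhaust[OF d4, of i] by (elim disjE) (simp_all add: p_def q_def)
  qed
  then show ?thesis by (simp add: distrib_left mult_ac)
 qed
 have "segre (slope2 \<beta>) (slope3 \<gamma>) c c' d e ~= 0"
  using segre_sign[OF d4, of "slope2 \<beta>" "slope3 \<gamma>"] assms(1) by auto
 then have "p c' * q c - p c * q c' ~= 0"
  by (simp add: segre_def p_def q_def mult_ac)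
 moreover have "A c' * (C (p c) * (B d * W e) + C (q c) * (B e * W d)) : L"
  using d4 by (intro l) auto
 ultimately show ?thesis
  using cross_eliminate[OF l[OF d4]] by (simp add: mult.assoc)
qed

text \<open>The same elimination with the first two pairs exchanged, for the case in which the
  determinant of \<open>star23\<close> vanishes.\<close>

lemma star13:
 assumes "segre (slope1 \<alpha>) (slope3 \<gamma>) 0 1 2 3 ~= 0" and d4: "distinct [c, c', d, e]"
 shows "B c * B c' * A d * W e : L"
proof -
 define p where "p x = (slope1 \<alpha> x - slope1 \<alpha> e) * (slope3 \<gamma> x - slope3 \<gamma> d)" for x
 define q where "q x = - ((slope1 \<alpha> x - slope1 \<alpha> d) * (slope3 \<gamma> x - slope3 \<gamma> e))" for x
 have l: "B c * (C (p c') * (A d * W e) + C (q c') * (A e * W d)) : L"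
  if d4: "distinct [c, c', d, e]" for c c'
 proof -
  have "C (p c') * (A d * B c * W e) + C (q c') * (A e * B c * W d) : L"
   unfolding A_def B_def W_def
  proof (rule products_in)
   fix i
   show "p c' * ((slope1 \<alpha> i - slope1 \<alpha> d) * (slope2 \<beta> i - slope2 \<beta> c) * (slope3 \<gamma> i - slope3 \<gamma> e)) +
     q c' * ((slope1 \<alpha> i - slope1 \<alpha> e) * (slope2 \<beta> i - slope2 \<beta> c) * (slope3 \<gamma> i - slope3 \<gamma> d)) = 0"
    using distinct4_exhaust[OF d4, of i] by (elim disjE) (simp_all add: p_def q_def)
  qed
  then show ?thesis by (simp add: distrib_left mult_ac)
 qed
 have "segre (slope1 \<alpha>) (slope3 \<gamma>) c c' d e ~= 0"
  using segre_sign[OF d4, of "slope1 \<alpha>" "slope3 \<gamma>"] assms(1) by auto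
 then have "p c' * q c - p c * q c' ~= 0"
  by (simp add: segre_def p_def q_def mult_ac)
 moreover have "B c' * (C (p c) * (A d * W e) + C (q c) * (A e * W d)) : L"
  using d4 by (intro l) auto
 ultimately show ?thesis
  using cross_eliminate[OF l[OF d4]] by (simp add: mult.assoc)
qed

text \<open>Serves the neighbourhood of \<open>E_2\<close>, where the second pair takes the part of
  the third.\<close>

lemma star12:
 assumes "segre (slope1 \<alpha>) (slope2 \<beta>) 0 1 2 3 ~= 0" and d4: "distinct [c, c', d, e]"
 shows "W c * W c' * A d * B e : L"
proof -
 define p where "p x = (slope1 \<alpha> x - slope1 \<alpha> e) * (slope2 \<beta> x - slope2 \<beta> d)" for x
 define q where "q x = - ((slope1 \<alpha> x - slope1 \<alpha> d) * (slope2 \<beta> x - slope2 \<beta> e))" for x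
 have l: "W c * (C (p c') * (A d * B e) + C (q c') * (A e * B d)) : L"
  if d4: "distinct [c, c', d, e]" for c c'
 proof -
  have "C (p c') * (A d * B e * W c) + C (q c') * (A e * B d * W c) : L"
   unfolding A_def B_def W_def
  proof (rule products_in)
   fix i
   show "p c' * ((slope1 \<alpha> i - slope1 \<alpha> d) * (slope2 \<beta> i - slope2 \<beta> e) * (slope3 \<gamma> i - slope3 \<gamma> c)) +
     q c' * ((slope1 \<alpha> i - slope1 \<alpha> e) * (slope2 \<beta> i - slope2 \<beta> d) * (slope3 \<gamma> i - slope3 \<gamma> c)) = 0"
    using distinct4_exhaust[OF d4, of i] by (elim disjE) (simp_all add: p_def q_def)
  qed
  then show ?thesis by (simp add: distrib_left mult_ac)
 qed
 have "segre (slope1 \<alpha>) (slope2 \<beta>) c c' d e ~= 0"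
  using segre_sign[OF d4, of "slope1 \<alpha>" "slope2 \<beta>"] assms(1) by auto
 then have "p c' * q c - p c * q c' ~= 0"
  by (simp add: segre_def p_def q_def mult_ac)
 moreover have "W c' * (C (p c) * (A d * B e) + C (q c) * (A e * B d)) : L"
  using d4 by (intro l) auto
 ultimately show ?thesis
  using cross_eliminate[OF l[OF d4]] by (simp add: mult.assoc)
qed

text \<open>On the plane of the conic \<open>cubu\<close> and \<open>u1*P\<close> both become
  combinations of \<open>u1*u2^2\<close>, \<open>u1*u3^2\<close> and \<open>u1^3\<close>, with
  proportional coefficients.\<close>

lemma cubu_K: "cubu : K c"
proof -
 let ?t1 = "slope1 \<alpha> c" and ?t2 = "slope2 \<beta> c" and ?t3 = "slope3 \<gamma> c"
 \<comment> \<open>The factor of proportionality \<open>k\<close> is read off from the coefficient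
   of \<open>u1^3\<close>.\<close>
 define c1 c3 c5 k where "c1 = (1+\<alpha>) * (1+\<beta>)" and "c3 = - ((1-\<gamma>) * (1-\<alpha>))" and "c5 = (1-\<gamma>) * (1+\<beta>)"
  and "k = - (c5 * \<alpha>) / ?t1"
 have t1: "?t1 ~= 0" using nz by (auto simp: slope1_def)
 then have E3: "- (c5 * \<alpha>) = k * ?t1" by (simp add: k_def)
 have "(c1 * ?t3^2 - c1 * \<gamma> + c5 * ?t1 * ?t3) * ?t1 = - (c5 * \<alpha>) * ?t3"
  using exhaust_4'[of c] by (elim disjE) (simp_all add: c1_def c5_def slope_defs algebra_simps power2_eq_square)
 moreover have "(c3 * ?t2^2 + c3 * \<beta> - c5 * ?t1 * ?t2) * ?t1 = - (c5 * \<alpha>) * ?t2"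
  using exhaust_4'[of c] by (elim disjE) (simp_all add: c3_def c5_def slope_defs algebra_simps power2_eq_square)
 ultimately have E1: "c1 * ?t3^2 - c1 * \<gamma> + c5 * ?t1 * ?t3 = k * ?t3" and E2: "c3 * ?t2^2 + c3 * \<beta> - c5 * ?t1 * ?t2 = k * ?t2"
  unfolding E3 using t1 by (simp_all add: mult.commute mult.left_commute)
 have cu: "cubu = u1 * (C c1 * v3^2 - C c1 * C \<gamma> * u3^2 + C c3 * v2^2 + C c3 * C \<beta> * u2^2)
  + C c5 * (v1 * (u3 * v3 - u2 * v2) - C \<alpha> * u1^3)"
  unfolding cubu_def c1_def c3_def c5_def by (simp add: Cs algebra_simps)
 have CE: "C c1 * (C ?t3)^2 - C c1 * C \<gamma> + C c5 * C ?t1 * C ?t3 = C k * C ?t3"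
  "C c3 * (C ?t2)^2 + C c3 * C \<beta> - C c5 * C ?t1 * C ?t2 = C k * C ?t2" "- (C c5 * C \<alpha>) = C k * C ?t1"
  using arg_cong[OF E1, of C] arg_cong[OF E2, of C] arg_cong[OF E3, of C] by (simp_all add: Cs)
 let ?rhs = "(C c5 * (u3 * v3 - u2 * v2) - C k * u1^2) * A c
  + (C c3 * u1 * (v2 + C ?t2 * u2) - C c5 * C ?t1 * u1 * u2 - C k * u1 * u2) * B c
  + (C c1 * u1 * (v3 + C ?t3 * u3) + C c5 * C ?t1 * u1 * u3 - C k * u1 * u3) * W c + C k * u1 * P"
 have "cubu - ?rhs = u1 * u3^2 * (C c1 * (C ?t3)^2 - C c1 * C \<gamma> + C c5 * C ?t1 * C ?t3 - C k * C ?t3)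
   + u1 * u2^2 * (C c3 * (C ?t2)^2 + C c3 * C \<beta> - C c5 * C ?t1 * C ?t2 - C k * C ?t2)
   + u1^3 * (- (C c5 * C \<alpha>) - C k * C ?t1)"
  unfolding cu A_def B_def W_def P_def by (simp add: algebra_simps power2_eq_square power3_eq_cube)
 then have "cubu = ?rhs"
  unfolding CE by simp
 then show ?thesis
  unfolding K_def using ideal_gen_base[of _ "{A c, B c, W c, P}"] by (simp add: ideal_genD)
qed

lemma cubu_E3: "cubu - C (- (1 - \<gamma>)) * u1 * F3 : ideal_gen {u3, v3, P}"
proof -
 have "cubu - C (- (1 - \<gamma>)) * u1 * F3 =
  (- C ((1+\<alpha>) * (1+\<beta>)) * C \<gamma> * u1 * u3 + C 2 * C ((1-\<gamma>) * (1+\<beta>)) * v1 * v3) * u3 + C ((1+\<alpha>) * (1+\<beta>)) * u1 * v3 * v3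
  + (- C ((1-\<gamma>) * (1+\<beta>)) * v1) * P"
  by (simp add: cubu_def F3_def P_def Cs algebra_simps power2_eq_square power3_eq_cube)
 then show ?thesis
  using ideal_gen_base[of _ "{u3, v3, P}"] by (simp add: ideal_genD)
qed

lemma cubu_E2: "cubu - C (- (1 + \<beta>)) * u1 * F2 : ideal_gen {u2, v2, P}"
proof -
 have "cubu - C (- (1 + \<beta>)) * u1 * F2 =
  (- C ((1-\<gamma>) * (1-\<alpha>)) * C \<beta> * u1 * u2 - C 2 * C ((1-\<gamma>) * (1+\<beta>)) * v1 * v2) * u2 + (- C ((1-\<gamma>) * (1-\<alpha>)) * u1 * v2) * v2
  + (C ((1-\<gamma>) * (1+\<beta>)) * v1) * P"
  by (simp add: cubu_def F2_def P_def Cs algebra_simps power2_eq_square power3_eq_cube)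
 then show ?thesis
  using ideal_gen_base[of _ "{u2, v2, P}"] by (simp add: ideal_genD)
qed

end

context chart
begin

text \<open>Away from \<open>u2 = v2 = 0\<close> the argument runs along \<open>E_3\<close>, away
  from \<open>u3 = v3 = 0\<close> along \<open>E_2\<close>. These regions cover the chart, since
  \<open>cubu\<close> reduces to a nonzero multiple of \<open>u1^3\<close> where all four
  coordinates vanish.\<close>

lemma chart_membership:
 assumes f: "on_all f"
  and prime: "!!c g. u3 * g : K c ==> g : K c" "!!c g. u2 * g : K c ==> g : K c"
 shows "f : L"
proof -
 define L2 where "L2 x = {g. EX N. x ^ N * g : L}" for x
 have L2: "saturated_ideal C (L2 x)" for x
 proof
  have "a + b : L2 x" if ab: "a : L2 x" "b : L2 x" for a b
  proof -
   from ab obtain n m where n: "x ^ n * a : L" "x ^ m * b : L" by (auto simp: L2_def)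
   have "x ^ (n + m) * (a + b) = x ^ m * (x ^ n * a) + x ^ n * (x ^ m * b)"
    by (simp add: power_add algebra_simps)
   then have "x ^ (n + m) * (a + b) : L" using n by (simp add: L_simps)
   then show ?thesis by (auto simp: L2_def)
  qed
  moreover have "r * a : L2 x" if a: "a : L2 x" for a r
  proof -
   from a obtain n where "x ^ n * a : L" by (auto simp: L2_def)
   from L_simps(3)[OF this, of r] show ?thesis by (auto simp: L2_def mult.left_commute)
  qed
  moreover have "0 : L2 x" using L_simps(1) by (simp add: L2_def)
  ultimately show "is_ideal (L2 x)" by (simp add: is_ideal_def)
 qed (rule C)
 have sub: "g : L2 x" if "g : L" for g x
  using that by (auto simp: L2_def intro: exI[of _ 0])
 have sat1: "g : L2 x" if "u1 * g : L2 x" for g x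
  using that sat by (auto simp: L2_def mult.left_commute)
 have sat2: "g : L2 x" if xg: "x * g : L2 x" for g x
 proof -
  from xg obtain N where "x ^ N * (x * g) : L" by (auto simp: L2_def)
  then have "x ^ Suc N * g : L" by (simp add: mult_ac)
  then show ?thesis unfolding L2_def by blast
 qed
 have k: "- (1 - \<gamma>) ~= 0" "- (1 + \<beta>) ~= 0" using nzs by auto
 have x2: "f : L2 x" if x: "x : {u2, v2}" for x
 proof -
  have "(ALL c c' d e. distinct [c, c', d, e] --> A c * A c' * B d * W e : L2 x) |
   (ALL c c' d e. distinct [c, c', d, e] --> B c * B c' * A d * W e : L2 x)"
   using segre_nonzero(1) star23 star13 sub by blast
  note star = this
  note nc = saturated_ideal.near_curve[OF L2[of x], where ?t1.0 = "slope1 \<alpha>" and ?t2.0 = "slope2 \<beta>" and ?t3.0 = "slope3 \<gamma>"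
      and ?u1.0 = u1 and ?v1.0 = v1 and ?u2.0 = u2 and ?v2.0 = v2 and ?u3.0 = u3 and ?v3.0 = v3 and ?x1.0 = u1 and ?x2.0 = x
      and G = cubu and k = "- (1 - \<gamma>)" and F = F3 and f = f, folded A_def B_def W_def P_def, folded K_def]
  show ?thesis
   by (rule nc) (rule inj_slopes sub[OF P_in] sub[OF cubu] cubu_K cubu_E3 k star x insertI1 |
     erule sat1 sat2 prime | use f in "simp add: on_all_def")+
 qed
 have P': "P = u1 * v1 + u3 * v3 + u2 * v2" by (simp add: P_def)
 have perm: "{u2, v2, u1 * v1 + u3 * v3 + u2 * v2} = {u2, v2, P}" "{u2, v2, u1 * v1 + u3 * v3 + u2 * v2, F2} = {u2, v2, P, F2}"
  "{A c, W c, B c, u1 * v1 + u3 * v3 + u2 * v2} = {A c, B c, W c, P}" for c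
  by (auto simp: P_def)
 have x3: "f \<in> L2 x" if x: "x : {u3, v3}" for x
 proof -
  have "(ALL c c' d e. distinct [c, c', d, e] --> A c * A c' * W d * B e : L2 x) |
   (ALL c c' d e. distinct [c, c', d, e] --> W c * W c' * A d * B e : L2 x)"
  proof (cases "segre (slope2 \<beta>) (slope3 \<gamma>) 0 1 2 3 ~= 0")
   case True
   have "A c * A c' * W d * B e : L2 x" if "distinct [c, c', d, e]" for c c' d e
    using sub[OF star23[OF True, of c c' e d]] that by (auto simp: mult_ac)
   then show ?thesis by blast
  qed (use segre_nonzero(2) star12 sub in blast)
  note star = this
  note nc = saturated_ideal.near_curve[OF L2[of x], where ?t1.0 = "slope1 \<alpha>" and ?t2.0 = "slope3 \<gamma>" and ?t3.0 = "slope2 \<beta>"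
      and ?u1.0 = u1 and ?v1.0 = v1 and ?u2.0 = u3 and ?v2.0 = v3 and ?u3.0 = u2 and ?v3.0 = v2 and ?x1.0 = u1 and ?x2.0 = x
      and G = cubu and k = "- (1 + \<beta>)" and F = F2 and f = f, folded A_def B_def W_def, unfolded perm, folded K_def]
  show ?thesis
   by (rule nc) (rule inj_slopes sub[OF P_in] sub[OF P_in[unfolded P']] sub[OF cubu] cubu_K cubu_E2 k star x insertI1 |
     erule sat1 sat2 prime | use f in "simp add: on_all_def")+
 qed
 \<comment> \<open>The radical of the annihilator of \<open>f\<close> modulo \<open>L\<close>;
   containing the four coordinates and \<open>cubu\<close>, it contains a nonzero multiple of
   \<open>u1^3\<close>.\<close>
 define R where "R = {g. EX N. g ^ N : {g. g * f : L}}"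
 have R: "is_ideal R" unfolding R_def by (intro radical_is_ideal colon_is_ideal L)
 note Rs = idealD[OF R]
 have xR: "u2 : R" "v2 : R" "u3 : R" "v3 : R"
  using x2[of u2] x2[of v2] x3[of u3] x3[of v3] by (auto simp: R_def L2_def)
 have "cubu : R"
  using L_simps(4)[OF cubu, of f] unfolding R_def by (auto intro: exI[of _ 1])
 moreover have "C ((1-\<gamma>) * (1+\<beta>) * \<alpha>) * u1^3 = (u1 * (C ((1+\<alpha>) * (1+\<beta>)) * v3)) * v3
   - (u1 * (C ((1+\<alpha>) * (1+\<beta>)) * C \<gamma> * u3)) * u3 - (u1 * C ((1-\<gamma>) * (1-\<alpha>)) * v2) * v2
   - (u1 * (C ((1-\<gamma>) * (1-\<alpha>)) * C \<beta> * u2)) * u2 + (C ((1-\<gamma>) * (1+\<beta>)) * v1 * v3) * u3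
   - (C ((1-\<gamma>) * (1+\<beta>)) * v1 * v2) * u2 - cubu"
  by (simp add: cubu_def Cs algebra_simps power2_eq_square power3_eq_cube)
 ultimately have "C ((1-\<gamma>) * (1+\<beta>) * \<alpha>) * u1^3 : R"
  using xR by (simp add: Rs)
 then obtain N where N: "(C ((1-\<gamma>) * (1+\<beta>) * \<alpha>) * u1^3) ^ N * f : L"
  by (auto simp: R_def)
 have "g : L" if "u1 ^ n * g : L" for n g
  using that
 proof (induction n)
  case (Suc n)
  then show ?case using sat[of "u1 ^ n * g"] by (simp add: mult.assoc)
 qed simp
 moreover have "((1-\<gamma>) * (1+\<beta>) * \<alpha>) ^ N ~= 0" using nzs by simp
 moreover have "C (((1-\<gamma>) * (1+\<beta>) * \<alpha>) ^ N) * (u1 ^ (3 * N) * f) : L"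
  using N by (simp only: power_mult_distrib rhom_power[OF C] power_mult rhomD(4)[OF C] mult.assoc)
 ultimately show ?thesis
  using unit_cancel by blast
qed

end

section \<open>Determinants of sparse matrices\<close>

text \<open>Conjugation by the enumeration \<open>f\<close> carries permutations of the index type
  to permutations of \<open>{0..<n}\<close> and preserves signs.\<close>

lemma det_reindex:
 fixes A :: "'r::comm_ring_1^'n^'n"
 assumes f: "bij_betw f {0..<n} (UNIV :: 'n set)"
 shows "Determinants.det A = Determinant.det (Matrix.mat n n (%(i, j). A $ f i $ f j))"
proof -
 let ?h = "%p x. if x : UNIV then f (p (inv_into {0..<n} f x)) else x"
 have inj: "inj_on f {0..<n}" and im: "f ` {0..<n} = UNIV"
  using f by (auto simp: bij_betw_def)
 have "Determinants.det A = (\<Sum>p\<in>{p. p permutes {0..<n}}. of_int (sign (?h p)) * (\<Prod>i\<in>UNIV. A $ i $ ?h p i))"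
  unfolding Determinants.det_def by (rule sum.reindex_bij_betw[OF bij_betw_permutations[OF f], symmetric])
 also have "... = (\<Sum>p\<in>{p. p permutes {0..<n}}. of_int (sign p) * (\<Prod>i = 0..<n. A $ f i $ f (p i)))"
 proof (intro sum.cong refl)
  fix p assume "p : {p. p permutes {0..<n}}"
  then have p: "p permutes {0..<n}" by simp
  have "?h p = map_permutation {0..<n} f p"
   by (auto simp: map_permutation_def restrict_id_def im fun_eq_iff)
  then have "sign (?h p) = sign p"
   using sign_map_permutation[OF inj p] by simp
  moreover have "(\<Prod>i\<in>UNIV. A $ i $ ?h p i) = (\<Prod>i\<in>{0..<n}. A $ f i $ f (p i))"
   using inj by (subst prod.reindex_bij_betw[OF f, symmetric]) (auto intro!: prod.cong)
  ultimately show "of_int (sign (?h p)) * (\<Prod>i\<in>UNIV. A $ i $ ?h p i) = of_int (sign p) * (\<Prod>i = 0..<n. A $ f i $ f (p i))"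
   by simp
 qed
 also have "... = Determinant.det (Matrix.mat n n (%(i, j). A $ f i $ f j))"
  unfolding Determinant.det_def
  by (auto intro!: sum.cong prod.cong dest: permutes_in_image)
 finally show ?thesis .
qed

text \<open>Laplace expansion along the first row; \<open>None\<close> stands for a zero entry that is skipped.\<close>

fun entry :: "'r option => 'r::zero" where
 "entry None = 0" | "entry (Some x) = x"

fun del :: "nat => 'a list => 'a list" where
 "del k [] = []" | "del 0 (x # xs) = xs" | "del (Suc k) (x # xs) = x # del k xs"

lemma length_del: "k < length xs ==> length (del k xs) = length xs - 1"
 by (induction k xs rule: del.induct) auto

lemma length_del_le: "length (del k xs) <= length xs"
 by (induction k xs rule: del.induct) auto

lemma nth_del: "k < length xs ==> i < length xs - 1 ==> del k xs ! i = xs ! (if i < k then i else Suc i)"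
proof (induction k xs arbitrary: i rule: del.induct)
 case (3 k x xs)
 then show ?case by (cases i) auto
qed auto

function (sequential) sdet :: "'r::comm_ring_1 option list list => 'r" and
 sexp :: "'r option list => nat => 'r option list list => 'r" where
 "sdet [] = 1"
| "sdet (r # rs) = sexp r 0 rs"
| "sexp [] k rs = 0"
| "sexp (None # r) k rs = - sexp r (Suc k) rs"
| "sexp (Some x # r) k rs = x * sdet (map (del k) rs) - sexp r (Suc k) rs"
 by pat_completeness auto
termination
 \<comment> \<open>Every row counts two on top of its length, so that removing the first row pays
   for the extra one in the measure of \<open>sexp\<close>.\<close>
 by (relation "Wellfounded.measure (%x. case x of Inl rs => 2 * length rs + sum_list (map length rs) + 0
    | Inr (r, k, rs) => 2 * length rs + 1 + length r + sum_list (map length rs))")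
  (auto simp: comp_def intro!: le_imp_less_Suc le_SucI trans_le_add2 sum_list_mono length_del_le)

lemma sexp_sum:
 "sexp r k rs = (\<Sum>j<length r. (- 1) ^ j * (entry (r ! j) * sdet (map (del (k + j)) rs)))"
proof (induction r arbitrary: k)
 case (Cons a r)
 have "sexp (a # r) k rs = entry a * sdet (map (del k) rs) - sexp r (Suc k) rs"
  by (cases a) auto
 then show ?case
  unfolding Cons.IH by (simp add: sum.lessThan_Suc_shift sum_negf[symmetric] del: sum.lessThan_Suc)
qed simp

lemma sdet_eq_det:
 assumes "length rs = n" "\<forall>r\<in>set rs. length r = n"
 shows "sdet rs = Determinant.det (Matrix.mat n n (%(i, j). entry (rs ! i ! j)))"
 using assms
proof (induction n arbitrary: rs)
 case 0
 then show ?case by simp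
next
 case (Suc n)
 then obtain r rs' where rs: "rs = r # rs'" by (cases rs) auto
 let ?A = "Matrix.mat (Suc n) (Suc n) (%(i, j). entry (rs ! i ! j))"
 have "sdet (map (del j) rs') = Determinant.det (mat_delete ?A 0 j)" if j: "j < Suc n" for j
 proof -
  have "sdet (map (del j) rs') = Determinant.det (Matrix.mat n n (%(i, j'). entry (map (del j) rs' ! i ! j')))"
   using Suc.prems j by (intro Suc.IH) (auto simp: rs length_del)
  also have "Matrix.mat n n (%(i, j'). entry (map (del j) rs' ! i ! j')) = mat_delete ?A 0 j"
   using Suc.prems j by (intro eq_matI) (auto simp: mat_delete_def rs nth_del)
  finally show ?thesis .
 qed
 then show ?case
  using Suc.prems by (subst laplace_expansion_row[of _ "Suc n" 0]) (auto simp: rs sexp_sum cofactor_def mult_ac intro!: sum.cong)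
qed

lemma det_eq_sdet:
 fixes A :: "'r::comm_ring_1^'n^'n"
 assumes xs: "distinct xs" "set xs = (UNIV :: 'n set)"
  and rs: "map (map entry) rs = map (%i. map (%j. A $ i $ j) xs) xs"
 shows "Determinants.det A = sdet rs"
proof -
 let ?n = "length xs"
 have l: "length rs = ?n" using arg_cong[OF rs, of length] by simp
 have rsi: "map entry (rs ! i) = map (%j. A $ (xs ! i) $ j) xs" if "i < ?n" for i
  using arg_cong[OF rs, of "%l. l ! i"] that l by simp
 have l2: "length (rs ! i) = ?n" if "i < ?n" for i
  using arg_cong[OF rsi[OF that], of length] by simp
 have e: "entry (rs ! i ! j) = A $ (xs ! i) $ (xs ! j)" if "i < ?n" "j < ?n" for i j
  using arg_cong[OF rsi[OF that(1)], of "%l. l ! j"] that l2 by simp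
 have "sdet rs = Determinant.det (Matrix.mat ?n ?n (%(i, j). entry (rs ! i ! j)))"
  using l l2 by (intro sdet_eq_det) (auto simp: in_set_conv_nth)
 also have "Matrix.mat ?n ?n (%(i, j). entry (rs ! i ! j)) = Matrix.mat ?n ?n (%(i, j). A $ (xs ! i) $ (xs ! j))"
  by (intro eq_matI) (auto simp: e)
 also have "Determinant.det ... = Determinants.det A"
  using xs by (intro det_reindex[symmetric] bij_betw_nth) (auto simp: atLeast0LessThan)
 finally show ?thesis by simp
qed

section \<open>Cubics in the ideal of the minors\<close>

text \<open>A functional on the degree-two part of \<open>A\<close>, recorded by its values on the
  products \<open>y_i*y_j\<close>.\<close>

definition bil :: "'k::comm_ring_1 => 'k => 'k => (4 => 4 => 'k) => bool" where
 "bil \<alpha> \<beta> \<gamma> b \<longleftrightarrow> (\<forall>(a, i, j, k) \<in> {(\<alpha>, 1, 2, 3), (\<beta>, 2, 3, 1), (\<gamma>, 3, 1, 2)}.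
  b 0 i - b i 0 = a * (b j k - b k j) & b 0 i + b i 0 = b j k + b k j)"

text \<open>The matrix \<open>l\<close> and the coefficient map are variable, because the symmetries
  replace the generic matrix by one with permuted columns.\<close>

definition minors_in :: "('k::field => 'r::comm_ring_1) => 'k => 'k => 'k => (2 => 4 => 'r) => 'r set => bool" where
 "minors_in C \<alpha> \<beta> \<gamma> l I \<longleftrightarrow> (\<forall>b :: 4 \<times> 2 => 4 => 4 => 'k. (ALL a. bil \<alpha> \<beta> \<gamma> (b a)) -->
  Determinants.det (\<chi> a c. \<Sum>j\<in>UNIV. C (b a (fst c) j) * l (snd c) j) : I)"

definition idx :: "(4 \<times> 2) list" where
 "idx = [(0, 0), (0, 1), (1, 0), (1, 1), (2, 0), (2, 1), (3, 0), (3, 1)]"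

lemma idx: "distinct idx" "set idx = UNIV" "length idx = 8"
proof -
 show "distinct idx" "length idx = 8" by (simp_all add: idx_def)
 have "(x, y) : set idx" for x :: 4 and y :: 2
  using exhaust_4'[of x] exhaust_2[of y] by (auto simp: idx_def)
 then show "set idx = UNIV" by auto
qed

definition row_of :: "('k => 'r::comm_ring_1) => (2 => 4 => 'r) => (4 => 4 => 'k) => 'r list" where
 "row_of C l b = map (%c. \<Sum>j\<in>UNIV. C (b (fst c) j) * l (snd c) j) idx"

lemma sum_4': "sum f (UNIV :: 4 set) = f 0 + f 1 + f 2 + f (3 :: 4)"
proof -
 have *: "(UNIV :: 4 set) = {0, 1, 2, 3}" using exhaust_4' by auto
 show ?thesis unfolding * by (simp add: add.assoc)
qed

lemma sdet_in_minors:
 assumes m: "minors_in C \<alpha> \<beta> \<gamma> l I" and bs: "length bs = 8" "\<forall>b\<in>set bs. bil \<alpha> \<beta> \<gamma> b"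
  and rs: "map (map entry) rs = map (row_of C l) bs"
 shows "sdet rs : I"
proof -
 define b where "b a = the (map_of (zip idx bs) a)" for a
 have bi: "b (idx ! i) = bs ! i" if "i < 8" for i
  using map_of_zip_nth[of idx bs i] idx bs that by (simp add: b_def)
 have mb: "map b idx = bs"
  using idx bs bi by (intro nth_equalityI) auto
 have "bil \<alpha> \<beta> \<gamma> (b a)" for a
 proof -
  have "a : set idx" by (simp add: idx)
  then have "b a : set (map b idx)" by simp
  then show ?thesis using bs(2) by (simp add: mb)
 qed
 then have "Determinants.det (\<chi> a c. \<Sum>j\<in>UNIV. C (b a (fst c) j) * l (snd c) j) : I"
  using m unfolding minors_in_def by blast
 moreover have "Determinants.det (\<chi> a c. \<Sum>j\<in>UNIV. C (b a (fst c) j) * l (snd c) j) = sdet rs"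
  using rs by (intro det_eq_sdet[OF idx(1,2)]) (simp add: mb[symmetric] row_of_def comp_def)
 ultimately show ?thesis by simp
qed

definition sq :: "4 => 4 => 4 => 'k::comm_ring_1" where
 "sq r x y = (if x = r & y = r then 1 else 0)"

text \<open>\<open>block i j k a b c d\<close> takes the values \<open>a, b, c, d\<close> at \<open>y\<^sub>0y\<^sub>i, y\<^sub>iy\<^sub>0, y\<^sub>jy\<^sub>k, y\<^sub>ky\<^sub>j\<close>.\<close>

definition block :: "4 => 4 => 4 => 'k => 'k => 'k => 'k => 4 => 4 => 'k::comm_ring_1" where
 "block i j k a b c d x y = (if x = 0 & y = i then a else if x = i & y = 0 then b
  else if x = j & y = k then c else if x = k & y = j then d else 0)"

lemma bil_sq: "bil \<alpha> \<beta> \<gamma> (sq r)"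
 using exhaust_4'[of r] by (auto simp: bil_def sq_def)

lemma bil_block:
 "a - b = \<alpha> * (c - d) ==> a + b = c + d ==> bil \<alpha> \<beta> \<gamma> (block 1 2 3 a b c d)"
 "a - b = \<beta> * (c - d) ==> a + b = c + d ==> bil \<alpha> \<beta> \<gamma> (block 2 3 1 a b c d)"
 "a - b = \<gamma> * (c - d) ==> a + b = c + d ==> bil \<alpha> \<beta> \<gamma> (block 3 1 2 a b c d)"
 by (simp_all add: bil_def block_def)

lemma row_of_sq:
 assumes "rhom C"
 shows "row_of C l (sq 0) = map entry [Some (l 0 0), Some (l 1 0), None, None, None, None, None, None]"
  "row_of C l (sq 1) = map entry [None, None, Some (l 0 1), Some (l 1 1), None, None, None, None]"
  "row_of C l (sq 2) = map entry [None, None, None, None, Some (l 0 2), Some (l 1 2), None, None]"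
  "row_of C l (sq 3) = map entry [None, None, None, None, None, None, Some (l 0 3), Some (l 1 3)]"
 by (simp_all add: row_of_def idx_def sum_4' sq_def rhomD(1,2)[OF assms])

lemma row_of_block:
 assumes "rhom C"
 shows "row_of C l (block 1 2 3 a b c d) = [C a * l 0 1, C a * l 1 1, C b * l 0 0, C b * l 1 0, C c * l 0 3, C c * l 1 3, C d * l 0 2, C d * l 1 2]"
  "row_of C l (block 2 3 1 a b c d) = [C a * l 0 2, C a * l 1 2, C d * l 0 3, C d * l 1 3, C b * l 0 0, C b * l 1 0, C c * l 0 1, C c * l 1 1]"
  "row_of C l (block 3 1 2 a b c d) = [C a * l 0 3, C a * l 1 3, C c * l 0 2, C c * l 1 2, C d * l 0 1, C d * l 1 1, C b * l 0 0, C b * l 1 0]"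
 by (simp_all add: row_of_def idx_def sum_4' block_def rhomD(1)[OF assms])

text \<open>Three rows are zero under \<open>y_0\<close>, so only the first and the last row meet
  the first two columns: the minor splits into \<open>z01\<close> and a six by six determinant that
  is cubic in the \<open>z_rs\<close>.\<close>

lemma sdet_cert_u:
 fixes p0 p1 p2 p3 q0 q1 q2 q3 :: "'r::comm_ring_1"
 shows "sdet [[Some p0, Some q0, None, None, None, None, None, None],
  [None, None, Some p1, Some q1, None, None, None, None],
  [None, None, None, None, Some p2, Some q2, None, None],
  [None, None, None, None, None, None, Some p3, Some q3],
  [None, None, Some (b1 * p0), Some (b1 * q0), Some (c1 * p3), Some (c1 * q3), Some (d1 * p2), Some (d1 * q2)],
  [None, None, Some (d2 * p3), Some (d2 * q3), Some (b2 * p0), Some (b2 * q0), Some (c2 * p1), Some (c2 * q1)],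
  [None, None, Some (c3 * p2), Some (c3 * q2), Some (d3 * p1), Some (d3 * q1), Some (b3 * p0), Some (b3 * q0)],
  [Some p1, Some q1, Some p0, Some q0, Some p3, Some q3, Some p2, Some q2]] =
 - (p0 * q1 - q0 * p1) * (- b1 * (p0 * q1 - q0 * p1) * (b2 * b3 * (p0 * q2 - q0 * p2) * (p0 * q3 - q0 * p3) + c2 * d3 * (p3 * q1 - q3 * p1) * (p1 * q2 - q1 * p2)) - c1 * (p2 * q3 - q2 * p3) * (d2 * b3 * (p3 * q1 - q3 * p1) * (p0 * q3 - q0 * p3) - c2 * c3 * (p3 * q1 - q3 * p1) * (p1 * q2 - q1 * p2)) - d1 * (p2 * q3 - q2 * p3) * (d2 * d3 * (p3 * q1 - q3 * p1) * (p1 * q2 - q1 * p2) + b2 * c3 * (p0 * q2 - q0 * p2) * (p1 * q2 - q1 * p2)))"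
 by (simp add: algebra_simps)

text \<open>The same six by six block, now completed by two rows whose contribution is
  \<open>z23\<close>.\<close>

lemma sdet_cert_v:
 fixes p0 p1 p2 p3 q0 q1 q2 q3 :: "'r::comm_ring_1"
 shows "sdet [[None, None, Some p1, Some q1, None, None, None, None],
  [None, None, None, None, Some p2, Some q2, None, None],
  [None, None, None, None, None, None, Some p3, Some q3],
  [None, None, Some (b1 * p0), Some (b1 * q0), Some (c1 * p3), Some (c1 * q3), Some (d1 * p2), Some (d1 * q2)],
  [None, None, Some (d2 * p3), Some (d2 * q3), Some (b2 * p0), Some (b2 * q0), Some (c2 * p1), Some (c2 * q1)],
  [None, None, Some (c3 * p2), Some (c3 * q2), Some (d3 * p1), Some (d3 * q1), Some (b3 * p0), Some (b3 * q0)],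
  [Some p2, Some q2, Some p3, Some q3, Some p0, Some q0, Some p1, Some q1],
  [Some p3, Some q3, Some p2, Some q2, Some p1, Some q1, Some p0, Some q0]] =
 - (p2 * q3 - q2 * p3) * (- b1 * (p0 * q1 - q0 * p1) * (b2 * b3 * (p0 * q2 - q0 * p2) * (p0 * q3 - q0 * p3) + c2 * d3 * (p3 * q1 - q3 * p1) * (p1 * q2 - q1 * p2)) - c1 * (p2 * q3 - q2 * p3) * (d2 * b3 * (p3 * q1 - q3 * p1) * (p0 * q3 - q0 * p3) - c2 * c3 * (p3 * q1 - q3 * p1) * (p1 * q2 - q1 * p2)) - d1 * (p2 * q3 - q2 * p3) * (d2 * d3 * (p3 * q1 - q3 * p1) * (p1 * q2 - q1 * p2) + b2 * c3 * (p0 * q2 - q0 * p2) * (p1 * q2 - q1 * p2)))"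
 by (simp add: algebra_simps)

text \<open>The two columns of \<open>y_r\<close> are met by the square row of \<open>y_r\<close>
  and one of the last four rows; the sum runs over the assignments of these rows to the
  generators.\<close>

lemma sdet_cert_cycle:
 fixes p0 p1 p2 p3 q0 q1 q2 q3 :: "'r::comm_ring_1"
 shows "sdet [[Some p0, Some q0, None, None, None, None, None, None],
  [None, None, Some p1, Some q1, None, None, None, None],
  [None, None, None, None, Some p2, Some q2, None, None],
  [None, None, None, None, None, None, Some p3, Some q3],
  [Some (a2 * p2), Some (a2 * q2), Some (d2 * p3), Some (d2 * q3), Some (b2 * p0), Some (b2 * q0), None, None],
  [Some (e2 * p2), Some (e2 * q2), Some (h2 * p3), Some (h2 * q3), None, None, Some (g2 * p1), Some (g2 * q1)],
  [Some (a3 * p3), Some (a3 * q3), Some (c3 * p2), Some (c3 * q2), Some (d3 * p1), Some (d3 * q1), None, None],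
  [Some (e3 * p3), Some (e3 * q3), Some (g3 * p2), Some (g3 * q2), None, None, Some (f3 * p0), Some (f3 * q0)]] =
 (a2 * (p0 * q2 - q0 * p2)) * (h2 * (p1 * q3 - q1 * p3)) * (d3 * (p2 * q1 - q2 * p1)) * (f3 * (p3 * q0 - q3 * p0)) - (a2 * (p0 * q2 - q0 * p2)) * (g2 * (p3 * q1 - q3 * p1)) * (d3 * (p2 * q1 - q2 * p1)) * (g3 * (p1 * q2 - q1 * p2)) - (d2 * (p1 * q3 - q1 * p3)) * (e2 * (p0 * q2 - q0 * p2)) * (d3 * (p2 * q1 - q2 * p1)) * (f3 * (p3 * q0 - q3 * p0)) + (d2 * (p1 * q3 - q1 * p3)) * (g2 * (p3 * q1 - q3 * p1)) * (d3 * (p2 * q1 - q2 * p1)) * (e3 * (p0 * q3 - q0 * p3)) + (b2 * (p2 * q0 - q2 * p0)) * (e2 * (p0 * q2 - q0 * p2)) * (c3 * (p1 * q2 - q1 * p2)) * (f3 * (p3 * q0 - q3 * p0)) - (b2 * (p2 * q0 - q2 * p0)) * (h2 * (p1 * q3 - q1 * p3)) * (a3 * (p0 * q3 - q0 * p3)) * (f3 * (p3 * q0 - q3 * p0)) + (b2 * (p2 * q0 - q2 * p0)) * (g2 * (p3 * q1 - q3 * p1)) * (a3 * (p0 * q3 - q0 * p3)) * (g3 * (p1 * q2 - q1 * p2)) - (b2 * (p2 * q0 - q2 * p0)) * (g2 * (p3 * q1 - q3 * p1)) * (c3 * (p1 * q2 - q1 * p2)) * (e3 * (p0 * q3 - q0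 * p3))"
 by (simp add: algebra_simps)

text \<open>Three rows vanish under \<open>y_3\<close> and three others under \<open>y_2\<close>,
  which gives the expansion its product form.\<close>

lemma sdet_cert_rest:
 fixes p0 p1 p2 p3 q0 q1 q2 q3 :: "'r::comm_ring_1"
 shows "sdet [[Some p0, Some q0, None, None, None, None, None, None],
  [None, None, Some p1, Some q1, None, None, None, None],
  [Some (a1 * p1), Some (a1 * q1), Some (b1 * p0), Some (b1 * q0), Some (c1 * p3), Some (c1 * q3), None, None],
  [Some (a2 * p2), Some (a2 * q2), Some (d2 * p3), Some (d2 * q3), Some (b2 * p0), Some (b2 * q0), None, None],
  [Some (a3 * p3), Some (a3 * q3), Some (c3 * p2), Some (c3 * q2), Some (d3 * p1), Some (d3 * q1), None, None],
  [Some (e1 * p1), Some (e1 * q1), Some (f1 * p0), Some (f1 * q0), None, None, Some (h1 * p2), Some (h1 * q2)],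
  [Some (e2 * p2), Some (e2 * q2), Some (h2 * p3), Some (h2 * q3), None, None, Some (g2 * p1), Some (g2 * q1)],
  [Some (e3 * p3), Some (e3 * q3), Some (g3 * p2), Some (g3 * q2), None, None, Some (f3 * p0), Some (f3 * q0)]] =
 (b1 * (p1 * q0 - q1 * p0) * (b2 * d3 * (p0 * q1 - q0 * p1)) - d2 * (p1 * q3 - q1 * p3) * (c1 * d3 * (p3 * q1 - q3 * p1)) + c3 * (p1 * q2 - q1 * p2) * (c1 * b2 * (p3 * q0 - q3 * p0))) * (e1 * (p0 * q1 - q0 * p1) * (g2 * f3 * (p1 * q0 - q1 * p0)) - e2 * (p0 * q2 - q0 * p2) * (h1 * f3 * (p2 * q0 - q2 * p0)) + e3 * (p0 * q3 - q0 * p3) * (h1 * g2 * (p2 * q1 - q2 * p1))) - (a1 * (p0 * q1 - q0 * p1) * (b2 * d3 * (p0 * q1 - q0 * p1)) - a2 * (p0 * q2 - q0 * p2) * (c1 * d3 * (p3 * q1 - q3 * p1)) + a3 * (p0 * q3 - q0 * p3) * (c1 * b2 * (p3 * q0 - q3 * p0))) * (f1 * (p1 * q0 - q1 * p0) * (g2 * f3 * (p1 * q0 - q1 * p0)) - h2 * (p1 * q3 - q1 * p3) * (h1 * f3 * (p2 * q0 - q2 * p0)) + g3 * (p1 * q2 - q1 * p2) * (h1 * g2 * (p2 * q1 - q2 * p1)))"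
 by (simp add: algebra_simps)

section \<open>Symmetries of the relations and of the minors\<close>

definition zz :: "(2 => 4 => 'r::comm_ring_1) => 4 => 4 => 'r" where
 "zz l r s = l 0 r * l 1 s - l 1 r * l 0 s"

lemma zz_swap: "zz l s r = - zz l r s"
 by (simp add: zz_def)

text \<open>Renaming the generators permutes the columns \<open>(r, s)\<close> of the matrix, which
  changes a minor by a sign only.\<close>

lemma minors_in_perm:
 fixes C :: "'k::field => 'r::comm_ring_1"
 assumes I: "is_ideal I" and s: "bij \<sigma>" "!!x. \<tau> (\<sigma> x) = x"
  and b: "!!b. bil \<alpha>' \<beta>' \<gamma>' b ==> bil \<alpha> \<beta> \<gamma> (%x y. b (\<tau> x) (\<tau> y))"
  and m: "minors_in C \<alpha> \<beta> \<gamma> l I"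
 shows "minors_in C \<alpha>' \<beta>' \<gamma>' (%s j. l s (\<sigma> j)) I"
 unfolding minors_in_def
proof (intro allI impI)
 fix b' :: "4 \<times> 2 => 4 => 4 => 'k" assume b': "ALL a. bil \<alpha>' \<beta>' \<gamma>' (b' a)"
 define \<pi> :: "4 \<times> 2 => 4 \<times> 2" where "\<pi> c = (\<sigma> (fst c), snd c)" for c
 define M where "M = (\<chi> a c. \<Sum>j\<in>UNIV. C (b' a (\<tau> (fst c)) (\<tau> j)) * l (snd c) j)"
 have \<pi>: "\<pi> permutes UNIV"
 proof (rule bij_imp_permutes)
  have "inj \<pi>" using s(1) by (auto simp: \<pi>_def inj_def bij_def prod_eq_iff)
  then show "bij_betw \<pi> UNIV UNIV" by (simp add: finite_UNIV_inj_surj bij_def)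
 qed simp
 have "Determinants.det M : I"
  using m[unfolded minors_in_def, rule_format, of "%a x y. b' a (\<tau> x) (\<tau> y)"] b[OF b'[rule_format]]
  by (simp add: M_def)
 then have "of_int (sign \<pi>) * Determinants.det M : I"
  by (rule idealD(3)[OF I])
 also have "of_int (sign \<pi>) * Determinants.det M = Determinants.det (\<chi> a c. M $ a $ \<pi> c)"
  by (rule det_permute_columns[OF \<pi>, symmetric])
 also have "(\<chi> a c. M $ a $ \<pi> c) = (\<chi> a c. \<Sum>j\<in>UNIV. C (b' a (fst c) j) * l (snd c) (\<sigma> j))"
 proof -
  have "(\<Sum>j\<in>UNIV. C (b' a (fst c) (\<tau> j)) * l (snd c) j) = (\<Sum>j\<in>UNIV. C (b' a (fst c) j) * l (snd c) (\<sigma> j))" for a c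
   using sum.reindex_bij_betw[OF s(1), of "%j. C (b' a (fst c) (\<tau> j)) * l (snd c) j"] by (simp add: s(2))
  then show ?thesis
   by (simp add: M_def \<pi>_def s(2) vec_eq_iff)
 qed
 finally show "Determinants.det (\<chi> a c. \<Sum>j\<in>UNIV. C (b' a (fst c) j) * l (snd c) (\<sigma> j)) : I" .
qed

definition cyc :: "4 => 4" where "cyc j = (if j = 1 then 2 else if j = 2 then 3 else if j = 3 then 1 else 0)"
definition cyc' :: "4 => 4" where "cyc' j = (if j = 1 then 3 else if j = 2 then 1 else if j = 3 then 2 else 0)"
definition sw1 :: "4 => 4" where "sw1 j = (if j = 0 then 1 else if j = 1 then 0 else if j = 2 then 3 else 2)"
definition sw2 :: "4 => 4" where "sw2 j = (if j = 0 then 2 else if j = 2 then 0 else if j = 1 then 3 else 1)"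
definition sw3 :: "4 => 4" where "sw3 j = (if j = 0 then 3 else if j = 3 then 0 else if j = 1 then 2 else 1)"

lemma perm_invs: "cyc' (cyc x) = x" "cyc (cyc' x) = x" "sw1 (sw1 x) = x" "sw2 (sw2 x) = x" "sw3 (sw3 x) = x"
 using exhaust_4'[of x] by (auto simp: cyc_def cyc'_def sw1_def sw2_def sw3_def)

lemma perm_bij: "bij cyc" "bij sw1" "bij sw2" "bij sw3"
 by (rule o_bij[where g = cyc'] o_bij[where g = sw1] o_bij[where g = sw2] o_bij[where g = sw3];
   simp add: fun_eq_iff perm_invs)+

lemma perm_vals: "cyc 0 = 0" "cyc 1 = 2" "cyc 2 = 3" "cyc 3 = 1"
 "sw1 0 = 1" "sw1 1 = 0" "sw1 2 = 3" "sw1 3 = 2" "sw2 0 = 2" "sw2 1 = 3" "sw2 2 = 0" "sw2 3 = 1"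
 "sw3 0 = 3" "sw3 1 = 2" "sw3 2 = 1" "sw3 3 = 0"
 by (simp_all add: cyc_def sw1_def sw2_def sw3_def)

context params
begin

text \<open>Exchanging \<open>y_0\<close> with \<open>y_i\<close> and the other two generators with
  each other inverts the two other parameters; the constraint is preserved up to a nonzero
  factor.\<close>

lemma swapped: "params \<alpha> (1 / \<beta>) (1 / \<gamma>)" "params (1 / \<alpha>) \<beta> (1 / \<gamma>)" "params (1 / \<alpha>) (1 / \<beta>) \<gamma>"
proof -
 have i: "1 / x ~: {0, 1, -1}" if "x ~: {0, 1, -1}" for x :: 'k
  using that by (auto simp: divide_eq_eq eq_divide_eq minus_equation_iff split: if_splits)
 have c: "\<alpha> + 1 / \<beta> + 1 / \<gamma> + \<alpha> * (1 / \<beta>) * (1 / \<gamma>) = (\<alpha> + \<beta> + \<gamma> + \<alpha> * \<beta> * \<gamma>) / (\<beta> * \<gamma>)"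
  "1 / \<alpha> + \<beta> + 1 / \<gamma> + (1 / \<alpha>) * \<beta> * (1 / \<gamma>) = (\<alpha> + \<beta> + \<gamma> + \<alpha> * \<beta> * \<gamma>) / (\<alpha> * \<gamma>)"
  "1 / \<alpha> + 1 / \<beta> + \<gamma> + (1 / \<alpha>) * (1 / \<beta>) * \<gamma> = (\<alpha> + \<beta> + \<gamma> + \<alpha> * \<beta> * \<gamma>) / (\<alpha> * \<beta>)"
  using nzs by (simp_all add: field_simps)
 show "params \<alpha> (1 / \<beta>) (1 / \<gamma>)" "params (1 / \<alpha>) \<beta> (1 / \<gamma>)" "params (1 / \<alpha>) (1 / \<beta>) \<gamma>"
  by (unfold_locales; use char nz i[OF nz(1)] i[OF nz(2)] i[OF nz(3)] c con in "simp")+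
qed

lemma rotated: "params \<beta> \<gamma> \<alpha>"
 by unfold_locales (use char nz con in "simp_all add: algebra_simps")

lemma bil_swapped:
 "bil \<alpha> (1 / \<beta>) (1 / \<gamma>) b ==> bil \<alpha> \<beta> \<gamma> (%x y. b (sw1 x) (sw1 y))"
 "bil (1 / \<alpha>) \<beta> (1 / \<gamma>) b ==> bil \<alpha> \<beta> \<gamma> (%x y. b (sw2 x) (sw2 y))"
 "bil (1 / \<alpha>) (1 / \<beta>) \<gamma> b ==> bil \<alpha> \<beta> \<gamma> (%x y. b (sw3 x) (sw3 y))"
 using nzs(1-3) by (auto simp: bil_def sw1_def sw2_def sw3_def field_simps)

lemma bil_rotated: "bil \<beta> \<gamma> \<alpha> b ==> bil \<alpha> \<beta> \<gamma> (%x y. b (cyc' x) (cyc' y))"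
 by (auto simp: bil_def cyc'_def)

end

locale minors_ideal = params \<alpha> \<beta> \<gamma> + saturated_ideal C I
 for C :: "'k::field => 'r::comm_ring_1" and \<alpha> \<beta> \<gamma> and l :: "2 => 4 => 'r" and I +
 assumes minors: "minors_in C \<alpha> \<beta> \<gamma> l I"
begin

sublocale line_coords C \<alpha> \<beta> \<gamma> "zz l 0 1" "zz l 2 3" "zz l 0 2" "zz l 3 1" "zz l 0 3" "zz l 1 2" .

lemmas Cs = rhomD[OF C] rhom_uminus[OF C] rhom_diff[OF C] rhom_power[OF C] rhom_numeral[OF C]

lemma P_zero: "P = 0"
 unfolding line_coords.P_def zz_def by (simp add: algebra_simps)

lemma transported:
 "minors_ideal C \<alpha> (1 / \<beta>) (1 / \<gamma>) (%s j. l s (sw1 j)) I"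
 "minors_ideal C (1 / \<alpha>) \<beta> (1 / \<gamma>) (%s j. l s (sw2 j)) I"
 "minors_ideal C (1 / \<alpha>) (1 / \<beta>) \<gamma> (%s j. l s (sw3 j)) I"
 "minors_ideal C \<beta> \<gamma> \<alpha> (%s j. l s (cyc j)) I"
 by (intro minors_ideal.intro minors_ideal_axioms.intro swapped rotated saturated_ideal_axioms
   minors_in_perm[OF L perm_bij(2) perm_invs(3) bil_swapped(1) minors]
   minors_in_perm[OF L perm_bij(3) perm_invs(4) bil_swapped(2) minors]
   minors_in_perm[OF L perm_bij(4) perm_invs(5) bil_swapped(3) minors]
   minors_in_perm[OF L perm_bij(1) perm_invs(1) bil_rotated minors]; assumption)+

text \<open>The first two minors are twice \<open>z01*cub0\<close> and twice
  \<open>z23*cub0\<close>; for \<open>cubu\<close> two minors have to be combined.\<close>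

lemma cub0_cert: "zz l 0 1 * cub0 : I" "zz l 2 3 * cub0 : I"
 and cubu_cert: "zz l 0 1 * cubu : I"
proof -
 have mem: "x : I" if "length bs = 8" "\<forall>b\<in>set bs. bil \<alpha> \<beta> \<gamma> b" "sdet rs = x" "map (map entry) rs = map (row_of C l) bs" for rs bs x
  using sdet_in_minors[OF minors that(1,2,4)] that(3) by simp
 have two: "(2 :: 'k) ~= 0" by (rule char)
 \<comment> \<open>\<open>(0, 2*\<alpha>, \<alpha> - 1, \<alpha> + 1)\<close> is, up to a factor,
   the functional on its block that kills \<open>y_0*y_i\<close>; the values
   \<open>(1, 1, 1, 1)\<close> satisfy the relations for every parameter.\<close>
 have "- zz l 0 1 * (- C (2 * \<alpha>) * zz l 0 1 * (C (2 * \<beta>) * C (2 * \<gamma>) * zz l 0 2 * zz l 0 3 + C (\<beta> - 1) * C (\<gamma> + 1) * zz l 3 1 * zz l 1 2) - C (\<alpha> - 1) * zz l 2 3 * (C (\<beta> + 1) * C (2 * \<gamma>) * zz l 3 1 * zz l 0 3 - C (\<beta> - 1) * C (\<gamma> - 1) * zz l 3 1 * zz l 1 2) - C (\<alpha> + 1) * zz l 2 3 * (C (\<beta> + 1) * C (\<gamma> + 1) * zz l 3 1 * zz l 1 2 + C (2 * \<beta>) * C (\<gamma> - 1) * zz l 0 2 * zz l 1 2)) : I"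
  unfolding zz_def
  by (rule mem[OF _ _ sdet_cert_u[where ?p0.0 = "l 0 0" and ?p1.0 = "l 0 1" and ?p2.0 = "l 0 2" and ?p3.0 = "l 0 3" and ?q0.0 = "l 1 0" and ?q1.0 = "l 1 1" and ?q2.0 = "l 1 2" and ?q3.0 = "l 1 3" and ?b1.0 = "C (2 * \<alpha>)" and ?b2.0 = "C (2 * \<beta>)" and ?b3.0 = "C (2 * \<gamma>)" and ?c1.0 = "C (\<alpha> - 1)" and ?c2.0 = "C (\<beta> - 1)" and ?c3.0 = "C (\<gamma> - 1)" and ?d1.0 = "C (\<alpha> + 1)" and ?d2.0 = "C (\<beta> + 1)" and ?d3.0 = "C (\<gamma> + 1)"], of "[sq 0, sq 1, sq 2, sq 3, block 1 2 3 (0) (2 * \<alpha>) (\<alpha> - 1) (\<alpha> + 1), block 2 3 1 (0) (2 * \<beta>) (\<beta> - 1) (\<beta> + 1), block 3 1 2 (0) (2 * \<gamma>) (\<gamma> - 1) (\<gamma> + 1), block 1 2 3 (1) (1) (1) (1)]"])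
   (auto simp: row_of_sq[OF C] row_of_block[OF C] Cs(1,2) intro!: bil_sq bil_block simp: algebra_simps)
 also have "- zz l 0 1 * (- C (2 * \<alpha>) * zz l 0 1 * (C (2 * \<beta>) * C (2 * \<gamma>) * zz l 0 2 * zz l 0 3 + C (\<beta> - 1) * C (\<gamma> + 1) * zz l 3 1 * zz l 1 2) - C (\<alpha> - 1) * zz l 2 3 * (C (\<beta> + 1) * C (2 * \<gamma>) * zz l 3 1 * zz l 0 3 - C (\<beta> - 1) * C (\<gamma> - 1) * zz l 3 1 * zz l 1 2) - C (\<alpha> + 1) * zz l 2 3 * (C (\<beta> + 1) * C (\<gamma> + 1) * zz l 3 1 * zz l 1 2 + C (2 * \<beta>) * C (\<gamma> - 1) * zz l 0 2 * zz l 1 2)) = C 2 * (zz l 0 1 * cub0)"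
  unfolding cub0_def trilin_def by (simp add: Cs algebra_simps)
 finally show "zz l 0 1 * cub0 : I" by (rule unit_cancel[OF two])
 have "- zz l 2 3 * (- C (2 * \<alpha>) * zz l 0 1 * (C (2 * \<beta>) * C (2 * \<gamma>) * zz l 0 2 * zz l 0 3 + C (\<beta> - 1) * C (\<gamma> + 1) * zz l 3 1 * zz l 1 2) - C (\<alpha> - 1) * zz l 2 3 * (C (\<beta> + 1) * C (2 * \<gamma>) * zz l 3 1 * zz l 0 3 - C (\<beta> - 1) * C (\<gamma> - 1) * zz l 3 1 * zz l 1 2) - C (\<alpha> + 1) * zz l 2 3 * (C (\<beta> + 1) * C (\<gamma> + 1) * zz l 3 1 * zz l 1 2 + C (2 * \<beta>) * C (\<gamma> - 1) * zz l 0 2 * zz l 1 2)) : I"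
  unfolding zz_def
  by (rule mem[OF _ _ sdet_cert_v[where ?p0.0 = "l 0 0" and ?p1.0 = "l 0 1" and ?p2.0 = "l 0 2" and ?p3.0 = "l 0 3" and ?q0.0 = "l 1 0" and ?q1.0 = "l 1 1" and ?q2.0 = "l 1 2" and ?q3.0 = "l 1 3" and ?b1.0 = "C (2 * \<alpha>)" and ?b2.0 = "C (2 * \<beta>)" and ?b3.0 = "C (2 * \<gamma>)" and ?c1.0 = "C (\<alpha> - 1)" and ?c2.0 = "C (\<beta> - 1)" and ?c3.0 = "C (\<gamma> - 1)" and ?d1.0 = "C (\<alpha> + 1)" and ?d2.0 = "C (\<beta> + 1)" and ?d3.0 = "C (\<gamma> + 1)"], of "[sq 1, sq 2, sq 3, block 1 2 3 (0) (2 * \<alpha>) (\<alpha> - 1) (\<alpha> + 1), block 2 3 1 (0) (2 * \<beta>) (\<beta> - 1) (\<beta> + 1), block 3 1 2 (0) (2 * \<gamma>) (\<gamma> - 1) (\<gamma> + 1), block 2 3 1 (1) (1) (1) (1), block 3 1 2 (1) (1) (1) (1)]"])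
   (auto simp: row_of_sq[OF C] row_of_block[OF C] Cs(1,2) intro!: bil_sq bil_block simp: algebra_simps)
 also have "- zz l 2 3 * (- C (2 * \<alpha>) * zz l 0 1 * (C (2 * \<beta>) * C (2 * \<gamma>) * zz l 0 2 * zz l 0 3 + C (\<beta> - 1) * C (\<gamma> + 1) * zz l 3 1 * zz l 1 2) - C (\<alpha> - 1) * zz l 2 3 * (C (\<beta> + 1) * C (2 * \<gamma>) * zz l 3 1 * zz l 0 3 - C (\<beta> - 1) * C (\<gamma> - 1) * zz l 3 1 * zz l 1 2) - C (\<alpha> + 1) * zz l 2 3 * (C (\<beta> + 1) * C (\<gamma> + 1) * zz l 3 1 * zz l 1 2 + C (2 * \<beta>) * C (\<gamma> - 1) * zz l 0 2 * zz l 1 2)) = C 2 * (zz l 2 3 * cub0)"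
  unfolding cub0_def trilin_def by (simp add: Cs algebra_simps)
 finally show "zz l 2 3 * cub0 : I" by (rule unit_cancel[OF two])
 \<comment> \<open>In this minor and the next, each functional on a block kills one of its four
   products, which keeps the matrices sparse.\<close>
 have 1: "(C (1 - \<beta>) * zz l 0 2) * (C (\<beta> - 1) * zz l 1 3) * (C (1 - \<gamma>) * zz l 2 1) * (C (1 - \<gamma>) * zz l 3 0) - (C (1 - \<beta>) * zz l 0 2) * (C (1 + \<beta>) * zz l 3 1) * (C (1 - \<gamma>) * zz l 2 1) * (C (2) * zz l 1 2) - (C (2) * zz l 1 3) * (C (2 * \<beta>) * zz l 0 2) * (C (1 - \<gamma>) * zz l 2 1) * (C (1 - \<gamma>) * zz l 3 0) + (C (2) * zz l 1 3) * (C (1 + \<beta>) * zz l 3 1) * (C (1 - \<gamma>) * zz l 2 1) * (C (1 + \<gamma>) * zz l 0 3) + (C (1 + \<beta>) * zz l 2 0) * (C (2 * \<beta>) * zz l 0 2) * (C (- (1 + \<gamma>)) * zz l 1 2) * (C (1 - \<gamma>) * zz l 3 0) - (C (1 + \<beta>) * zz l 2 0) * (C (\<beta> - 1) * zz l 1 3) * (C (- (2 * \<gamma>)) * zz l 0 3) * (C (1 - \<gamma>) * zz l 3 0) + (C (1 + \<beta>) * zz l 2 0) * (C (1 + \<beta>) * zz l 3 1) * (C (- (2 * \<gamma>)) * zz l 0 3) * (C (2) * zz l 1 2) - (C (1 + \<beta>) * zz l 2 0) * (C (1 + \<beta>) * zz l 3 1) * (C (- (1 + \<gamma>)) * zz l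 1 2) * (C (1 + \<gamma>) * zz l 0 3) : I" (is "?cyc : I")
  unfolding zz_def
  by (rule mem[OF _ _ sdet_cert_cycle[where ?p0.0 = "l 0 0" and ?p1.0 = "l 0 1" and ?p2.0 = "l 0 2" and ?p3.0 = "l 0 3" and ?q0.0 = "l 1 0" and ?q1.0 = "l 1 1" and ?q2.0 = "l 1 2" and ?q3.0 = "l 1 3" and ?a2.0 = "C (1 - \<beta>)" and ?b2.0 = "C (1 + \<beta>)" and ?d2.0 = "C (2)" and ?e2.0 = "C (2 * \<beta>)" and ?g2.0 = "C (1 + \<beta>)" and ?h2.0 = "C (\<beta> - 1)" and ?a3.0 = "C (- (2 * \<gamma>))" and ?c3.0 = "C (- (1 + \<gamma>))" and ?d3.0 = "C (1 - \<gamma>)" and ?e3.0 = "C (1 + \<gamma>)" and ?f3.0 = "C (1 - \<gamma>)" and ?g3.0 = "C (2)"], of "[sq 0, sq 1, sq 2, sq 3, block 2 3 1 (1 - \<beta>) (1 + \<beta>) (0) (2), block 2 3 1 (2 * \<beta>) (0) (1 + \<beta>) (\<beta> - 1), block 3 1 2 (- (2 * \<gamma>)) (0) (- (1 + \<gamma>)) (1 - \<gamma>), block 3 1 2 (1 + \<gamma>) (1 - \<gamma>) (2) (0)]"])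
   (auto simp: row_of_sq[OF C] row_of_block[OF C] Cs(1,2) intro!: bil_sq bil_block simp: algebra_simps)
 have 2: "(C (1 - \<alpha>) * zz l 1 0 * (C (1 + \<beta>) * C (1 - \<gamma>) * zz l 0 1) - C (2) * zz l 1 3 * (C (2) * C (1 - \<gamma>) * zz l 3 1) + C (- (1 + \<gamma>)) * zz l 1 2 * (C (2) * C (1 + \<beta>) * zz l 3 0)) * (C (1 - \<alpha>) * zz l 0 1 * (C (1 + \<beta>) * C (1 - \<gamma>) * zz l 1 0) - C (2 * \<beta>) * zz l 0 2 * (C (2) * C (1 - \<gamma>) * zz l 2 0) + C (1 + \<gamma>) * zz l 0 3 * (C (2) * C (1 + \<beta>) * zz l 2 1)) - (C (1 + \<alpha>) * zz l 0 1 * (C (1 + \<beta>) * C (1 - \<gamma>) * zz l 0 1) - C (1 - \<beta>) * zz l 0 2 * (C (2) * C (1 - \<gamma>) * zz l 3 1) + C (- (2 * \<gamma>)) * zz l 0 3 * (C (2) * C (1 + \<beta>) * zz l 3 0)) * (C (1 + \<alpha>) * zz l 1 0 * (C (1 + \<beta>) * C (1 - \<gamma>) * zz l 1 0) - C (\<beta> - 1) * zz l 1 3 * (C (2) * C (1 - \<gamma>) * zz l 2 0) + C (2) * zz l 1 2 * (C (2) * C (1 + \<beta>) * zz l 2 1)) : I" (is "?rest : I")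
  unfolding zz_def
  by (rule mem[OF _ _ sdet_cert_rest[where ?p0.0 = "l 0 0" and ?p1.0 = "l 0 1" and ?p2.0 = "l 0 2" and ?p3.0 = "l 0 3" and ?q0.0 = "l 1 0" and ?q1.0 = "l 1 1" and ?q2.0 = "l 1 2" and ?q3.0 = "l 1 3" and ?a2.0 = "C (1 - \<beta>)" and ?b2.0 = "C (1 + \<beta>)" and ?d2.0 = "C (2)" and ?e2.0 = "C (2 * \<beta>)" and ?g2.0 = "C (1 + \<beta>)" and ?h2.0 = "C (\<beta> - 1)" and ?a3.0 = "C (- (2 * \<gamma>))" and ?c3.0 = "C (- (1 + \<gamma>))" and ?d3.0 = "C (1 - \<gamma>)" and ?e3.0 = "C (1 + \<gamma>)" and ?f3.0 = "C (1 - \<gamma>)" and ?g3.0 = "C (2)" and ?a1.0 = "C (1 + \<alpha>)" and ?b1.0 = "C (1 - \<alpha>)" and ?c1.0 = "C (2)" and ?e1.0 = "C (1 - \<alpha>)" and ?f1.0 = "C (1 + \<alpha>)" and ?h1.0 = "C (2)"], of "[sq 0, sq 1, block 1 2 3 (1 + \<alpha>) (1 - \<alpha>) (2) (0), block 2 3 1 (1 - \<beta>) (1 + \<beta>) (0) (2), block 3 1 2 (- (2 * \<gamma>)) (0) (- (1 + \<gamma>)) (1 - \<gamma>), block 1 2 3 (1 - \<alpha>) (1 + \<alpha>) (0) (2), block 2 3 1 (2 * \<beta>) (0) (1 + \<beta>) (\<beta> - 1), block 3 1 2 (1 + \<gamma>) (1 - \<gamma>) (2) (0)]"])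
   (auto simp: row_of_sq[OF C] row_of_block[OF C] Cs(1,2) intro!: bil_sq bil_block simp: algebra_simps)
 \<comment> \<open>Modulo the Pluecker relation this combination of the two minors is divisible by
   \<open>z01\<close>.\<close>
 have "?rest + 4 * ?cyc = C (4 * (1 + \<beta>) * (1 - \<gamma>)) * (zz l 0 1 * cubu
   + C ((1 + \<beta>) * (1 - \<gamma>)) * (zz l 0 2 * zz l 3 1 - zz l 0 3 * zz l 1 2) * P)"
  unfolding cubu_def P_def zz_swap[of l 1 0] zz_swap[of l 2 0] zz_swap[of l 3 0] zz_swap[of l 2 1] zz_swap[of l 1 3]
  by (simp add: Cs algebra_simps power2_eq_square power3_eq_cube)
 then have "C (4 * (1 + \<beta>) * (1 - \<gamma>)) * (zz l 0 1 * cubu) = ?rest + 4 * ?cyc"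
  by (simp add: P_zero)
 moreover have "?rest + 4 * ?cyc : I"
  using 1 2 by (intro idealD(2,3)[OF L])
 moreover have "4 * (1 + \<beta>) * (1 - \<gamma>) ~= 0"
  using nzs two by (metis mult_eq_0_iff numeral_Bit0_eq_double)
 ultimately show "zz l 0 1 * cubu : I"
  using unit_cancel by metis
qed

end

lemma trilin_scale: "rhom C ==> C k * line_coords.trilin C u1 v1 u2 v2 u3 v3 a0 a1 a2 a3 w0 w1 w2 w3 =
  line_coords.trilin C u1 v1 u2 v2 u3 v3 (k * a0) (k * a1) (k * a2) (k * a3) (k * w0) (k * w1) (k * w2) (k * w3)"
 unfolding line_coords.trilin_def by (simp add: rhomD(4) distrib_left mult.assoc)

context minors_ideal
begin

lemma zz_perm: "zz (%s j. l s (\<sigma> j)) a b = zz l (\<sigma> a) (\<sigma> b)"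
 by (simp add: zz_def)

text \<open>The exchanges \<open>sw1\<close>, \<open>sw2\<close>, \<open>sw3\<close> carry
  \<open>cub0\<close> to the other trilinear cubics, up to sign and the factor clearing
  denominators. \<open>sw2\<close> and \<open>sw3\<close> carry \<open>z23\<close> to
  \<open>z01\<close> up to sign, which is the purpose of the second certificate for
  \<open>cub0\<close>.\<close>

lemma cub_cert: "zz l 0 1 * cub1 : I" "zz l 0 1 * cub2 : I" "zz l 0 1 * cub3 : I"
proof -
 note z = zz_swap[of l 1 0] zz_swap[of l 2 0] zz_swap[of l 3 0] zz_swap[of l 2 1] zz_swap[of l 1 3] zz_swap[of l 3 2]
 have "zz l 1 0 * line_coords.cub0 C \<alpha> (1 / \<beta>) (1 / \<gamma>) (zz l 1 0) (zz l 3 2) (zz l 1 3) (zz l 2 0) (zz l 1 2) (zz l 0 3) : I"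
  using minors_ideal.cub0_cert(1)[OF transported(1)] by (simp add: zz_perm[of sw1] perm_vals)
 then have "C (\<beta> * \<gamma>) * (zz l 1 0 * line_coords.cub0 C \<alpha> (1 / \<beta>) (1 / \<gamma>) (zz l 1 0) (zz l 3 2) (zz l 1 3) (zz l 2 0) (zz l 1 2) (zz l 0 3)) : I"
  by (rule L_simps)
 also have "C (\<beta> * \<gamma>) * (zz l 1 0 * line_coords.cub0 C \<alpha> (1 / \<beta>) (1 / \<gamma>) (zz l 1 0) (zz l 3 2) (zz l 1 3) (zz l 2 0) (zz l 1 2) (zz l 0 3)) = - (zz l 0 1 * cub1)"
 proof -
  have c: "\<beta> * \<gamma> * (1 + \<alpha> * (1 / \<beta>) + 1 / \<beta> * (1 / \<gamma>) + 1 / \<gamma> * \<alpha>) = 1 + \<alpha> * \<beta> + \<beta> * \<gamma> + \<gamma> * \<alpha>"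
   "\<beta> * \<gamma> * (4 * \<alpha> * (1 / \<beta>) * (1 / \<gamma>)) = 4 * \<alpha>" "\<beta> * \<gamma> * (\<alpha> * (1 / \<beta> - 1) * (1 + 1 / \<gamma>)) = \<alpha> * (1 - \<beta>) * (1 + \<gamma>)"
   "\<beta> * \<gamma> * (1 / \<beta> * (1 / \<gamma> - 1) * (1 + \<alpha>)) = (1 - \<gamma>) * (1 + \<alpha>)" "\<beta> * \<gamma> * (1 / \<gamma> * (\<alpha> - 1) * (1 + 1 / \<beta>)) = (\<alpha> - 1) * (1 + \<beta>)"
   using nzs by (simp_all add: field_simps)
  show ?thesis
   unfolding mult.left_commute[of "C _" "zz l 1 0"] line_coords.cub0_def trilin_scale[OF C] c cub1_def
   by (simp add: line_coords.trilin_def z mult_ac add_ac)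
 qed
 finally show "zz l 0 1 * cub1 : I" using L_simps(5) by fastforce
 have "zz l 0 1 * line_coords.cub0 C (1 / \<alpha>) \<beta> (1 / \<gamma>) (zz l 2 3) (zz l 0 1) (zz l 2 0) (zz l 1 3) (zz l 2 1) (zz l 3 0) : I"
  using minors_ideal.cub0_cert(2)[OF transported(2)] by (simp add: zz_perm[of sw2] perm_vals)
 then have "C (\<alpha> * \<gamma>) * (zz l 0 1 * line_coords.cub0 C (1 / \<alpha>) \<beta> (1 / \<gamma>) (zz l 2 3) (zz l 0 1) (zz l 2 0) (zz l 1 3) (zz l 2 1) (zz l 3 0)) : I"
  by (rule L_simps)
 also have "C (\<alpha> * \<gamma>) * (zz l 0 1 * line_coords.cub0 C (1 / \<alpha>) \<beta> (1 / \<gamma>) (zz l 2 3) (zz l 0 1) (zz l 2 0) (zz l 1 3) (zz l 2 1) (zz l 3 0)) = zz l 0 1 * cub2"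
 proof -
  have c: "\<alpha> * \<gamma> * (1 + 1 / \<alpha> * \<beta> + \<beta> * (1 / \<gamma>) + 1 / \<gamma> * (1 / \<alpha>)) = 1 + \<alpha> * \<beta> + \<beta> * \<gamma> + \<gamma> * \<alpha>"
   "\<alpha> * \<gamma> * (4 * (1 / \<alpha>) * \<beta> * (1 / \<gamma>)) = 4 * \<beta>" "\<alpha> * \<gamma> * (1 / \<alpha> * (\<beta> - 1) * (1 + 1 / \<gamma>)) = (\<beta> - 1) * (1 + \<gamma>)"
   "\<alpha> * \<gamma> * (\<beta> * (1 / \<gamma> - 1) * (1 + 1 / \<alpha>)) = \<beta> * (1 - \<gamma>) * (1 + \<alpha>)" "\<alpha> * \<gamma> * (1 / \<gamma> * (1 / \<alpha> - 1) * (1 + \<beta>)) = (1 - \<alpha>) * (1 + \<beta>)"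
   using nzs by (simp_all add: field_simps)
  show ?thesis
   unfolding mult.left_commute[of "C _" "zz l 0 1"] line_coords.cub0_def trilin_scale[OF C] c cub2_def
   by (simp add: line_coords.trilin_def z mult_ac add_ac)
 qed
 finally show "zz l 0 1 * cub2 : I" .
 have "zz l 1 0 * line_coords.cub0 C (1 / \<alpha>) (1 / \<beta>) \<gamma> (zz l 3 2) (zz l 1 0) (zz l 3 1) (zz l 0 2) (zz l 3 0) (zz l 2 1) : I"
  using minors_ideal.cub0_cert(2)[OF transported(3)] by (simp add: zz_perm[of sw3] perm_vals)
 then have "C (\<alpha> * \<beta>) * (zz l 1 0 * line_coords.cub0 C (1 / \<alpha>) (1 / \<beta>) \<gamma> (zz l 3 2) (zz l 1 0) (zz l 3 1) (zz l 0 2) (zz l 3 0) (zz l 2 1)) : I"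
  by (rule L_simps)
 also have "C (\<alpha> * \<beta>) * (zz l 1 0 * line_coords.cub0 C (1 / \<alpha>) (1 / \<beta>) \<gamma> (zz l 3 2) (zz l 1 0) (zz l 3 1) (zz l 0 2) (zz l 3 0) (zz l 2 1)) = - (zz l 0 1 * cub3)"
 proof -
  have c: "\<alpha> * \<beta> * (1 + 1 / \<alpha> * (1 / \<beta>) + 1 / \<beta> * \<gamma> + \<gamma> * (1 / \<alpha>)) = 1 + \<alpha> * \<beta> + \<beta> * \<gamma> + \<gamma> * \<alpha>"
   "\<alpha> * \<beta> * (4 * (1 / \<alpha>) * (1 / \<beta>) * \<gamma>) = 4 * \<gamma>" "\<alpha> * \<beta> * (1 / \<alpha> * (1 / \<beta> - 1) * (1 + \<gamma>)) = (1 - \<beta>) * (1 + \<gamma>)"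
   "\<alpha> * \<beta> * (1 / \<beta> * (\<gamma> - 1) * (1 + 1 / \<alpha>)) = (\<gamma> - 1) * (1 + \<alpha>)" "\<alpha> * \<beta> * (\<gamma> * (1 / \<alpha> - 1) * (1 + 1 / \<beta>)) = \<gamma> * (1 - \<alpha>) * (1 + \<beta>)"
   using nzs by (simp_all add: field_simps)
  show ?thesis
   unfolding mult.left_commute[of "C _" "zz l 1 0"] line_coords.cub0_def trilin_scale[OF C] c cub3_def
   by (simp add: line_coords.trilin_def z mult_ac add_ac)
 qed
 finally show "zz l 0 1 * cub3 : I" using L_simps(5) by fastforce
qed

end

section \<open>From one chart to all six\<close>

definition good where
 "good C \<alpha> \<beta> \<gamma> u1 v1 u2 v2 u3 v3 f \<longleftrightarrow> line_coords.on_all C \<alpha> \<beta> \<gamma> u1 v1 u2 v2 u3 v3 f &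
  (ALL c g x. x : {u1, v1, u2, v2, u3, v3} --> x * g \<in> line_coords.K C \<alpha> \<beta> \<gamma> u1 v1 u2 v2 u3 v3 c -->
    g : line_coords.K C \<alpha> \<beta> \<gamma> u1 v1 u2 v2 u3 v3 c)"

text \<open>\<open>h\<close> substitutes two by two minors for the Pluecker coordinates; the
  preimage of the minors ideal saturated at \<open>h u1\<close> satisfies the assumptions of
  \<open>chart\<close>.\<close>

lemma minors_chart:
 fixes C :: "'k::field => 'r::comm_ring_1" and D :: "'k => 's::comm_ring_1"
 assumes m: "minors_ideal C \<alpha> \<beta> \<gamma> l I" and D: "rhom D" and h: "rhom h" and hD: "!!c. h (D c) = C c"
  and t: "h u1 = zz l 0 1" "h v1 = zz l 2 3" "h u2 = zz l 0 2" "h v2 = zz l 3 1" "h u3 = zz l 0 3" "h v3 = zz l 1 2"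
  and g: "good D \<alpha> \<beta> \<gamma> u1 v1 u2 v2 u3 v3 f"
 shows "EX N. h u1 ^ N * h f : I"
proof -
 interpret m: minors_ideal C \<alpha> \<beta> \<gamma> l I by (rule m)
 interpret lc: line_coords D \<alpha> \<beta> \<gamma> u1 v1 u2 v2 u3 v3 .
 define L where "L = {g. EX N. h u1 ^ N * h g : I}"
 note hs = rhomD[OF h] rhom_diff[OF h] rhom_power[OF h] rhom_uminus[OF h]
 have L: "is_ideal L"
  unfolding is_ideal_def
 proof (intro conjI ballI allI)
  show "0 : L" using idealD(1)[OF m.L] by (simp add: L_def hs)
 next
  fix a b assume "a : L" "b : L"
  then obtain n k where n: "h u1 ^ n * h a : I" "h u1 ^ k * h b : I" by (auto simp: L_def)
  have "h u1 ^ (n + k) * h (a + b) = h u1 ^ k * (h u1 ^ n * h a) + h u1 ^ n * (h u1 ^ k * h b)"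
   by (simp add: hs power_add algebra_simps)
  then have "h u1 ^ (n + k) * h (a + b) : I" using n by (simp add: m.L_simps)
  then show "a + b : L" unfolding L_def by blast
 next
  fix a r assume "a : L"
  then obtain n where n: "h u1 ^ n * h a : I" by (auto simp: L_def)
  from m.L_simps(3)[OF n, of "h r"] show "r * a : L" unfolding L_def by (auto simp: hs mult.left_commute)
 qed
 have in1: "x : L" if "h u1 * h x : I" for x
  using that unfolding L_def by (auto intro!: exI[of _ 1])
 have tr: "h (lc.trilin a0 a1 a2 a3 w0 w1 w2 w3) = m.trilin a0 a1 a2 a3 w0 w1 w2 w3" for a0 a1 a2 a3 w0 w1 w2 w3
  unfolding lc.trilin_def m.trilin_def by (simp only: hs hD t)
 interpret chart D \<alpha> \<beta> \<gamma> u1 v1 u2 v2 u3 v3 L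
 proof
  show "rhom D" "is_ideal L" by (fact D L)+
  fix f assume "u1 * f : L"
  then obtain n where "h u1 ^ n * h (u1 * f) : I" by (auto simp: L_def)
  then have "h u1 ^ Suc n * h f : I" by (simp add: hs mult_ac)
  then show "f : L" unfolding L_def by blast
 next
  have "h lc.P = 0" using m.P_zero unfolding lc.P_def m.P_def by (simp only: hs t)
  then show "lc.P : L" using idealD(1)[OF m.L] by (simp add: L_def)
 next
  show "lc.cub0 : L" using m.cub0_cert(1) unfolding lc.cub0_def m.cub0_def by (intro in1) (simp only: tr t)
  show "lc.cub1 : L" using m.cub_cert(1) unfolding lc.cub1_def m.cub1_def by (intro in1) (simp only: tr t)
  show "lc.cub2 : L" using m.cub_cert(2) unfolding lc.cub2_def m.cub2_def by (intro in1) (simp only: tr t)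
  show "lc.cub3 : L" using m.cub_cert(3) unfolding lc.cub3_def m.cub3_def by (intro in1) (simp only: tr t)
  show "lc.cubu : L" using m.cubu_cert unfolding lc.cubu_def m.cubu_def by (intro in1) (simp only: hs hD t)
 qed
 have "f : L"
  using g unfolding good_def by (intro chart_membership) blast+
 then show ?thesis by (simp add: L_def)
qed

lemma ideal_gen_subset: "G \<subseteq> ideal_gen H ==> ideal_gen G \<subseteq> ideal_gen H"
 by (rule ideal_gen_minimal) auto

lemma ideal_gen_eqI: "G \<subseteq> ideal_gen H ==> H \<subseteq> ideal_gen G ==> ideal_gen G = ideal_gen H"
 by (simp add: ideal_gen_subset subset_antisym)

lemma ideal_gen_multiple: "h : H ==> g = r * h ==> g : ideal_gen H"
 by (simp add: ideal_gen_base ideal_genD)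

lemma good_cyc:
 assumes "good C \<alpha> \<beta> \<gamma> u1 v1 u2 v2 u3 v3 f"
 shows "good C \<beta> \<gamma> \<alpha> u2 v2 u3 v3 u1 v1 f"
proof -
 interpret a: line_coords C \<alpha> \<beta> \<gamma> u1 v1 u2 v2 u3 v3 .
 interpret b: line_coords C \<beta> \<gamma> \<alpha> u2 v2 u3 v3 u1 v1 .
 have P: "b.P = a.P" by (simp add: a.P_def b.P_def)
 have F: "b.F1 = a.F2" "b.F2 = a.F3" "b.F3 = a.F1"
  by (simp_all add: a.F1_def b.F1_def a.F2_def b.F2_def a.F3_def b.F3_def)
 \<comment> \<open>The renumbering of the conics under rotation: only \<open>C_0\<close> keeps its
   number.\<close>
 define p where "p c = (if c = 0 then 0 else if c = 1 then 2 else if c = 2 then 3 else (1 :: 4))" for c :: 4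
 have K: "b.K c = a.K (p c)" for c
 proof -
  have "b.A c = a.B (p c)" "b.B c = a.W (p c)" "b.W c = a.A (p c)"
   using exhaust_4'[of c] by (auto simp: a.A_def a.B_def a.W_def b.A_def b.B_def b.W_def p_def slope_defs)
  then have "{b.A c, b.B c, b.W c, b.P} = {a.A (p c), a.B (p c), a.W (p c), a.P}" by (auto simp: P)
  then show ?thesis by (simp only: a.K_def b.K_def)
 qed
 have S: "{u2, v2, u3, v3, u1, v1} = {u1, v1, u2, v2, u3, v3}" by auto
 show ?thesis
  using assms unfolding good_def a.on_all_def b.on_all_def K P F S by blast
qed

text \<open>This is how \<open>sw2\<close> acts on the Pluecker coordinates: it exchanges
  \<open>u1\<close> with \<open>v1\<close> and multiplies the equations of the seven curves by
  nonzero constants.\<close>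

lemma good_swap:
 assumes p: "params \<alpha> \<beta> \<gamma>" and C: "rhom C" and g: "good C \<alpha> \<beta> \<gamma> u1 v1 u2 v2 u3 v3 f"
 shows "good C (1 / \<alpha>) \<beta> (1 / \<gamma>) v1 u1 (- u2) (- v2) (- v3) (- u3) f"
proof -
 interpret params \<alpha> \<beta> \<gamma> by (rule p)
 interpret a: line_coords C \<alpha> \<beta> \<gamma> u1 v1 u2 v2 u3 v3 .
 interpret b: line_coords C "1 / \<alpha>" \<beta> "1 / \<gamma>" v1 u1 "- u2" "- v2" "- v3" "- u3" .
 note Cs = rhomD(3,4)[OF C] rhom_diff[OF C]
 have P: "b.P = a.P" by (simp add: a.P_def b.P_def mult_ac)
 have inv: "C a * C (1 / a) = 1" if "a ~= 0" for a
  using that by (simp add: rhomD(4)[OF C, symmetric] rhomD(2)[OF C])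
 have sl: "slope1 (1 / \<alpha>) c = 1 / slope1 \<alpha> c" "slope3 (1 / \<gamma>) c = 1 / slope3 \<gamma> c" "slope1 \<alpha> c ~= 0" "slope3 \<gamma> c ~= 0" for c
  using nzs by (auto simp: slope_defs)
 have A: "b.A c = (- C (1 / slope1 \<alpha> c)) * a.A c" "a.A c = (- C (slope1 \<alpha> c)) * b.A c" for c
  using sl(3)[of c] by (simp_all add: a.A_def b.A_def sl(1) algebra_simps inv)
 have B: "b.B c = (- 1) * a.B c" "a.B c = (- 1) * b.B c" for c
  by (simp_all add: a.B_def b.B_def)
 have W: "b.W c = C (1 / slope3 \<gamma> c) * a.W c" "a.W c = C (slope3 \<gamma> c) * b.W c" for c
  using sl(4)[of c] by (simp_all add: a.W_def b.W_def sl(2) algebra_simps inv)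
 have K: "b.K c = a.K c" for c
  unfolding a.K_def b.K_def
 proof (rule ideal_gen_eqI)
  show "{b.A c, b.B c, b.W c, b.P} \<subseteq> ideal_gen {a.A c, a.B c, a.W c, a.P}"
   using ideal_gen_multiple[OF _ A(1)[of c], of "{a.A c, a.B c, a.W c, a.P}"] ideal_gen_multiple[OF _ B(1)[of c], of "{a.A c, a.B c, a.W c, a.P}"]
    ideal_gen_multiple[OF _ W(1)[of c], of "{a.A c, a.B c, a.W c, a.P}"] by (simp add: P ideal_gen_base)
  show "{a.A c, a.B c, a.W c, a.P} \<subseteq> ideal_gen {b.A c, b.B c, b.W c, b.P}"
   using ideal_gen_multiple[OF _ A(2)[of c], of "{b.A c, b.B c, b.W c, b.P}"] ideal_gen_multiple[OF _ B(2)[of c], of "{b.A c, b.B c, b.W c, b.P}"]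
    ideal_gen_multiple[OF _ W(2)[of c], of "{b.A c, b.B c, b.W c, b.P}"] by (simp add: P ideal_gen_base)
 qed
 have gg: "C \<gamma> * C (1 / \<gamma>) = 1" "C \<alpha> * C (1 / \<alpha>) = 1"
  using nzs by (simp_all add: rhomD(4)[OF C, symmetric] rhomD(2)[OF C])
 have F: "a.F1 = C \<gamma> * b.F1" "a.F2 = (- C (\<alpha> * \<gamma>)) * b.F2" "a.F3 = (- C \<alpha>) * b.F3"
 proof -
  have "\<gamma> * (1 + 1 / \<gamma>) = 1 + \<gamma>" "\<gamma> * (1 - 1 / \<gamma>) = - (1 - \<gamma>)" "\<alpha> * (1 + 1 / \<alpha>) = 1 + \<alpha>" "\<alpha> * (1 - 1 / \<alpha>) = - (1 - \<alpha>)"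
   using nzs by (simp_all add: algebra_simps)
  then have "C \<gamma> * C (1 + 1 / \<gamma>) = C (1 + \<gamma>)" "C \<gamma> * C (1 - 1 / \<gamma>) = - C (1 - \<gamma>)" "C \<alpha> * C (1 + 1 / \<alpha>) = C (1 + \<alpha>)" "C \<alpha> * C (1 - 1 / \<alpha>) = - C (1 - \<alpha>)"
   by (simp_all only: rhomD(4)[OF C, symmetric] rhom_uminus[OF C, symmetric])
  note c = this
  have "C \<gamma> * b.F1 = C (1 - \<beta>) * (C \<gamma> * u3^2 + (C \<gamma> * C (1 / \<gamma>)) * v3^2) - (C \<gamma> * C (1 + 1 / \<gamma>)) * (v2^2 - C \<beta> * u2^2)"
   by (simp add: b.F1_def algebra_simps)
  then show "a.F1 = C \<gamma> * b.F1" by (simp add: c gg a.F1_def add.commute)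
  have "(- C (\<alpha> * \<gamma>)) * b.F2 = - (C \<gamma> * C (1 - 1 / \<gamma>)) * (C \<alpha> * u1^2 + (C \<alpha> * C (1 / \<alpha>)) * v1^2)
    + (C \<alpha> * C (1 + 1 / \<alpha>)) * (C \<gamma> * u3^2 - (C \<gamma> * C (1 / \<gamma>)) * v3^2)"
   by (simp add: b.F2_def rhomD(4)[OF C] algebra_simps)
  then show "a.F2 = (- C (\<alpha> * \<gamma>)) * b.F2" by (simp add: c gg a.F2_def algebra_simps)
  have "(- C \<alpha>) * b.F3 = - (C \<alpha> * C (1 - 1 / \<alpha>)) * (v2^2 + C \<beta> * u2^2) + C (1 + \<beta>) * (C \<alpha> * u1^2 - (C \<alpha> * C (1 / \<alpha>)) * v1^2)"
   by (simp add: b.F3_def algebra_simps)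
  then show "a.F3 = (- C \<alpha>) * b.F3" by (simp add: c gg a.F3_def algebra_simps)
 qed
 have E: "ideal_gen {u1, v1, a.P, a.F1} \<subseteq> ideal_gen {v1, u1, b.P, b.F1}"
  "ideal_gen {u2, v2, a.P, a.F2} \<subseteq> ideal_gen {- u2, - v2, b.P, b.F2}"
  "ideal_gen {u3, v3, a.P, a.F3} \<subseteq> ideal_gen {- v3, - u3, b.P, b.F3}"
 proof -
  have n: "x : ideal_gen H" if "- x : H" for x and H :: "'b set"
   using ideal_genD(5)[OF ideal_gen_base[OF that]] by simp
  show "ideal_gen {u1, v1, a.P, a.F1} \<subseteq> ideal_gen {v1, u1, b.P, b.F1}"
   using ideal_gen_multiple[OF _ F(1), of "{v1, u1, b.P, b.F1}"] by (intro ideal_gen_subset) (auto simp: P ideal_gen_base)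
  show "ideal_gen {u2, v2, a.P, a.F2} \<subseteq> ideal_gen {- u2, - v2, b.P, b.F2}"
   using ideal_gen_multiple[OF _ F(2), of "{- u2, - v2, b.P, b.F2}"] by (intro ideal_gen_subset) (auto simp: P ideal_gen_base n)
  show "ideal_gen {u3, v3, a.P, a.F3} \<subseteq> ideal_gen {- v3, - u3, b.P, b.F3}"
   using ideal_gen_multiple[OF _ F(3), of "{- v3, - u3, b.P, b.F3}"] by (intro ideal_gen_subset) (auto simp: P ideal_gen_base n)
 qed
 have "y * g : a.K c --> g : a.K c" if "y : {v1, u1, - u2, - v2, - v3, - u3}" for y g c
 proof
  assume h: "y * g \<in> a.K c"
  have "is_ideal (a.K c)" by (simp add: a.K_def)
  then have "- y * g : a.K c" using idealD(5)[OF _ h] by simp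
  moreover have "y : {u1, v1, u2, v2, u3, v3} | - y : {u1, v1, u2, v2, u3, v3}" using that by auto
  ultimately show "g \<in> a.K c" using g h unfolding good_def by blast
 qed
 then show ?thesis
  using g E unfolding good_def a.on_all_def b.on_all_def K by blast
qed

text \<open>\<open>sw2\<close> carries the chart of \<open>v1\<close> to that of \<open>u1\<close>,
  and rotation supplies the remaining four.\<close>

theorem on_all_in_minors:
 fixes C :: "'k::field => 'r::comm_ring_1" and D :: "'k => 's::comm_ring_1"
 assumes m: "minors_ideal C \<alpha> \<beta> \<gamma> l I" and D: "rhom D" and h: "rhom h" and hD: "!!c. h (D c) = C c"
  and t: "h u1 = zz l 0 1" "h v1 = zz l 2 3" "h u2 = zz l 0 2" "h v2 = zz l 3 1" "h u3 = zz l 0 3" "h v3 = zz l 1 2"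
  and g: "good D \<alpha> \<beta> \<gamma> u1 v1 u2 v2 u3 v3 f"
  and x: "x : {u1, v1, u2, v2, u3, v3}"
 shows "EX N. h x ^ N * h f : I"
proof -
 have *: "(EX N. h u1 ^ N * h f : I) & (EX N. h v1 ^ N * h f : I)"
  if m: "minors_ideal C \<alpha> \<beta> \<gamma> l I" and g: "good D \<alpha> \<beta> \<gamma> u1 v1 u2 v2 u3 v3 f"
   and t: "h u1 = zz l 0 1" "h v1 = zz l 2 3" "h u2 = zz l 0 2" "h v2 = zz l 3 1" "h u3 = zz l 0 3" "h v3 = zz l 1 2"
  for \<alpha> \<beta> \<gamma> l u1 v1 u2 v2 u3 v3
 proof
  interpret m: minors_ideal C \<alpha> \<beta> \<gamma> l I by (rule m)
  show "EX N. h u1 ^ N * h f : I" by (rule minors_chart[OF m D h hD t g])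
  show "EX N. h v1 ^ N * h f : I"
   by (rule minors_chart[OF m.transported(2) D h hD _ _ _ _ _ _ good_swap[OF m.params_axioms D g]])
    (simp_all add: rhom_uminus[OF h] t m.zz_perm[of sw2] perm_vals zz_swap[of l 2 0] zz_swap[of l 1 3] zz_swap[of l 2 1] zz_swap[of l 3 0])
 qed
 interpret m: minors_ideal C \<alpha> \<beta> \<gamma> l I by (rule m)
 let ?l = "%s j. l s (cyc j)"
 interpret m': minors_ideal C \<beta> \<gamma> \<alpha> ?l I by (rule m.transported(4))
 have z: "zz ?l a b = zz l (cyc a) (cyc b)" for a b by (rule m.zz_perm)
 note 2 = *[OF m.transported(4) good_cyc[OF g]]
 note 3 = *[OF m'.transported(4) good_cyc[OF good_cyc[OF g]]]
 show ?thesis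
  using x *[OF m g t] 2 3 t
  by (auto simp: z m'.zz_perm[of cyc] perm_vals)
qed

section \<open>Hilbert functions\<close>

definition sub :: "('x, 'k::field) mpoly set => bool" where
 "sub V \<longleftrightarrow> 0 : V & (\<forall>f\<in>V. \<forall>g\<in>V. f + g : V) & (ALL c. \<forall>f\<in>V. Const c * f : V)"

lemma subD:
 assumes "sub V"
 shows "0 : V" "f : V ==> g : V ==> f + g : V" "f : V ==> Const c * f : V"
  "f : V ==> - f : V" "f : V ==> g : V ==> f - g : V"
proof -
 have z: "0 : V" and a: "!!f g. f : V ==> g : V ==> f + g : V" and m: "!!f c. f : V ==> Const c * f : V"
  using assms by (auto simp: sub_def)
 have u: "- g : V" if "g : V" for g
  using m[OF that, of "- 1"] by (simp add: Const_simps)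
 show "0 : V" "f : V ==> g : V ==> f + g : V" "f : V ==> Const c * f : V" "f : V ==> - f : V"
  by (fact z a m u)+
 show "f : V ==> g : V ==> f - g : V"
  using a[of f "- g"] u[of g] by simp
qed

lemma sub_sum: "sub V ==> (!!x. x : A ==> f x : V) ==> sum f A : V"
 by (induction A rule: infinite_finite_induct) (auto simp: subD)

definition forms :: "nat => ('x, 'k::field) mpoly set => ('x, 'k) mpoly set" where
 "forms d I = {f \<in> I. homogeneous d f}"

lemma sub_forms: "is_ideal I ==> sub (forms d I)"
 by (auto simp: sub_def forms_def idealD intro: homogeneous_add homogeneous_Const_mult)

lemma is_ideal_UNIV [simp]: "is_ideal UNIV"
 by (simp add: is_ideal_def)

lemma is_ideal_Int: "is_ideal I ==> is_ideal J ==> is_ideal (I Int J)"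
 by (auto simp: is_ideal_def)

text \<open>\<open>codim V W n\<close>: the quotient \<open>V / W\<close> has dimension \<open>n\<close>.\<close>

definition codim :: "('x, 'k::field) mpoly set => ('x, 'k) mpoly set => nat => bool" where
 "codim V W n \<longleftrightarrow> (EX b. (\<forall>k<n. b k : V) & (\<forall>v\<in>V. EX c. v - (\<Sum>k<n. Const (c k) * b k) : W) &
  (ALL c. (\<Sum>k<n. Const (c k) * b k) : W --> (\<forall>k<n. c k = 0)))"

lemma codimI:
 fixes b :: "'i => ('x, 'k::field) mpoly"
 assumes K: "finite K" "card K = n" and "!!k. k : K ==> b k : V"
  and s: "!!v. v : V ==> EX c. v - (\<Sum>k\<in>K. Const (c k) * b k) : W"
  and i: "!!c k. (\<Sum>k\<in>K. Const (c k) * b k) : W ==> k : K ==> c k = 0"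
 shows "codim V W n"
proof -
 obtain h where h: "bij_betw h {..<n} K"
  using K ex_bij_betw_nat_finite[of K] by (auto simp: atLeast0LessThan)
 define g where "g = inv_into {..<n} h"
 have gh: "g (h k) = k" if "k < n" for k
  using h that by (simp add: g_def bij_betw_def)
 have hg: "h (g k) = k" "g k < n" if "k : K" for k
 proof -
  have "g k : {..<n}" unfolding g_def using h that by (metis bij_betw_def inv_into_into)
  then show "g k < n" by simp
  show "h (g k) = k" unfolding g_def using h that by (metis bij_betw_def f_inv_into_f)
 qed
 have re: "(\<Sum>k<n. Const (c k) * b (h k)) = (\<Sum>k\<in>K. Const (c (g k)) * b k)" for c
  using sum.reindex_bij_betw[OF h, of "%k. Const (c (g k)) * b k"] gh by simp
 show ?thesis
  unfolding codim_def
 proof (intro exI[of _ "%k. b (h k)"] conjI allI impI ballI)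
  fix k assume "k < n"
  then show "b (h k) : V" using h assms(3) by (auto simp: bij_betw_def)
 next
  fix v assume "v : V"
  then obtain c where c: "v - (\<Sum>k\<in>K. Const (c k) * b k) : W" using s by blast
  have "(\<Sum>k<n. Const (c (h k)) * b (h k)) = (\<Sum>k\<in>K. Const (c k) * b k)"
   using sum.reindex_bij_betw[OF h, of "%k. Const (c k) * b k"] by simp
  then show "EX c. v - (\<Sum>k<n. Const (c k) * b (h k)) : W"
   using c by (intro exI[of _ "%k. c (h k)"]) simp
 next
  fix c k assume "(\<Sum>k<n. Const (c k) * b (h k)) : W" "k < n"
  then show "c k = 0"
   using i[of "%k. c (g k)" "h k"] h gh by (auto simp: re bij_betw_def)
 qed
qed

lemma codim_trans:
 assumes U: "sub U" "sub W" "W \<subseteq> U" "U \<subseteq> V" and n: "codim V U n" and m: "codim U W m"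
 shows "codim V W (n + m)"
proof -
 obtain b where b: "!!k. k < n ==> b k : V" "!!v. v : V ==> EX c. v - (\<Sum>k<n. Const (c k) * b k) : U"
   "!!c k. (\<Sum>k<n. Const (c k) * b k) : U ==> k < n ==> c k = 0"
  using n unfolding codim_def by blast
 obtain b' where b': "!!k. k < m ==> b' k : U" "!!v. v : U ==> EX c. v - (\<Sum>k<m. Const (c k) * b' k) : W"
   "!!c k. (\<Sum>k<m. Const (c k) * b' k) : W ==> k < m ==> c k = 0"
  using m unfolding codim_def by blast
 let ?b = "case_sum b b'" and ?K = "{..<n} <+> {..<m}"
 have sp: "(\<Sum>k\<in>?K. Const (c k) * ?b k) = (\<Sum>k<n. Const (c (Inl k)) * b k) + (\<Sum>k<m. Const (c (Inr k)) * b' k)" for c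
  by (subst sum.Plus) auto
 show ?thesis
 proof (rule codimI[of ?K _ ?b])
  show "finite ?K" "card ?K = n + m" by (simp_all add: card_Plus)
  show "?b k : V" if "k : ?K" for k using that b(1) b'(1) U by auto
 next
  fix v assume "v : V"
  then obtain c where c: "v - (\<Sum>k<n. Const (c k) * b k) : U" using b(2) by blast
  then obtain c' where "v - (\<Sum>k<n. Const (c k) * b k) - (\<Sum>k<m. Const (c' k) * b' k) : W" using b'(2) by blast
  then show "EX c. v - (\<Sum>k\<in>?K. Const (c k) * ?b k) : W"
   by (intro exI[of _ "case_sum c c'"]) (simp add: sp diff_diff_eq)
 next
  fix c k assume h: "(\<Sum>k\<in>?K. Const (c k) * ?b k) : W" and k: "k : ?K"
  have "(\<Sum>k<m. Const (c (Inr k)) * b' k) : U"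
   using b'(1) U by (intro sub_sum) (auto simp: subD)
  moreover have "(\<Sum>k\<in>?K. Const (c k) * ?b k) : U" using h U by auto
  ultimately have "(\<Sum>k<n. Const (c (Inl k)) * b k) : U"
   using subD(5)[OF U(1)] unfolding sp by force
  then have 0: "c (Inl k) = 0" if "k < n" for k using b(3)[of "%k. c (Inl k)"] that by blast
  then have "(\<Sum>k<m. Const (c (Inr k)) * b' k) : W"
   using h by (simp add: sp Const_simps)
  then have "c (Inr k) = 0" if "k < m" for k using b'(3)[of "%k. c (Inr k)"] that by blast
  with 0 k show "c k = 0" by auto
 qed
qed

text \<open>Multiplication by \<open>h\<close> induces an isomorphism of \<open>V / V'\<close> with
  \<open>U / W\<close>.\<close>

lemma codim_transfer:
 assumes V: "sub V" "sub W" and n: "codim V V' n"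
  and T: "!!f. f : V ==> h * f : U" "!!f. f : V ==> h * f : W \<longleftrightarrow> f : V'" "V' \<subseteq> V"
  and s: "!!u. u : U ==> \<exists>f\<in>V. u - h * f : W"
 shows "codim U W n"
proof -
 obtain b where b: "!!k. k < n ==> b k : V" "!!v. v : V ==> EX c. v - (\<Sum>k<n. Const (c k) * b k) : V'"
   "!!c k. (\<Sum>k<n. Const (c k) * b k) : V' ==> k < n ==> c k = 0"
  using n unfolding codim_def by blast
 have hs: "(\<Sum>k<n. Const (c k) * (h * b k)) = h * (\<Sum>k<n. Const (c k) * b k)" for c
  by (simp add: sum_distrib_left mult.left_commute)
 have sV: "(\<Sum>k<n. Const (c k) * b k) : V" for c
  using b(1) V by (intro sub_sum) (auto simp: subD)
 show ?thesis
 proof (rule codimI[of "{..<n}" _ "%k. h * b k"])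
  show "h * b k : U" if "k : {..<n}" for k using that b(1) T(1) by simp
 next
  fix u assume "u : U"
  then obtain f where f: "f : V" "u - h * f : W" using s by blast
  obtain c where c: "f - (\<Sum>k<n. Const (c k) * b k) : V'" using b(2)[OF f(1)] by blast
  then have "h * (f - (\<Sum>k<n. Const (c k) * b k)) : W"
   using T(2) T(3) by blast
  from subD(2)[OF V(2) f(2) this] have "u - h * (\<Sum>k<n. Const (c k) * b k) : W"
   by (simp add: right_diff_distrib)
  then show "EX c. u - (\<Sum>k\<in>{..<n}. Const (c k) * (h * b k)) : W"
   by (intro exI[of _ c]) (simp only: hs)
 next
  fix c k assume "(\<Sum>k\<in>{..<n}. Const (c k) * (h * b k)) : W" "k : {..<n}"
  then show "c k = 0" using T(2)[OF sV] b(3)[of c k] by (simp add: hs)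
 qed simp_all
qed

text \<open>The second isomorphism theorem: as \<open>V = U + W\<close>, the quotients
  \<open>U / (U Int W)\<close> and \<open>V / W\<close> have the same dimension.\<close>

lemma codim_Int:
 assumes V: "sub V" "sub U" "sub W" "U \<subseteq> V" "W \<subseteq> V" and n: "codim V U n" "codim V W m"
  and s: "!!v. v : V ==> \<exists>u\<in>U. v - u : W"
 shows "codim V (U Int W) (n + m)"
proof (rule codim_trans)
 show "codim V U n" by (rule n)
 obtain b where b: "!!k. k < m ==> b k : V" "!!v. v : V ==> EX c. v - (\<Sum>k<m. Const (c k) * b k) : W"
   "!!c k. (\<Sum>k<m. Const (c k) * b k) : W ==> k < m ==> c k = 0"
  using n(2) unfolding codim_def by blast
 have "ALL k. EX u. k < m --> u : U & b k - u : W" using s b(1) by blast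
 then obtain u where u: "!!k. k < m ==> u k : U" "!!k. k < m ==> b k - u k : W" by metis
 have d: "(\<Sum>k<m. Const (c k) * b k) - (\<Sum>k<m. Const (c k) * u k) : W" for c
  unfolding sum_subtractf[symmetric] right_diff_distrib[symmetric]
  using u(2) V(3) by (intro sub_sum) (auto simp: subD)
 have sU: "(\<Sum>k<m. Const (c k) * u k) : U" for c
  using u(1) V by (intro sub_sum) (auto simp: subD)
 show "codim U (U Int W) m"
 proof (rule codimI[of "{..<m}" _ u])
  fix v assume v: "v : U"
  then obtain c where c: "v - (\<Sum>k<m. Const (c k) * b k) : W" using b(2) V by blast
  have "v - (\<Sum>k<m. Const (c k) * u k) : W"
   using subD(2)[OF V(3) c d[of c]] by simp
  then show "EX c. v - (\<Sum>k\<in>{..<m}. Const (c k) * u k) : U Int W"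
   using v sU V by (intro exI[of _ c]) (auto simp: subD)
 next
  fix c k assume h: "(\<Sum>k\<in>{..<m}. Const (c k) * u k) : U Int W" and k: "k : {..<m}"
  have "(\<Sum>k<m. Const (c k) * b k) : W"
   using subD(2)[OF V(3) d[of c], of "\<Sum>k<m. Const (c k) * u k"] h by simp
  then show "c k = 0" using b(3)[of c k] k by simp
 qed (use u in auto)
 show "sub (U Int W)" using V by (auto simp: sub_def)
qed (use V in auto)

lemma vector_space_scale: "Vector_Spaces.vector_space (scale :: 'k::field => ('x, 'k) mpoly => ('x, 'k) mpoly)"
 by standard (simp_all add: Const_simps algebra_simps)

lemma finite_monomials: "finite {m :: ('x::finite) \<Rightarrow>\<^sub>0 nat. mdeg m = d}"
proof -
 have "inj_on Poly_Mapping.lookup {m :: 'x \<Rightarrow>\<^sub>0 nat. mdeg m = d}"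
  unfolding inj_on_def poly_mapping_eq_iff by blast
 moreover have "Poly_Mapping.lookup ` {m :: 'x \<Rightarrow>\<^sub>0 nat. mdeg m = d} \<subseteq> PiE UNIV (%_. {..d})"
 proof
  fix f assume "f : Poly_Mapping.lookup ` {m :: 'x \<Rightarrow>\<^sub>0 nat. mdeg m = d}"
  then obtain m where m: "f = Poly_Mapping.lookup m" "mdeg m = d" by auto
  have "mdeg m = (\<Sum>x\<in>UNIV. Poly_Mapping.lookup m x)" by (rule mdeg_superset) auto
  then have "f x <= d" for x using m by (simp add: member_le_sum)
  then show "f : PiE UNIV (%_. {..d})" by (simp add: PiE_iff)
 qed
 moreover have "finite (PiE UNIV (%_ :: 'x. {..d}))" by (rule finite_PiE) auto
 ultimately show ?thesis by (metis finite_imageD finite_subset)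
qed

text \<open>A lifted basis of the quotient and a basis of \<open>forms d I\<close> together form a
  basis of all forms; there are finitely many monomials, so the dimensions may be
  subtracted.\<close>

lemma hilbert_function_codim:
 fixes I :: "('x::finite, 'k::field) mpoly set"
 assumes I: "is_ideal I" and n: "codim (forms d UNIV) (forms d I) n"
 shows "hilbert_function I d = n"
proof -
 interpret vs: Vector_Spaces.vector_space "scale :: 'k => ('x, 'k) mpoly => ('x, 'k) mpoly"
  by (rule vector_space_scale)
 let ?V = "forms d UNIV :: ('x, 'k) mpoly set" and ?W = "forms d I"
 have sV: "vs.subspace ?V" and sW: "vs.subspace ?W"
  using sub_forms[OF is_ideal_UNIV, of d] sub_forms[OF I, of d] by (auto simp: sub_def vs.subspace_def)
 define M where "M = (%m. Poly_Mapping.single m (1 :: 'k)) ` {m :: 'x \<Rightarrow>\<^sub>0 nat. mdeg m = d}"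
 have M: "finite M" by (simp add: M_def finite_monomials)
 have VM: "?V \<subseteq> vs.span M"
 proof
  fix f assume "f : ?V"
  then have h: "homogeneous d f" by (simp add: forms_def)
  have "f = (\<Sum>m\<in>Poly_Mapping.keys f. scale (Poly_Mapping.lookup f m) (Poly_Mapping.single m 1))"
   by (subst poly_mapping_sum_single) (simp add: Const_def mult_single)
  also have "... : vs.span M"
   using h by (intro vs.span_sum vs.span_scale vs.span_base) (auto simp: M_def homogeneous_iff)
  finally show "f : vs.span M" .
 qed
 obtain b where b: "!!k. k < n ==> b k : ?V" "!!v. v : ?V ==> EX c. v - (\<Sum>k<n. Const (c k) * b k) : ?W"
   "!!c k. (\<Sum>k<n. Const (c k) * b k) : ?W ==> k < n ==> c k = 0"
  using n unfolding codim_def by blast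
 obtain B where B: "B \<subseteq> ?W" "vs.independent B" "?W \<subseteq> vs.span B" "card B = vs.dim ?W"
  using vs.basis_exists by blast
 have WV: "?W \<subseteq> ?V" by (auto simp: forms_def)
 have fB: "finite B"
  using vs.independent_span_bound[OF M B(2)] B(1) WV VM by blast
 have spW: "vs.span B = ?W"
  using B sW by (metis vs.span_eq_iff vs.span_mono subset_antisym)
 have inj: "inj_on b {..<n}"
 proof (rule inj_onI, rule ccontr)
  fix i j assume ij: "i : {..<n}" "j : {..<n}" "b i = b j" "i ~= j"
  define c :: "nat => 'k" where "c k = (if k = i then 1 else if k = j then - 1 else 0)" for k
  have "(\<Sum>k<n. Const (c k) * b k) = (\<Sum>k\<in>{i, j}. Const (c k) * b k)"
   using ij by (intro sum.mono_neutral_right) (auto simp: c_def Const_simps)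
  also have "... = 0" using ij by (simp add: c_def Const_simps)
  finally have "c i = 0" using b(3)[of c i] ij vs.subspace_0[OF sW] by simp
  then show False by (simp add: c_def)
 qed
 let ?A = "b ` {..<n}"
 have Asum: "(\<Sum>a\<in>?A. scale (c a) a) = (\<Sum>k<n. Const (c (b k)) * b k)" for c
  by (simp add: sum.reindex[OF inj])
 have indA: "c a = 0" if "(\<Sum>a\<in>?A. scale (c a) a) : ?W" "a : ?A" for c a
  using that b(3)[of "%k. c (b k)"] by (auto simp: Asum)
 have disj: "?A Int B = {}"
 proof -
  have False if "a \<in> ?A" "a \<in> B" for a
  proof -
   have "(\<Sum>a'\<in>?A. scale ((%x. if x = a then 1 else 0) a') a') = (\<Sum>a'\<in>?A. if a' = a then a' else 0)"
    by (intro sum.cong) (auto simp: Const_simps)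
   also have "... = a" using that by (simp add: sum.delta)
   finally have "(%x. if x = a then (1 :: 'k) else 0) a = 0"
    using that B(1) by (intro indA) auto
   then show False by simp
  qed
  then show ?thesis by blast
 qed
 have ind: "vs.independent (?A Un B)"
 proof (rule vs.independent_if_scalars_zero)
  show "finite (?A Un B)" using fB by simp
  fix f x assume s: "(\<Sum>x\<in>?A Un B. scale (f x) x) = 0" and x: "x : ?A Un B"
  have s': "(\<Sum>x\<in>?A. scale (f x) x) + (\<Sum>x\<in>B. scale (f x) x) = 0"
   using s disj fB by (subst (asm) sum.union_disjoint) auto
  have "(\<Sum>x\<in>B. scale (f x) x) : ?W"
   unfolding spW[symmetric] by (intro vs.span_sum vs.span_scale vs.span_base)
  moreover have "(\<Sum>x\<in>?A. scale (f x) x) = - (\<Sum>x\<in>B. scale (f x) x)"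
   using s' by (simp only: eq_neg_iff_add_eq_0)
  ultimately have "(\<Sum>x\<in>?A. scale (f x) x) : ?W"
   using vs.subspace_neg[OF sW] by simp
  then have A0: "f a = 0" if "a : ?A" for a using indA that by blast
  then have "(\<Sum>x\<in>?A. scale (f x) x) = 0" by (intro sum.neutral) (auto simp: Const_simps)
  then have "(\<Sum>x\<in>B. scale (f x) x) = 0" using s' by simp
  then have "f a = 0" if "a : B" for a
   using vs.independentD[OF B(2) fB subset_refl] that by blast
  then show "f x = 0" using A0 x by blast
 qed
 have span: "vs.span (?A Un B) = ?V"
 proof
  show "vs.span (?A Un B) \<subseteq> ?V"
   using b(1) B(1) WV by (intro vs.span_minimal sV) auto
  show "?V \<subseteq> vs.span (?A Un B)"
  proof
   fix v assume "v : ?V"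
   then obtain c where "v - (\<Sum>k<n. Const (c k) * b k) : vs.span B" using b(2) spW by blast
   then have "v - (\<Sum>k<n. Const (c k) * b k) : vs.span (?A Un B)"
    using vs.span_mono[of B "?A Un B"] by blast
   moreover have "(\<Sum>k<n. Const (c k) * b k) : vs.span (?A Un B)"
    by (intro vs.span_sum vs.span_scale vs.span_base) auto
   ultimately have "v - (\<Sum>k<n. Const (c k) * b k) + (\<Sum>k<n. Const (c k) * b k) : vs.span (?A Un B)"
    by (rule vs.span_add)
   then show "v : vs.span (?A Un B)" by simp
  qed
 qed
 have "vs.dim ?V = card (?A Un B)"
  using vs.dim_span[of "?A Un B"] vs.dim_eq_card_independent[OF ind] by (simp add: span)
 also have "... = n + vs.dim ?W"
  using disj fB B(4) by (subst card_Un_disjoint) (auto simp: card_image[OF inj])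
 finally show ?thesis
  unfolding hilbert_function_def forms_def by simp
qed

text \<open>Polynomials agreeing at all large integers are equal, which resolves the definite
  description.\<close>

lemma hilbert_poly_linear:
 assumes "!!d. d \<ge> N ==> int (hilbert_function I d) = a * int d + b"
 shows "hilbert_poly I = [:of_int b, of_int a:]"
 unfolding hilbert_poly_def
proof (rule the_equality)
 have ev: "poly [:of_int b, of_int a:] (of_nat d) = (of_nat (hilbert_function I d) :: rat)" if "d \<ge> N" for d
 proof -
  have "(of_nat (hilbert_function I d) :: rat) = of_int (a * int d + b)"
   using assms[OF that] by (metis of_int_of_nat_eq)
  then show ?thesis by (simp add: algebra_simps)
 qed
 then show "\<forall>\<^sub>F d in sequentially. poly [:of_int b, of_int a:] (of_nat d) = (of_nat (hilbert_function I d) :: rat)"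
  by (auto simp: eventually_sequentially)
 fix p :: "rat poly" assume "\<forall>\<^sub>F d in sequentially. poly p (of_nat d) = of_nat (hilbert_function I d)"
 then obtain M where M: "!!d. d \<ge> M ==> poly p (of_nat d) = of_nat (hilbert_function I d)"
  by (auto simp: eventually_sequentially)
 have "p - [:of_int b, of_int a:] = 0"
 proof (rule poly_zero_infinite)
  show "infinite ((of_nat :: nat => rat) ` {max M N..})"
   by (simp add: finite_image_iff inj_on_def infinite_Ici)
  show "poly (p - [:of_int b, of_int a:]) x = 0" if "x : of_nat ` {max M N..}" for x
   using that M ev by (auto simp: poly_diff)
 qed
 then show "p = [:of_int b, of_int a:]" by simp
qed

subsection \<open>Comaximal ideals\<close>

text \<open>A quantitative form of having no projective zero: applied to a sum of two ideals,
  \<open>a\<close> is a degree from which on the Chinese remainder theorem holds.\<close>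

definition thick :: "nat => ('x, 'k::field) mpoly set => bool" where
 "thick a I \<longleftrightarrow> (\<forall>d\<ge>a. ALL f. homogeneous d f --> f : I)"

definition isum :: "'r::comm_ring_1 set => 'r set => 'r set" where
 "isum I J = {f + g |f g. f : I & g : J}"

lemma isum_ideal: "is_ideal I ==> is_ideal J ==> is_ideal (isum I J)"
proof -
 assume I: "is_ideal I" and J: "is_ideal J"
 have "0 : isum I J" unfolding isum_def using idealD(1)[OF I] idealD(1)[OF J] by force
 moreover have "a + b : isum I J" if "a : isum I J" "b : isum I J" for a b
 proof -
  from that obtain f g f' g' where "a = f + g" "b = f' + g'" "f : I" "g : J" "f' : I" "g' : J" by (auto simp: isum_def)
  then have "a + b = (f + f') + (g + g')" "f + f' : I" "g + g' : J" using idealD(2)[OF I] idealD(2)[OF J] by auto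
  then show ?thesis unfolding isum_def by blast
 qed
 moreover have "r * a : isum I J" if "a : isum I J" for a r
 proof -
  from that obtain f g where "a = f + g" "f : I" "g : J" by (auto simp: isum_def)
  then have "r * a = r * f + r * g" "r * f : I" "r * g : J" using idealD(3)[OF I] idealD(3)[OF J] by (auto simp: distrib_left)
  then show ?thesis unfolding isum_def by blast
 qed
 ultimately show ?thesis by (simp add: is_ideal_def)
qed

lemma isum_left: "is_ideal J ==> f : I ==> f : isum I J" and isum_right: "is_ideal I ==> g : J ==> g : isum I J"
 using idealD(1) by (force simp: isum_def)+

lemma split_monomial:
 assumes "mdeg m = a + b"
 obtains m1 m2 where "m = m1 + m2" "mdeg m1 = a" "mdeg m2 = b"
proof -
 have "EX m1 m2. m = m1 + m2 & mdeg m1 = a" if "a <= mdeg m" for a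
  using that
 proof (induction a)
  case 0
  then show ?case by (intro exI[of _ 0] exI[of _ m]) simp
 next
  case (Suc a)
  then obtain m1 m2 where m: "m = m1 + m2" "mdeg m1 = a" by auto
  then have "mdeg m2 ~= 0" using Suc.prems by (simp add: mdeg_add)
  then obtain x where x: "x : Poly_Mapping.keys m2"
   unfolding mdeg_def by (meson sum.not_neutral_contains_not_neutral)
  then have "Poly_Mapping.single x 1 + (m2 - Poly_Mapping.single x 1) = m2"
   by (intro poly_mapping_eqI) (auto simp: lookup_add lookup_minus lookup_single when_def in_keys_iff)
  then have "m = (m1 + Poly_Mapping.single x 1) + (m2 - Poly_Mapping.single x 1)"
   by (simp add: m add.assoc)
  moreover have "mdeg (m1 + Poly_Mapping.single x 1) = Suc a" by (simp add: mdeg_add m)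
  ultimately show ?case by blast
 qed
 from this[of a] obtain m1 m2 where "m = m1 + m2" "mdeg m1 = a" using assms by auto
 then show ?thesis using that[of m1 m2] assms by (simp add: mdeg_add)
qed

text \<open>A monomial of degree at least \<open>a + b\<close> splits into one of degree
  \<open>a\<close> and one of degree at least \<open>b\<close>.\<close>

lemma thick_mult:
 assumes I: "thick a I" and J: "thick b J" and K: "is_ideal K" and m: "!!f g. f : I ==> g : J ==> f * g : K"
 shows "thick (a + b) K"
 unfolding thick_def
proof (intro allI impI)
 fix d and f :: "('a, 'b) mpoly" assume d: "a + b <= d" and f: "homogeneous d f"
 have "Poly_Mapping.single n c : K" if "mdeg n = d" for n c
 proof -
  have "mdeg n = a + (d - a)" using that d by simp
  then obtain n1 n2 where n: "n = n1 + n2" "mdeg n1 = a" "mdeg n2 = d - a"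
   by (rule split_monomial)
  have b: "b <= d - a" using d by simp
  have I1: "Poly_Mapping.single n1 c : I"
   using I[unfolded thick_def, rule_format, of a "Poly_Mapping.single n1 c"] homogeneous_single[of n1 c] n(2) by simp
  have J1: "Poly_Mapping.single n2 1 : J"
   using J[unfolded thick_def, rule_format, OF b, of "Poly_Mapping.single n2 1"] homogeneous_single[of n2 "1 :: 'b"] n(3) by simp
  from m[OF I1 J1] show ?thesis by (simp add: mult_single n)
 qed
 then show "f : K"
  using f by (subst poly_mapping_sum_single) (auto intro!: ideal_sum[OF K] simp: homogeneous_iff)
qed

lemma thick_Vars:
 assumes I: "is_ideal I" and V: "!!x. Var x : I"
 shows "thick 1 I"
 unfolding thick_def
proof (intro allI impI)
 fix d and f :: "('a, 'b) mpoly" assume d: "1 <= d" and f: "homogeneous d f"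
 have "Poly_Mapping.single n c : I" if "mdeg n = d" for n c
 proof -
  have "mdeg n = 1 + (d - 1)" using that d by simp
  then obtain n1 n2 where n: "n = n1 + n2" "mdeg n1 = 1" "mdeg n2 = d - 1"
   by (rule split_monomial)
  then obtain x where x: "x : Poly_Mapping.keys n1"
   unfolding mdeg_def by (metis sum.empty zero_neq_one ex_in_conv)
  then have "Poly_Mapping.single x 1 + (n - Poly_Mapping.single x 1) = n"
   by (intro poly_mapping_eqI) (auto simp: n(1) lookup_add lookup_minus lookup_single when_def in_keys_iff)
  then have "Poly_Mapping.single n c = Var x * Poly_Mapping.single (n - Poly_Mapping.single x 1) c"
   by (simp add: Var_def mult_single)
  then show ?thesis using idealD(4)[OF I V] by simp
 qed
 then show "f : I"
  using f by (subst poly_mapping_sum_single) (auto intro!: ideal_sum[OF I] simp: homogeneous_iff)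
qed

text \<open>The product of \<open>J + K\<close> and \<open>J + K'\<close> is contained in
  \<open>J + (K Int K')\<close>, so the bounds add.\<close>

lemma thick_Int:
 assumes J: "is_ideal J" and K: "is_ideal K" "is_ideal K'" and t: "thick a (isum J K)" "thick b (isum J K')"
 shows "thick (a + b) (isum J (K Int K'))"
proof (rule thick_mult[OF t])
 show "is_ideal (isum J (K Int K'))" using J K by (intro isum_ideal is_ideal_Int)
 fix f g assume "f : isum J K" "g : isum J K'"
 then obtain j k j' k' where "f = j + k" "g = j' + k'" "j : J" "k : K" "j' : J" "k' : K'" by (auto simp: isum_def)
 then have "f * g = (j * (j' + k') + k * j') + k * k'" "j * (j' + k') + k * j' : J" "k * k' : K Int K'"
  using J K by (auto simp: algebra_simps idealD)
 then show "f * g : isum J (K Int K')" unfolding isum_def by blast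
qed

lemma isum_commute: "isum I J = isum J I"
 by (auto simp: isum_def) (metis add.commute)+

definition graded :: "('x, 'k::field) mpoly set => bool" where
 "graded I \<longleftrightarrow> (\<forall>f\<in>I. ALL d. hcomp d f : I)"

lemma graded_Int: "graded I ==> graded J ==> graded (I Int J)"
 by (auto simp: graded_def)

lemma graded_ideal_gen:
 assumes "!!g. g : G ==> EX e. homogeneous e g"
 shows "graded (ideal_gen G)"
proof -
 have "ideal_gen G \<subseteq> {f. ALL d. hcomp d f : ideal_gen G}"
  unfolding ideal_gen_def
 proof
  fix f assume "f : module.span (*) G"
  then show "f : {f. ALL d. hcomp d f : module.span (*) G}"
  proof (induction rule: Modules.module.span_induct_alt[OF ring_module, consumes 1])
   case 1
   then show ?case by (simp add: Modules.module.span_zero[OF ring_module])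
  next
   case (2 c x y)
   have "hcomp d (c * x) : module.span (*) G" for d
   proof -
    obtain e where "homogeneous e x" using assms 2(1) by blast
    have "hcomp d (c * x) = hcomp d (x * c)" by (simp only: mult.commute)
    also have "... = (if e <= d then hcomp (d - e) c * x else 0)"
     unfolding hcomp_mult_homogeneous[OF \<open>homogeneous e x\<close>] by (simp only: mult.commute)
    finally show ?thesis
     using Modules.module.span_scale[OF ring_module Modules.module.span_base[OF ring_module 2(1)], of "hcomp (d - e) c"]
      Modules.module.span_zero[OF ring_module, of G] by simp
   qed
   with 2 show ?case by (auto simp: hcomp_add intro: Modules.module.span_add[OF ring_module])
  qed
 qed
 then show ?thesis by (auto simp: graded_def)
qed

lemma comaximal_split:
 assumes t: "thick a (isum I J)" and g: "graded I" "graded J" and d: "a <= d" "homogeneous d f"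
 shows "\<exists>u\<in>forms d I. f - u : forms d J"
proof -
 obtain u v where uv: "f = u + v" "u : I" "v : J" using t d unfolding thick_def isum_def by blast
 have "f = hcomp d u + hcomp d v"
  using hcomp_of_homogeneous[OF d(2), of d] uv(1) by (simp add: hcomp_add)
 then have "f - hcomp d u = hcomp d v" by simp
 then show ?thesis
  using uv g hcomp_homogeneous by (intro bexI[of _ "hcomp d u"]) (auto simp: forms_def graded_def)
qed

text \<open>The Chinese remainder theorem in degree \<open>d\<close>, expressed by
  dimensions.\<close>

lemma codim_forms_Int:
 assumes t: "thick a (isum I J)" and g: "graded I" "graded J" and i: "is_ideal I" "is_ideal J" and d: "a <= d"
  and n: "codim (forms d UNIV) (forms d I) n" "codim (forms d UNIV) (forms d J) m"
 shows "codim (forms d UNIV) (forms d (I Int J)) (n + m)"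
proof -
 have e: "forms d (I Int J) = forms d I Int forms d J" by (auto simp: forms_def)
 show ?thesis
  unfolding e using comaximal_split[OF t g d] n sub_forms[OF i(1)] sub_forms[OF i(2)] sub_forms[OF is_ideal_UNIV]
  by (intro codim_Int) (auto simp: forms_def)
qed

section \<open>Polynomial functions of two variables\<close>

text \<open>Functions instead of polynomials: identities between normal forms can then be checked
  pointwise, with square roots of values taken in the field.\<close>

definition pfun :: "('k::alg_closed_field => 'k => 'k) => bool" where
 "pfun F \<longleftrightarrow> (\<exists>a :: (2, 'k) mpoly. ALL z w. F z w = peval (\<chi> i. if i = 0 then z else w) a)"

lemma pfun_peval: "pfun (%z w. peval (\<chi> i :: 2. if i = 0 then z else w) a)"
 unfolding pfun_def by blast

lemma pfun_const: "pfun (%z w. c)" and pfun_fst: "pfun (%z w. z)" and pfun_snd: "pfun (%z w. w)"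
 unfolding pfun_def by (rule exI[of _ "Const c"] exI[of _ "Var 0"] exI[of _ "Var 1"]; simp)+

lemma pfun_add: "pfun F ==> pfun G ==> pfun (%z w. F z w + G z w)"
 and pfun_mult: "pfun F ==> pfun G ==> pfun (%z w. F z w * G z w)"
 and pfun_diff: "pfun F ==> pfun G ==> pfun (%z w. F z w - G z w)"
 unfolding pfun_def by (metis peval_simps(3), metis peval_simps(4), metis rhom_diff[OF peval_rhom])

lemma pfun_uminus: "pfun F ==> pfun (%z w. - F z w)"
 using pfun_diff[OF pfun_const[of 0]] by simp

lemma pfun_power: "pfun F ==> pfun (%z w. F z w ^ n)"
 by (induction n) (simp_all add: pfun_const pfun_mult)

lemmas pfun_intros = pfun_peval pfun_const pfun_fst pfun_snd pfun_add pfun_mult pfun_diff pfun_uminus pfun_power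

lemma vec2: "(\<chi> i :: 2. if i = 0 then v $ 0 else v $ 1) = v"
 unfolding Finite_Cartesian_Product.vec_eq_iff
proof
 fix i :: 2
 have "i = 0 | i = 1" using exhaust_2[of i] by auto
 then show "(\<chi> i. if i = 0 then v $ 0 else v $ 1) $ i = v $ i" by auto
qed

lemma pfun_mult_zero:
 fixes F G :: "'k::alg_closed_field => 'k => 'k"
 assumes "pfun F" "pfun G" "!!z w. F z w * G z w = 0"
 shows "(ALL z w. F z w = 0) | (ALL z w. G z w = 0)"
proof -
 obtain a b :: "(2, 'k) mpoly" where a: "!!z w. F z w = peval (\<chi> i. if i = 0 then z else w) a"
  and b: "!!z w. G z w = peval (\<chi> i. if i = 0 then z else w) b"
  using assms(1,2) unfolding pfun_def by blast
 have "peval v a * peval v b = 0" for v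
  using assms(3)[of "v $ 0" "v $ 1"] by (simp add: a b vec2)
 then have "a = 0 | b = 0" by (rule peval_mult_zero)
 then show ?thesis by (auto simp: a b)
qed

text \<open>Multiplication by the first coordinate gives vanishing at the origin as well and can be
  cancelled by \<open>pfun_mult_zero\<close>.\<close>

lemma pfun_punctured:
 fixes F :: "'k::alg_closed_field => 'k => 'k"
 assumes "pfun F" "!!z w. (z, w) ~= (0, 0) ==> F z w = 0"
 shows "F z w = 0"
proof -
 have "z * F z w = 0" for z w using assms(2)[of z w] by auto
 then have "(ALL z w. z = (0::'k)) | (ALL z w. F z w = 0)"
  using pfun_mult_zero[OF pfun_fst assms(1)] by blast
 then show ?thesis by (metis zero_neq_one)
qed

lemma peval_zero_2: "(!!z w. peval (\<chi> i. if i = 0 then z else w) a = 0) ==> a = 0"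
 for a :: "(2, 'k::alg_closed_field) mpoly"
 by (rule peval_eqI) (metis vec2 peval_simps(1))

lemma order_simple: "poly R \<rho> ~= 0 ==> Polynomial.order \<rho> ([:- \<rho>, 1:] * R) = 1" for R :: "'k::field poly"
proof -
 assume R: "poly R \<rho> ~= 0"
 then have "R ~= 0" by auto
 then have "[:- \<rho>, 1:] * R ~= 0" by (simp only: mult_eq_0_iff) simp
 then have "Polynomial.order \<rho> ([:- \<rho>, 1:] * R) = Polynomial.order \<rho> [:- \<rho>, 1:] + Polynomial.order \<rho> R"
  by (rule order_mult)
 moreover have "Polynomial.order \<rho> [:- \<rho>, 1:] = 1" using order_power_n_n[of \<rho> 1] by simp
 ultimately show ?thesis using order_0I[OF R] by simp
qed

text \<open>A function with a simple zero on almost every horizontal line is not a square.\<close>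

lemma pfun_nonsquare:
 fixes F N Q :: "'k::alg_closed_field => 'k => 'k"
 assumes F: "pfun F" "pfun N" and sq: "!!z w. F z w ^ 2 = Q z w * N z w ^ 2"
  and Q: "!!w. w ~= 0 ==> \<exists>\<rho> R. poly R \<rho> ~= 0 & (ALL z. Q z w = (z - \<rho>) * poly R z)"
 shows "N z w = 0"
proof -
 have uni: "EX p. ALL z. poly p z = G z w" if G: "pfun G" for G :: "'k => 'k => 'k" and w :: 'k
 proof -
  obtain a :: "(2, 'k) mpoly" where a: "!!z w. G z w = peval (\<chi> i. if i = 0 then z else w) a" using G unfolding pfun_def by blast
  have C: "rhom (%c :: 'k. [:c:])" by (simp add: rhom_def one_pCons)
  have h: "rhom (%p. poly p t)" for t :: 'k by (simp add: rhom_def)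
  have "poly (aeval (%c. [:c:]) (%i. if i = 0 then [:0, 1:] else [:w:]) a) z = G z w" for z
  proof -
   have "(%i::2. poly (if i = 0 then [:0, 1:] else [:w:]) z) = (%i. if i = 0 then z else w)" by auto
   then show ?thesis by (simp add: aeval_comp[OF C h[of z]] a peval_def)
  qed
  then show ?thesis by blast
 qed
 \<comment> \<open>The factor \<open>w\<close> accounts for the excluded line \<open>w = 0\<close>;
   it is cancelled at the end.\<close>
 have "w * N z w = 0" for z w
 proof (cases "w = 0")
  case False
  obtain f n where f: "!!z. poly f z = F z w" and n: "!!z. poly n z = N z w" using uni F by metis
  obtain \<rho> R where R: "poly R \<rho> ~= 0" "!!z. Q z w = (z - \<rho>) * poly R z" using Q[OF False] by blast
  have e: "f ^ 2 = ([:- \<rho>, 1:] * R) * n ^ 2"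
  proof -
   have "poly (f ^ 2 - ([:- \<rho>, 1:] * R) * n ^ 2) z = 0" for z
    by (simp add: f n sq R(2) algebra_simps)
   then have "f ^ 2 - ([:- \<rho>, 1:] * R) * n ^ 2 = 0"
    by (intro poly_zero_infinite[OF infinite_alg_closed]) auto
   then show ?thesis by simp
  qed
  have "n = 0"
  proof (rule ccontr)
   assume n0: "n ~= 0"
   have "R ~= 0" using R(1) by auto
   then have R0: "[:- \<rho>, 1:] * R ~= 0" by (simp only: mult_eq_0_iff) simp
   then have nz: "f ~= 0" using e n0 by auto
   have sq2: "Polynomial.order \<rho> (g ^ 2) = 2 * Polynomial.order \<rho> g" if "g ~= 0" for g :: "'k poly"
    using order_mult[of g g \<rho>] that by (simp add: power2_eq_square)
   \<comment> \<open>The order at the simple root \<rho> is even for the square on the left and odd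
     on the right.\<close>
   have "Polynomial.order \<rho> (f ^ 2) = 1 + 2 * Polynomial.order \<rho> n"
    unfolding e using R0 n0 order_simple[OF R(1)] by (subst order_mult) (auto simp: sq2)
   then show False using sq2[OF nz] by presburger
  qed
  then show ?thesis using n[of z] by simp
 qed simp
 then have "(ALL z w. w = (0::'k)) | (ALL z w. N z w = 0)"
  using pfun_mult_zero[OF pfun_snd F(2)] by blast
 then show ?thesis by (metis zero_neq_one)
qed

text \<open>The roots are \<open>s*w\<close> and \<open>-s*w\<close> with \<open>s^2 = -q/p\<close>;
  they differ because 2 is nonzero.\<close>

lemma simple_root:
 fixes p q w :: "'k::alg_closed_field"
 assumes "(2::'k) ~= 0" "p ~= 0" "q ~= 0" "w ~= 0"
 obtains \<rho> R where "poly R \<rho> ~= 0" "!!z. p * z^2 + q * w^2 = (z - \<rho>) * poly R z" "p * \<rho>^2 = - q * w^2" "\<rho> ~= 0"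
proof -
 obtain s where s: "s ^ 2 = - q / p" using nth_root_exists[of 2 "- q / p"] by auto
 have s0: "s ~= 0" using s assms by auto
 have ps: "p * s ^ 2 = - q" using s assms by simp
 show ?thesis
 proof (rule that[of "[:p * s * w, p:]" "s * w"])
  have "poly [:p * s * w, p:] (s * w) = 2 * (p * s * w)" by (simp add: algebra_simps)
  then show "poly [:p * s * w, p:] (s * w) ~= 0" using assms s0 by simp
  have "(z - s * w) * poly [:p * s * w, p:] z = p * z^2 - (p * s^2) * w^2" for z
   by (simp add: algebra_simps power2_eq_square)
  then show "p * z^2 + q * w^2 = (z - s * w) * poly [:p * s * w, p:] z" for z by (simp add: ps)
  show "p * (s * w)^2 = - q * w^2" using ps by (simp add: power_mult_distrib mult.assoc[symmetric])
  show "s * w ~= 0" using s0 assms by simp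
 qed
qed

section \<open>Ideals with free quotient over two coordinates\<close>

text \<open>Turns binary polynomials into polynomials in two chosen linear forms, over which the
  coordinate rings of the curves are free.\<close>

definition lin2 :: "('x, 'k::comm_ring_1) mpoly => ('x, 'k) mpoly => (2, 'k) mpoly => ('x, 'k) mpoly" where
 "lin2 Z W = psubst (%i. if i = 0 then Z else W)"

lemma lin2_simps [simp]: "lin2 Z W (Const c) = Const c" "lin2 Z W (Var 0) = Z" "lin2 Z W (Var 1) = W"
 "lin2 Z W (a + b) = lin2 Z W a + lin2 Z W b" "lin2 Z W (a * b) = lin2 Z W a * lin2 Z W b"
 "lin2 Z W (a - b) = lin2 Z W a - lin2 Z W b" "lin2 Z W (- a) = - lin2 Z W a" "lin2 Z W 0 = 0" "lin2 Z W 1 = 1" "lin2 Z W (a ^ n) = lin2 Z W a ^ n"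
 by (simp_all add: lin2_def)

lemma lin2_rhom: "rhom (lin2 Z W)" by (simp add: lin2_def psubst_rhom)

lemma peval_lin2: "peval v (lin2 Z W a) = peval (\<chi> i. if i = 0 then peval v Z else peval v W) a"
proof -
 have "(\<chi> i. peval v (if i = 0 then Z else W)) = (\<chi> i::2. if i = 0 then peval v Z else peval v W)" by (rule arg_cong[of _ _ vec_lambda]) auto
 then show ?thesis by (simp add: lin2_def peval_psubst)
qed

lemma homogeneous_mval: "(!!x. homogeneous 1 (g x)) ==> homogeneous (mdeg m) (mval g m)"
proof -
 assume g: "!!x. homogeneous 1 (g x)"
 have "homogeneous (\<Sum>x\<in>A. Poly_Mapping.lookup m x) (\<Prod>x\<in>A. g x ^ Poly_Mapping.lookup m x)" if "finite A" for A
  using that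
 proof induction
  case (insert x A)
  then show ?case using homogeneous_mult[OF homogeneous_power[OF g, of "Poly_Mapping.lookup m x" x]] by simp
 qed simp
 then show ?thesis by (simp add: mdeg_def mval_def)
qed

lemma hcomp_psubst: "(!!x. homogeneous 1 (g x)) ==> hcomp d (psubst g a) = psubst g (hcomp d a)"
proof (induction a rule: poly_mapping_single_induct)
 case (single m c)
 have "homogeneous (mdeg m) (Const c * mval g m)" by (intro homogeneous_Const_mult homogeneous_mval single)
 then show ?case
  by (simp add: psubst_def aeval_single[OF Const_rhom] hcomp_of_homogeneous[OF homogeneous_single] hcomp_of_homogeneous aeval_0)
qed (auto simp: hcomp_add)

lemma hcomp_lin2: "homogeneous 1 Z ==> homogeneous 1 W ==> hcomp d (lin2 Z W a) = lin2 Z W (hcomp d a)"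
 unfolding lin2_def by (rule hcomp_psubst) simp

definition mono2 :: "nat => nat => 2 \<Rightarrow>\<^sub>0 nat" where
 "mono2 i j = Poly_Mapping.single 0 i + Poly_Mapping.single 1 j"

lemma mono2_lookup: "Poly_Mapping.lookup (mono2 i j) 0 = i" "Poly_Mapping.lookup (mono2 i j) 1 = j"
 by (simp_all add: mono2_def lookup_add lookup_single)

lemma mdeg_mono2: "mdeg (mono2 i j) = i + j"
 by (simp add: mono2_def mdeg_add)

lemma mono2_eq: "mono2 (Poly_Mapping.lookup m 0) (Poly_Mapping.lookup m 1) = m"
proof (rule poly_mapping_eqI)
 fix k :: 2
 have "k = 0 | k = 1" using exhaust_2[of k] by auto
 then show "Poly_Mapping.lookup (mono2 (Poly_Mapping.lookup m 0) (Poly_Mapping.lookup m 1)) k = Poly_Mapping.lookup m k"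
  by (auto simp: mono2_lookup)
qed

lemma binary_form:
 fixes a :: "(2, 'k::field) mpoly"
 assumes "homogeneous D a"
 shows "a = (\<Sum>i\<le>D. Const (Poly_Mapping.lookup a (mono2 i (D - i))) * Poly_Mapping.single (mono2 i (D - i)) 1)"
proof (rule poly_mapping_eqI)
 fix m :: "2 \<Rightarrow>\<^sub>0 nat"
 let ?i = "Poly_Mapping.lookup m 0" and ?j = "Poly_Mapping.lookup m 1"
 have md: "mdeg m = ?i + ?j" by (metis mono2_eq mdeg_mono2)
 have "(\<Sum>i\<le>D. Poly_Mapping.lookup (Const (Poly_Mapping.lookup a (mono2 i (D - i))) * Poly_Mapping.single (mono2 i (D - i)) 1) m) =
   (\<Sum>i\<le>D. if i = ?i then (if ?j = D - ?i then Poly_Mapping.lookup a m else 0) else 0)"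
  (is "?l = ?r")
 proof (intro sum.cong refl)
  fix i assume "i : {..D}"
  have "mono2 i (D - i) = m \<longleftrightarrow> i = ?i & D - i = ?j" by (metis mono2_eq mono2_lookup)
  then show "Poly_Mapping.lookup (Const (Poly_Mapping.lookup a (mono2 i (D - i))) * Poly_Mapping.single (mono2 i (D - i)) 1) m =
    (if i = ?i then (if ?j = D - ?i then Poly_Mapping.lookup a m else 0) else 0)"
   by (auto simp: Const_def mult_single lookup_single when_def)
 qed
 also have "... = (if ?i <= D & ?j = D - ?i then Poly_Mapping.lookup a m else 0)" by (simp add: sum.delta)
 also have "... = Poly_Mapping.lookup a m"
 proof (cases "Poly_Mapping.lookup a m = 0")
  case False
  then have "mdeg m = D" using assms by (simp add: homogeneous_iff in_keys_iff)
  then show ?thesis using md by auto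
 qed simp
 finally show "Poly_Mapping.lookup a m = Poly_Mapping.lookup (\<Sum>i\<le>D. Const (Poly_Mapping.lookup a (mono2 i (D - i))) * Poly_Mapping.single (mono2 i (D - i)) 1) m"
  by (simp add: lookup_sum)
qed

text \<open>The hypotheses say that the quotient is a free graded module over \<open>k[Z, W]\<close>
  with basis elements \<open>m k\<close> of degree \<open>e k\<close>; each contributes the binary
  monomials of degree \<open>d - e k\<close>.\<close>

lemma codim_normal_form:
 fixes I :: "('x, 'k::field) mpoly set" and n :: nat
 assumes I: "is_ideal I" "graded I" and Z: "homogeneous 1 Z" "homogeneous 1 W"
  and m: "!!k. k < n ==> homogeneous (e k) (m k)" "!!k. k < n ==> e k <= d"
  and N: "!!f. EX a. f - (\<Sum>k<n. m k * lin2 Z W (a k)) : I"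
  and U: "!!a k. (\<Sum>k<n. m k * lin2 Z W (a k)) : I ==> k < n ==> a k = 0"
 shows "codim (forms d UNIV) (forms d I) (\<Sum>k<n. d - e k + 1)"
proof (rule codimI[of "Sigma {..<n} (%k. {..d - e k})"
   _ "%(k, i). m k * lin2 Z W (Poly_Mapping.single (mono2 i (d - e k - i)) 1)"])
 let ?K = "Sigma {..<n} (%k. {..d - e k})"
 let ?b = "%(k, i). m k * lin2 Z W (Poly_Mapping.single (mono2 i (d - e k - i)) 1)"
 show "finite ?K" by (intro finite_SigmaI) auto
 show "card ?K = (\<Sum>k<n. d - e k + 1)" by (subst card_SigmaI) auto
 have hb: "homogeneous d (m k * lin2 Z W a)" if k: "k < n" and a: "homogeneous (d - e k) a" for k a
 proof -
  have "lin2 Z W a = hcomp (d - e k) (lin2 Z W a)"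
   using hcomp_lin2[OF Z, of "d - e k" a] hcomp_of_homogeneous[OF a, of "d - e k"] by simp
  then have "homogeneous (d - e k) (lin2 Z W a)" by (metis hcomp_homogeneous)
  from homogeneous_mult[OF m(1)[OF k] this] show ?thesis using m(2)[OF k] by simp
 qed
 have hmono: "homogeneous (d - e k) (Poly_Mapping.single (mono2 i (d - e k - i)) (1 :: 'k))" if "i <= d - e k" for k i
 proof -
  have "mdeg (mono2 i (d - e k - i)) = d - e k" using that by (simp add: mdeg_mono2 del: diff_diff_left)
  then show ?thesis by (metis homogeneous_single)
 qed
 show "?b x : forms d UNIV" if "x : ?K" for x
  using that hb hmono by (auto simp: forms_def)
 have sumK: "(\<Sum>x\<in>?K. Const (c x) * ?b x) =
   (\<Sum>k<n. m k * lin2 Z W (\<Sum>i\<le>d - e k. Const (c (k, i)) * Poly_Mapping.single (mono2 i (d - e k - i)) 1))" for c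
 proof -
  have "(\<Sum>x\<in>?K. Const (c x) * ?b x) = (\<Sum>(k, i)\<in>?K. Const (c (k, i)) * ?b (k, i))"
   by (rule sum.cong) auto
  also have "... = (\<Sum>k<n. \<Sum>i\<le>d - e k. Const (c (k, i)) * ?b (k, i))"
   by (rule sum.Sigma[symmetric]) auto
  also have "... = (\<Sum>k<n. m k * lin2 Z W (\<Sum>i\<le>d - e k. Const (c (k, i)) * Poly_Mapping.single (mono2 i (d - e k - i)) 1))"
   by (simp only: prod.case rhom_sum[OF lin2_rhom] sum_distrib_left lin2_simps mult.left_commute)
  finally show ?thesis .
 qed
 show "EX c. v - (\<Sum>x\<in>?K. Const (c x) * ?b x) : forms d I" if "v : forms d UNIV" for v
 proof -
  have v: "homogeneous d v" using that by (simp add: forms_def)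
  obtain a where a: "v - (\<Sum>k<n. m k * lin2 Z W (a k)) : I" using N by blast
  define c where "c x = Poly_Mapping.lookup (hcomp (d - e (fst x)) (a (fst x))) (mono2 (snd x) (d - e (fst x) - snd x))" for x
  have "hcomp d (v - (\<Sum>k<n. m k * lin2 Z W (a k))) = v - (\<Sum>k<n. m k * lin2 Z W (hcomp (d - e k) (a k)))"
   using m by (simp add: hcomp_diff hcomp_sum hcomp_of_homogeneous[OF v] hcomp_mult_homogeneous[OF m(1)] hcomp_lin2[OF Z])
  also have "... = v - (\<Sum>x\<in>?K. Const (c x) * ?b x)"
   unfolding sumK c_def fst_conv snd_conv binary_form[OF hcomp_homogeneous, symmetric] ..
  finally have "v - (\<Sum>x\<in>?K. Const (c x) * ?b x) = hcomp d (v - (\<Sum>k<n. m k * lin2 Z W (a k)))" ..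
  moreover have "hcomp d (v - (\<Sum>k<n. m k * lin2 Z W (a k))) : forms d I"
   using I(2) a hcomp_homogeneous by (auto simp: forms_def graded_def)
  ultimately show ?thesis by (intro exI[of _ c]) (simp only:)
 qed
 show "c x = 0" if s: "(\<Sum>x\<in>?K. Const (c x) * ?b x) : forms d I" and x: "x : ?K" for c x
 proof -
  obtain k i where xk: "x = (k, i)" "k < n" "i <= d - e k" using x by auto
  let ?s = "\<Sum>i\<le>d - e k. Const (c (k, i)) * Poly_Mapping.single (mono2 i (d - e k - i)) 1"
  have "?s = 0"
   using U[of "%k. \<Sum>i\<le>d - e k. Const (c (k, i)) * Poly_Mapping.single (mono2 i (d - e k - i)) 1" k] s xk(2)
   unfolding sumK by (simp add: forms_def)
  then have "0 = Poly_Mapping.lookup ?s (mono2 i (d - e k - i))" by simp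
  also have "... = (\<Sum>j\<le>d - e k. if j = i then c (k, j) else 0)"
   unfolding lookup_sum
  proof (intro sum.cong refl)
   fix j assume "j : {..d - e k}"
   have "mono2 j (d - e k - j) = mono2 i (d - e k - i) \<longleftrightarrow> j = i" by (metis mono2_lookup(1))
   then show "Poly_Mapping.lookup (Const (c (k, j)) * Poly_Mapping.single (mono2 j (d - e k - j)) 1) (mono2 i (d - e k - i)) = (if j = i then c (k, j) else 0)"
    by (simp add: Const_def mult_single lookup_single when_def)
  qed
  also have "... = c (k, i)" using xk(3) by (simp add: sum.delta)
  finally show "c x = 0" by (simp add: xk(1))
 qed
qed

lemma nf_closure:
 fixes I :: "('x, 'k::field) mpoly set"
 assumes I: "is_ideal I" and M: "!!c. Const c : M" "!!f g. f : M ==> g : M ==> f + g : M"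
  and V: "!!x f. f : M ==> \<exists>g\<in>M. Var x * f - g : I"
 shows "\<exists>g\<in>M. f - g : I"
proof (induction f rule: mpoly_induct)
 case (Const c)
 then show ?case using M(1) idealD(1)[OF I] by (intro bexI[of _ "Const c"]) auto
next
 case (add f g)
 then obtain f' g' where f': "f' : M" "g' : M" "f - f' : I" "g - g' : I" by auto
 have "f + g - (f' + g') = (f - f') + (g - g')" by simp
 then have "f + g - (f' + g') : I" using idealD(2)[OF I f'(3,4)] by (simp only:)
 then show ?case using M(2) f' by blast
next
 case (Var f x)
 then obtain f' where f': "f' : M" "f - f' : I" by auto
 obtain g where g: "g : M" "Var x * f' - g : I" using V[OF f'(1)] by blast
 have "Var x * f - g = Var x * (f - f') + (Var x * f' - g)" by (simp add: algebra_simps)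
 then have "Var x * f - g : I" using idealD(2)[OF I idealD(3)[OF I f'(2)] g(2)] by (simp only:)
 then show ?case using g(1) by blast
qed

lemma peval_ideal_gen: "f : ideal_gen G ==> (!!g. g : G ==> peval v g = 0) ==> peval v f = 0"
proof -
 assume f: "f : ideal_gen G" and g: "!!g. g : G ==> peval v g = 0"
 have "is_ideal {f. peval v f = 0}" by (auto simp: is_ideal_def)
 then have "ideal_gen G \<subseteq> {f. peval v f = 0}" by (rule ideal_gen_minimal) (use g in auto)
 then show ?thesis using f by blast
qed

lemma mod_Var0: "f - psubst (%i :: 2. if i = 0 then 0 else Var 1) f : ideal_gen {Var 0}"
 for f :: "(2, 'k::field) mpoly"
proof (induction f rule: mpoly_induct)
 case (add f g)
 have "f + g - psubst (%i. if i = 0 then 0 else Var 1) (f + g) =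
  (f - psubst (%i. if i = 0 then 0 else Var 1) f) + (g - psubst (%i. if i = 0 then 0 else Var 1) g)" by simp
 then show ?case using ideal_genD(2)[OF add] by (simp only:)
next
 case (Var f x)
 let ?s = "psubst (%i :: 2. if i = 0 then 0 else Var 1)"
 consider "x = 0" | "x = 1" using exhaust_2[of x] by auto
 then show ?case
 proof cases
  case 1
  then show ?thesis by (simp add: ideal_genD(4) ideal_gen_base)
 next
  case 2
  then have "Var x * f - ?s (Var x * f) = Var 1 * (f - ?s f)" by (simp add: right_diff_distrib)
  then show ?thesis using ideal_genD(3)[OF Var] by simp
 qed
qed (simp add: ideal_genD)

text \<open>Divisibility follows from vanishing on the line \<open>z = 0\<close>; the factor
  \<open>c * w^2\<close> is the value of the equation of a conic on that line.\<close>

lemma Var0_dvd: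
 fixes b :: "(2, 'k::alg_closed_field) mpoly"
 assumes "!!w. c * w^2 * peval (\<chi> i. if i = 0 then 0 else w) b = 0" "c ~= 0"
 shows "EX b'. b = Var 0 * b'"
proof -
 let ?s = "psubst (%i :: 2. if i = 0 then 0 else Var 1) :: (2, 'k) mpoly => (2, 'k) mpoly"
 have ps: "peval (\<chi> i. if i = 0 then z else w) (?s b) = peval (\<chi> i. if i = 0 then 0 else w) b" for z w
 proof -
  have "(\<chi> i::2. peval (\<chi> i::2. if i = 0 then z else w) (if i = 0 then 0 else Var 1)) = (\<chi> i. if i = 0 then 0 else w)"
   by (rule arg_cong[of _ _ vec_lambda]) auto
  then show ?thesis by (simp only: peval_psubst)
 qed
 have "w^2 * peval (\<chi> i. if i = 0 then z else w) (?s b) = 0" for z w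
  using assms(1)[of w] assms(2) by (simp add: ps)
 then have "(\<forall>(z::'k) (w::'k). w^2 = 0) | (ALL z w. peval (\<chi> i. if i = 0 then z else w) (?s b) = 0)"
  by (intro pfun_mult_zero pfun_intros)
 then have "?s b = 0" using peval_zero_2[of "?s b"] by (metis power_one zero_neq_one)
 then show ?thesis using mod_Var0[of b] by (auto simp: ideal_gen_insert mult.commute)
qed

locale frame =
 fixes u1 v1 u2 v2 u3 v3 :: "('x::finite, 'k::alg_closed_field) mpoly"
 assumes two: "(2 :: 'k) ~= 0"
  and lin: "!!y. y : {u1, v1, u2, v2, u3, v3} ==> homogeneous 1 y"
  and vars: "!!x. \<exists>y\<in>{u1, v1, u2, v2, u3, v3}. Var x = y | Var x = - y"
  and ev: "!!a1 b1 a2 b2 a3 b3. EX v. peval v u1 = a1 & peval v v1 = b1 & peval v u2 = a2 & peval v v2 = b2 &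
   peval v u3 = a3 & peval v v3 = b3"
begin

lemma frame_zero: "(!!y. y : {u1, v1, u2, v2, u3, v3} ==> peval v y = 0) ==> v = 0"
proof -
 assume y: "!!y. y : {u1, v1, u2, v2, u3, v3} ==> peval v y = 0"
 have "v $ x = 0" for x
 proof -
  obtain z where z: "z : {u1, v1, u2, v2, u3, v3}" "Var x = z | Var x = - z" using vars by blast
  then have "peval v (Var x) = peval v z | peval v (Var x) = - peval v z" by (metis rhom_uminus[OF peval_rhom])
  then show ?thesis using y[OF z(1)] by simp
 qed
 then show ?thesis by (simp add: Finite_Cartesian_Product.vec_eq_iff)
qed

end

section \<open>The coordinate ring of a conic\<close>

locale conic = frame u1 v1 u2 v2 u3 v3
 for u1 v1 u2 v2 u3 v3 :: "('x::finite, 'k::alg_closed_field) mpoly" +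
 fixes t1 t2 t3 :: 'k
 assumes t: "t1 ~= 0" "t2 ~= 0" "t3 ~= 0"
begin

definition cone :: "'k^'x => bool" where "cone v \<longleftrightarrow> peval v v1 = t1 * peval v u1 & peval v v2 = t2 * peval v u2 & peval v v3 = t3 * peval v u3 &
 t1 * peval v u1 ^ 2 + t2 * peval v u2 ^ 2 + t3 * peval v u3 ^ 2 = 0"

definition "ideal = ideal_gen {v1 - Const t1 * u1, v2 - Const t2 * u2, v3 - Const t3 * u3, u1 * v1 + u2 * v2 + u3 * v3}"

lemma is_ideal: "is_ideal ideal" by (simp add: ideal_def)

lemmas I = idealD[OF is_ideal]

lemma gens: "v1 - Const t1 * u1 : ideal" "v2 - Const t2 * u2 : ideal" "v3 - Const t3 * u3 : ideal" "u1 * v1 + u2 * v2 + u3 * v3 : ideal"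
 by (simp_all add: ideal_def ideal_gen_base)

lemma graded: "graded ideal"
 unfolding ideal_def
proof (rule graded_ideal_gen)
 fix g assume "g : {v1 - Const t1 * u1, v2 - Const t2 * u2, v3 - Const t3 * u3, u1 * v1 + u2 * v2 + u3 * v3}"
 moreover have "homogeneous 1 (v - Const t * u)" if "v : {u1, v1, u2, v2, u3, v3}" "u \<in> {u1, v1, u2, v2, u3, v3}" for t u v
  by (intro homogeneous_diff homogeneous_Const_mult lin that)
 moreover have "homogeneous 2 (u1 * v1 + u2 * v2 + u3 * v3)"
 proof -
  have "homogeneous 2 (u * v)" if "v : {u1, v1, u2, v2, u3, v3}" "u \<in> {u1, v1, u2, v2, u3, v3}" for u v
   using homogeneous_mult[OF lin[OF that(2)] lin[OF that(1)]] by (simp add: numeral_2_eq_2)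
  then show ?thesis by (intro homogeneous_add) auto
 qed
 ultimately show "EX e. homogeneous e g" by auto
qed

lemma ideal_vanish: "f : ideal ==> cone v ==> peval v f = 0"
proof -
 assume f: "f : ideal" and c: "cone v"
 have "peval v u1 * peval v v1 + peval v u2 * peval v v2 + peval v u3 * peval v v3 =
   t1 * peval v u1 ^ 2 + t2 * peval v u2 ^ 2 + t3 * peval v u3 ^ 2"
 proof -
  have e: "peval v v1 = t1 * peval v u1" "peval v v2 = t2 * peval v u2" "peval v v3 = t3 * peval v u3" using c by (simp_all add: cone_def)
  show ?thesis unfolding e by (simp add: power2_eq_square algebra_simps)
 qed
 then have P: "peval v (u1 * v1 + u2 * v2 + u3 * v3) = 0" using c by (simp add: cone_def)
 have "peval v g = 0" if "g : {v1 - Const t1 * u1, v2 - Const t2 * u2, v3 - Const t3 * u3, u1 * v1 + u2 * v2 + u3 * v3}" for g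
 proof -
  have "peval v (v1 - Const t1 * u1) = 0" "peval v (v2 - Const t2 * u2) = 0" "peval v (v3 - Const t3 * u3) = 0"
   using c by (simp_all add: cone_def)
  then show ?thesis using that P by blast
 qed
 then show ?thesis using f peval_ideal_gen unfolding ideal_def by blast
qed

abbreviation "\<theta> \<equiv> lin2 u2 u3"

text \<open>The value of \<open>u1^2\<close> modulo the ideal as a binary form in \<open>u2\<close>,
  \<open>u3\<close>: the coordinate ring is free with basis \<open>1\<close>,
  \<open>u1\<close>.\<close>

definition Lp :: "(2, 'k) mpoly" where "Lp = Const (- t2 / t1) * Var 0 ^ 2 + Const (- t3 / t1) * Var 1 ^ 2"

lemma rel: "u1 ^ 2 - \<theta> Lp : ideal"
proof -
 have c: "Const (1 / t1) * Const t1 = (1 :: ('x, 'k) mpoly)" "Const (1 / t1) * Const t2 = (Const (t2 / t1) :: ('x, 'k) mpoly)"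
  "Const (1 / t1) * Const t3 = (Const (t3 / t1) :: ('x, 'k) mpoly)"
  using t by (simp_all add: Const_simps(4)[symmetric] Const_simps(2))
 have "Const (1 / t1) * (u1 * v1 + u2 * v2 + u3 * v3 - (u1 * (v1 - Const t1 * u1) + u2 * (v2 - Const t2 * u2) + u3 * (v3 - Const t3 * u3)))
  = (Const (1 / t1) * Const t1) * u1^2 + (Const (1 / t1) * Const t2) * u2^2 + (Const (1 / t1) * Const t3) * u3^2"
  by (simp add: algebra_simps power2_eq_square)
 also have "... = u1 ^ 2 - \<theta> Lp" unfolding c Lp_def by (simp add: Const_simps)
 finally have "u1 ^ 2 - \<theta> Lp = Const (1 / t1) * (u1 * v1 + u2 * v2 + u3 * v3 - (u1 * (v1 - Const t1 * u1) + u2 * (v2 - Const t2 * u2) + u3 * (v3 - Const t3 * u3)))" ..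
 also have "... : ideal" using gens using I(2,3,6) by presburger
 finally show ?thesis .
qed

definition M where "M = {\<theta> a + u1 * \<theta> b |a b. True}"

lemma M_mult: "y : {u1, v1, u2, v2, u3, v3} ==> m \<in> M ==> \<exists>g\<in>M. y * m - g : ideal"
proof -
 assume y: "y : {u1, v1, u2, v2, u3, v3}" and "m \<in> M"
 then obtain a b where m: "m = \<theta> a + u1 * \<theta> b" by (auto simp: M_def)
 have u1: "\<exists>g\<in>M. u1 * m - g : ideal"
 proof (intro bexI)
  show "\<theta> (Lp * b) + u1 * \<theta> a : M" unfolding M_def by blast
  have "u1 * m - (\<theta> (Lp * b) + u1 * \<theta> a) = (u1 ^ 2 - \<theta> Lp) * \<theta> b"
   by (simp add: m algebra_simps power2_eq_square)
  then show "u1 * m - (\<theta> (Lp * b) + u1 * \<theta> a) : ideal" using I(4)[OF rel] by simp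
 qed
 have "u2 * m = \<theta> (Var 0 * a) + u1 * \<theta> (Var 0 * b)" "u3 * m = \<theta> (Var 1 * a) + u1 * \<theta> (Var 1 * b)"
  by (simp_all add: m algebra_simps)
 then have "u2 * m : M" "u3 * m : M" unfolding M_def by blast+
 then have u23: "\<exists>g\<in>M. u2 * m - g : ideal" "\<exists>g\<in>M. u3 * m - g : ideal" using I(1) by force+
 have v: "\<exists>g\<in>M. v * m - g : ideal" if uv: "v - Const t * u : ideal" "\<exists>g\<in>M. u * m - g : ideal" for u v t
 proof -
  obtain g where g: "g : M" "u * m - g : ideal" using uv(2) by blast
  then obtain a b where ab: "g = \<theta> a + u1 * \<theta> b" by (auto simp: M_def)
  have "Const t * g = \<theta> (Const t * a) + u1 * \<theta> (Const t * b)" by (simp add: ab algebra_simps)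
  then have "Const t * g : M" unfolding M_def by blast
  moreover have "v * m - Const t * g = (v - Const t * u) * m + Const t * (u * m - g)" by (simp add: algebra_simps)
  then have "v * m - Const t * g : ideal" using uv(1) g(2) by (simp add: I)
  ultimately show ?thesis by blast
 qed
 show ?thesis using y u1 u23 v[OF gens(1) u1] v[OF gens(2) u23(1)] v[OF gens(3) u23(2)] by auto
qed

lemma normal_form: "EX a b. f - (\<theta> a + u1 * \<theta> b) : ideal"
proof -
 have "\<exists>g\<in>M. f - g : ideal"
 proof (rule nf_closure[OF is_ideal])
  show "Const c : M" for c
  proof -
   have "Const c = \<theta> (Const c) + u1 * \<theta> 0" by simp
   then show ?thesis unfolding M_def by blast
  qed
  show "f + g : M" if "f : M" "g : M" for f g
  proof -
   from that obtain a b c d where "f = \<theta> a + u1 * \<theta> b" "g = \<theta> c + u1 * \<theta> d" by (auto simp: M_def)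
   then have "f + g = \<theta> (a + c) + u1 * \<theta> (b + d)" by (simp add: algebra_simps)
   then show ?thesis unfolding M_def by blast
  qed
  fix x m assume m: "m : M"
  obtain y where y: "y : {u1, v1, u2, v2, u3, v3}" "Var x = y | Var x = - y" using vars by blast
  obtain g where g: "g : M" "y * m - g : ideal" using M_mult[OF y(1) m] by blast
  then obtain a b where ab: "g = \<theta> a + u1 * \<theta> b" by (auto simp: M_def)
  have "- g = \<theta> (- a) + u1 * \<theta> (- b)" by (simp add: ab)
  then have ng: "- g : M" unfolding M_def by blast
  show "\<exists>g\<in>M. Var x * m - g : ideal"
   using y(2)
  proof
   assume "Var x = - y"
   then have "Var x * m - - g = - (y * m - g)" by simp
   then have "Var x * m - - g : ideal" using I(5)[OF g(2)] by simp
   then show ?thesis using ng by blast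
  qed (use g in auto)
 qed
 then show ?thesis by (auto simp: M_def)
qed

abbreviation "ev2 z w a \<equiv> peval (\<chi> i. if i = 0 then z else w) (a :: (2, 'k) mpoly)"

lemma Lp_at: "ev2 z w Lp = (- t2 / t1) * z^2 + (- t3 / t1) * w^2" by (simp add: Lp_def)

lemma cone_point:
 assumes "s ^ 2 = ev2 z w Lp"
 obtains v where "cone v" "!!a b. peval v (\<theta> a + u1 * \<theta> b) = ev2 z w a + s * ev2 z w b" "peval v u1 = s" "peval v u2 = z" "peval v u3 = w"
proof -
 obtain v where v: "peval v u1 = s" "peval v v1 = t1 * s" "peval v u2 = z" "peval v v2 = t2 * z" "peval v u3 = w" "peval v v3 = t3 * w"
  using ev by blast
 have "t1 * s^2 = - t2 * z^2 - t3 * w^2" unfolding assms Lp_at using t by (simp add: algebra_simps)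
 then have "t1 * s^2 + t2 * z^2 + t3 * w^2 = 0" by Groebner_Basis.algebra
 then have "cone v" by (simp add: cone_def v)
 moreover have "peval v (\<theta> a + u1 * \<theta> b) = ev2 z w a + s * ev2 z w b" for a b by (simp add: peval_lin2 v cong: if_cong)
 ultimately show ?thesis using that v by blast
qed

text \<open>Both square roots of the value of \<open>Lp\<close> give points over
  \<open>(z, w)\<close>; sum and difference of the two values separate \<open>a\<close> from
  \<open>b\<close>.\<close>

lemma signs:
 assumes "!!v. cone v ==> peval v u2 = z ==> peval v u3 = w ==> peval v (\<theta> a + u1 * \<theta> b) = 0"
 shows "ev2 z w a = 0" "ev2 z w Lp * ev2 z w b = 0"
proof -
 obtain s where s: "s ^ 2 = ev2 z w Lp" using nth_root_exists[of 2 "ev2 z w Lp"] by auto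
 then have s': "(- s) ^ 2 = ev2 z w Lp" by simp
 obtain v v' where v: "cone v" "!!a b. peval v (\<theta> a + u1 * \<theta> b) = ev2 z w a + s * ev2 z w b" "peval v u2 = z" "peval v u3 = w"
  and v': "cone v'" "!!a b. peval v' (\<theta> a + u1 * \<theta> b) = ev2 z w a + - s * ev2 z w b" "peval v' u2 = z" "peval v' u3 = w"
  using cone_point[OF s] cone_point[OF s'] by metis
 have e: "ev2 z w a + s * ev2 z w b = 0" "ev2 z w a - s * ev2 z w b = 0"
  using assms[OF v(1,3,4)] assms[OF v'(1,3,4)] v(2) v'(2) by simp_all
 have "2 * ev2 z w a = (ev2 z w a + s * ev2 z w b) + (ev2 z w a - s * ev2 z w b)" by simp
 also have "... = 0" unfolding e by simp
 finally have "2 * ev2 z w a = 0" .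
 then show a: "ev2 z w a = 0" using two by simp
 then have "s * ev2 z w b = 0" using e by simp
 then show "ev2 z w Lp * ev2 z w b = 0" unfolding s[symmetric] by (simp add: power2_eq_square)
qed

lemma Lp_nonzero: "(ALL z w. ev2 z w Lp * ev2 z w b = 0) ==> b = 0"
proof -
 assume "ALL z w. ev2 z w Lp * ev2 z w b = 0"
 then have "(ALL z w. ev2 z w Lp = 0) | (ALL z w. ev2 z w b = 0)" by (intro pfun_mult_zero pfun_intros) auto
 moreover have "ev2 1 0 Lp ~= 0" using t by (simp add: Lp_at)
 ultimately show "b = 0" using peval_zero_2 by blast
qed

lemma unique:
 assumes "!!v. cone v ==> v ~= 0 ==> peval v (\<theta> a + u1 * \<theta> b) = 0"
 shows "a = 0" "b = 0"
proof -
 have *: "ev2 z w a = 0 & ev2 z w Lp * ev2 z w b = 0" if "(z, w) ~= (0, 0)" for z w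
 proof -
  have "v ~= 0" if "peval v u2 = z" "peval v u3 = w" for v
  proof
   assume "v = 0"
   have "peval 0 y = 0" if "homogeneous 1 y" for y :: "('x, 'k) mpoly"
    using peval_scale[OF that, of 0 0] by simp
   then show False using \<open>v = 0\<close> lin that \<open>(z, w) ~= (0, 0)\<close> by auto
  qed
  then show ?thesis using signs[of z w a b] assms by blast
 qed
 have "ev2 z w a = 0" for z w by (rule pfun_punctured[of "%z w. ev2 z w a"]) (intro pfun_intros, use * in blast)
 then show "a = 0" by (rule peval_zero_2)
 have "ev2 z w Lp * ev2 z w b = 0" for z w by (rule pfun_punctured[of "%z w. ev2 z w Lp * ev2 z w b"]) (intro pfun_intros, use * in blast)
 then show "b = 0" using Lp_nonzero by blast
qed

text \<open>The Nullstellensatz for this ideal holds because a normal form that vanishes on the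
  punctured cone is zero.\<close>

lemma in_ideal_iff: "f : ideal \<longleftrightarrow> (ALL v. cone v --> v ~= 0 --> peval v f = 0)"
proof
 assume f: "ALL v. cone v --> v ~= 0 --> peval v f = 0"
 obtain a b where ab: "f - (\<theta> a + u1 * \<theta> b) : ideal" using normal_form by blast
 have "peval v (\<theta> a + u1 * \<theta> b) = 0" if "cone v" "v ~= 0" for v
 proof -
  have "peval v f - peval v (\<theta> a + u1 * \<theta> b) = 0"
   using ideal_vanish[OF ab that(1)] by (simp only: rhom_diff[OF peval_rhom])
  then show ?thesis using f that by (simp del: peval_simps)
 qed
 note n = this
 have za: "a = 0" by (rule unique(1)[OF n])
  have zb: "b = 0" by (rule unique(2)[OF n])
  have "a = 0" "b = 0" using za zb by simp_all
 then show "f : ideal" using ab by simp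
qed (use ideal_vanish in blast)

text \<open>The norm \<open>a^2 - Lp*b^2\<close> to binary forms vanishes for one factor if the
  product vanishes on the cone; as \<open>Lp\<close> is not a square, a zero norm forces a zero
  normal form.\<close>

lemma prime:
 assumes "f * g : ideal"
 shows "f : ideal | g : ideal"
proof -
 obtain a b c d where f: "f - (\<theta> a + u1 * \<theta> b) : ideal" and g: "g - (\<theta> c + u1 * \<theta> d) : ideal"
  using normal_form by meson
 have nf: "x : ideal" if N: "!!z w. ev2 z w a ^ 2 - ev2 z w Lp * ev2 z w b ^ 2 = 0" and x: "x - (\<theta> a + u1 * \<theta> b) : ideal" for x a b
 proof -
  have sq: "ev2 z w a ^ 2 = ev2 z w Lp * ev2 z w b ^ 2" for z w using N[of z w] by simp
  have b: "ev2 z w b = 0" for z w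
  proof (rule pfun_nonsquare[OF pfun_peval pfun_peval sq])
   fix w :: 'k assume "w ~= 0"
   then obtain \<rho> R where "poly R \<rho> ~= 0" "!!z. (- t2 / t1) * z^2 + (- t3 / t1) * w^2 = (z - \<rho>) * poly R z"
    using simple_root[OF two, of "- t2 / t1" "- t3 / t1" w] t by (metis divide_eq_0_iff neg_equal_0_iff_equal)
   then show "\<exists>\<rho> R. poly R \<rho> ~= 0 & (ALL z. ev2 z w Lp = (z - \<rho>) * poly R z)" unfolding Lp_at by blast
  qed
  then have "ev2 z w a = 0" for z w using sq[of z w] by simp
  then have "a = 0" by (rule peval_zero_2)
  moreover have "b = 0" using b by (rule peval_zero_2)
  ultimately have "a = 0" "b = 0" .
  then show ?thesis using x by simp
 qed
 have "(ev2 z w a ^ 2 - ev2 z w Lp * ev2 z w b ^ 2) * (ev2 z w c ^ 2 - ev2 z w Lp * ev2 z w d ^ 2) = 0" for z w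
 proof -
  obtain s where s: "s ^ 2 = ev2 z w Lp" using nth_root_exists[of 2 "ev2 z w Lp"] by auto
  have z: "(ev2 z w a + s * ev2 z w b) * (ev2 z w c + s * ev2 z w d) = 0" if sL: "s ^ 2 = ev2 z w Lp" for s
  proof -
   obtain v where v: "cone v" "!!a b. peval v (\<theta> a + u1 * \<theta> b) = ev2 z w a + s * ev2 z w b" using cone_point[OF sL] by metis
   have "peval v f = ev2 z w a + s * ev2 z w b" "peval v g = ev2 z w c + s * ev2 z w d"
    using ideal_vanish[OF f v(1)] ideal_vanish[OF g v(1)] v(2) by (simp_all del: peval_simps(3,4))
   then show ?thesis using ideal_vanish[OF assms v(1)] by simp
  qed
  have "(ev2 z w a ^ 2 - s^2 * ev2 z w b ^ 2) * (ev2 z w c ^ 2 - s^2 * ev2 z w d ^ 2) =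
    ((ev2 z w a + s * ev2 z w b) * (ev2 z w c + s * ev2 z w d)) * ((ev2 z w a + - s * ev2 z w b) * (ev2 z w c + - s * ev2 z w d))"
   by (simp add: algebra_simps power2_eq_square)
  also have "... = 0" using z[OF s] by simp
  finally show ?thesis by (simp add: s)
 qed
 then have "(ALL z w. ev2 z w a ^ 2 - ev2 z w Lp * ev2 z w b ^ 2 = 0) | (ALL z w. ev2 z w c ^ 2 - ev2 z w Lp * ev2 z w d ^ 2 = 0)"
  by (intro pfun_mult_zero pfun_intros)
 then show ?thesis using nf f g by blast
qed

lemma codim_ideal: "d \<ge> 1 ==> codim (forms d UNIV) (forms d ideal) (2 * d + 1)"
proof -
 assume d: "d \<ge> 1"
 let ?m = "%k::nat. if k = 0 then 1 else u1"
 have s2: "(\<Sum>k<2. f k) = f 0 + f 1" for f :: "nat => ('x, 'k) mpoly" by (simp add: numeral_2_eq_2)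
 have "codim (forms d UNIV) (forms d ideal) (\<Sum>k<2. d - k + 1)"
 proof (rule codim_normal_form[OF is_ideal graded, of u2 u3 2 "%k. k" ?m d])
  show "homogeneous 1 u2" "homogeneous 1 u3" by (rule lin; simp)+
  show "homogeneous k (?m k)" if "k < 2" for k using that lin[of u1] by (cases k) auto
  show "k <= d" if "k < 2" for k using that d by simp
  show "EX a. f - (\<Sum>k<2. ?m k * \<theta> (a k)) : ideal" for f
  proof -
   obtain a b where "f - (\<theta> a + u1 * \<theta> b) : ideal" using normal_form by blast
   then show ?thesis by (intro exI[of _ "%k. if k = 0 then a else b"]) (simp add: s2)
  qed
  show "a k = 0" if "(\<Sum>k<2. ?m k * \<theta> (a k)) : ideal" "k < 2" for a k
  proof -
   have "\<theta> (a 0) + u1 * \<theta> (a 1) : ideal" using that(1) by (simp add: s2)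
   then have "a 0 = 0" "a 1 = 0" using unique[of "a 0" "a 1"] ideal_vanish by blast+
   then show ?thesis using that(2) by (cases k) auto
  qed
 qed
 moreover have "(\<Sum>k<2. d - k + 1) = 2 * d + 1" using d by (simp add: numeral_2_eq_2)
 ultimately show ?thesis by simp
qed

text \<open>In normal form the hypothesis reads \<open>Lp*b = z*c\<close> and
  \<open>a = z*d\<close>. On \<open>z = 0\<close> the form \<open>Lp\<close> is a nonzero multiple
  of \<open>w^2\<close>, so \<open>z\<close> divides \<open>b\<close> as well.\<close>

lemma divide:
 assumes h: "u1 * h - u2 * k : ideal"
 shows "EX k'. h - u2 * k' : ideal"
proof -
 obtain a b c d where f: "h - (\<theta> a + u1 * \<theta> b) : ideal" and g: "k - (\<theta> c + u1 * \<theta> d) : ideal"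
  using normal_form by meson
 have "(\<theta> (Lp * b - Var 0 * c) + u1 * \<theta> (a - Var 0 * d)) =
   (u1 * h - u2 * k) - u1 * (h - (\<theta> a + u1 * \<theta> b)) + u2 * (k - (\<theta> c + u1 * \<theta> d)) - (u1^2 - \<theta> Lp) * \<theta> b"
  by (simp add: algebra_simps power2_eq_square)
 also have "... : ideal" using h f g rel by (simp add: I)
 finally have "Lp * b - Var 0 * c = 0" "a - Var 0 * d = 0" using unique ideal_vanish by blast+
 then have e: "Lp * b = Var 0 * c" "a = Var 0 * d" by simp_all
 have "(- t3 / t1) * w^2 * ev2 0 w b = 0" for w
  using arg_cong[OF e(1), of "peval (\<chi> i. if i = 0 then 0 else w)"] by (simp add: Lp_at)
 then obtain b' where b': "b = Var 0 * b'" using Var0_dvd[of "- t3 / t1" b] t by auto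
 have "h - u2 * (\<theta> d + u1 * \<theta> b') = h - (\<theta> a + u1 * \<theta> b)" by (simp add: e(2) b' algebra_simps)
 then have "h - u2 * (\<theta> d + u1 * \<theta> b') : ideal" using f by (simp only:)
 then show ?thesis by blast
qed

end

section \<open>The coordinate ring of an elliptic quartic\<close>

locale quartic =
 fixes X Y Z W U V :: "('x::finite, 'k::alg_closed_field) mpoly" and p q :: 'k
 assumes two: "(2 :: 'k) ~= 0" and pq: "p ~= 0" "q ~= 0" "p^2 ~= q^2"
  and lin: "!!y. y : {X, Y, Z, W, U, V} ==> homogeneous 1 y"
  and vars: "!!x. EX a b c d e f. Var x = Const a * X + Const b * Y + Const c * Z + Const d * W + Const e * U + Const f * V"
  and ev: "!!a b c d. EX v. peval v X = a & peval v Y = b & peval v Z = c & peval v W = d & peval v U = 0 & peval v V = 0"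
begin

abbreviation "\<theta> \<equiv> lin2 Z W"
abbreviation "ev2 z w a \<equiv> peval (\<chi> i. if i = 0 then z else w) (a :: (2, 'k) mpoly)"

text \<open>The curve is \<open>X^2 = L1\<close>, \<open>Y^2 = L2\<close> in the space
  \<open>U = V = 0\<close>; the condition \<open>p^2 ~= q^2\<close> makes the two binary forms
  coprime.\<close>

definition L1 :: "(2, 'k) mpoly" where "L1 = Const p * Var 0 ^ 2 + Const q * Var 1 ^ 2"
definition L2 :: "(2, 'k) mpoly" where "L2 = Const q * Var 0 ^ 2 + Const p * Var 1 ^ 2"

lemma L_at: "ev2 z w L1 = p * z^2 + q * w^2" "ev2 z w L2 = q * z^2 + p * w^2"
 by (simp_all add: L1_def L2_def)

definition cone :: "'k^'x => bool" where
 "cone v \<longleftrightarrow> peval v U = 0 & peval v V = 0 & peval v X ^ 2 = p * peval v Z ^ 2 + q * peval v W ^ 2 &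
  peval v Y ^ 2 = q * peval v Z ^ 2 + p * peval v W ^ 2"

definition "ideal = ideal_gen {U, V, X^2 - \<theta> L1, Y^2 - \<theta> L2}"

lemma is_ideal: "is_ideal ideal" by (simp add: ideal_def)

lemmas I = idealD[OF is_ideal]

lemma gens: "U : ideal" "V : ideal" "X^2 - \<theta> L1 : ideal" "Y^2 - \<theta> L2 : ideal"
 by (simp_all add: ideal_def ideal_gen_base)

lemma ideal_vanish: "f : ideal ==> cone v ==> peval v f = 0"
 unfolding ideal_def by (erule ideal_gen_4E) (simp add: cone_def L1_def L2_def)

lemma graded: "graded ideal"
 unfolding ideal_def
proof (rule graded_ideal_gen)
 have sq: "homogeneous 2 (Const c * y ^ 2)" if "y : {X, Y, Z, W, U, V}" for y c
  using homogeneous_power[OF lin[OF that], of 2] by (simp add: homogeneous_Const_mult)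
 have "homogeneous 2 (X^2 - \<theta> L1)" "homogeneous 2 (Y^2 - \<theta> L2)"
  using sq[of X 1] sq[of Y 1] sq[of Z] sq[of W]
  by (simp_all add: L1_def L2_def homogeneous_add homogeneous_diff Const_simps)
 then show "EX e. homogeneous e g" if "g : {U, V, X^2 - \<theta> L1, Y^2 - \<theta> L2}" for g
  using that lin[of U] lin[of V] by auto
qed

definition "nf a b c d = \<theta> a + X * \<theta> b + Y * \<theta> c + X * Y * \<theta> d"

definition M where "M = {nf a b c d |a b c d. True}"

lemma nf_in_M: "nf a b c d : M" by (auto simp: M_def)

lemma M_step: "y : {X, Y, Z, W, U, V} ==> m \<in> M ==> \<exists>g\<in>M. y * m - g : ideal"
proof -
 assume y: "y : {X, Y, Z, W, U, V}" and "m \<in> M"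
 then obtain a b c d where m: "m = nf a b c d" by (auto simp: M_def)
 have e: "X * m - nf (L1 * b) a (L1 * d) c = (X^2 - \<theta> L1) * (\<theta> b + Y * \<theta> d)"
  "Y * m - nf (L2 * c) (L2 * d) a b = (Y^2 - \<theta> L2) * (\<theta> c + X * \<theta> d)"
  "Z * m - nf (Var 0 * a) (Var 0 * b) (Var 0 * c) (Var 0 * d) = 0"
  "W * m - nf (Var 1 * a) (Var 1 * b) (Var 1 * c) (Var 1 * d) = 0"
  "U * m - nf 0 0 0 0 = U * m" "V * m - nf 0 0 0 0 = V * m"
  by (simp_all add: m nf_def algebra_simps power2_eq_square)
 have "X * m - nf (L1 * b) a (L1 * d) c : ideal" "Y * m - nf (L2 * c) (L2 * d) a b : ideal"
  "Z * m - nf (Var 0 * a) (Var 0 * b) (Var 0 * c) (Var 0 * d) : ideal"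
  "W * m - nf (Var 1 * a) (Var 1 * b) (Var 1 * c) (Var 1 * d) : ideal"
  "U * m - nf 0 0 0 0 : ideal" "V * m - nf 0 0 0 0 : ideal"
  unfolding e by (intro I(1) I(4) gens)+
 then show ?thesis using y nf_in_M by blast
qed

lemma M_add: "f : M ==> g : M ==> f + g : M"
proof -
 assume "f : M" "g : M"
 then obtain a b c d a' b' c' d' where "f = nf a b c d" "g = nf a' b' c' d'" by (auto simp: M_def)
 then have "f + g = nf (a + a') (b + b') (c + c') (d + d')" by (simp add: nf_def algebra_simps)
 then show ?thesis by (simp add: nf_in_M)
qed

lemma M_scale: "f : M ==> Const t * f : M"
proof -
 assume "f : M"
 then obtain a b c d where "f = nf a b c d" by (auto simp: M_def)
 then have "Const t * f = nf (Const t * a) (Const t * b) (Const t * c) (Const t * d)" by (simp add: nf_def algebra_simps)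
 then show ?thesis by (simp add: nf_in_M)
qed

lemma normal_form: "EX a b c d. f - nf a b c d : ideal"
proof -
 have "\<exists>g\<in>M. f - g : ideal"
 proof (rule nf_closure[OF is_ideal])
  show "Const t : M" for t using nf_in_M[of "Const t" 0 0 0] by (simp add: nf_def)
  fix x m assume m: "m : M"
  define Q where "Q y \<longleftrightarrow> (\<exists>g\<in>M. y * m - g : ideal)" for y
  have add: "Q (y + y')" if "Q y" "Q y'" for y y'
  proof -
   obtain g g' where g: "g : M" "g' : M" "y * m - g : ideal" "y' * m - g' : ideal" using that by (meson Q_def \<open>Q y'\<close> \<open>Q y\<close>)
   have "(y + y') * m - (g + g') = (y * m - g) + (y' * m - g')" by (simp add: algebra_simps)
   then show ?thesis using g M_add I(2) unfolding Q_def by metis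
  qed
  have scl: "Q (Const t * y)" if "Q y" for y t
  proof -
   obtain g where g: "g : M" "y * m - g : ideal" using that using Q_def \<open>Q y\<close> by blast
   have "(Const t * y) * m - Const t * g = Const t * (y * m - g)" by (simp add: algebra_simps)
   then show ?thesis using g M_scale I(3) unfolding Q_def by metis
  qed
  have "Q y" if "y : {X, Y, Z, W, U, V}" for y unfolding Q_def by (rule M_step[OF that m])
  then have "Q X" "Q Y" "Q Z" "Q W" "Q U" "Q V" by auto
  moreover obtain a b c d e f where "Var x = Const a * X + Const b * Y + Const c * Z + Const d * W + Const e * U + Const f * V"
   using vars by blast
  ultimately have "Q (Var x)" by (simp add: add scl)
  then show "\<exists>g\<in>M. Var x * m - g : ideal" by (simp add: Q_def)
 qed (rule M_add)
 then show ?thesis by (auto simp: M_def)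
qed

lemma cone_point:
 assumes "s ^ 2 = ev2 z w L1" "t ^ 2 = ev2 z w L2"
 obtains v where "cone v" "!!a b c d. peval v (nf a b c d) = ev2 z w a + s * ev2 z w b + t * ev2 z w c + s * t * ev2 z w d"
  "peval v Z = z" "peval v W = w"
proof -
 obtain v where v: "peval v X = s" "peval v Y = t" "peval v Z = z" "peval v W = w" "peval v U = 0" "peval v V = 0"
  using ev by blast
 then have "cone v" using assms by (simp add: cone_def L_at)
 moreover have "peval v (nf a b c d) = ev2 z w a + s * ev2 z w b + t * ev2 z w c + s * t * ev2 z w d" for a b c d
  by (simp add: nf_def peval_lin2 v cong: if_cong)
 ultimately show ?thesis using that v by blast
qed

lemma signs:
 assumes "!!v. cone v ==> peval v Z = z ==> peval v W = w ==> peval v (nf a b c d) = 0"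
 shows "ev2 z w a = 0" "ev2 z w L1 * ev2 z w b = 0" "ev2 z w L2 * ev2 z w c = 0" "(ev2 z w L1 * ev2 z w L2) * ev2 z w d = 0"
proof -
 obtain s t where s: "s ^ 2 = ev2 z w L1" "t ^ 2 = ev2 z w L2"
  using nth_root_exists[of 2 "ev2 z w L1"] nth_root_exists[of 2 "ev2 z w L2"] by auto
 have e: "ev2 z w a + s * ev2 z w b + t * ev2 z w c + s * t * ev2 z w d = 0" if "s ^ 2 = ev2 z w L1" "t ^ 2 = ev2 z w L2" for s t
  using cone_point[OF that] assms by metis
 have f: "ev2 z w a + s * ev2 z w b + t * ev2 z w c + s * t * ev2 z w d = 0"
  "ev2 z w a - s * ev2 z w b + t * ev2 z w c - s * t * ev2 z w d = 0"
  "ev2 z w a + s * ev2 z w b - t * ev2 z w c - s * t * ev2 z w d = 0"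
  "ev2 z w a - s * ev2 z w b - t * ev2 z w c + s * t * ev2 z w d = 0"
  using e[of s t] e[of "- s" t] e[of s "- t"] e[of "- s" "- t"] s by simp_all
 have "2 * (2 * ev2 z w a) = 0" "2 * (2 * (s * ev2 z w b)) = 0" "2 * (2 * (t * ev2 z w c)) = 0" "2 * (2 * (s * t * ev2 z w d)) = 0"
  using f by Groebner_Basis.algebra+
 then have z: "ev2 z w a = 0" "s * ev2 z w b = 0" "t * ev2 z w c = 0" "s * t * ev2 z w d = 0" using two by (auto simp only: mult_eq_0_iff)
 show "ev2 z w a = 0" by (rule z)
 show "ev2 z w L1 * ev2 z w b = 0" "ev2 z w L2 * ev2 z w c = 0" "(ev2 z w L1 * ev2 z w L2) * ev2 z w d = 0"
  unfolding s[symmetric] using z(2-) by Groebner_Basis.algebra+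
qed

lemma L_nonzero: "ev2 1 0 L1 ~= 0" "ev2 1 0 L2 ~= 0" "ev2 1 0 L1 * ev2 1 0 L2 ~= 0"
 using pq by (simp_all add: L_at)

lemma unique:
 assumes "!!v. cone v ==> v ~= 0 ==> peval v (nf a b c d) = 0"
 shows "a = 0" "b = 0" "c = 0" "d = 0"
proof -
 have nz: "v ~= 0" if "peval v Z = z" "peval v W = w" "(z, w) ~= (0, 0)" for v z w
 proof
  assume "v = 0"
  have "peval 0 y = 0" if "homogeneous 1 y" for y :: "('x, 'k) mpoly"
   using peval_scale[OF that, of 0 0] by simp
  then show False using \<open>v = 0\<close> lin that by auto
 qed
 have *: "ev2 z w a = 0" "ev2 z w L1 * ev2 z w b = 0" "ev2 z w L2 * ev2 z w c = 0" "(ev2 z w L1 * ev2 z w L2) * ev2 z w d = 0"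
  if "(z, w) ~= (0, 0)" for z w
  using signs[of z w a b c d] nz[OF _ _ that] assms by blast+
 have "ev2 z w a = 0" for z w by (rule pfun_punctured[of "%z w. ev2 z w a"]) (intro pfun_intros, rule *)
 then show "a = 0" by (rule peval_zero_2)
 have "ev2 z w L1 * ev2 z w b = 0" for z w
  by (rule pfun_punctured[of "%z w. ev2 z w L1 * ev2 z w b"]) (intro pfun_intros, rule *)
 then have "(ALL z w. ev2 z w L1 = 0) | (ALL z w. ev2 z w b = 0)" by (intro pfun_mult_zero pfun_intros)
 then show "b = 0" using peval_zero_2[of b] L_nonzero by blast
 have "ev2 z w L2 * ev2 z w c = 0" for z w
  by (rule pfun_punctured[of "%z w. ev2 z w L2 * ev2 z w c"]) (intro pfun_intros, rule *)
 then have "(ALL z w. ev2 z w L2 = 0) | (ALL z w. ev2 z w c = 0)" by (intro pfun_mult_zero pfun_intros)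
 then show "c = 0" using peval_zero_2[of c] L_nonzero by blast
 have "(ev2 z w L1 * ev2 z w L2) * ev2 z w d = 0" for z w
  by (rule pfun_punctured[of "%z w. (ev2 z w L1 * ev2 z w L2) * ev2 z w d"]) (intro pfun_intros, rule *)
 then have "(ALL z w. ev2 z w L1 * ev2 z w L2 = 0) | (ALL z w. ev2 z w d = 0)" by (intro pfun_mult_zero pfun_intros)
 then show "d = 0" using peval_zero_2[of d] L_nonzero by blast
qed

lemma in_ideal_iff: "f : ideal \<longleftrightarrow> (ALL v. cone v --> v ~= 0 --> peval v f = 0)"
proof
 assume f: "ALL v. cone v --> v ~= 0 --> peval v f = 0"
 obtain a b c d where ab: "f - nf a b c d : ideal" using normal_form by blast
 have "peval v (nf a b c d) = 0" if "cone v" "v ~= 0" for v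
  using ideal_vanish[OF ab that(1)] f that by (simp add: rhom_diff[OF peval_rhom])
 note n = this
 have za: "a = 0" by (rule unique(1)[OF n])
  have zb: "b = 0" by (rule unique(2)[OF n])
  have zc: "c = 0" by (rule unique(3)[OF n])
  have zd: "d = 0" by (rule unique(4)[OF n])
  have "a = 0" "b = 0" "c = 0" "d = 0" using za zb zc zd by simp_all
 then show "f : ideal" using ab by (simp add: nf_def)
qed (use ideal_vanish in blast)

text \<open>At a root of \<open>L1\<close> the value of \<open>L2\<close> is nonzero, because
  \<open>p^2 ~= q^2\<close>; the root therefore stays simple in the product.\<close>

lemma nonsquares:
 assumes "w ~= 0"
 shows "\<exists>\<rho> R. poly R \<rho> ~= 0 & (ALL z. ev2 z w L1 = (z - \<rho>) * poly R z)"
  "\<exists>\<rho> R. poly R \<rho> ~= 0 & (ALL z. ev2 z w L2 = (z - \<rho>) * poly R z)"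
  "\<exists>\<rho> R. poly R \<rho> ~= 0 & (ALL z. ev2 z w L1 * ev2 z w L2 = (z - \<rho>) * poly R z)"
proof -
 obtain \<rho> R where r: "poly R \<rho> ~= 0" "!!z. p * z^2 + q * w^2 = (z - \<rho>) * poly R z" "p * \<rho>^2 = - q * w^2"
  using simple_root[OF two pq(1,2) assms] by metis
 show "\<exists>\<rho> R. poly R \<rho> ~= 0 & (ALL z. ev2 z w L1 = (z - \<rho>) * poly R z)" unfolding L_at using r by blast
 have "p * (q * \<rho>^2 + p * w^2) = q * (p * \<rho>^2) + p^2 * w^2" by (simp add: algebra_simps power2_eq_square)
 also have "... = (p^2 - q^2) * w^2" unfolding r(3) by (simp add: algebra_simps power2_eq_square)
 finally have "q * \<rho>^2 + p * w^2 ~= 0" using pq assms by auto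
 moreover have "poly (R * [:p * w^2, 0, q:]) \<rho> = poly R \<rho> * (q * \<rho>^2 + p * w^2)" by (simp add: algebra_simps power2_eq_square)
 ultimately have "poly (R * [:p * w^2, 0, q:]) \<rho> ~= 0" using r(1) by simp
 moreover have "ev2 z w L1 * ev2 z w L2 = (z - \<rho>) * poly (R * [:p * w^2, 0, q:]) z" for z
  unfolding L_at r(2) by (simp add: algebra_simps power2_eq_square)
 ultimately show "\<exists>\<rho> R. poly R \<rho> ~= 0 & (ALL z. ev2 z w L1 * ev2 z w L2 = (z - \<rho>) * poly R z)" by blast
 show "\<exists>\<rho> R. poly R \<rho> ~= 0 & (ALL z. ev2 z w L2 = (z - \<rho>) * poly R z)"
  unfolding L_at using simple_root[OF two pq(2,1) assms] by metis
qed

text \<open>The norm from \<open>K(\<surd>L1, \<surd>L2)\<close> to \<open>K = k(z, w)\<close> vanishes only at \<open>0\<close>, as \<open>L1\<close>, \<open>L2\<close> and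
 \<open>L1 L2\<close> are not squares.\<close>

definition "half1 a b c d z w = ev2 z w a ^ 2 + ev2 z w L1 * ev2 z w b ^ 2 - ev2 z w L2 * ev2 z w c ^ 2 - ev2 z w L1 * ev2 z w L2 * ev2 z w d ^ 2"
definition "half2 a b c d z w = 2 * ev2 z w a * ev2 z w b - 2 * ev2 z w L2 * ev2 z w c * ev2 z w d"

lemma norm_zero:
 assumes N: "!!z w. half1 a b c d z w ^ 2 - ev2 z w L1 * half2 a b c d z w ^ 2 = 0"
 shows "a = 0" "b = 0" "c = 0" "d = 0"
proof -
 have sq: "half1 a b c d z w ^ 2 = ev2 z w L1 * half2 a b c d z w ^ 2" for z w using N[of z w] by simp
 have pf: "pfun (half1 a b c d)" "pfun (half2 a b c d)"
  unfolding half1_def half2_def by (intro pfun_intros)+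
 have 2: "half2 a b c d z w = 0" for z w
  by (rule pfun_nonsquare[OF pf sq]) (rule nonsquares)
 then have 1: "half1 a b c d z w = 0" for z w using sq[of z w] by simp
 have h1: "ev2 z w a ^ 2 + ev2 z w L1 * ev2 z w b ^ 2 = ev2 z w L2 * (ev2 z w c ^ 2 + ev2 z w L1 * ev2 z w d ^ 2)" for z w
  using 1[of z w] unfolding half1_def by Groebner_Basis.algebra
 have "2 * (ev2 z w a * ev2 z w b - ev2 z w L2 * ev2 z w c * ev2 z w d) = 0" for z w
  using 2[of z w] unfolding half2_def by Groebner_Basis.algebra
 then have h2: "ev2 z w a * ev2 z w b = ev2 z w L2 * ev2 z w c * ev2 z w d" for z w using two by simp
 \<comment> \<open>With \<open>s^2 = L1\<close> the equations say
   \<open>(a + s*b)^2 = L2*(c + s*d)^2\<close>. Multiplication by \<open>(c - s*d)^2\<close> turns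
   this into \<open>(e + s*f)^2 = L2*n^2\<close>, and the part with \<open>s\<close> gives
   \<open>e*f = 0\<close>.\<close>
 define e where "e z w = ev2 z w a * ev2 z w c - ev2 z w L1 * ev2 z w b * ev2 z w d" for z w
 define f where "f z w = ev2 z w b * ev2 z w c - ev2 z w a * ev2 z w d" for z w
 define n where "n z w = ev2 z w c ^ 2 - ev2 z w L1 * ev2 z w d ^ 2" for z w
 have pf': "pfun e" "pfun f" "pfun n" unfolding e_def f_def n_def by (intro pfun_intros)+
 have ef: "e z w * f z w = 0" "e z w ^ 2 + ev2 z w L1 * f z w ^ 2 = ev2 z w L2 * n z w ^ 2" for z w
  using h1[of z w] h2[of z w] unfolding e_def f_def n_def by Groebner_Basis.algebra+
 have n0: "n z w = 0" for z w
 proof -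
  consider "!!z w. e z w = 0" | "!!z w. f z w = 0" using pfun_mult_zero[OF pf'(1,2) ef(1)] by blast
  then show ?thesis
  proof cases
   case 1
   have s: "(ev2 z w L1 * f z w) ^ 2 = (ev2 z w L1 * ev2 z w L2) * n z w ^ 2" for z w
    using ef(2)[of z w] 1[of z w] by Groebner_Basis.algebra
   show ?thesis
    by (rule pfun_nonsquare[OF pfun_mult[OF pfun_peval pf'(2)] pf'(3) s]) (rule nonsquares)
  next
   case 2
   have s: "e z w ^ 2 = ev2 z w L2 * n z w ^ 2" for z w using ef(2)[of z w] 2[of z w] by simp
   show ?thesis by (rule pfun_nonsquare[OF pf'(1,3) s]) (rule nonsquares)
  qed
 qed
 have s: "ev2 z w c ^ 2 = ev2 z w L1 * ev2 z w d ^ 2" for z w using n0[of z w] by (simp add: n_def)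
 have d0: "ev2 z w d = 0" for z w by (rule pfun_nonsquare[OF pfun_peval pfun_peval s]) (rule nonsquares)
 then have c0: "ev2 z w c = 0" for z w using s[of z w] by simp
 have ab: "ev2 z w a * ev2 z w b = 0" "ev2 z w a ^ 2 + ev2 z w L1 * ev2 z w b ^ 2 = 0" for z w
  using h1[of z w] h2[of z w] c0[of z w] d0[of z w] by simp_all
 consider "!!z w. ev2 z w a = 0" | "!!z w. ev2 z w b = 0" using pfun_mult_zero[OF pfun_peval pfun_peval ab(1)] by blast
 then have ab0: "(ALL z w. ev2 z w a = 0) & (ALL z w. ev2 z w b = 0)"
 proof cases
  case 1
  then have "ev2 z w L1 * (ev2 z w b * ev2 z w b) = 0" for z w using ab(2)[of z w] by (simp add: power2_eq_square)
  then have "(ALL z w. ev2 z w L1 = 0) | (ALL z w. ev2 z w b * ev2 z w b = 0)" by (intro pfun_mult_zero pfun_intros)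
  then show ?thesis using 1 L_nonzero by auto
 next
  case 2
  then show ?thesis using ab(2) by auto
 qed
 then show "a = 0" "b = 0" "c = 0" "d = 0" using c0 d0 peval_zero_2 by blast+
qed

text \<open>The norm is the product of the values at the four points over \<open>(z, w)\<close>, so
  the norms of two factors multiply to zero; \<open>norm_zero\<close> then makes one normal form
  zero.\<close>

lemma prime:
 assumes "f * g : ideal"
 shows "f : ideal | g : ideal"
proof -
 obtain a b c d a' b' c' d' where f: "f - nf a b c d : ideal" and g: "g - nf a' b' c' d' : ideal"
  using normal_form by meson
 let ?N = "%a b c d z w. half1 a b c d z w ^ 2 - ev2 z w L1 * half2 a b c d z w ^ 2"
 let ?v = "%a b c d z w s t. ev2 z w a + s * ev2 z w b + t * ev2 z w c + s * t * ev2 z w d"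
 have "?N a b c d z w * ?N a' b' c' d' z w = 0" for z w
 proof -
  obtain s t where s: "s ^ 2 = ev2 z w L1" "t ^ 2 = ev2 z w L2"
   using nth_root_exists[of 2 "ev2 z w L1"] nth_root_exists[of 2 "ev2 z w L2"] by auto
  have e: "?v a b c d z w s t * ?v a' b' c' d' z w s t = 0" if st: "s ^ 2 = ev2 z w L1" "t ^ 2 = ev2 z w L2" for s t
  proof -
   obtain v where v: "cone v" "!!a b c d. peval v (nf a b c d) = ?v a b c d z w s t" using cone_point[OF st] by metis
   have "peval v f = ?v a b c d z w s t" "peval v g = ?v a' b' c' d' z w s t"
    using ideal_vanish[OF f v(1)] ideal_vanish[OF g v(1)] v(2) by (simp_all add: rhom_diff[OF peval_rhom])
   then show ?thesis using ideal_vanish[OF assms v(1)] by simp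
  qed
  have N: "?N a b c d z w = ?v a b c d z w s t * ?v a b c d z w s (- t) * (?v a b c d z w (- s) t * ?v a b c d z w (- s) (- t))" for a b c d
  proof -
   have "half1 a b c d z w + s * half2 a b c d z w = ?v a b c d z w s t * ?v a b c d z w s (- t)"
    "half1 a b c d z w - s * half2 a b c d z w = ?v a b c d z w (- s) t * ?v a b c d z w (- s) (- t)"
    unfolding half1_def half2_def s[symmetric] by Groebner_Basis.algebra+
   moreover have "?N a b c d z w = (half1 a b c d z w + s * half2 a b c d z w) * (half1 a b c d z w - s * half2 a b c d z w)"
    unfolding s[symmetric] by Groebner_Basis.algebra
   ultimately show ?thesis by simp
  qed
  show ?thesis unfolding N using e[OF s] by auto
 qed
 then have "(ALL z w. ?N a b c d z w = 0) | (ALL z w. ?N a' b' c' d' z w = 0)"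
  unfolding half1_def half2_def by (intro pfun_mult_zero pfun_intros)
 then show ?thesis
 proof
  assume "ALL z w. ?N a b c d z w = 0"
  then have "a = 0" "b = 0" "c = 0" "d = 0" using norm_zero[of a b c d] by blast+
  then show ?thesis using f by (simp add: nf_def)
 next
  assume "ALL z w. ?N a' b' c' d' z w = 0"
  then have "a' = 0" "b' = 0" "c' = 0" "d' = 0" using norm_zero[of a' b' c' d'] by blast+
  then show ?thesis using g by (simp add: nf_def)
 qed
qed

text \<open>The basis \<open>1\<close>, \<open>X\<close>, \<open>Y\<close>, \<open>X*Y\<close>
  contributes \<open>(d + 1) + d + d + (d - 1)\<close>.\<close>

lemma codim_ideal: "d \<ge> 2 ==> codim (forms d UNIV) (forms d ideal) (4 * d)"
proof -
 assume d: "d \<ge> 2"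
 let ?m = "%k::nat. if k = 0 then 1 else if k = 1 then X else if k = 2 then Y else X * Y"
 let ?e = "%k::nat. if k = 0 then 0 else if k = 3 then 2 else 1 :: nat"
 have lt4: "k < 4 \<longleftrightarrow> k = 0 | k = 1 | k = 2 | k = 3" for k :: nat by auto
 have s4: "(\<Sum>k<4. f k) = f 0 + f 1 + f 2 + f 3" for f :: "nat => 'b::comm_monoid_add" by (simp add: eval_nat_numeral)
 have XY: "homogeneous 2 (X * Y)" using homogeneous_mult[OF lin[of X] lin[of Y]] by (simp add: numeral_2_eq_2)
 have "codim (forms d UNIV) (forms d ideal) (\<Sum>k<4. d - ?e k + 1)"
 proof (rule codim_normal_form[OF is_ideal graded, of Z W 4 ?e ?m d])
  show "homogeneous 1 Z" "homogeneous 1 W" by (rule lin; simp)+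
  show "homogeneous (?e k) (?m k)" if "k < 4" for k using that lin[of X] lin[of Y] XY unfolding lt4 by auto
  show "?e k <= d" if "k < 4" for k using that d unfolding lt4 by auto
  show "EX a. f - (\<Sum>k<4. ?m k * \<theta> (a k)) : ideal" for f
  proof -
   obtain a b c d where "f - nf a b c d : ideal" using normal_form by blast
   then show ?thesis
    by (intro exI[of _ "%k. if k = 0 then a else if k = 1 then b else if k = 2 then c else d"]) (simp add: s4 nf_def)
  qed
  show "a k = 0" if "(\<Sum>k<4. ?m k * \<theta> (a k)) : ideal" "k < 4" for a k
  proof -
   have "nf (a 0) (a 1) (a 2) (a 3) : ideal" using that(1) by (simp add: s4 nf_def)
   then have "a 0 = 0" "a 1 = 0" "a 2 = 0" "a 3 = 0" using unique[of "a 0" "a 1" "a 2" "a 3"] ideal_vanish by blast+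
   then show ?thesis using that(2) unfolding lt4 by auto
  qed
 qed
 moreover have "(\<Sum>k<4. d - ?e k + 1) = 4 * d" using d by (simp add: s4)
 ultimately show ?thesis by simp
qed

end

lemma ideal_Const_cancel:
 fixes f :: "('x, 'k::field) mpoly"
 assumes "is_ideal I" "c ~= 0" "Const c * f : I"
 shows "f : I"
proof -
 have "Const (1 / c) * (Const c * f) = (Const (1 / c) * Const c) * f" by (simp only: mult.assoc)
 also have "... = f" using assms(2) by (simp add: Const_simps(4)[symmetric] Const_simps(2))
 finally show ?thesis using idealD(3)[OF assms(1,3), of "Const (1 / c)"] by simp
qed

context frame
begin

lemma frame_23: "frame u1 v1 u3 v3 u2 v2"
proof unfold_locales
 have s: "{u1, v1, u3, v3, u2, v2} = {u1, v1, u2, v2, u3, v3}" by auto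
 show "homogeneous 1 y" if "y \<in> {u1, v1, u3, v3, u2, v2}" for y using lin[of y] that unfolding s .
 show "\<exists>y\<in>{u1, v1, u3, v3, u2, v2}. Var x = y | Var x = - y" for x unfolding s by (rule vars)
 show "EX v. peval v u1 = a1 & peval v v1 = b1 & peval v u3 = a2 & peval v v3 = b2 & peval v u2 = a3 & peval v v2 = b3" for a1 b1 a2 b2 a3 b3
  using ev[of a1 b1 a3 b3 a2 b2] by blast
qed (rule two)

lemma frame_cyc: "frame u2 v2 u3 v3 u1 v1"
proof unfold_locales
 have s: "{u2, v2, u3, v3, u1, v1} = {u1, v1, u2, v2, u3, v3}" by auto
 show "homogeneous 1 y" if "y \<in> {u2, v2, u3, v3, u1, v1}" for y using lin[of y] that unfolding s .
 show "\<exists>y\<in>{u2, v2, u3, v3, u1, v1}. Var x = y | Var x = - y" for x unfolding s by (rule vars)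
 show "EX v. peval v u2 = a1 & peval v v2 = b1 & peval v u3 = a2 & peval v v3 = b2 & peval v u1 = a3 & peval v v1 = b3" for a1 b1 a2 b2 a3 b3
  using ev[of a3 b3 a1 b1 a2 b2] by blast
qed (rule two)

end

context conic
begin

lemma conic_23: "conic u1 v1 u3 v3 u2 v2 t1 t3 t2"
 using frame_23 t by (simp add: conic_def conic_axioms_def)

lemma conic_cyc: "conic u2 v2 u3 v3 u1 v1 t2 t3 t1"
 using frame_cyc t by (simp add: conic_def conic_axioms_def)

lemma ideal_perm: "conic.ideal u1 v1 u3 v3 u2 v2 t1 t3 t2 = ideal" "conic.ideal u2 v2 u3 v3 u1 v1 t2 t3 t1 = ideal"
proof -
 have "{v1 - Const t1 * u1, v3 - Const t3 * u3, v2 - Const t2 * u2, u1 * v1 + u3 * v3 + u2 * v2} =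
   {v1 - Const t1 * u1, v2 - Const t2 * u2, v3 - Const t3 * u3, u1 * v1 + u2 * v2 + u3 * v3}"
  "{v2 - Const t2 * u2, v3 - Const t3 * u3, v1 - Const t1 * u1, u2 * v2 + u3 * v3 + u1 * v1} =
   {v1 - Const t1 * u1, v2 - Const t2 * u2, v3 - Const t3 * u3, u1 * v1 + u2 * v2 + u3 * v3}"
  by (auto simp: add_ac)
 then show "conic.ideal u1 v1 u3 v3 u2 v2 t1 t3 t2 = ideal" "conic.ideal u2 v2 u3 v3 u1 v1 t2 t3 t1 = ideal"
  unfolding conic.ideal_def[OF conic_23] conic.ideal_def[OF conic_cyc] ideal_def by simp_all
qed

lemma u_notin: "u1 ~: ideal" "u2 ~: ideal" "u3 ~: ideal"
proof -
 have n: "u1 ~: ideal" if "conic u1 v1 u2 v2 u3 v3 t1 t2 t3" "conic.ideal u1 v1 u2 v2 u3 v3 t1 t2 t3 = ideal" for u1 v1 u2 v2 u3 v3 :: "('x, 'k) mpoly" and t1 t2 t3 ideal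
 proof
  assume "u1 : ideal"
  then have "lin2 u2 u3 0 + u1 * lin2 u2 u3 1 : conic.ideal u1 v1 u2 v2 u3 v3 t1 t2 t3" using that(2) by simp
  then have "(1 :: (2, 'k) mpoly) = 0" using conic.unique(2)[OF that(1)] conic.ideal_vanish[OF that(1)] by blast
  then show False by simp
 qed
 show "u1 ~: ideal" by (rule n[OF conic_axioms refl])
 show "u2 ~: ideal" by (rule n[OF conic_cyc ideal_perm(2)])
 have "conic u3 v3 u1 v1 u2 v2 t3 t1 t2" "conic.ideal u3 v3 u1 v1 u2 v2 t3 t1 t2 = ideal"
  using conic.conic_cyc[OF conic_cyc] conic.ideal_perm(2)[OF conic_cyc] ideal_perm(2) by simp_all
 then show "u3 ~: ideal" by (rule n)
qed

text \<open>On a conic the three coordinates behave like pairwise coprime elements: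
  \<open>divide\<close> cancels one against another.\<close>

lemma divide3:
 assumes f: "f - u1 * g1 : ideal" "f - u2 * g2 : ideal" "f - u3 * g3 : ideal"
 shows "EX g. f - u1 * u2 * u3 * g : ideal"
proof -
 have "u1 * g1 - u2 * g2 = (f - u2 * g2) - (f - u1 * g1)" by simp
 then have "u1 * g1 - u2 * g2 : ideal" using I(6)[OF f(2,1)] by (simp only:)
 then obtain k where k: "g1 - u2 * k : ideal" using divide by blast
 have "u1 * (u2 * k) - u3 * g3 = (f - u3 * g3) - (f - u1 * g1) - u1 * (g1 - u2 * k)" by (simp add: algebra_simps)
 then have "u1 * (u2 * k) - u3 * g3 : ideal" using I(6)[OF I(6)[OF f(3,1)] I(3)[OF k]] by (simp only:)
 then obtain k2 where k2: "u2 * k - u3 * k2 : ideal"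
  using conic.divide[OF conic_23] unfolding ideal_perm by blast
 then obtain k3 where k3: "k - u3 * k3 : ideal"
  using conic.divide[OF conic_cyc] unfolding ideal_perm by blast
 have "f - u1 * u2 * u3 * k3 = (f - u1 * g1) + u1 * (g1 - u2 * k) + u1 * u2 * (k - u3 * k3)"
  by (simp add: algebra_simps)
 then have "f - u1 * u2 * u3 * k3 : ideal" using I(2)[OF I(2)[OF f(1) I(3)[OF k]] I(3)[OF k3]] by (simp only:)
 then show ?thesis by blast
qed

end

section \<open>The seven curves in one coordinate frame\<close>

locale curves = frame u1 v1 u2 v2 u3 v3 + params \<alpha> \<beta> \<gamma> + line_coords Const \<alpha> \<beta> \<gamma> u1 v1 u2 v2 u3 v3
 for u1 v1 u2 v2 u3 v3 :: "('x::finite, 'k::alg_closed_field) mpoly" and \<alpha> \<beta> \<gamma> :: 'k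
begin

definition "E1 = ideal_gen {u1, v1, P, F1}"
definition "E2 = ideal_gen {u2, v2, P, F2}"
definition "E3 = ideal_gen {u3, v3, P, F3}"

lemma E_is_ideal: "is_ideal E1" "is_ideal E2" "is_ideal E3" and K_is_ideal: "is_ideal (K c)"
 by (simp_all add: E1_def E2_def E3_def K_def)

lemma curves_cyc: "curves u2 v2 u3 v3 u1 v1 \<beta> \<gamma> \<alpha>"
proof -
 have "params \<beta> \<gamma> \<alpha>" by unfold_locales (use char nz con in "auto simp: algebra_simps")
 then show ?thesis using frame_cyc by (simp add: curves_def)
qed

lemma E_cyc: "curves.E1 u2 v2 u3 v3 u1 v1 \<gamma> \<alpha> = E2" "curves.E2 u2 v2 u3 v3 u1 v1 \<beta> \<alpha> = E3" "curves.E3 u2 v2 u3 v3 u1 v1 \<beta> \<gamma> = E1"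
proof -
 have P: "line_coords.P u2 v2 u3 v3 u1 v1 = P" by (simp add: line_coords.P_def add_ac)
 show "curves.E1 u2 v2 u3 v3 u1 v1 \<gamma> \<alpha> = E2" "curves.E2 u2 v2 u3 v3 u1 v1 \<beta> \<alpha> = E3" "curves.E3 u2 v2 u3 v3 u1 v1 \<beta> \<gamma> = E1"
  unfolding curves.E1_def[OF curves_cyc] curves.E2_def[OF curves_cyc] curves.E3_def[OF curves_cyc] E1_def E2_def E3_def P
  by (simp_all add: line_coords.F1_def line_coords.F2_def line_coords.F3_def)
qed

text \<open>In the coordinates \<open>v3 + s*u3\<close>, \<open>v3 - s*u3\<close>,
  \<open>v2 + r*u2\<close>, \<open>v2 - r*u2\<close> with \<open>s^2 = \<gamma>\<close> and
  \<open>r^2 = - \<beta>\<close> the pencil of \<open>F1\<close> and \<open>P\<close> contains two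
  diagonal quadrics: modulo \<open>u1\<close> and \<open>v1\<close> they are \<open>F1\<close> plus
  and minus \<open>2*s*(1 - \<beta>)*P\<close>, divided by \<open>1 - \<beta>\<close>.\<close>

lemma E1_quartic:
 obtains s r p q where "quartic (v3 + Const s * u3) (v3 - Const s * u3) (v2 + Const r * u2) (v2 - Const r * u2) u1 v1 p q"
  "quartic.ideal (v3 + Const s * u3) (v3 - Const s * u3) (v2 + Const r * u2) (v2 - Const r * u2) u1 v1 p q = E1"
proof -
 obtain s r where sr: "s^2 = \<gamma>" "r^2 = - \<beta>"
  using nth_root_exists[of 2 \<gamma>] nth_root_exists[of 2 "- \<beta>"] by auto
 have s0: "s ~= 0" "r ~= 0" using sr nzs by auto
 \<comment> \<open>Comparing the coefficients of \<open>v2^2\<close> and of \<open>u2*v2\<close>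
   prescribes \<open>p + q = H\<close> and \<open>p - q = - G\<close>.\<close>
 define H G where "H = (1 + \<gamma>) / (1 - \<beta>)" and "G = s / r"
 define p q where "p = (H - G) / 2" and "q = (H + G) / 2"
 have "2 * p = H - G" "2 * q = H + G" using two by (simp_all add: p_def q_def)
 then have "2 * (p + q) = 2 * H" "2 * (p - q) = 2 * (- G)" by Groebner_Basis.algebra+
 then have "p + q = H" "p - q = - G" using two by (metis mult_cancel_left)+
 then have pq: "p + q = (1 + \<gamma>) / (1 - \<beta>)" "p - q = - (s / r)" by (simp_all only: H_def G_def)
 then have pq': "(p + q) * (1 - \<beta>) = 1 + \<gamma>" "(p - q) * r = - s" using nzs s0 by simp_all
 have "(p + q) * (p - q) ~= 0" unfolding pq using nzs s0 by simp
 moreover have "(p + q) * (p - q) = p^2 - q^2" by (simp add: algebra_simps power2_eq_square)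
 ultimately have ne: "p^2 ~= q^2" by auto
 \<comment> \<open>As \<open>4*p*q = (p + q)^2 - (p - q)^2\<close>, the nonvanishing of
   \<open>p*q\<close> comes down to \<open>bc\<close>.\<close>
 have "\<beta> * ((p + q) * (1 - \<beta>))^2 + (1 - \<beta>)^2 * ((p - q) * r)^2 = (\<beta> + \<gamma>) * (1 + \<beta> * \<gamma>)"
  unfolding pq' power2_minus sr(1) by Groebner_Basis.algebra
 moreover have "\<beta> * ((p + q) * (1 - \<beta>))^2 + (1 - \<beta>)^2 * ((p - q) * r)^2 = 4 * p * q * \<beta> * (1 - \<beta>)^2"
  using sr(2) by Groebner_Basis.algebra
 ultimately have "4 * p * q * \<beta> * (1 - \<beta>)^2 ~= 0" using bc by simp
 then have p0: "p ~= 0" "q ~= 0" by auto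
 let ?X = "v3 + Const s * u3" and ?Y = "v3 - Const s * u3" and ?Z = "v2 + Const r * u2" and ?W = "v2 - Const r * u2"
 have h: "Const (1 / 2) * (a + Const t * b) + Const (1 / 2) * (a - Const t * b) = a"
  "Const (1 / (2 * t)) * (a + Const t * b) + Const (- (1 / (2 * t))) * (a - Const t * b) = b"
  if "t ~= 0" for a b :: "('x, 'k) mpoly" and t
 proof -
  define e u where "e = 1 / (2 :: 'k)" and "u = 1 / (2 * t)"
  have eu: "2 * e = 1" "2 * t * u = 1" using two that by (simp_all add: e_def u_def)
  have w: "e * (x + t * y) + e * (x - t * y) = x" "u * (x + t * y) + - u * (x - t * y) = y" for x y
   using eu by Groebner_Basis.algebra+
  have "Const e * (a + Const t * b) + Const e * (a - Const t * b) = a"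
  proof (rule peval_eqI)
   fix v
   have "peval v (Const e * (a + Const t * b) + Const e * (a - Const t * b)) = e * (peval v a + t * peval v b) + e * (peval v a - t * peval v b)" by simp
   also have "... = peval v a" by (rule w)
   finally show "peval v (Const e * (a + Const t * b) + Const e * (a - Const t * b)) = peval v a" .
  qed
  then show "Const (1 / 2) * (a + Const t * b) + Const (1 / 2) * (a - Const t * b) = a" by (simp only: e_def)
  have "Const u * (a + Const t * b) + Const (- u) * (a - Const t * b) = b"
  proof (rule peval_eqI)
   fix v
   have "peval v (Const u * (a + Const t * b) + Const (- u) * (a - Const t * b)) = u * (peval v a + t * peval v b) + - u * (peval v a - t * peval v b)" by simp
   also have "... = peval v b" by (rule w)
   finally show "peval v (Const u * (a + Const t * b) + Const (- u) * (a - Const t * b)) = peval v b" .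
  qed
  then show "Const (1 / (2 * t)) * (a + Const t * b) + Const (- (1 / (2 * t))) * (a - Const t * b) = b" by (simp only: u_def)
 qed
 define Q where "Q y \<longleftrightarrow> (EX a b c d e f. y = Const a * ?X + Const b * ?Y + Const c * ?Z + Const d * ?W + Const e * u1 + Const f * v1)" for y
 have QI: "Q y" if "y = Const a * ?X + Const b * ?Y + Const c * ?Z + Const d * ?W + Const e * u1 + Const f * v1" for y a b c d e f
  unfolding Q_def using that by blast
 have Qn: "Q (- y)" if Qy: "Q y" for y
 proof -
  obtain a b c d e f where "y = Const a * ?X + Const b * ?Y + Const c * ?Z + Const d * ?W + Const e * u1 + Const f * v1"
   using Qy unfolding Q_def by blast
  then have "- y = Const (- a) * ?X + Const (- b) * ?Y + Const (- c) * ?Z + Const (- d) * ?W + Const (- e) * u1 + Const (- f) * v1"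
   by (simp add: Const_simps)
  then show ?thesis by (rule QI)
 qed
 have Q6: "Q u1" "Q v1" "Q u2" "Q v2" "Q u3" "Q v3"
  using QI[of u1 0 0 0 0 1 0] QI[of v1 0 0 0 0 0 1] h(2)[OF s0(2), of v2 u2] QI[of u2 0 0 "1 / (2 * r)" "- (1 / (2 * r))" 0 0]
   h(1)[OF s0(2), of v2 u2] QI[of v2 0 0 "1 / 2" "1 / 2" 0 0]
   h(2)[OF s0(1), of v3 u3] QI[of u3 "1 / (2 * s)" "- (1 / (2 * s))" 0 0 0 0]
   h(1)[OF s0(1), of v3 u3] QI[of v3 "1 / 2" "1 / 2" 0 0 0 0]
  by (simp_all only: Const_simps(1,2) mult_zero_left mult_1_left add_0_left add_0_right)
 interpret q: quartic ?X ?Y ?Z ?W u1 v1 p q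
 proof unfold_locales
  show "homogeneous 1 y" if "y : {?X, ?Y, ?Z, ?W, u1, v1}" for y
   using that lin[of u1] lin[of v1] lin[of u2] lin[of v2] lin[of u3] lin[of v3]
   by (auto intro!: homogeneous_add homogeneous_diff homogeneous_Const_mult)
  show "EX a b c d e f. Var x = Const a * ?X + Const b * ?Y + Const c * ?Z + Const d * ?W + Const e * u1 + Const f * v1" for x
  proof -
   obtain y where y: "y : {u1, v1, u2, v2, u3, v3}" "Var x = y | Var x = - y" using vars by blast
   have "Q y" using y(1) Q6 by blast
   then have "Q (Var x)" using y(2) Qn by metis
   then show ?thesis by (simp only: Q_def)
  qed
  show "EX v. peval v ?X = a & peval v ?Y = b & peval v ?Z = c & peval v ?W = d & peval v u1 = 0 & peval v v1 = 0" for a b c d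
  proof -
   obtain v where v: "peval v u1 = 0" "peval v v1 = 0" "peval v u2 = (c - d) / (2 * r)" "peval v v2 = (c + d) / 2"
     "peval v u3 = (a - b) / (2 * s)" "peval v v3 = (a + b) / 2"
    using ev by blast
   have hf: "(x + y) / 2 + (x - y) / 2 = x" "(x + y) / 2 - (x - y) / 2 = y" for x y :: 'k
   proof -
    have a: "2 * ((x + y) / 2) = x + y" "2 * ((x - y) / 2) = x - y" using two by simp_all
    then have "2 * ((x + y) / 2 + (x - y) / 2) = 2 * x" "2 * ((x + y) / 2 - (x - y) / 2) = 2 * y"
     by (simp_all only: distrib_left right_diff_distrib a) simp_all
    then show "(x + y) / 2 + (x - y) / 2 = x" "(x + y) / 2 - (x - y) / 2 = y" using two by (metis mult_cancel_left)+
   qed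
   have c: "t * (x / (2 * t)) = x / 2" if "t ~= 0" for t x :: 'k using that by simp
   have pe: "peval v ?X = peval v v3 + s * peval v u3" "peval v ?Y = peval v v3 - s * peval v u3"
    "peval v ?Z = peval v v2 + r * peval v u2" "peval v ?W = peval v v2 - r * peval v u2" by simp_all
   have "peval v ?X = a" "peval v ?Y = b" "peval v ?Z = c" "peval v ?W = d"
    unfolding pe v c[OF s0(1)] c[OF s0(2)] by (rule hf)+
   then show ?thesis using v(1,2) by blast
  qed
 qed (use two p0 ne in auto)
 let ?A = "?X^2 - lin2 ?Z ?W q.L1" and ?B = "?Y^2 - lin2 ?Z ?W q.L2"
 have k: "(1 - \<beta>) * ((V3 + s * U3)^2 - (p * (V2 + r * U2)^2 + q * (V2 - r * U2)^2)) =
   ((1 - \<beta>) * (V3^2 + \<gamma> * U3^2) - (1 + \<gamma>) * (V2^2 - \<beta> * U2^2)) + 2 * s * (1 - \<beta>) * (U2 * V2 + U3 * V3)"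
  if h: "s^2 = \<gamma>" "(p + q) * (1 - \<beta>) = 1 + \<gamma>" "(p - q) * r = - s" for s p q U2 V2 U3 V3
 proof -
  have "(1 - \<beta>) * ((V3 + s * U3)^2 - (p * (V2 + r * U2)^2 + q * (V2 - r * U2)^2)) =
   (1 - \<beta>) * (V3^2 + s^2 * U3^2) - ((p + q) * (1 - \<beta>)) * (V2^2 + r^2 * U2^2) + 2 * s * (1 - \<beta>) * U3 * V3 - 2 * (1 - \<beta>) * ((p - q) * r) * (V2 * U2)"
   by Groebner_Basis.algebra
  also have "... = ((1 - \<beta>) * (V3^2 + \<gamma> * U3^2) - (1 + \<gamma>) * (V2^2 - \<beta> * U2^2)) + 2 * s * (1 - \<beta>) * (U2 * V2 + U3 * V3)"
   unfolding h sr(2) by Groebner_Basis.algebra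
  finally show ?thesis .
 qed
 have id: "Const (1 - \<beta>) * ?A = F1 + Const (2 * s * (1 - \<beta>)) * (P - u1 * v1)"
 proof (rule peval_eqI)
  fix v
  have "peval v (Const (1 - \<beta>) * ?A) = (1 - \<beta>) * ((peval v v3 + s * peval v u3)^2 - (p * (peval v v2 + r * peval v u2)^2 + q * (peval v v2 - r * peval v u2)^2))"
   by (simp add: q.L1_def)
  also note k[OF sr(1) pq']
  finally show "peval v (Const (1 - \<beta>) * ?A) = peval v (F1 + Const (2 * s * (1 - \<beta>)) * (P - u1 * v1))"
   by (simp add: F1_def P_def)
 qed
 have idB: "Const (1 - \<beta>) * ?B = F1 - Const (2 * s * (1 - \<beta>)) * (P - u1 * v1)"
 proof (rule peval_eqI)
  fix v
  have h: "(- s)^2 = \<gamma>" "(q + p) * (1 - \<beta>) = 1 + \<gamma>" "(q - p) * r = - (- s)"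
  proof -
   show "(- s)^2 = \<gamma>" using sr(1) by simp
   show "(q + p) * (1 - \<beta>) = 1 + \<gamma>" using pq'(1) by (simp only: add.commute[of q p])
   show "(q - p) * r = - (- s)" using pq'(2) by Groebner_Basis.algebra
  qed
  have "peval v (Const (1 - \<beta>) * ?B) = (1 - \<beta>) * ((peval v v3 + - s * peval v u3)^2 - (q * (peval v v2 + r * peval v u2)^2 + p * (peval v v2 - r * peval v u2)^2))"
   by (simp add: q.L2_def)
  also note k[OF h]
  finally show "peval v (Const (1 - \<beta>) * ?B) = peval v (F1 - Const (2 * s * (1 - \<beta>)) * (P - u1 * v1))"
   by (simp add: F1_def P_def)
 qed
 have id2: "Const 2 * F1 = Const (1 - \<beta>) * ?A + Const (1 - \<beta>) * ?B"
  "Const (4 * s * (1 - \<beta>)) * P = Const (1 - \<beta>) * ?A - Const (1 - \<beta>) * ?B + Const (4 * s * (1 - \<beta>)) * (u1 * v1)"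
  unfolding id idB by (rule peval_eqI; simp add: algebra_simps)+
 have four: "(4 :: 'k) ~= 0" using two by (metis mult_eq_0_iff numeral_Bit0_eq_double)
 have "q.ideal = E1"
 proof
  have g: "u1 : E1" "v1 : E1" "P : E1" "F1 : E1" by (simp_all add: E1_def ideal_gen_base)
  have m: "P - u1 * v1 : E1" by (intro idealD(3,6)[OF E_is_ideal(1)] g)
  have "Const (1 - \<beta>) * ?A : E1" "Const (1 - \<beta>) * ?B : E1"
   unfolding id idB by (intro idealD(2,3,6)[OF E_is_ideal(1)] g m)+
  then have "?A : E1" "?B : E1" using ideal_Const_cancel[OF E_is_ideal(1), of "1 - \<beta>"] nzs by blast+
  then show "q.ideal \<subseteq> E1" unfolding q.ideal_def using g by (intro ideal_gen_minimal E_is_ideal) auto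
  have "Const 2 * F1 : q.ideal" "Const (4 * s * (1 - \<beta>)) * P : q.ideal"
   unfolding id2 by (intro q.I q.gens)+
  note i = this
  have "F1 : q.ideal" "P : q.ideal"
  proof -
   have n: "4 * s * (1 - \<beta>) ~= 0" using four s0 nzs by simp
   show "F1 : q.ideal" by (rule ideal_Const_cancel[OF q.is_ideal two i(1)])
   show "P : q.ideal" by (rule ideal_Const_cancel[OF q.is_ideal n i(2)])
  qed
  then show "E1 \<subseteq> q.ideal" unfolding E1_def using q.gens by (intro ideal_gen_minimal q.is_ideal) auto
 qed
 then show ?thesis using that q.quartic_axioms by blast
qed

definition "zero1 v \<longleftrightarrow> peval v u1 = 0 & peval v v1 = 0 & peval v P = 0 & peval v F1 = 0"
definition "zero2 v \<longleftrightarrow> peval v u2 = 0 & peval v v2 = 0 & peval v P = 0 & peval v F2 = 0"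
definition "zero3 v \<longleftrightarrow> peval v u3 = 0 & peval v v3 = 0 & peval v P = 0 & peval v F3 = 0"

lemma zero_cyc: "curves.zero1 u2 v2 u3 v3 u1 v1 \<gamma> \<alpha> = zero2" "curves.zero2 u2 v2 u3 v3 u1 v1 \<beta> \<alpha> = zero3"
proof -
 have P: "line_coords.P u2 v2 u3 v3 u1 v1 = P" by (simp add: line_coords.P_def add_ac)
 show "curves.zero1 u2 v2 u3 v3 u1 v1 \<gamma> \<alpha> = zero2" "curves.zero2 u2 v2 u3 v3 u1 v1 \<beta> \<alpha> = zero3"
  unfolding curves.zero1_def[OF curves_cyc] curves.zero2_def[OF curves_cyc] zero2_def zero3_def P fun_eq_iff
  by (simp_all add: line_coords.F1_def line_coords.F2_def line_coords.F3_def)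
qed

lemma E1_prime: "f * g : E1 ==> f : E1 | g : E1"
 by (rule E1_quartic) (use quartic.prime in blast)

lemma E1_codim: "2 <= d ==> codim (forms d UNIV) (forms d E1) (4 * d)"
 by (rule E1_quartic) (use quartic.codim_ideal in metis)

lemma E1_graded: "graded E1"
 by (rule E1_quartic) (use quartic.graded in metis)

lemma E1_iff: "f : E1 \<longleftrightarrow> (ALL v. zero1 v --> v ~= 0 --> peval v f = 0)"
proof (rule E1_quartic)
 fix s r p q
 assume q: "quartic (v3 + Const s * u3) (v3 - Const s * u3) (v2 + Const r * u2) (v2 - Const r * u2) u1 v1 p q"
  and e: "quartic.ideal (v3 + Const s * u3) (v3 - Const s * u3) (v2 + Const r * u2) (v2 - Const r * u2) u1 v1 p q = E1"
 interpret q: quartic "v3 + Const s * u3" "v3 - Const s * u3" "v2 + Const r * u2" "v2 - Const r * u2" u1 v1 p q by (rule q)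
 have "q.cone v \<longleftrightarrow> zero1 v" for v
 proof
  assume "q.cone v"
  then have "peval v f = 0" if "f : E1" for f using q.ideal_vanish that unfolding e by blast
  then show "zero1 v" by (simp add: zero1_def E1_def ideal_gen_base)
 next
  assume "zero1 v"
  then have z: "peval v f = 0" if "f : q.ideal" for f
   using that unfolding e E1_def by (rule_tac peval_ideal_gen) (auto simp: zero1_def)
  show "q.cone v"
   using q.gens[THEN z] by (simp add: q.cone_def q.L1_def q.L2_def rhom_diff[OF peval_rhom])
 qed
 then show ?thesis using q.in_ideal_iff[of f] by (simp only: e)
qed

lemmas E2_prime = curves.E1_prime[OF curves_cyc, unfolded E_cyc]
 and E2_codim = curves.E1_codim[OF curves_cyc, unfolded E_cyc]
 and E2_graded = curves.E1_graded[OF curves_cyc, unfolded E_cyc]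
 and E2_iff = curves.E1_iff[OF curves_cyc, unfolded E_cyc zero_cyc]

lemmas E3_prime = curves.E2_prime[OF curves_cyc, unfolded E_cyc]
 and E3_codim = curves.E2_codim[OF curves_cyc, unfolded E_cyc]
 and E3_graded = curves.E2_graded[OF curves_cyc, unfolded E_cyc]
 and E3_iff = curves.E2_iff[OF curves_cyc, unfolded E_cyc zero_cyc]

lemma K_conic: "conic u1 v1 u2 v2 u3 v3 (slope1 \<alpha> c) (slope2 \<beta> c) (slope3 \<gamma> c)"
 by unfold_locales (use nzs in "auto simp: slope_defs")

lemma K_eq: "conic.ideal u1 v1 u2 v2 u3 v3 (slope1 \<alpha> c) (slope2 \<beta> c) (slope3 \<gamma> c) = K c"
 by (simp add: conic.ideal_def[OF K_conic] K_def A_def B_def W_def P_def)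

lemmas K_prime = conic.prime[OF K_conic, unfolded K_eq]
 and K_codim = conic.codim_ideal[OF K_conic, unfolded K_eq]
 and K_graded = conic.graded[OF K_conic, unfolded K_eq]
 and K_iff = conic.in_ideal_iff[OF K_conic, unfolded K_eq]
 and K_u_notin = conic.u_notin[OF K_conic, unfolded K_eq]
 and K_divide3 = conic.divide3[OF K_conic, unfolded K_eq]

section \<open>Disjointness and the Hilbert functions of the unions\<close>

lemma K_comax: "c ~= c' ==> thick 1 (isum (K c) (K c'))"
proof (rule thick_Vars)
 assume c: "c ~= c'"
 show i: "is_ideal (isum (K c) (K c'))" by (simp add: isum_ideal K_is_ideal)
 note I = idealD[OF i]
 have *: "u : isum (K c) (K c') & v : isum (K c) (K c')"
  if g: "v - Const s * u : K c" "v - Const t * u : K c'" "s ~= t" for u v s t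
 proof -
  have m: "v - Const s * u : isum (K c) (K c')" "v - Const t * u : isum (K c) (K c')"
   using g isum_left isum_right K_is_ideal by blast+
  have "Const (t - s) * u = (v - Const s * u) - (v - Const t * u)" by (simp add: Const_simps algebra_simps)
  then have "Const (t - s) * u : isum (K c) (K c')" using I(6)[OF m] by (simp only:)
  then have u: "u : isum (K c) (K c')" using ideal_Const_cancel[OF i, of "t - s"] g(3) by simp
  have "v = (v - Const s * u) + Const s * u" by simp
  then show ?thesis using u I(2)[OF m(1) I(3)[OF u]] by metis
 qed
 have g: "A c : K c" "B c : K c" "W c : K c" for c by (simp_all add: K_def ideal_gen_base)
 have "slope1 \<alpha> c ~= slope1 \<alpha> c'" "slope2 \<beta> c ~= slope2 \<beta> c'" "slope3 \<gamma> c ~= slope3 \<gamma> c'"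
  using c inj_slopes by (auto dest: injD)
 then have "y : isum (K c) (K c')" if "y : {u1, v1, u2, v2, u3, v3}" for y
  using *[OF g(1)[of c, unfolded A_def] g(1)[of c', unfolded A_def]] *[OF g(2)[of c, unfolded B_def] g(2)[of c', unfolded B_def]]
   *[OF g(3)[of c, unfolded W_def] g(3)[of c', unfolded W_def]] that by auto
 then show "Var x : isum (K c) (K c')" for x using vars[of x] I(5) by metis
qed

text \<open>Modulo \<open>u1, v1, u2, v2\<close> the sum contains \<open>u3*v3\<close> by
  \<open>P\<close>, and \<open>v3^2\<close> and \<open>u3^2\<close> by the combinations of
  \<open>(1 + \<alpha>)*F1\<close> with minus or plus \<open>(1 - \<beta>)*F2\<close>; hence it
  contains all forms of degree two.\<close>

lemma E12_comax: "thick 2 (isum E1 E2)"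
proof -
 let ?I = "isum E1 E2"
 have i: "is_ideal ?I" by (simp add: isum_ideal E_is_ideal)
 note I = idealD[OF i]
 have "u1 : E1" "v1 : E1" "P : E1" "F1 : E1" "u2 : E2" "v2 : E2" "F2 : E2"
  by (simp_all add: E1_def E2_def ideal_gen_base)
 then have g: "u1 : ?I" "v1 : ?I" "P : ?I" "F1 : ?I" "u2 : ?I" "v2 : ?I" "F2 : ?I"
  using isum_left isum_right E_is_ideal by blast+
 have e: "u3 * v3 = P - u1 * v1 - u2 * v2"
  "Const (2 * (1 - \<beta>) * (1 + \<alpha>)) * v3^2 = Const (1 + \<alpha>) * (F1 + Const (1 + \<gamma>) * (v2 * v2 - Const \<beta> * (u2 * u2)))
   - Const (1 - \<beta>) * (F2 - Const (1 - \<gamma>) * (v1 * v1 + Const \<alpha> * (u1 * u1)))"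
  "Const (2 * (1 - \<beta>) * (1 + \<alpha>) * \<gamma>) * u3^2 = Const (1 + \<alpha>) * (F1 + Const (1 + \<gamma>) * (v2 * v2 - Const \<beta> * (u2 * u2)))
   + Const (1 - \<beta>) * (F2 - Const (1 - \<gamma>) * (v1 * v1 + Const \<alpha> * (u1 * u1)))"
  by (simp add: P_def, (rule peval_eqI; simp add: F1_def F2_def rhom_diff[OF peval_rhom]; Groebner_Basis.algebra)+)
 have "u3 * v3 : ?I" "Const (2 * (1 - \<beta>) * (1 + \<alpha>)) * v3^2 : ?I" "Const (2 * (1 - \<beta>) * (1 + \<alpha>) * \<gamma>) * u3^2 : ?I"
  unfolding e by (intro I(2) I(3) I(6) g)+
 note sq = this
 have n: "2 * (1 - \<beta>) * (1 + \<alpha>) ~= 0" "2 * (1 - \<beta>) * (1 + \<alpha>) * \<gamma> ~= 0" using two nzs by simp_all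
 have s: "u3 * v3 : ?I" "v3 * v3 : ?I" "u3 * u3 : ?I" "v3 * u3 : ?I"
  using sq(1) ideal_Const_cancel[OF i n(1) sq(2)] ideal_Const_cancel[OF i n(2) sq(3)] by (simp_all only: power2_eq_square mult.commute[of v3 u3])
 have L: "u1 * x : ?I" "v1 * x : ?I" "u2 * x : ?I" "v2 * x : ?I" "x * u1 : ?I" "x * v1 : ?I" "x * u2 : ?I" "x * v2 : ?I" for x
  by (rule I(4)[OF g(1)] I(4)[OF g(2)] I(4)[OF g(5)] I(4)[OF g(6)] I(3)[OF g(1)] I(3)[OF g(2)] I(3)[OF g(5)] I(3)[OF g(6)])+
 have m: "y * y' : ?I" if "y : {u1, v1, u2, v2, u3, v3}" "y' \<in> {u1, v1, u2, v2, u3, v3}" for y y'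
  using that by (elim insertE emptyE) (simp_all only: L s)
 have V: "Var x * Var x' : ?I" for x x'
 proof -
  obtain y y' where y: "y : {u1, v1, u2, v2, u3, v3}" "Var x = y | Var x = - y" "y' : {u1, v1, u2, v2, u3, v3}" "Var x' = y' | Var x' = - y'"
   using vars by meson
  then show ?thesis using m[OF y(1,3)] I(5)[OF m[OF y(1,3)]] by auto
 qed
 let ?M = "ideal_gen (range Var)"
 have M: "thick 1 ?M" by (rule thick_Vars) (simp_all add: ideal_gen_base)
 have sub: "?M \<subseteq> {g. g * f : ?I}" if "!!x. Var x * f : ?I" for f
  by (rule ideal_gen_minimal[OF colon_is_ideal[OF i]]) (use that in auto)
 have "f * Var x : ?I" if "f : ?M" for f x using sub[OF V] that by auto
 then have "g * f : ?I" if "f : ?M" "g : ?M" for f g using sub[of f] that by (auto simp: mult.commute)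
 then have "thick (1 + 1) ?I" using thick_mult[OF M M i] by blast
 then show ?thesis by (simp add: numeral_2_eq_2)
qed

lemmas E23_comax = curves.E12_comax[OF curves_cyc, unfolded E_cyc]
lemmas E31_comax = curves.E23_comax[OF curves_cyc, unfolded E_cyc]

definition "JE = E1 Int E2 Int E3"
definition "JC = K 0 Int K 1 Int K 2 Int K 3"

lemma J_ideal: "is_ideal JE" "is_ideal JC" "graded JE" "graded JC"
 by (simp_all add: JE_def JC_def is_ideal_Int graded_Int E_is_ideal K_is_ideal E1_graded E2_graded E3_graded K_graded)

lemma codim_JE: "4 <= d ==> codim (forms d UNIV) (forms d JE) (12 * d)"
proof -
 assume d: "4 <= d"
 have t: "thick 4 (isum (E1 Int E2) E3)"
 proof -
  have b: "thick 2 (isum E3 E2)" using E23_comax unfolding isum_commute[of E2 E3] .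
  have "thick (2 + 2) (isum E3 (E1 Int E2))" by (rule thick_Int[OF E_is_ideal(3,1,2) E31_comax b])
  then show ?thesis unfolding isum_commute[of E3] by simp
 qed
 have "codim (forms d UNIV) (forms d (E1 Int E2 Int E3)) (4 * d + 4 * d + 4 * d)"
  using d by (intro codim_forms_Int[OF t] codim_forms_Int[OF E12_comax] graded_Int is_ideal_Int E_is_ideal E1_graded E2_graded E3_graded E1_codim E2_codim E3_codim) auto
 then show ?thesis by (simp add: JE_def)
qed

lemma JC_comax: "thick 2 (isum (K 0 Int K 1) (K 2))" "thick 3 (isum (K 0 Int K 1 Int K 2) (K 3))"
proof -
 have 0: "thick 1 (isum (K 3) (K 0))" "thick 1 (isum (K 3) (K 1))" "thick 1 (isum (K 3) (K 2))"
  "thick 1 (isum (K 2) (K 0))" "thick 1 (isum (K 2) (K 1))" by (rule K_comax; simp)+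
 show "thick 2 (isum (K 0 Int K 1) (K 2))"
  using thick_Int[OF K_is_ideal K_is_ideal K_is_ideal 0(4,5)] by (simp add: isum_commute[of "K 2"] numeral_2_eq_2)
 have "thick (1 + 1 + 1) (isum (K 3) (K 0 Int K 1 Int K 2))"
  by (intro thick_Int is_ideal_Int K_is_ideal 0)
 then show "thick 3 (isum (K 0 Int K 1 Int K 2) (K 3))" by (simp add: isum_commute[of "K 3"] numeral_3_eq_3)
qed

lemma codim_JC: "3 <= d ==> codim (forms d UNIV) (forms d JC) (4 * (2 * d + 1))"
proof -
 assume d: "3 <= d"
 have t: "thick 1 (isum (K 0) (K 1))" by (rule K_comax) simp
 have "codim (forms d UNIV) (forms d (K 0 Int K 1 Int K 2 Int K 3)) ((2 * d + 1) + (2 * d + 1) + (2 * d + 1) + (2 * d + 1))"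
  using d by (intro codim_forms_Int[OF JC_comax(2)] codim_forms_Int[OF JC_comax(1)] codim_forms_Int[OF t] graded_Int is_ideal_Int K_is_ideal K_graded K_codim) auto
 moreover have "(2 * d + 1) + (2 * d + 1) + (2 * d + 1) + (2 * d + 1) = 4 * (2 * d + 1)" by simp
 ultimately show ?thesis by (simp only: JC_def)
qed

text \<open>The residues are joined one conic at a time; the comaximality bounds are 1, 2 and 3,
  whence the degree.\<close>

lemma JC_crt:
 assumes d: "3 <= d" and f: "!!c. homogeneous d (f c)"
 shows "EX g. homogeneous d g & (ALL c. g - f c : K c)"
proof -
 have step: "EX g. homogeneous d g & g - a : I & g - b : J"
  if t: "thick m (isum I J)" "m <= d" "graded I" "graded J" "is_ideal I" "is_ideal J" "homogeneous d a" "homogeneous d b" for m I J a b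
 proof -
  have "homogeneous d (b - a)" using t by (intro homogeneous_diff)
  then obtain u where u: "u : forms d I" "b - a - u : forms d J" using comaximal_split[OF t(1,3,4,2)] by blast
  have "homogeneous d (a + u)" using u(1) t(7) by (auto simp: forms_def intro: homogeneous_add)
  moreover have "a + u - a : I" using u by (simp add: forms_def)
  moreover have "a + u - b : J"
  proof -
   have e: "a + u - b = - (b - a - u)" by simp
   have "b - a - u : J" using u(2) by (simp add: forms_def)
   then show ?thesis unfolding e by (rule idealD(5)[OF t(6)])
  qed
  ultimately show ?thesis by blast
 qed
 have t: "thick 1 (isum (K 0) (K 1))" by (rule K_comax) simp
 obtain g1 where g1: "homogeneous d g1" "g1 - f 0 : K 0" "g1 - f 1 : K 1"
  using step[OF t _ K_graded K_graded K_is_ideal K_is_ideal f f] d by auto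
 obtain g2 where g2: "homogeneous d g2" "g2 - g1 : K 0 Int K 1" "g2 - f 2 : K 2"
  using step[OF JC_comax(1) _ graded_Int[OF K_graded K_graded] K_graded is_ideal_Int[OF K_is_ideal K_is_ideal] K_is_ideal g1(1) f] d by auto
 obtain g3 where g3: "homogeneous d g3" "g3 - g2 : K 0 Int K 1 Int K 2" "g3 - f 3 : K 3"
  using step[OF JC_comax(2) _ graded_Int[OF graded_Int[OF K_graded K_graded] K_graded] K_graded
    is_ideal_Int[OF is_ideal_Int[OF K_is_ideal K_is_ideal] K_is_ideal] K_is_ideal g2(1) f] d by auto
 have tr: "x - z : K c" if "x - y : K c" "y - z : K c" for x y z c
  using idealD(2)[OF K_is_ideal that] by simp
 have "g3 - f c : K c" for c
  using exhaust_4'[of c] tr[of g3 g2 0 "f 0"] tr[of g2 g1 0 "f 0"] tr[of g3 g2 1 "f 1"] tr[of g2 g1 1 "f 1"] tr[of g3 g2 2 "f 2"] g1 g2 g3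
  by auto
 then show ?thesis using g3 by blast
qed

text \<open>On the plane of a conic, the quadric cutting out an elliptic curve is a multiple of the square
 of the coordinate vanishing on the curve.\<close>

lemma E1_mod_K: "f : E1 ==> EX g. f - u1 * g : K c"
proof -
 assume "f : E1"
 then obtain a b e h where f: "f = a * u1 + b * v1 + e * P + h * F1" unfolding E1_def by (rule ideal_gen_4E)
 let ?x = "slope1 \<alpha> c" and ?y = "slope2 \<beta> c" and ?z = "slope3 \<gamma> c"
 \<comment> \<open>On the plane of the conic \<open>F1\<close> becomes \<kappa> times
   \<open>t2*u2^2 + t3*u3^2\<close>, which is \<open>- \<kappa> * t1 * u1^2\<close> modulo
   \<open>P\<close>.\<close>
 obtain \<kappa> where k: "(1 - \<beta>) * (?z^2 + \<gamma>) = \<kappa> * ?z" "- (1 + \<gamma>) * (?y^2 - \<beta>) = \<kappa> * ?y"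
 proof (rule that)
  let ?k = "if c = 0 then - (1 - \<beta>) * (1 + \<gamma>) else if c = 1 then - (1 - \<beta>) * (1 + \<gamma>) else if c = 2 then (1 - \<beta>) * (1 + \<gamma>) else (1 - \<beta>) * (1 + \<gamma>)"
  show "(1 - \<beta>) * (?z^2 + \<gamma>) = ?k * ?z" "- (1 + \<gamma>) * (?y^2 - \<beta>) = ?k * ?y"
   by (simp_all add: slope_defs algebra_simps power2_eq_square)
 qed
 have g: "A c : K c" "B c : K c" "W c : K c" "P : K c" by (simp_all add: K_def ideal_gen_base)
 have k': "F1 + Const (\<kappa> * ?x) * u1^2 = Const (1 - \<beta>) * ((v3 + Const ?z * u3) * W c) - Const (1 + \<gamma>) * ((v2 + Const ?y * u2) * B c)
  + Const \<kappa> * (P - u1 * A c - u2 * B c - u3 * W c)"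
  by (rule peval_eqI; simp add: F1_def P_def A_def B_def W_def rhom_diff[OF peval_rhom]; use k in Groebner_Basis.algebra)
 have F: "F1 + Const (\<kappa> * ?x) * u1^2 : K c"
  unfolding k' using g by (intro idealD(2,3,6)[OF K_is_ideal])
 have "f - u1 * (a + b * Const ?x - h * (Const (\<kappa> * ?x) * u1)) = b * A c + e * P + h * (F1 + Const (\<kappa> * ?x) * u1^2)"
  by (simp add: f A_def algebra_simps power2_eq_square)
 also have "... : K c" by (intro idealD(2)[OF K_is_ideal] idealD(3)[OF K_is_ideal g(1)] idealD(3)[OF K_is_ideal g(4)] idealD(3)[OF K_is_ideal F])
 finally show ?thesis by blast
qed

text \<open>Rotation permutes the conics \<open>C_1\<close>, \<open>C_2\<close>, \<open>C_3\<close>,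
  as the slopes \<alpha>, \<beta>, \<gamma> mark one of them each.\<close>

definition rot :: "4 => 4" where "rot c = (if c = 0 then 0 else if c = 1 then 3 else if c = 2 then 1 else 2)"

lemma K_cyc: "line_coords.K Const \<beta> \<gamma> \<alpha> u2 v2 u3 v3 u1 v1 (rot c) = K c"
proof -
 have "slope1 \<beta> (rot c) = slope2 \<beta> c" "slope2 \<gamma> (rot c) = slope3 \<gamma> c" "slope3 \<alpha> (rot c) = slope1 \<alpha> c"
  using exhaust_4'[of c] by (auto simp: slope_defs rot_def)
 then have "{line_coords.A Const \<beta> u2 v2 (rot c), line_coords.B Const \<gamma> u3 v3 (rot c), line_coords.W Const \<alpha> u1 v1 (rot c), line_coords.P u2 v2 u3 v3 u1 v1}
  = {A c, B c, W c, P}"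
  unfolding line_coords.A_def line_coords.B_def line_coords.W_def line_coords.P_def by (auto simp: add_ac)
 then show ?thesis unfolding line_coords.K_def by (simp only:)
qed

lemma E2_mod_K: "f : E2 ==> EX g. f - u2 * g : K c"
 using curves.E1_mod_K[OF curves_cyc, of f "rot c"] unfolding E_cyc K_cyc .

lemma E3_mod_K: "f : E3 ==> EX g. f - u3 * g : K c"
 using curves.E2_mod_K[OF curves_cyc, of f "rot c"] unfolding E_cyc K_cyc .

text \<open>Multiplication by \<open>u1*u2*u3\<close> identifies forms of degree
  \<open>d - 3\<close> on the conics with \<open>JE\<close> modulo \<open>JE Int JC\<close>: a form
  in \<open>JE\<close> is divisible by the product on each conic, and the four quotients are
  interpolated by \<open>JC_crt\<close>. Interpolation in degree \<open>d - 3\<close> accounts for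
  the bound six.\<close>

lemma codim_J: "6 <= d ==> codim (forms d UNIV) (forms d (JE Int JC)) (20 * d - 20)"
proof -
 assume d: "6 <= d"
 let ?h = "u1 * u2 * u3"
 have hh: "homogeneous 3 ?h"
  using homogeneous_mult[OF homogeneous_mult[OF lin[of u1] lin[of u2]] lin[of u3]] by (simp add: numeral_3_eq_3)
 have uE: "u1 : E1" "u2 : E2" "u3 : E3" by (simp_all add: E1_def E2_def E3_def ideal_gen_base)
 have hE: "?h * f : JE" for f
 proof -
  have "?h * f = (u2 * u3 * f) * u1" "?h * f = (u1 * u3 * f) * u2" "?h * f = (u1 * u2 * f) * u3" by (simp_all add: mult_ac)
  then show ?thesis unfolding JE_def using uE idealD(3)[OF E_is_ideal(1)] idealD(3)[OF E_is_ideal(2)] idealD(3)[OF E_is_ideal(3)]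
   by (metis IntI)
 qed
 have hK: "?h * f : K c \<longleftrightarrow> f : K c" for f c
  using K_prime[of "u1 * u2 * u3" f c] K_prime[of "u1 * u2" u3 c] K_prime[of u1 u2 c] K_u_notin[of c] idealD(3)[OF K_is_ideal, of f c ?h] by blast
 have hJ: "?h * f : JC \<longleftrightarrow> f : JC" for f by (simp add: JC_def hK)
 have homh: "homogeneous d (?h * f)" if "homogeneous (d - 3) f" for f
  using homogeneous_mult[OF hh that] d by simp
 have t: "codim (forms d JE) (forms d (JE Int JC)) (4 * (2 * (d - 3) + 1))"
 proof (rule codim_transfer[where V = "forms (d - 3) UNIV" and V' = "forms (d - 3) JC" and h = ?h])
  show "sub (forms (d - 3) (UNIV :: ('x, 'k) mpoly set))" "sub (forms d (JE Int JC))" by (intro sub_forms is_ideal_Int J_ideal is_ideal_UNIV)+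
  show "codim (forms (d - 3) UNIV) (forms (d - 3) JC) (4 * (2 * (d - 3) + 1))" by (rule codim_JC) (use d in simp)
  show "?h * f : forms d JE" if "f : forms (d - 3) UNIV" for f
   using that hE homh by (simp add: forms_def)
  show "?h * f : forms d (JE Int JC) \<longleftrightarrow> f : forms (d - 3) JC" if "f : forms (d - 3) UNIV" for f
   using that hE hJ homh by (simp add: forms_def)
  show "forms (d - 3) JC \<subseteq> forms (d - 3) UNIV" by (auto simp: forms_def)
  show "\<exists>f\<in>forms (d - 3) UNIV. u - ?h * f : forms d (JE Int JC)" if u: "u : forms d JE" for u
  proof -
   have hu: "homogeneous d u" and uJ: "u : E1" "u : E2" "u : E3" using u by (auto simp: forms_def JE_def)
   have "EX g. homogeneous (d - 3) g & u - ?h * g : K c" for c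
   proof -
    obtain g where g: "u - ?h * g : K c"
     using E1_mod_K[OF uJ(1), of c] E2_mod_K[OF uJ(2), of c] E3_mod_K[OF uJ(3), of c] K_divide3[of u _ c] by meson
    have "hcomp d (u - ?h * g) = u - ?h * hcomp (d - 3) g"
     using d by (simp add: hcomp_diff hcomp_of_homogeneous[OF hu] hcomp_mult_homogeneous[OF hh])
    then show ?thesis using K_graded[of c] g hcomp_homogeneous unfolding graded_def by metis
   qed
   then obtain g where g: "!!c. homogeneous (d - 3) (g c)" "!!c. u - ?h * g c : K c" by metis
   have d3: "3 <= d - 3" using d by simp
   obtain f where f: "homogeneous (d - 3) f" "!!c. f - g c : K c" using JC_crt[of "d - 3" g, OF d3 g(1)] by blast
   have "u - ?h * f = (u - ?h * g c) - ?h * (f - g c)" for c by (simp add: algebra_simps)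
   then have "u - ?h * f : K c" for c using idealD(6)[OF K_is_ideal g(2) idealD(3)[OF K_is_ideal f(2)]] by metis
   then have "u - ?h * f : JC" by (simp add: JC_def)
   moreover have "u - ?h * f : JE" using u hE idealD(6)[OF J_ideal(1)] by (simp add: forms_def)
   moreover have "homogeneous d (u - ?h * f)" using hu homh[OF f(1)] by (rule homogeneous_diff)
   ultimately show ?thesis using f(1) by (intro bexI[of _ f]) (auto simp: forms_def)
  qed
 qed
 have "codim (forms d UNIV) (forms d (JE Int JC)) (12 * d + 4 * (2 * (d - 3) + 1))"
  using d by (intro codim_trans[OF _ _ _ _ codim_JE t] sub_forms is_ideal_Int J_ideal) (auto simp: forms_def)
 moreover have "12 * d + 4 * (2 * (d - 3) + 1) = 20 * d - 20" using d by simp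
 ultimately show ?thesis by simp
qed

end

section \<open>Zero sets of radical ideals\<close>

text \<open>Homogeneous, radical and saturated at once: testing only nonzero vectors makes the ideal
  equal to the vanishing ideal of its projective zero set.\<close>

definition nice :: "('x::finite, 'k::alg_closed_field) mpoly set => bool" where
 "nice I \<longleftrightarrow> is_ideal I & graded I & (ALL f. (ALL v. v ~= 0 --> (\<forall>g\<in>I. peval v g = 0) --> peval v f = 0) --> f : I)"

lemma niceD:
 assumes "nice I"
 shows "is_ideal I" "graded I" "(!!v. v ~= 0 ==> (!!g. g : I ==> peval v g = 0) ==> peval v f = 0) ==> f : I"
proof -
 show "is_ideal I" "graded I" using assms by (simp_all add: nice_def)
 assume a: "!!v. v ~= 0 ==> (!!g. g : I ==> peval v g = 0) ==> peval v f = 0"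
 have "ALL v. v ~= 0 --> (\<forall>g\<in>I. peval v g = 0) --> peval v f = 0" using a by blast
 then show "f : I" using assms unfolding nice_def by blast
qed

lemma nice_Int: "nice I ==> nice J ==> nice (I Int J)"
 unfolding nice_def by (auto simp: is_ideal_Int graded_Int)

lemma graded_scale:
 assumes "graded I" "!!g. g : I ==> peval v g = 0" "g : I"
 shows "peval (c *s v) g = 0"
proof -
 obtain D where D: "g = (\<Sum>d<D. hcomp d g)" using hcomp_decomp by blast
 have "peval (c *s v) (\<Sum>d<D. hcomp d g) = (\<Sum>d<D. c ^ d * peval v (hcomp d g))"
  by (simp add: peval_scale[OF hcomp_homogeneous])
 also have "... = 0" using assms by (intro sum.neutral) (auto simp: graded_def)
 finally show ?thesis using D by metis
qed

lemma proj_point_mem: "v : proj_point w \<longleftrightarrow> (EX c. c ~= 0 & v = c *s w)"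
 by (auto simp: proj_point_def)

lemma proj_point_self: "v : proj_point v"
 unfolding proj_point_mem by (rule exI[of _ 1]) simp

lemma proj_point_scale: "c ~= 0 ==> proj_point (c *s v) = proj_point v"
proof -
 assume c: "c ~= 0"
 show ?thesis
 proof (intro equalityI subsetI)
  fix x assume "x : proj_point (c *s v)"
  then obtain a where "a ~= 0" "x = a *s (c *s v)" by (auto simp: proj_point_mem)
  then show "x : proj_point v" unfolding proj_point_mem using c by (intro exI[of _ "a * c"]) (simp add: vector_smult_assoc)
 next
  fix x assume "x : proj_point v"
  then obtain a where "a ~= 0" "x = a *s v" by (auto simp: proj_point_mem)
  then show "x : proj_point (c *s v)" unfolding proj_point_mem using c by (intro exI[of _ "a * inverse c"]) (simp add: vector_smult_assoc)
 qed
qed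

lemma proj_point_eq: "v : proj_point w ==> proj_point v = proj_point w"
 by (auto simp: proj_point_mem proj_point_scale)

lemma zeros_graded: "graded I ==> zeros I = {proj_point v |v. v ~= 0 & (\<forall>g\<in>I. peval v g = 0)}"
proof -
 assume g: "graded I"
 have "proj_point v : zeros I \<longleftrightarrow> (\<forall>g\<in>I. peval v g = 0)" if "v ~= 0" for v
 proof
  assume "proj_point v : zeros I"
  then show "\<forall>g\<in>I. peval v g = 0" using proj_point_self by (auto simp: zeros_def vanishes_def)
 next
  assume z: "\<forall>g\<in>I. peval v g = 0"
  then have "peval (c *s v) f = 0" if "f : I" for c f using graded_scale[OF g, of v f c] that by blast
  then show "proj_point v : zeros I" using \<open>v ~= 0\<close> by (auto simp: zeros_def vanishes_def proj_space_def proj_point_mem)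
 qed
 note m = this
 have sub: "zeros I \<subseteq> proj_space" by (auto simp: zeros_def)
 show ?thesis
 proof (intro equalityI subsetI)
  fix Q assume Q: "Q : zeros I"
  then obtain v where v: "Q = proj_point v" "v ~= 0" using sub unfolding proj_space_def by blast
  then show "Q : {proj_point v |v. v ~= 0 & (\<forall>g\<in>I. peval v g = 0)}" using m[OF v(2)] Q by blast
 qed (use m in blast)
qed

lemma nice_vanishing: "nice I ==> vanishing_ideal (zeros I) = I"
proof (intro equalityI subsetI)
 fix f assume n: "nice I"
 note g = niceD(2)[OF n]
 show "f : I" if "f : vanishing_ideal (zeros I)"
 proof (rule niceD(3)[OF n])
  fix v :: "'b^'a" assume "v ~= 0" "!!g. g : I ==> peval v g = 0"
  then have "proj_point v : zeros I" unfolding zeros_graded[OF g] by blast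
  then show "peval v f = 0" using that proj_point_self[of v] by (auto simp: vanishing_ideal_def vanishes_def)
 qed
 show "f : vanishing_ideal (zeros I)" if "f : I"
  using that by (auto simp: vanishing_ideal_def zeros_def)
qed

lemma vanishing_ideal_ideal: "is_ideal (vanishing_ideal X)"
 unfolding is_ideal_def vanishing_ideal_def vanishes_def by simp

lemma zeros_vanishing: "zariski_closed X ==> zeros (vanishing_ideal X) = X"
 by (auto simp: zariski_closed_def zeros_def vanishing_ideal_def)

lemma vanishing_graded: "X \<subseteq> proj_space ==> graded (vanishing_ideal X)"
 for X :: "('k::alg_closed_field^'x::finite) set set"
 unfolding graded_def
proof (intro ballI allI)
 fix f d assume X: "X \<subseteq> proj_space" and f: "f : vanishing_ideal X"
 have "peval v (hcomp d f) = 0" if P: "P : X" "v : P" for P v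
 proof (rule peval_hcomp_zero)
  fix c :: 'k assume c: "c ~= 0"
  obtain w where w: "P = proj_point w" using P X by (auto simp: proj_space_def)
  then have "c *s v : P" using P c by (auto simp: proj_point_mem intro: exI[of _ "c * _"])
  then show "peval (c *s v) f = 0" using f P by (auto simp: vanishing_ideal_def vanishes_def)
 qed
 then show "hcomp d f : vanishing_ideal X" by (auto simp: vanishing_ideal_def vanishes_def)
qed

lemma zariski_closed_zeros: "zariski_closed (zeros F)"
 by (auto simp: zariski_closed_def)

lemma zariski_closed_sub: "zariski_closed X ==> X \<subseteq> proj_space"
 by (auto simp: zariski_closed_def zeros_def)

lemma zariski_closed_Int: "zariski_closed X ==> zariski_closed Y ==> zariski_closed (X Int Y)"
proof -
 assume "zariski_closed X" "zariski_closed Y"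
 then obtain F G where "X = zeros F" "Y = zeros G" by (auto simp: zariski_closed_def)
 then have "X Int Y = zeros (F Un G)" by (auto simp: zeros_def)
 then show ?thesis by (auto simp: zariski_closed_def)
qed

lemma zeros_Int:
 assumes "is_ideal I" "graded I" "is_ideal J" "graded J"
 shows "zeros (I Int J) = zeros I Un zeros J"
proof -
 have "(\<forall>g\<in>I. peval v g = 0) | (\<forall>g\<in>J. peval v g = 0)" if z: "\<forall>g\<in>I Int J. peval v g = 0" for v
 proof (rule ccontr)
  assume "~ ?thesis"
  then obtain f g where f: "f : I" "peval v f ~= 0" "g : J" "peval v g ~= 0" by blast
  then have "f * g : I Int J" using idealD(3,4) assms by blast
  then have "peval v (f * g) = 0" using z by blast
  then show False using f by simp
 qed
 then show ?thesis
  unfolding zeros_graded[OF assms(2)] zeros_graded[OF assms(4)] zeros_graded[OF graded_Int[OF assms(2,4)]] by blast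
qed

lemma zariski_closed_Un: "zariski_closed X ==> zariski_closed Y ==> zariski_closed (X Un Y)"
 for X Y :: "('k::alg_closed_field^'x::finite) set set"
 using zeros_Int[of "vanishing_ideal X" "vanishing_ideal Y"] vanishing_ideal_ideal vanishing_graded zariski_closed_sub
  zeros_vanishing zariski_closed_zeros by metis

lemma irreducible_prime:
 fixes X :: "('k::alg_closed_field^'x::finite) set set"
 assumes X: "zariski_closed X" "X ~= {}" and p: "!!f g. f * g : vanishing_ideal X ==> f : vanishing_ideal X | g : vanishing_ideal X"
 shows "irreducible_closed X"
 unfolding irreducible_closed_def
proof (intro conjI X allI impI)
 fix Y Z assume a: "zariski_closed Y & zariski_closed Z & X = Y Un Z"
 have e: "EX f. f : vanishing_ideal Y & f ~: vanishing_ideal X" if "X ~= Y" "zariski_closed Y" "Y \<subseteq> X" for Y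
 proof (rule ccontr)
  assume "~ ?thesis"
  then have "vanishing_ideal Y \<subseteq> vanishing_ideal X" by blast
  then have "zeros (vanishing_ideal X) \<subseteq> zeros (vanishing_ideal Y)" by (auto simp: zeros_def)
  then show False using zeros_vanishing[OF X(1)] zeros_vanishing[OF that(2)] that by auto
 qed
 show "X = Y | X = Z"
 proof (rule ccontr)
  assume "~ ?thesis"
  then obtain f g where fg: "f : vanishing_ideal Y" "f ~: vanishing_ideal X" "g : vanishing_ideal Z" "g ~: vanishing_ideal X"
   using e[of Y] e[of Z] a by blast
  then have "f * g : vanishing_ideal X" using a by (auto simp: vanishing_ideal_def vanishes_def)
  then show False using p fg by blast
 qed
qed

lemma nice_irreducible:
 assumes n: "nice I" and p: "!!f g. f * g : I ==> f : I | g : I" and 1: "1 ~: I"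
 shows "irreducible_closed (zeros I)"
proof (rule irreducible_prime)
 show "zeros I ~= {}"
 proof
  assume "zeros I = {}"
  then have "vanishing_ideal (zeros I) = UNIV" by (simp add: vanishing_ideal_def)
  then show False using nice_vanishing[OF n] 1 by simp
 qed
qed (use p in "auto simp: nice_vanishing[OF n] zariski_closed_zeros")

lemma irreducible_cover:
 fixes Z :: "('k::alg_closed_field^'x::finite) set set"
 assumes "finite \<X>" "!!X. X : \<X> ==> zariski_closed X" "irreducible_closed Z" "Z \<subseteq> \<Union>\<X>"
 shows "\<exists>X\<in>\<X>. Z \<subseteq> X"
proof -
 have "Z \<subseteq> \<Union>\<X> --> (\<exists>X\<in>\<X>. Z \<subseteq> X)" if "finite \<X>" "\<forall>X\<in>\<X>. zariski_closed X" for \<X>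
  using that
 proof (induction \<X>)
  case empty
  then show ?case using assms(3) by (auto simp: irreducible_closed_def)
 next
  case (insert Y \<X>)
  have cl: "zariski_closed (\<Union>\<Y>)" if "finite \<Y>" "\<forall>X\<in>\<Y>. zariski_closed X" for \<Y> :: "('k^'x) set set set"
   using that
  proof (induction \<Y>)
   case empty
   have "Q ~: zeros {1 :: ('x, 'k) mpoly}" for Q
   proof
    assume Q: "Q \<in> zeros {1 :: ('x, 'k) mpoly}"
    then obtain v where "Q = proj_point v" by (auto simp: zeros_def proj_space_def)
    then have "peval v (1 :: ('x, 'k) mpoly) = 0" using Q proj_point_self[of v] by (auto simp: zeros_def vanishes_def)
    then show False by simp
   qed
   then have "zeros {1 :: ('x, 'k) mpoly} = {}" by blast
   then show ?case using zariski_closed_zeros[of "{1 :: ('x, 'k) mpoly}"] by simp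
  qed (simp add: zariski_closed_Un)
  show ?case
  proof
   assume Z: "Z \<subseteq> \<Union>(insert Y \<X>)"
   have "zariski_closed Z" using assms(3) by (simp add: irreducible_closed_def)
   then have "zariski_closed (Z Int Y)" "zariski_closed (Z Int \<Union>\<X>)" "Z = (Z Int Y) Un (Z Int \<Union>\<X>)"
    using zariski_closed_Int cl[of \<X>] insert Z by auto
   then have "Z = Z Int Y | Z = Z Int \<Union>\<X>" using assms(3) unfolding irreducible_closed_def by blast
   then show "\<exists>X\<in>insert Y \<X>. Z \<subseteq> X" using insert by blast
  qed
 qed
 then show ?thesis using assms by blast
qed

text \<open>Each component is multiplied by the missing power of \<open>x\<close>, which is
  congruent to one.\<close>

lemma homogenize:
 "EX F D. homogeneous D F & f - F : ideal_gen {Var x - 1}" for f :: "('x, 'k::field) mpoly"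
proof -
 obtain D where D: "f = (\<Sum>d<D. hcomp d f)" using hcomp_decomp by blast
 let ?F = "\<Sum>d<D. Var x ^ (D - d) * hcomp d f"
 have "homogeneous D (Var x ^ (D - d) * hcomp d f)" if "d < D" for d
  using homogeneous_mult[OF homogeneous_power[OF homogeneous_Var, of "D - d" x] hcomp_homogeneous[of d f]] that by simp
 then have "homogeneous D ?F" by (intro homogeneous_sum) auto
 moreover have "f - ?F = (\<Sum>d<D. (1 - Var x ^ (D - d)) * hcomp d f)"
  by (subst (1) D) (simp add: sum_subtractf algebra_simps)
 moreover have "(1 - Var x ^ n) * h : ideal_gen {Var x - 1}" for n and h :: "('x, 'k) mpoly"
 proof -
  have "EX q. Var x ^ n - 1 = (Var x - 1 :: ('x, 'k) mpoly) * q"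
  proof (induction n)
   case 0
   show ?case by (rule exI[of _ 0]) simp
  next
   case (Suc n)
   then obtain q where "Var x ^ n - 1 = (Var x - 1 :: ('x, 'k) mpoly) * q" by blast
   moreover have "Var x ^ Suc n - 1 = (Var x - 1) * Var x ^ n + (Var x ^ n - 1 :: ('x, 'k) mpoly)" by (simp add: algebra_simps)
   ultimately have "Var x ^ Suc n - 1 = (Var x - 1 :: ('x, 'k) mpoly) * (Var x ^ n + q)" by (simp only: distrib_left)
   then show ?case by blast
  qed
  then obtain q where q: "Var x ^ n - 1 = (Var x - 1 :: ('x, 'k) mpoly) * q" by blast
  have "(1 - Var x ^ n) * h = - ((Var x ^ n - 1) * h)" by (simp add: algebra_simps)
  also have "... = (- q * h) * (Var x - 1)" unfolding q by (simp add: algebra_simps)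
  finally have "(1 - Var x ^ n) * h = (- q * h) * (Var x - 1)" .
  then show ?thesis using ideal_genD(3)[OF ideal_gen_base[of "Var x - 1" "{Var x - 1}"]] by (metis insertI1)
 qed
 then have "(\<Sum>d<D. (1 - Var x ^ (D - d)) * hcomp d f) : ideal_gen {Var x - 1}" by (intro ideal_sum) auto
 ultimately show ?thesis by auto
qed

text \<open>On the chart \<open>x = 1\<close> the polynomial \<open>f\<close> is congruent to its
  homogenisation \<open>F\<close> and to \<open>x*F\<close>. The latter vanishes on the whole cone:
  by rescaling to the chart where \<open>x\<close> is nonzero, and through the factor
  \<open>x\<close> elsewhere.\<close>

lemma nice_reduced:
 assumes n: "nice I"
 shows "reduced_scheme I"
 unfolding reduced_scheme_def
proof (intro allI impI)
 fix x m and f :: "('a, 'b) mpoly"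
 let ?K = "ideal_gen (insert (Var x - 1) I)"
 assume f: "f ^ m : ?K"
 have K: "Var x - 1 : ?K" "I \<subseteq> ?K" by (auto intro: ideal_gen_base)
 have z: "peval v f = 0" if v: "v $ x = 1" "!!g. g : I ==> peval v g = 0" for v
 proof -
  have "peval v (f ^ m) = 0" by (rule peval_ideal_gen[OF f]) (use v in auto)
  then show ?thesis by simp
 qed
 obtain F D where F: "homogeneous D F" "f - F : ideal_gen {Var x - 1}" using homogenize by metis
 have FK: "f - F \<in> ?K" using F(2) ideal_gen_minimal[of ?K "{Var x - 1}"] K by auto
 have "Var x * F \<in> I"
 proof (rule niceD(3)[OF n])
  fix v :: "'b^'a" assume v: "v ~= 0" "!!g. g : I ==> peval v g = 0"
  show "peval v (Var x * F) = 0"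
  proof (cases "v $ x = 0")
   case False
   let ?w = "inverse (v $ x) *s v"
   have w: "?w $ x = 1" using False by simp
   have "peval ?w g = 0" if "g : I" for g using graded_scale[OF niceD(2)[OF n] v(2) that] .
   then have "peval ?w f = 0" using z w by blast
   moreover have "peval ?w (f - F) = 0" by (rule peval_ideal_gen[OF F(2)]) (use w in auto)
   ultimately have "peval ?w F = 0" by simp
   then have "peval v F = 0" using False by (simp add: peval_scale[OF F(1)])
   then show ?thesis by simp
  qed simp
 qed
 then have "Var x * F : ?K" using K by blast
 moreover have "f = (f - F) + (Var x * F - F * (Var x - 1))" by (simp add: algebra_simps)
 ultimately show "f : ?K"
  using FK ideal_genD(2)[OF FK ideal_genD(6)[OF _ ideal_genD(3)[OF K(1)]]] by metis
qed

text \<open>The sum contains a power of every coordinate.\<close>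

lemma thick_disjoint:
 assumes "is_ideal I" "is_ideal J" "thick n (isum I J)"
 shows "zeros I Int zeros J = {}"
proof (rule ccontr)
 assume "zeros I Int zeros J ~= {}"
 then obtain v where v: "v ~= 0" "proj_point v \<in> zeros I" "proj_point v \<in> zeros J"
  by (auto simp: zeros_def proj_space_def)
 then obtain x where x: "v $ x ~= 0" by (auto simp: Finite_Cartesian_Product.vec_eq_iff)
 have "homogeneous n (Var x ^ n :: ('a, 'b) mpoly)" using homogeneous_power[OF homogeneous_Var, of n x] by simp
 then have "Var x ^ n : isum I J" using assms(3) unfolding thick_def by blast
 then obtain f g where fg: "Var x ^ n = f + g" "f : I" "g : J" by (auto simp: isum_def)
 then have "peval v f = 0" "peval v g = 0" using v proj_point_self[of v] by (auto simp: zeros_def vanishes_def)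
 then have "peval v (Var x ^ n) = 0" by (simp add: fg)
 then show False using x by simp
qed

section \<open>Gradients\<close>

lemma partial_superset:
 "finite A ==> Poly_Mapping.keys f \<subseteq> A ==> partial x f = (\<Sum>m\<in>A. Poly_Mapping.single (m - Poly_Mapping.single x 1)
   (of_nat (Poly_Mapping.lookup m x) * Poly_Mapping.lookup f m))"
 unfolding partial_def by (rule sum.mono_neutral_left) (auto simp: in_keys_iff)

lemma partial_add: "partial x (f + g) = partial x f + partial x g"
proof -
 let ?A = "Poly_Mapping.keys f Un Poly_Mapping.keys g"
 have "Poly_Mapping.keys (f + g) \<subseteq> ?A" by (simp add: keys_add)
 then show ?thesis
  by (subst (1 2 3) partial_superset[of ?A]) (auto simp: lookup_add distrib_left single_add sum.distrib)
qed

lemma partial_0 [simp]: "partial x 0 = 0"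
 by (simp add: partial_def)

lemma partial_single: "partial x (Poly_Mapping.single m c) = Poly_Mapping.single (m - Poly_Mapping.single x 1) (of_nat (Poly_Mapping.lookup m x) * c)"
 by (subst partial_superset[of "{m}"]) (auto simp: lookup_single)

lemma partial_Const [simp]: "partial x (Const c) = 0"
 by (simp add: Const_def partial_single)

lemma partial_Var: "partial x (Var y) = (if x = y then 1 else 0)"
 unfolding Var_def partial_single by (auto simp: lookup_single single_one)

lemma partial_Var_mult: "partial x (Var y * f) = Var y * partial x f + partial x (Var y) * f"
proof (induction f rule: poly_mapping_single_induct)
 case (single m c)
 have a: "Var y * Poly_Mapping.single n d = Poly_Mapping.single (Poly_Mapping.single y 1 + n) d" for n and d :: 'b
  by (simp add: Var_def mult_single)
 show ?case
 proof (cases "x = y")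
  case True
  have 1: "Poly_Mapping.single x 1 + m - Poly_Mapping.single x 1 = m" by (rule poly_mapping_eqI) (simp add: lookup_minus lookup_add)
  show ?thesis
  proof (cases "Poly_Mapping.lookup m x = 0")
   case False
   then have 2: "Poly_Mapping.single x 1 + (m - Poly_Mapping.single x 1) = m"
    by (intro poly_mapping_eqI) (auto simp: lookup_add lookup_minus lookup_single when_def)
   show ?thesis unfolding True[symmetric] a[unfolded True[symmetric]] partial_single partial_Var 1 2
    by (simp add: lookup_add distrib_right single_add add.commute)
  qed (use True in "simp add: a partial_single partial_Var 1 lookup_add")
 next
  case False
  have 3: "Poly_Mapping.single y 1 + m - Poly_Mapping.single x 1 = Poly_Mapping.single y 1 + (m - Poly_Mapping.single x 1)"
   using False by (intro poly_mapping_eqI) (auto simp: lookup_add lookup_minus lookup_single when_def)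
  show ?thesis unfolding a partial_single partial_Var 3 using False by (simp add: lookup_add lookup_single)
 qed
qed (simp_all add: partial_add algebra_simps)

lemma partial_mult: "partial x (f * g) = f * partial x g + partial x f * g"
proof (induction f rule: mpoly_induct)
 case (Const c)
 show ?case
 proof (induction g rule: poly_mapping_single_induct)
  case (single m d)
  then show ?case by (simp add: Const_def partial_single mult_single mult.left_commute)
 qed (simp_all add: partial_add algebra_simps)
next
 case (add f h)
 then show ?case by (simp add: partial_add algebra_simps)
next
 case (Var f y)
 have "partial x (Var y * f * g) = Var y * partial x (f * g) + partial x (Var y) * (f * g)" by (simp add: partial_Var_mult mult.assoc)
 also have "... = Var y * f * partial x g + partial x (Var y * f) * g" unfolding Var partial_Var_mult by (simp add: algebra_simps)
 finally show ?case .
qed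

text \<open>The derivative of \<open>f\<close> at \<open>v\<close> in direction \<open>w\<close>;
  varying \<open>w\<close> replaces partial derivatives with respect to a frame.\<close>

definition polar :: "'k^'x => 'k^'x => ('x::finite, 'k::field) mpoly => 'k" where
 "polar w v f = (\<Sum>x\<in>UNIV. w $ x * peval v (partial x f))"

lemma polar_simps [simp]: "polar w v (f + g) = polar w v f + polar w v g" "polar w v (Const c) = 0" "polar w v (Var x) = w $ x"
 "polar w v (f * g) = peval v f * polar w v g + polar w v f * peval v g" "polar w v 0 = 0"
proof -
 show "polar w v (f + g) = polar w v f + polar w v g" by (simp add: polar_def partial_add sum.distrib distrib_left)
 show "polar w v (Const c) = 0" "polar w v 0 = 0" by (simp_all add: polar_def)
 have "polar w v (Var x) = (\<Sum>y\<in>UNIV. if y = x then w $ y else 0)" unfolding polar_def by (intro sum.cong) (auto simp: partial_Var)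
 then show "polar w v (Var x) = w $ x" by simp
 show "polar w v (f * g) = peval v f * polar w v g + polar w v f * peval v g"
  by (simp add: polar_def partial_mult sum.distrib sum_distrib_left sum_distrib_right algebra_simps)
qed

lemma polar_uminus [simp]: "polar w v (- f) = - polar w v f" "polar w v (f - g) = polar w v f - polar w v g" "polar w v (f ^ 2) = 2 * (peval v f * polar w v f)"
proof -
 have "polar w v (f + - f) = polar w v f + polar w v (- f)" for f by (rule polar_simps)
 then have u: "polar w v (- f) = - polar w v f" for f by (simp add: add_eq_0_iff)
 show "polar w v (- f) = - polar w v f" by (rule u)
 show "polar w v (f - g) = polar w v f - polar w v g" using polar_simps(1)[of w v f "- g"] u by simp
 show "polar w v (f ^ 2) = 2 * (peval v f * polar w v f)" by (simp add: power2_eq_square)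
qed

section \<open>Singular points of the multiplication map\<close>

text \<open>\<open>relT T\<close> says that the tensor with coefficients \<open>T\<close> is a combination of the relations of \<open>A\<close>.\<close>

definition relT :: "'k::field => 'k => 'k => (4 => 4 => 'k) => bool" where
 "relT \<alpha> \<beta> \<gamma> T \<longleftrightarrow> T 0 0 = 0 & T 1 1 = 0 & T 2 2 = 0 & T 3 3 = 0 &
  (\<forall>(a, i, j, k) \<in> {(\<alpha>, 1, 2, 3), (\<beta>, 2, 3, 1), (\<gamma>, 3, 1, 2)}.
   T 0 i * (1 + a) + T i 0 * (1 - a) + 2 * T j k = 0 & T 0 i * (1 - a) + T i 0 * (1 + a) + 2 * T k j = 0)"

lemma relT_bil:
 fixes T b :: "4 => 4 => 'k::field"
 assumes "(2 :: 'k) ~= 0" "relT \<alpha> \<beta> \<gamma> T" "bil \<alpha> \<beta> \<gamma> b"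
 shows "(\<Sum>r\<in>UNIV. \<Sum>j\<in>UNIV. T r j * b r j) = 0"
proof -
 have *: "T0i * b0i + Ti0 * bi0 + Tjk * bjk + Tkj * bkj = 0"
  if "b0i - bi0 = a * (bjk - bkj)" "b0i + bi0 = bjk + bkj"
   "T0i * (1 + a) + Ti0 * (1 - a) + 2 * Tjk = 0" "T0i * (1 - a) + Ti0 * (1 + a) + 2 * Tkj = 0"
  for T0i Ti0 Tjk Tkj b0i bi0 bjk bkj a :: 'k
 proof -
  have "2 * (T0i * b0i + Ti0 * bi0 + Tjk * bjk + Tkj * bkj) = 0" using that by Groebner_Basis.algebra
  then show ?thesis using assms(1) by (metis mult_eq_0_iff)
 qed
 have "T 0 1 * b 0 1 + T 1 0 * b 1 0 + T 2 3 * b 2 3 + T 3 2 * b 3 2 = 0"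
  "T 0 2 * b 0 2 + T 2 0 * b 2 0 + T 3 1 * b 3 1 + T 1 3 * b 1 3 = 0"
  "T 0 3 * b 0 3 + T 3 0 * b 3 0 + T 1 2 * b 1 2 + T 2 1 * b 2 1 = 0"
  using assms(2,3) by (auto simp: relT_def bil_def intro: *)
 moreover have "T 0 0 = 0" "T 1 1 = 0" "T 2 2 = 0" "T 3 3 = 0" using assms(2) by (auto simp: relT_def)
 ultimately show ?thesis unfolding sum_4' by Groebner_Basis.algebra
qed

lemma relTI:
 "T 0 0 = 0 ==> T 1 1 = 0 ==> T 2 2 = 0 ==> T 3 3 = 0 ==>
 T 0 1 * (1 + \<alpha>) + T 1 0 * (1 - \<alpha>) + 2 * T 2 3 = 0 ==> T 0 1 * (1 - \<alpha>) + T 1 0 * (1 + \<alpha>) + 2 * T 3 2 = 0 ==>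
 T 0 2 * (1 + \<beta>) + T 2 0 * (1 - \<beta>) + 2 * T 3 1 = 0 ==> T 0 2 * (1 - \<beta>) + T 2 0 * (1 + \<beta>) + 2 * T 1 3 = 0 ==>
 T 0 3 * (1 + \<gamma>) + T 3 0 * (1 - \<gamma>) + 2 * T 1 2 = 0 ==> T 0 3 * (1 - \<gamma>) + T 3 0 * (1 + \<gamma>) + 2 * T 2 1 = 0 ==>
 relT \<alpha> \<beta> \<gamma> T"
 unfolding relT_def by blast

lemma relTD:
 assumes "relT \<alpha> \<beta> \<gamma> T"
 shows "T 0 0 = 0" "T 1 1 = 0" "T 2 2 = 0" "T 3 3 = 0"
  "T 0 1 * (1 + \<alpha>) + T 1 0 * (1 - \<alpha>) + 2 * T 2 3 = 0" "T 0 1 * (1 - \<alpha>) + T 1 0 * (1 + \<alpha>) + 2 * T 3 2 = 0"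
  "T 0 2 * (1 + \<beta>) + T 2 0 * (1 - \<beta>) + 2 * T 3 1 = 0" "T 0 2 * (1 - \<beta>) + T 2 0 * (1 + \<beta>) + 2 * T 1 3 = 0"
  "T 0 3 * (1 + \<gamma>) + T 3 0 * (1 - \<gamma>) + 2 * T 1 2 = 0" "T 0 3 * (1 - \<gamma>) + T 3 0 * (1 + \<gamma>) + 2 * T 2 1 = 0"
 using assms unfolding relT_def by blast+

text \<open>The line with Pluecker coordinates \<open>z\<close> belongs to the line scheme: with
  \<open>U\<close> spanned by the rows of \<open>l\<close>, \<kappa> is a nonzero kernel vector of
  the multiplication from \<open>A_1\<close> tensor \<open>U\<close> to \<open>A_2\<close>.\<close>

definition sing :: "'k::field => 'k => 'k => (4 => 4 => 'k) => bool" where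
 "sing \<alpha> \<beta> \<gamma> z \<longleftrightarrow> (\<exists>(l :: 2 => 4 => 'k) (\<kappa> :: 4 => 2 => 'k). (EX r s. \<kappa> r s ~= 0) & (ALL r j. zz l r j = z r j) &
  relT \<alpha> \<beta> \<gamma> (%r j. \<kappa> r 0 * l 0 j + \<kappa> r 1 * l 1 j))"

lemma sing_cyc:
 assumes "sing \<beta> \<gamma> \<alpha> (%r s. z (cyc r) (cyc s))"
 shows "sing \<alpha> \<beta> \<gamma> z"
proof -
 obtain l and \<kappa> :: "4 => 2 => 'a" where k: "EX r s. \<kappa> r s ~= 0" "!!r j. zz l r j = z (cyc r) (cyc j)"
  "relT \<beta> \<gamma> \<alpha> (%r j. \<kappa> r 0 * l 0 j + \<kappa> r 1 * l 1 j)"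
  using assms unfolding sing_def by blast
 let ?l = "%s j. l s (cyc' j)" and ?k = "%r s. \<kappa> (cyc' r) s"
 obtain r s where "\<kappa> r s ~= 0" using k(1) by blast
 then have "?k (cyc r) s ~= 0" by (simp add: perm_invs)
 then have a: "EX r s. ?k r s ~= 0" by blast
 have b: "ALL r j. zz ?l r j = z r j"
 proof (intro allI)
  fix r j
  show "zz ?l r j = z r j" using k(2)[of "cyc' r" "cyc' j"] by (simp add: zz_def perm_invs)
 qed
 have c: "relT \<alpha> \<beta> \<gamma> (%r j. ?k r 0 * ?l 0 j + ?k r 1 * ?l 1 j)"
 proof -
  have cv: "cyc' 0 = 0" "cyc' 1 = 3" "cyc' 2 = 1" "cyc' 3 = 2" by (simp_all add: cyc'_def)
  note d = relTD[OF k(3)]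
  show ?thesis by (rule relTI; unfold cv; rule d)
 qed
 show ?thesis unfolding sing_def by (intro exI[of _ ?l] exI[of _ ?k] conjI a b c)
qed

definition skew :: "(4 => 4 => 'k::field) => bool" where
 "skew z \<longleftrightarrow> (ALL r. z r r = 0) & (ALL r s. z s r = - z r s)"

lemma decomposable:
 assumes s: "skew z" and p: "z 0 1 * z 2 3 - z 0 2 * z 1 3 + z 0 3 * z 1 2 = 0" and nz: "z a b ~= 0"
 obtains l where "!!r s. zz l r s = z r s"
proof -
 have sk: "z 1 0 = - z 0 1" "z 2 0 = - z 0 2" "z 3 0 = - z 0 3" "z 2 1 = - z 1 2" "z 3 1 = - z 1 3" "z 3 2 = - z 2 3"
  "z 0 0 = 0" "z 1 1 = 0" "z 2 2 = 0" "z 3 3 = 0"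
  proof -
  have a: "z s r = - z r s" and b: "z r r = 0" for r s using s unfolding skew_def by blast+
  show "z 1 0 = - z 0 1" "z 2 0 = - z 0 2" "z 3 0 = - z 0 3" "z 2 1 = - z 1 2" "z 3 1 = - z 1 3" "z 3 2 = - z 2 3"
   "z 0 0 = 0" "z 1 1 = 0" "z 2 2 = 0" "z 3 3 = 0"
   by (rule a b)+
 qed
 have p': "z 0 1 * z 2 3 = z 0 2 * z 1 3 - z 0 3 * z 1 2" using p by Groebner_Basis.algebra
 have e: "z a b * z r t = z r b * z a t - z a r * z t b" for r t
  using exhaust_4'[of a] exhaust_4'[of b] exhaust_4'[of r] exhaust_4'[of t]
  by (elim disjE; simp add: sk; (simp add: p' algebra_simps; fail)?; (use p in "Groebner_Basis.algebra")?)
 \<comment> \<open>A decomposable skew tensor is recovered from its column \<open>b\<close>, divided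
   by \<open>z a b\<close>, and its row \<open>a\<close>.\<close>
 have "zz (%s r. if s = 0 then z r b / z a b else z a r) r t = z r t" for r t
 proof -
  have "zz (%s r. if s = 0 then z r b / z a b else z a r) r t = (z r b * z a t - z a r * z t b) / z a b"
   by (simp add: zz_def diff_divide_distrib)
  also have "... = z r t" unfolding e[symmetric] using nz by simp
  finally show ?thesis .
 qed
 then show ?thesis using that by blast
qed

text \<open>The rows of \<open>z\<close> are combinations of the two equations of the line, so
  multiplying row \<open>r\<close> by \<open>h r\<close> gives a tensor in \<open>A_1\<close> tensor
  \<open>U\<close>.\<close>

lemma sing_conic:
 fixes h :: "4 => 'k::field"
 assumes s: "skew z" and p: "z 0 1 * z 2 3 - z 0 2 * z 1 3 + z 0 3 * z 1 2 = 0" and nz: "z a b ~= 0" and h: "!!r. h r ~= 0"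
  and T: "relT \<alpha> \<beta> \<gamma> (%r j. h r * z r j)"
 shows "sing \<alpha> \<beta> \<gamma> z"
proof -
 obtain l where l: "!!r s. zz l r s = z r s" using decomposable[OF s p nz] by blast
 let ?k = "%r s. if s = (0 :: 2) then - h r * l 1 r else h r * l 0 r"
 have "l 0 a ~= 0 | l 0 b ~= 0" using l[of a b] nz by (auto simp: zz_def)
 then obtain r where "l 0 r ~= 0" by blast
 then have "?k r 1 ~= 0" using h by simp
 then have a: "EX r s. ?k r s ~= 0" by blast
 have b: "ALL r j. zz l r j = z r j" using l by blast
 have e: "(%r j. h r * z r j) = (%r j. ?k r 0 * l 0 j + ?k r 1 * l 1 j)"
  unfolding l[symmetric] zz_def by (simp add: fun_eq_iff algebra_simps)
 have c: "relT \<alpha> \<beta> \<gamma> (%r j. ?k r 0 * l 0 j + ?k r 1 * l 1 j)" using T unfolding e .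
 show ?thesis unfolding sing_def by (intro exI[of _ l] exI[of _ ?k] conjI a b c)
qed

lemma rank_one:
 fixes x y z w :: "'k::field"
 assumes "x * w = y * z"
 obtains p q r s where "x = p * r" "y = p * s" "z = q * r" "w = q * s"
proof (cases "x = 0 & y = 0")
 case True
 then show ?thesis using that[of 0 z 1 "w / z" ] that[of 0 0 z w] that[of 0 1 z w] by (metis mult_1 mult_zero_left that)
next
 case False
 then show ?thesis
 proof (cases "x = 0")
  case True
  then have "z = 0" using assms False by simp
  then show ?thesis using that[of 1 x "w / y" y] that[of 1 0 y "w / y"] that[of 1 x y "w / y"] False True by (auto simp: field_simps)
 next
  case False
  then show ?thesis using that[of 1 x y "z / x"] assms by (simp add: field_simps)
 qed
qed

text \<open>For a line \<open>p1 y0 - p0 y1 = p3 y2 - p2 y3 = 0\<close> the tensors \<open>(a y2 + b y3) (p1 y0 - p0 y1) + (c y0 + d y1) (p3 y2 - p2 y3)\<close>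
 lead to four linear equations whose determinant is the quadric defining the elliptic curve.\<close>

lemma quad_kernel:
 fixes p0 p1 p2 p3 \<beta> \<gamma> :: "'k::field"
 assumes two: "(2 :: 'k) ~= 0" and nz: "1 - \<beta> ~= 0" "1 + \<beta> ~= 0" "1 + \<gamma> ~= 0" "1 - \<gamma> ~= 0" "\<beta> ~= 0" "\<gamma> ~= 0"
  and F: "(1 - \<beta>) * ((p0 * p3)^2 + \<gamma> * (p1 * p2)^2) - (1 + \<gamma>) * ((p0 * p2)^2 - \<beta> * (p1 * p3)^2) = 0"
  and p: "p0 ~= 0 | p1 ~= 0" "p2 ~= 0 | p3 ~= 0"
 obtains a b c d where "(a, b, c, d) ~= (0, 0, 0, 0)"
  "c * p3 * (1 + \<beta>) + a * p1 * (1 - \<beta>) - 2 * b * p0 = 0" "c * p3 * (1 - \<beta>) + a * p1 * (1 + \<beta>) - 2 * d * p2 = 0"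
  "- c * p2 * (1 + \<gamma>) + b * p1 * (1 - \<gamma>) + 2 * d * p3 = 0" "- c * p2 * (1 - \<gamma>) + b * p1 * (1 + \<gamma>) - 2 * a * p0 = 0"
proof -
 consider "p0 = 0" | "p0 ~= 0" "p2 = 0" | "p0 ~= 0" "p2 ~= 0" by blast
 then show ?thesis
 proof cases
  case 1
  then have p1: "p1 ~= 0" using p by simp
  have "p1^2 * ((1 - \<beta>) * \<gamma> * p2^2 + (1 + \<gamma>) * \<beta> * p3^2) = (1 - \<beta>) * ((p0 * p3)^2 + \<gamma> * (p1 * p2)^2) - (1 + \<gamma>) * ((p0 * p2)^2 - \<beta> * (p1 * p3)^2)"
   by (simp add: 1 algebra_simps power2_eq_square)
  also have "... = 0" by (rule F)
  finally have "p1^2 * ((1 - \<beta>) * \<gamma> * p2^2 + (1 + \<gamma>) * \<beta> * p3^2) = 0" .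
  then have e: "(1 - \<beta>) * \<gamma> * p2^2 + (1 + \<gamma>) * \<beta> * p3^2 = 0" using p1 by simp
  then have p23: "p2 ~= 0" "p3 ~= 0" using p nz by auto
  \<comment> \<open>\<open>a\<close> and \<open>c\<close> solve the first equation, \<open>b\<close>
    and \<open>d\<close> the fourth and the second; the third is then a consequence of the
    quadric.\<close>
  define c where "c = - p1 * (1 - \<beta>)"
  define a where "a = p3 * (1 + \<beta>)"
  define b where "b = p2 * (1 - \<gamma>) * c / (p1 * (1 + \<gamma>))"
  define d where "d = (c * p3 * (1 - \<beta>) + a * p1 * (1 + \<beta>)) / (2 * p2)"
  have b: "b * p1 * (1 + \<gamma>) = p2 * (1 - \<gamma>) * c" and d: "2 * d * p2 = c * p3 * (1 - \<beta>) + a * p1 * (1 + \<beta>)"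
   using p1 p23 nz two by (simp_all add: b_def d_def)
  have "(1 + \<gamma>) * p2 * (- c * p2 * (1 + \<gamma>) + b * p1 * (1 - \<gamma>) + 2 * d * p3) =
   - c * p2^2 * (1 + \<gamma>)^2 + p2 * (1 - \<gamma>) * (b * p1 * (1 + \<gamma>)) + (1 + \<gamma>) * p3 * (2 * d * p2)" by Groebner_Basis.algebra
  also have "... = 4 * p1 * ((1 - \<beta>) * \<gamma> * p2^2 + (1 + \<gamma>) * \<beta> * p3^2)"
   unfolding b d unfolding a_def c_def by Groebner_Basis.algebra
  finally have "(1 + \<gamma>) * p2 * (- c * p2 * (1 + \<gamma>) + b * p1 * (1 - \<gamma>) + 2 * d * p3) = 0" using e by simp
  then have "- c * p2 * (1 + \<gamma>) + b * p1 * (1 - \<gamma>) + 2 * d * p3 = 0" using nz p23 by (simp only: mult_eq_0_iff) simp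
  moreover have "c * p3 * (1 + \<beta>) + a * p1 * (1 - \<beta>) - 2 * b * p0 = 0" unfolding 1 a_def c_def by (simp add: algebra_simps)
  moreover have "- c * p2 * (1 - \<gamma>) + b * p1 * (1 + \<gamma>) - 2 * a * p0 = 0" unfolding 1 b by (simp add: algebra_simps)
  moreover have "c ~= 0" using p1 nz by (simp add: c_def)
  ultimately show ?thesis using that[of a b c d] d by simp
 next
  case 2
  then have p3: "p3 ~= 0" using p by simp
  have "p3^2 * ((1 - \<beta>) * p0^2 + (1 + \<gamma>) * \<beta> * p1^2) = (1 - \<beta>) * ((p0 * p3)^2 + \<gamma> * (p1 * p2)^2) - (1 + \<gamma>) * ((p0 * p2)^2 - \<beta> * (p1 * p3)^2)"
   by (simp add: 2 algebra_simps power2_eq_square)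
  also have "... = 0" by (rule F)
  finally have "p3^2 * ((1 - \<beta>) * p0^2 + (1 + \<gamma>) * \<beta> * p1^2) = 0" .
  then have e: "(1 - \<beta>) * p0^2 + (1 + \<gamma>) * \<beta> * p1^2 = 0" using p3 by simp
  \<comment> \<open>\<open>a\<close> and \<open>c\<close> solve the second equation,
    \<open>b\<close> and \<open>d\<close> the first and the third; the fourth is then a consequence
    of the quadric.\<close>
  define c where "c = - p1 * (1 + \<beta>)"
  define a where "a = p3 * (1 - \<beta>)"
  define b where "b = (c * p3 * (1 + \<beta>) + a * p1 * (1 - \<beta>)) / (2 * p0)"
  define d where "d = - b * p1 * (1 - \<gamma>) / (2 * p3)"
  have b: "2 * b * p0 = c * p3 * (1 + \<beta>) + a * p1 * (1 - \<beta>)" using 2 two by (simp add: b_def)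
  have d: "2 * d * p3 = - b * p1 * (1 - \<gamma>)" using p3 two by (simp add: d_def)
  have "2 * p0 * (- c * p2 * (1 - \<gamma>) + b * p1 * (1 + \<gamma>) - 2 * a * p0) = p1 * (1 + \<gamma>) * (2 * b * p0) - 4 * a * p0^2"
   unfolding 2 by Groebner_Basis.algebra
  also have "... = - 4 * p3 * ((1 - \<beta>) * p0^2 + (1 + \<gamma>) * \<beta> * p1^2)" unfolding b unfolding a_def c_def by Groebner_Basis.algebra
  finally have "- c * p2 * (1 - \<gamma>) + b * p1 * (1 + \<gamma>) - 2 * a * p0 = 0" using e two 2(1) by simp
  moreover have "c * p3 * (1 - \<beta>) + a * p1 * (1 + \<beta>) - 2 * d * p2 = 0" unfolding 2 a_def c_def by (simp add: algebra_simps)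
  moreover have "- c * p2 * (1 + \<gamma>) + b * p1 * (1 - \<gamma>) + 2 * d * p3 = 0" unfolding d 2 by simp
  moreover have "a ~= 0" using p3 nz by (simp add: a_def)
  ultimately show ?thesis using that[of a b c d] b by simp
 next
  case 3
  \<comment> \<open>Eliminating \<open>b\<close> and \<open>d\<close> by the first two equations
    leaves two equations in \<open>a\<close> and \<open>c\<close>, whose determinant is
    \<open>- 8*p0\<close> times the quadric.\<close>
  define A where "A = - 4 * p0^2 + p1^2 * (1 + \<gamma>) * (1 - \<beta>)"
  define B where "B = p1 * p3 * (1 + \<gamma>) * (1 + \<beta>) - 2 * p0 * p2 * (1 - \<gamma>)"
  define A' where "A' = p1^2 * p2 * (1 - \<gamma>) * (1 - \<beta>) + 2 * p0 * p1 * p3 * (1 + \<beta>)"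
  define B' where "B' = p1 * p2 * p3 * (1 - \<gamma>) * (1 + \<beta>) - 2 * p0 * p2^2 * (1 + \<gamma>) + 2 * p0 * p3^2 * (1 - \<beta>)"
  have "A * B' - A' * B = - 8 * p0 * ((1 - \<beta>) * ((p0 * p3)^2 + \<gamma> * (p1 * p2)^2) - (1 + \<gamma>) * ((p0 * p2)^2 - \<beta> * (p1 * p3)^2))"
   unfolding A_def B_def A'_def B'_def by Groebner_Basis.algebra
  then have det: "A * B' = A' * B" using F by simp
  obtain a c where ac: "(a, c) ~= (0, 0)" "A * a + B * c = 0" "A' * a + B' * c = 0"
  proof (cases "A = 0 & B = 0")
   case True
   show ?thesis
   proof (cases "A' = 0 & B' = 0")
    case True
    then show ?thesis using that[of 1 0] \<open>A = 0 & B = 0\<close> by simp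
   next
    case False
    then show ?thesis using that[of B' "- A'"] True by (auto simp: mult.commute)
   qed
  next
   case False
   then show ?thesis using that[of B "- A"] det by (auto simp: mult.commute)
  qed
  define b where "b = (c * p3 * (1 + \<beta>) + a * p1 * (1 - \<beta>)) / (2 * p0)"
  define d where "d = (c * p3 * (1 - \<beta>) + a * p1 * (1 + \<beta>)) / (2 * p2)"
  have b: "2 * b * p0 = c * p3 * (1 + \<beta>) + a * p1 * (1 - \<beta>)" and d: "2 * d * p2 = c * p3 * (1 - \<beta>) + a * p1 * (1 + \<beta>)"
   using 3 two by (simp_all add: b_def d_def)
  have "2 * p0 * (- c * p2 * (1 - \<gamma>) + b * p1 * (1 + \<gamma>) - 2 * a * p0) = A * a + B * c"
   unfolding A_def B_def using b by Groebner_Basis.algebra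
  then have r4: "- c * p2 * (1 - \<gamma>) + b * p1 * (1 + \<gamma>) - 2 * a * p0 = 0" using ac(2) two 3(1) by simp
  have "2 * p0 * p2 * (- c * p2 * (1 + \<gamma>) + b * p1 * (1 - \<gamma>) + 2 * d * p3) = A' * a + B' * c"
   unfolding A'_def B'_def using b d by Groebner_Basis.algebra
  then have r3: "- c * p2 * (1 + \<gamma>) + b * p1 * (1 - \<gamma>) + 2 * d * p3 = 0" using ac(3) two 3 by simp
  show ?thesis using that[of a b c d] ac(1) b d r3 r4 by auto
 qed
qed

lemma sing_E1:
 fixes z :: "4 => 4 => 'k::field"
 assumes p: "params \<alpha> \<beta> \<gamma>" and s: "skew z" and z: "z 0 1 = 0" "z 2 3 = 0" "z 0 2 * z 1 3 = z 0 3 * z 1 2" and nz: "z a b ~= 0"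
  and F: "(1 - \<beta>) * (z 1 2 ^ 2 + \<gamma> * z 0 3 ^ 2) - (1 + \<gamma>) * (z 1 3 ^ 2 - \<beta> * z 0 2 ^ 2) = 0"
 shows "sing \<alpha> \<beta> \<gamma> z"
proof -
 interpret params \<alpha> \<beta> \<gamma> by (rule p)
 have sk: "z 1 0 = - z 0 1" "z 2 0 = - z 0 2" "z 3 0 = - z 0 3" "z 2 1 = - z 1 2" "z 3 1 = - z 1 3" "z 3 2 = - z 2 3"
  "z 0 0 = 0" "z 1 1 = 0" "z 2 2 = 0" "z 3 3 = 0"
  proof -
  have a: "z s r = - z r s" and b: "z r r = 0" for r s using s unfolding skew_def by blast+
  show "z 1 0 = - z 0 1" "z 2 0 = - z 0 2" "z 3 0 = - z 0 3" "z 2 1 = - z 1 2" "z 3 1 = - z 1 3" "z 3 2 = - z 2 3"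
   "z 0 0 = 0" "z 1 1 = 0" "z 2 2 = 0" "z 3 3 = 0"
   by (rule a b)+
 qed
 \<comment> \<open>For \<open>z01 = z23 = 0\<close> the four other coordinates form a matrix of
   determinant zero; its factors are the coefficients of the two equations of the line.\<close>
 obtain p1 m0 p3 m2 where f: "z 0 2 = p1 * p3" "z 0 3 = p1 * m2" "z 1 2 = m0 * p3" "z 1 3 = m0 * m2" using rank_one[OF z(3)] by metis
 define p0 where "p0 = - m0"
 define p2 where "p2 = - m2"
 have f': "z 0 2 = p1 * p3" "z 0 3 = - p1 * p2" "z 1 2 = - p0 * p3" "z 1 3 = p0 * p2" by (simp_all add: f p0_def p2_def)
 have all: "z r t = 0" if "p0 = 0 & p1 = 0 | p2 = 0 & p3 = 0" for r t
  using exhaust_4'[of r] exhaust_4'[of t] that by (elim disjE) (simp_all add: sk z f')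
 have n: "p0 ~= 0 | p1 ~= 0" "p2 ~= 0 | p3 ~= 0" using all[of a b] \<open>z a b ~= 0\<close> by blast+
 have F': "(1 - \<beta>) * ((p0 * p3)^2 + \<gamma> * (p1 * p2)^2) - (1 + \<gamma>) * ((p0 * p2)^2 - \<beta> * (p1 * p3)^2) = 0"
  using F by (simp add: f')
 obtain a b c d where k: "(a, b, c, d) ~= (0, 0, 0, 0)"
  "c * p3 * (1 + \<beta>) + a * p1 * (1 - \<beta>) - 2 * b * p0 = 0" "c * p3 * (1 - \<beta>) + a * p1 * (1 + \<beta>) - 2 * d * p2 = 0"
  "- c * p2 * (1 + \<gamma>) + b * p1 * (1 - \<gamma>) + 2 * d * p3 = 0" "- c * p2 * (1 - \<gamma>) + b * p1 * (1 + \<gamma>) - 2 * a * p0 = 0"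
  using quad_kernel[OF char nzs(8,5,6,9,2,3) F' n] by metis
 define l :: "2 => 4 => 'k" where "l s j = (if s = 0 then (if j = 0 then p1 else if j = 1 then - p0 else 0) else (if j = 2 then p3 else if j = 3 then - p2 else 0))" for s j
 define \<kappa> :: "4 => 2 => 'k" where "\<kappa> r s = (if s = 0 then (if r = 2 then a else if r = 3 then b else 0) else (if r = 0 then c else if r = 1 then d else 0))" for r s
 have "EX r s. \<kappa> r s ~= 0"
 proof (rule ccontr)
  assume "~ ?thesis"
  then have "\<kappa> 2 0 = 0" "\<kappa> 3 0 = 0" "\<kappa> 0 1 = 0" "\<kappa> 1 1 = 0" by blast+
  then show False using k(1) by (simp add: \<kappa>_def)
 qed
 moreover have "zz l r j = z r j" for r j
  using exhaust_4'[of r] exhaust_4'[of j] by (elim disjE) (simp_all add: zz_def l_def sk z f')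
 moreover have "relT \<alpha> \<beta> \<gamma> (%r j. \<kappa> r 0 * l 0 j + \<kappa> r 1 * l 1 j)"
 proof -
  define T where "T r j = \<kappa> r 0 * l 0 j + \<kappa> r 1 * l 1 j" for r j
  have Tv: "T 2 0 = a * p1" "T 2 1 = - a * p0" "T 3 0 = b * p1" "T 3 1 = - b * p0" "T 0 2 = c * p3" "T 0 3 = - c * p2" "T 1 2 = d * p3" "T 1 3 = - d * p2"
   "T 0 0 = 0" "T 1 1 = 0" "T 2 2 = 0" "T 3 3 = 0" "T 0 1 = 0" "T 1 0 = 0" "T 2 3 = 0" "T 3 2 = 0"
   by (simp_all add: T_def \<kappa>_def l_def)
  have "relT \<alpha> \<beta> \<gamma> T"
  proof (rule relTI)
   show "T 0 2 * (1 + \<beta>) + T 2 0 * (1 - \<beta>) + 2 * T 3 1 = 0" unfolding Tv using k(2) by Groebner_Basis.algebra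
   show "T 0 2 * (1 - \<beta>) + T 2 0 * (1 + \<beta>) + 2 * T 1 3 = 0" unfolding Tv using k(3) by Groebner_Basis.algebra
   show "T 0 3 * (1 + \<gamma>) + T 3 0 * (1 - \<gamma>) + 2 * T 1 2 = 0" unfolding Tv using k(4) by Groebner_Basis.algebra
   show "T 0 3 * (1 - \<gamma>) + T 3 0 * (1 + \<gamma>) + 2 * T 2 1 = 0" unfolding Tv using k(5) by Groebner_Basis.algebra
  qed (simp_all add: Tv)
  moreover have "T = (%r j. \<kappa> r 0 * l 0 j + \<kappa> r 1 * l 1 j)" by (intro ext) (rule T_def)
  ultimately show ?thesis by (simp only:)
 qed
 ultimately show ?thesis unfolding sing_def by blast
qed

section \<open>The ideal of the line scheme\<close>

text \<open>The extension of \<open>b\<close> to the free algebra that ignores all words of length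
  other than two.\<close>

definition word_pairing :: "(4 => 4 => 'k::field) => (4, 'k) free_algebra => 'k" where
 "word_pairing b f = (\<Sum>r\<in>UNIV. \<Sum>s\<in>UNIV. b r s * Poly_Mapping.lookup f (Word [r, s]))"

lemma word_pairing_add: "word_pairing b (f + g) = word_pairing b f + word_pairing b g"
 by (simp add: word_pairing_def lookup_add distrib_left sum.distrib)

lemma word_pairing_0 [simp]: "word_pairing b 0 = 0"
 by (simp add: word_pairing_def)

lemma word_pairing_uminus: "word_pairing b (- f) = - word_pairing b f"
 by (simp add: word_pairing_def sum_negf)

lemma word_pairing_diff: "word_pairing b (f - g) = word_pairing b f - word_pairing b g"
 using word_pairing_add[of b f "- g"] by (simp add: word_pairing_uminus)

lemma word_pairing_single: "word_pairing b (Poly_Mapping.single (Word [i, j]) c) = c * b i j"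
proof -
 have "word_pairing b (Poly_Mapping.single (Word [i, j]) c) = (\<Sum>r\<in>UNIV. \<Sum>s\<in>UNIV. if s = j then (if r = i then c * b r s else 0) else 0)"
  unfolding word_pairing_def by (intro sum.cong refl) (auto simp: lookup_single)
 then show ?thesis by (simp add: sum.delta)
qed

lemma word_pairing_other: "(!!r s. w ~= Word [r, s]) ==> word_pairing b (Poly_Mapping.single w c) = 0"
 unfolding word_pairing_def by (intro sum.neutral ballI) (simp add: lookup_single)

lemma gen_mult: "gen i * gen j = (Poly_Mapping.single (Word [i, j]) 1 :: ('g, 'k::semiring_1) free_algebra)"
 by (simp add: gen_def mult_single)

lemma Const_single: "Const c * Poly_Mapping.single w d = (Poly_Mapping.single w (c * d) :: ('g, 'k::semiring_1) free_algebra)"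
 by (simp add: Const_def mult_single)

lemma word_pairing_scale: "word_pairing b (scale c f) = c * word_pairing b f"
proof (induction f rule: poly_mapping_single_induct)
 case (single w d)
 show ?case
 proof (cases "EX r s. w = Word [r, s]")
  case True
  then show ?thesis by (auto simp: Const_single word_pairing_single)
 qed (simp add: Const_single word_pairing_other)
qed (simp_all add: distrib_left word_pairing_add)

lemma free_Const:
 "Const (a + b) = (Const a + Const b :: ('g, 'k::field) free_algebra)" "Const (a * b) = (Const a * Const b :: ('g, 'k::field) free_algebra)"
 "Const 1 = (1 :: ('g, 'k::field) free_algebra)"
 by (simp_all add: Const_def single_add mult_single)

lemma bil_functional:
 assumes "bil \<alpha> \<beta> \<gamma> b"
 shows "word_pairing b : A_functionals \<alpha> \<beta> \<gamma>"
proof -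
 have "Vector_Spaces.linear scale (*) (word_pairing b)"
  by unfold_locales (simp_all add: free_Const word_pairing_add word_pairing_scale distrib_left distrib_right mult.assoc)
 moreover have "word_pairing b f = 0" if "f : A_ideal \<alpha> \<beta> \<gamma>" for f
  using that unfolding A_ideal_def
 proof induction
  case (mult g x y)
  \<comment> \<open>Multiplication by nonempty words leaves length two, so only the constant terms
    of \<open>x\<close> and \<open>y\<close> matter.\<close>
  have mono: "word_pairing b (x * Poly_Mapping.single (Word [i, j]) c * y) = Poly_Mapping.lookup x 0 * Poly_Mapping.lookup y 0 * c * b i j" for i j c
  proof (induction x rule: poly_mapping_single_induct)
   case (single u d)
   show ?case
   proof (induction y rule: poly_mapping_single_induct)
    case (single w e)
    have e: "Poly_Mapping.single u d * Poly_Mapping.single (Word [i, j]) c * Poly_Mapping.single w e =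
      Poly_Mapping.single (u + Word [i, j] + w) (d * c * e)" by (simp add: mult_single)
    obtain us ws where uw: "u = Word us" "w = Word ws" by (cases u; cases w) auto
    show ?case
    proof (cases "us = [] & ws = []")
     case True
     then show ?thesis unfolding e unfolding uw by (simp add: word_pairing_single zero_word_def lookup_single mult_ac)
    next
     case False
     then have "u + Word [i, j] + w ~= Word [r, s]" for r s
      unfolding uw by (cases us; cases ws) (auto simp: append_eq_Cons_conv Cons_eq_append_conv)
     then have "word_pairing b (Poly_Mapping.single (u + Word [i, j] + w) (d * c * e)) = 0" by (rule word_pairing_other)
     moreover have "Poly_Mapping.lookup (Poly_Mapping.single u d) 0 * Poly_Mapping.lookup (Poly_Mapping.single w e) 0 = 0"
      using False by (auto simp: uw zero_word_def lookup_single)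
     ultimately show ?thesis unfolding e by (metis mult_zero_left)
    qed
   qed (simp_all add: distrib_left word_pairing_add lookup_add algebra_simps)
  qed (simp_all add: distrib_right word_pairing_add lookup_add algebra_simps)
  let ?\<phi> = "%g. word_pairing b (x * g * y)"
  have lin: "?\<phi> (g - h) = ?\<phi> g - ?\<phi> h" "?\<phi> (g + h) = ?\<phi> g + ?\<phi> h" for g h
   by (simp_all add: distrib_left distrib_right left_diff_distrib right_diff_distrib word_pairing_add word_pairing_diff)
  have gg: "?\<phi> (gen i * gen j) = Poly_Mapping.lookup x 0 * Poly_Mapping.lookup y 0 * b i j"
   "?\<phi> (scale c (gen i * gen j)) = Poly_Mapping.lookup x 0 * Poly_Mapping.lookup y 0 * c * b i j" for i j c
   by (simp_all add: gen_mult Const_single mono)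
  have z: "?\<phi> (gen 0 * gen i - gen i * gen 0 - scale a (gen j * gen k - gen k * gen j)) = 0"
   "?\<phi> (gen 0 * gen i + gen i * gen 0 - (gen j * gen k + gen k * gen j)) = 0"
   if "b 0 i - b i 0 = a * (b j k - b k j)" "b 0 i + b i 0 = b j k + b k j" for a i j k
  proof -
   have "?\<phi> (gen 0 * gen i - gen i * gen 0 - scale a (gen j * gen k - gen k * gen j)) =
    Poly_Mapping.lookup x 0 * Poly_Mapping.lookup y 0 * ((b 0 i - b i 0) - a * (b j k - b k j))"
    unfolding right_diff_distrib[of "Const a"] lin gg by (simp add: algebra_simps)
   then show "?\<phi> (gen 0 * gen i - gen i * gen 0 - scale a (gen j * gen k - gen k * gen j)) = 0" using that by simp
   have "?\<phi> (gen 0 * gen i + gen i * gen 0 - (gen j * gen k + gen k * gen j)) =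
    Poly_Mapping.lookup x 0 * Poly_Mapping.lookup y 0 * ((b 0 i + b i 0) - (b j k + b k j))"
    unfolding lin gg by (simp add: algebra_simps)
   then show "?\<phi> (gen 0 * gen i + gen i * gen 0 - (gen j * gen k + gen k * gen j)) = 0" using that by simp
  qed
  show ?case using mult assms z unfolding A_relations_def bil_def by auto
 qed (simp_all add: word_pairing_add)
 ultimately show ?thesis by (simp add: A_functionals_def)
qed

lemma functional_bil:
 assumes "\<phi> : A_functionals \<alpha> \<beta> \<gamma>"
 shows "bil \<alpha> \<beta> \<gamma> (%r j. \<phi> (gen r * gen j))"
proof -
 have L: "Vector_Spaces.linear scale (*) \<phi>" and Z: "!!f. f : A_ideal \<alpha> \<beta> \<gamma> ==> \<phi> f = 0"
  using assms by (auto simp: A_functionals_def)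
 interpret Vector_Spaces.linear scale "(*)" \<phi> by (rule L)
 have m: "\<phi> g = 0" if "g : A_relations \<alpha> \<beta> \<gamma>" for g
  using Z two_sided_ideal.mult[OF that, of 1 1] by (simp add: A_ideal_def)
 have "\<phi> (gen 0 * gen i) - \<phi> (gen i * gen 0) = a * (\<phi> (gen j * gen k) - \<phi> (gen k * gen j)) &
   \<phi> (gen 0 * gen i) + \<phi> (gen i * gen 0) = \<phi> (gen j * gen k) + \<phi> (gen k * gen j)"
  if "(a, i, j, k) : {(\<alpha>, 1, 2, 3), (\<beta>, 2, 3, 1), (\<gamma>, 3, 1, 2)}" for a i j k
 proof -
  have "gen 0 * gen i - gen i * gen 0 - scale a (gen j * gen k - gen k * gen j) : A_relations \<alpha> \<beta> \<gamma>"
   "gen 0 * gen i + gen i * gen 0 - (gen j * gen k + gen k * gen j) : A_relations \<alpha> \<beta> \<gamma>"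
   using that unfolding A_relations_def by blast+
  from this[THEN m] show ?thesis by (simp only: add diff scale) simp
 qed
 then show ?thesis unfolding bil_def by auto
qed

lemma psubst_minors:
 fixes \<alpha> \<beta> \<gamma> :: "'k::field"
 shows "minors_in Const \<alpha> \<beta> \<gamma> (%s j. Var (s, j)) (ideal_gen (line_minors \<alpha> \<beta> \<gamma>))"
 unfolding minors_in_def
proof (intro allI impI)
 fix b :: "4 \<times> 2 => 4 => 4 => 'k" assume b: "ALL a. bil \<alpha> \<beta> \<gamma> (b a)"
 have e: "b a r j = word_pairing (b a) (gen r * gen j)" for a r j
  by (simp add: gen_mult word_pairing_single)
 have "Determinants.det (\<chi> a c. \<Sum>j\<in>UNIV. Const (word_pairing (b a) (gen (fst c) * gen j)) * Var (snd c, j)) : line_minors \<alpha> \<beta> \<gamma>"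
  unfolding line_minors_def by (rule CollectI, rule exI[of _ "%a. word_pairing (b a)"]) (use bil_functional b in blast)
 then have "Determinants.det (\<chi> a c. \<Sum>j\<in>UNIV. Const (b a (fst c) j) * Var (snd c, j)) : line_minors \<alpha> \<beta> \<gamma>"
  by (simp only: e[symmetric])
 then show "Determinants.det (\<chi> a c. \<Sum>j\<in>UNIV. Const (b a (fst c) j) * Var (snd c, j)) : ideal_gen (line_minors \<alpha> \<beta> \<gamma>)"
  by (rule ideal_gen_base)
qed

lemma det_zero_kernel:
 fixes A :: "'k::field^'n::finite^'n"
 assumes "A *v x = 0" "x ~= 0"
 shows "Determinants.det A = 0"
proof (rule ccontr)
 assume "Determinants.det A ~= 0"
 then have "invertible A" by (simp add: invertible_det_nz)
 then obtain B where "B ** A = mat 1" by (auto simp: invertible_def)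
 then have "x = B *v (A *v x)" by (simp add: matrix_vector_mul_assoc)
 then show False using assms by simp
qed

text \<open>Functionals on \<open>A\<close> kill the relations, so \<kappa> is a common kernel
  vector of all the evaluated matrices.\<close>

lemma minors_vanish:
 fixes l :: "2 => 4 => 'k::field" and \<kappa> :: "4 => 2 => 'k"
 assumes two: "(2 :: 'k) ~= 0" and k: "EX r s. \<kappa> r s ~= 0" and T: "relT \<alpha> \<beta> \<gamma> (%r j. \<kappa> r 0 * l 0 j + \<kappa> r 1 * l 1 j)"
  and f: "f : line_minors \<alpha> \<beta> \<gamma>"
 shows "peval (\<chi> x. l (fst x) (snd x)) f = 0"
proof -
 obtain \<phi> :: "4 \<times> 2 => (4, 'k) free_algebra => 'k" where p: "!!a. \<phi> a : A_functionals \<alpha> \<beta> \<gamma>"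
  and f: "f = Determinants.det (\<chi> a c. \<Sum>j\<in>UNIV. Const (\<phi> a (gen (fst c) * gen j)) * Var (snd c, j))"
  using f unfolding line_minors_def by blast
 let ?A = "(\<chi> a c. \<Sum>j\<in>UNIV. \<phi> a (gen (fst c) * gen j) * l (snd c) j) :: 'k^(4 \<times> 2)^(4 \<times> 2)"
 let ?x = "(\<chi> c. \<kappa> (fst c) (snd c)) :: 'k^(4 \<times> 2)"
 have U2: "(UNIV :: 2 set) = {0, 1}" using exhaust_2 by (simp add: UNIV_2 doubleton_eq_iff)
 have "(?A *v ?x) $ a = 0" for a
 proof -
  have "(?A *v ?x) $ a = (\<Sum>c\<in>UNIV \<times> UNIV. (\<Sum>j\<in>UNIV. \<phi> a (gen (fst c) * gen j) * l (snd c) j) * \<kappa> (fst c) (snd c))"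
   by (simp add: matrix_vector_mult_def)
  also have "... = (\<Sum>r\<in>UNIV. \<Sum>s\<in>UNIV. (\<Sum>j\<in>UNIV. \<phi> a (gen r * gen j) * l s j) * \<kappa> r s)"
   by (subst sum.cartesian_product) (simp add: case_prod_unfold)
  also have "... = (\<Sum>r\<in>UNIV. \<Sum>j\<in>UNIV. (\<kappa> r 0 * l 0 j + \<kappa> r 1 * l 1 j) * \<phi> a (gen r * gen j))"
   by (simp add: U2 sum_distrib_left sum_distrib_right sum.distrib algebra_simps)
  also have "... = 0" by (rule relT_bil[OF two T functional_bil[OF p]])
  finally show ?thesis .
 qed
 then have "?A *v ?x = 0" by (simp add: Finite_Cartesian_Product.vec_eq_iff)
 moreover have "?x ~= 0" using k by (auto simp: Finite_Cartesian_Product.vec_eq_iff)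
 ultimately have "Determinants.det ?A = 0" by (rule det_zero_kernel)
 moreover have "peval (\<chi> x. l (fst x) (snd x)) f = Determinants.det ?A"
  unfolding f rhom_det[OF peval_rhom] by (rule arg_cong[of _ _ Determinants.det]) (simp add: Finite_Cartesian_Product.vec_eq_iff)
 ultimately show ?thesis by simp
qed

text \<open>As a skew matrix a Pluecker vector can be rotated by renaming indices.\<close>

definition zc :: "'k::field^pl => 4 => 4 => 'k" where
 "zc v r s = (if r = 0 & s = 1 then v $ Z01 else if r = 1 & s = 0 then - v $ Z01
  else if r = 0 & s = 2 then v $ Z02 else if r = 2 & s = 0 then - v $ Z02
  else if r = 0 & s = 3 then v $ Z03 else if r = 3 & s = 0 then - v $ Z03
  else if r = 1 & s = 2 then v $ Z12 else if r = 2 & s = 1 then - v $ Z12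
  else if r = 1 & s = 3 then v $ Z13 else if r = 3 & s = 1 then - v $ Z13
  else if r = 2 & s = 3 then v $ Z23 else if r = 3 & s = 2 then - v $ Z23 else 0)"

lemma zc_skew: "skew (zc v)"
 unfolding skew_def
proof (intro conjI allI)
 show "zc v r r = 0" for r using exhaust_4'[of r] by (auto simp: zc_def)
 show "zc v s r = - zc v r s" for r s using exhaust_4'[of r] exhaust_4'[of s] by (elim disjE) (simp_all add: zc_def)
qed

lemma zc_nonzero: "v ~= 0 ==> EX a b. zc v a b ~= 0"
proof -
 assume "v ~= 0"
 then obtain e where "v $ e ~= 0" by (auto simp: Finite_Cartesian_Product.vec_eq_iff)
 then have "zc v (fst (pl_index e)) (snd (pl_index e)) ~= 0" by (cases e) (auto simp: zc_def)
 then show ?thesis by blast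
qed

text \<open>Some coordinate of \<open>v\<close> is nonzero, so the power of it that occurs in the
  saturation can be cancelled.\<close>

lemma line_scheme_vanish:
 assumes two: "(2 :: 'k::alg_closed_field) ~= 0" and s: "sing \<alpha> \<beta> \<gamma> (zc v)" and v: "v ~= 0" and f: "f : line_scheme \<alpha> \<beta> (\<gamma> :: 'k)"
 shows "peval v f = 0"
proof -
 obtain l and \<kappa> :: "4 => 2 => 'k" where k: "EX r s. \<kappa> r s ~= 0" "!!r j. zz l r j = zc v r j"
  "relT \<alpha> \<beta> \<gamma> (%r j. \<kappa> r 0 * l 0 j + \<kappa> r 1 * l 1 j)"
  using s unfolding sing_def by blast
 let ?m = "\<chi> x. l (fst x) (snd x)"
 have g: "peval ?m (generic_pluecker e) = v $ e" for e
  using k(2)[of "fst (pl_index e)" "snd (pl_index e)"]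
  by (cases e) (simp_all add: generic_pluecker_def pluecker_def zz_def zc_def)
 obtain e where e: "v $ e ~= 0" using v by (auto simp: Finite_Cartesian_Product.vec_eq_iff)
 obtain N where N: "generic_pluecker e ^ N * psubst generic_pluecker f : ideal_gen (line_minors \<alpha> \<beta> \<gamma>)"
  using f by (auto simp: line_scheme_def)
 have "peval ?m (generic_pluecker e ^ N * psubst generic_pluecker f) = 0"
  by (rule peval_ideal_gen[OF N]) (rule minors_vanish[OF two k(1,3)])
 then have "v $ e ^ N * peval v f = 0" by (simp add: g peval_psubst)
 then show ?thesis using e by simp
qed

section \<open>The ideal of the line scheme\<close>

locale lines = params \<alpha> \<beta> \<gamma> for \<alpha> \<beta> \<gamma> :: "'k::alg_closed_field"

lemma (in lines) frame_pl: "frame (Var Z01 :: (pl, 'k) mpoly) (Var Z23) (Var Z02) (- Var Z13) (Var Z03) (Var Z12)"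
proof unfold_locales
 show "homogeneous 1 y" if "y : {Var Z01, Var Z23, Var Z02, - Var Z13, Var Z03, Var Z12}" for y :: "(pl, 'k) mpoly"
  using that homogeneous_Var by (auto intro: homogeneous_uminus simp del: One_nat_def)
 show "\<exists>y\<in>{Var Z01, Var Z23, Var Z02, - Var Z13, Var Z03, Var Z12}. Var x = y | Var x = - (y :: (pl, 'k) mpoly)" for x
  by (cases x) auto
 fix a1 b1 a2 b2 a3 b3 :: 'k
 show "EX v. peval v (Var Z01) = a1 & peval v (Var Z23) = b1 & peval v (Var Z02) = a2 & peval v (- Var Z13) = b2 & peval v (Var Z03) = a3 & peval v (Var Z12) = b3"
  by (rule exI[of _ "\<chi> e. case e of Z01 => a1 | Z02 => a2 | Z03 => a3 | Z12 => b3 | Z13 => - b2 | Z23 => b1"]) simp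
qed (rule char)

sublocale lines \<subseteq> curves "Var Z01" "Var Z23" "Var Z02" "- Var Z13" "Var Z03" "Var Z12" \<alpha> \<beta> \<gamma>
 using frame_pl params_axioms by (simp add: curves_def)

context lines
begin

lemma J_in_line_scheme: "JE Int JC \<subseteq> line_scheme \<alpha> \<beta> \<gamma>"
proof
 fix f assume f: "f : JE Int JC"
 let ?I = "ideal_gen (line_minors \<alpha> \<beta> \<gamma>)" and ?l = "%s j. Var (s, j) :: (2 \<times> 4, 'k) mpoly" and ?h = "psubst generic_pluecker :: (pl, 'k) mpoly => _"
 have m: "minors_ideal Const \<alpha> \<beta> \<gamma> ?l ?I"
  by unfold_locales (simp_all add: Const_rhom psubst_minors)
 have v: "v ~: K c" if "u ~: K c" "v - Const t * u : K c" "t ~= 0" for u v t c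
 proof
  assume "v : K c"
  then have "v - (v - Const t * u) : K c" using that(2) idealD(6)[OF K_is_ideal] by blast
  then have "Const t * u : K c" by simp
  then show False using ideal_Const_cancel[OF K_is_ideal that(3)] that(1) by blast
 qed
 have g: "A c : K c" "B c : K c" "W c : K c" for c by (simp_all add: K_def ideal_gen_base)
 have t0: "slope1 \<alpha> c ~= 0" "slope2 \<beta> c ~= 0" "slope3 \<gamma> c ~= 0" for c using nzs by (auto simp: slope_defs)
 \<comment> \<open>The slopes are nonzero, so the \<open>v_i\<close> as well as the
   \<open>u_i\<close> lie outside the prime ideals of the conics and can be cancelled.\<close>
 have nK: "x ~: K c" if "x : {Var Z01, Var Z23, Var Z02, - Var Z13, Var Z03, Var Z12}" for x c
  using that K_u_notin[of c] v[OF K_u_notin(1) g(1)[unfolded A_def] t0(1)] v[OF K_u_notin(2) g(2)[unfolded B_def] t0(2)]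
   v[OF K_u_notin(3) g(3)[unfolded W_def] t0(3)] by blast
 have gd: "good Const \<alpha> \<beta> \<gamma> (Var Z01) (Var Z23) (Var Z02) (- Var Z13) (Var Z03) (Var Z12) f"
  unfolding good_def on_all_def
 proof (intro conjI allI impI)
  show "f : K c" for c using f exhaust_4'[of c] by (auto simp: JC_def)
  show "f : ideal_gen {Var Z01, Var Z23, P, F1}" "f \<in> ideal_gen {Var Z02, - Var Z13, P, F2}" "f \<in> ideal_gen {Var Z03, Var Z12, P, F3}"
   using f by (auto simp: JE_def E1_def E2_def E3_def)
  show "g : K c" if "x : {Var Z01, Var Z23, Var Z02, - Var Z13, Var Z03, Var Z12}" "x * g \<in> K c" for x g c
   using K_prime[OF that(2)] nK[OF that(1)] by blast
 qed
 have h: "?h (Var Z01) = zz ?l 0 1" "?h (Var Z23) = zz ?l 2 3" "?h (Var Z02) = zz ?l 0 2" "?h (- Var Z13) = zz ?l 3 1" "?h (Var Z03) = zz ?l 0 3" "?h (Var Z12) = zz ?l 1 2"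
  by (simp_all add: generic_pluecker_def pluecker_def zz_def)
 note oa = on_all_in_minors[OF m Const_rhom psubst_rhom _ h gd]
 have N: "EX N. ?h x ^ N * ?h f : ?I" if "x : {Var Z01, Var Z23, Var Z02, - Var Z13, Var Z03, Var Z12}" for x
  using oa that by simp
 have "EX N. generic_pluecker e ^ N * ?h f : ?I" for e
 proof (cases "e = Z13")
  case True
  obtain N where N: "?h (- Var Z13) ^ N * ?h f : ?I" using N[of "- Var Z13"] by auto
  have "generic_pluecker Z13 ^ N * ?h f = (- 1) ^ N * (?h (- Var Z13) ^ N * ?h f)"
   by (simp add: power_mult_distrib[symmetric] mult.assoc[symmetric])
  then show ?thesis unfolding True using ideal_genD(3)[OF N] by metis
 next
  case False
  then have "Var e : {Var Z01, Var Z23, Var Z02, - Var Z13, Var Z03, Var Z12 :: (pl, 'k) mpoly}" by (cases e) auto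
  from N[OF this] show ?thesis by simp
 qed
 then show "f : line_scheme \<alpha> \<beta> \<gamma>" by (simp add: line_scheme_def)
qed

lemma line_scheme_in_J: "line_scheme \<alpha> \<beta> \<gamma> \<subseteq> JE Int JC"
proof
 fix f assume f: "f : line_scheme \<alpha> \<beta> \<gamma>"
 have vanish: "peval v f = 0" if "sing \<alpha> \<beta> \<gamma> (zc v)" "v ~= 0" for v by (rule line_scheme_vanish[OF char that f])
 have rot: "params \<beta> \<gamma> \<alpha>" "params \<gamma> \<alpha> \<beta>" by (unfold_locales; use char nz con in "auto simp: algebra_simps")+
 have sk: "skew (%r s. zc v (cyc r) (cyc s))" "skew (%r s. zc v (cyc (cyc r)) (cyc (cyc s)))" for v
  using zc_skew[of v] unfolding skew_def by blast+
 have vals: "peval v P = v $ Z01 * v $ Z23 - v $ Z02 * v $ Z13 + v $ Z03 * v $ Z12" for v by (simp add: P_def)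
 have 1: "sing \<alpha> \<beta> \<gamma> (zc v)" if z: "zero1 v" and v: "v ~= 0" for v
 proof -
  obtain a b where nz: "zc v a b ~= 0" using zc_nonzero[OF v] by blast
  have zv: "zc v 0 1 = v $ Z01" "zc v 2 3 = v $ Z23" "zc v 0 2 = v $ Z02" "zc v 1 3 = v $ Z13" "zc v 0 3 = v $ Z03" "zc v 1 2 = v $ Z12"
   by (simp_all add: zc_def)
  have f: "v $ Z01 = 0" "v $ Z23 = 0" "peval v P = 0" "peval v F1 = 0" using z by (simp_all add: zero1_def)
  show ?thesis
  proof (rule sing_E1[OF params_axioms zc_skew _ _ _ nz])
   show "zc v 0 1 = 0" "zc v 2 3 = 0" unfolding zv by (rule f)+
   show "zc v 0 2 * zc v 1 3 = zc v 0 3 * zc v 1 2" unfolding zv using f(1,3) unfolding vals by Groebner_Basis.algebra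
   have "peval v F1 = (1 - \<beta>) * (v $ Z12 ^ 2 + \<gamma> * v $ Z03 ^ 2) - (1 + \<gamma>) * (v $ Z13 ^ 2 - \<beta> * v $ Z02 ^ 2)" by (simp add: F1_def)
   then show "(1 - \<beta>) * (zc v 1 2 ^ 2 + \<gamma> * zc v 0 3 ^ 2) - (1 + \<gamma>) * (zc v 1 3 ^ 2 - \<beta> * zc v 0 2 ^ 2) = 0" unfolding zv using f(4) by (simp only:)
  qed
 qed
 have 2: "sing \<alpha> \<beta> \<gamma> (zc v)" if z: "zero2 v" and v: "v ~= 0" for v
 proof -
  obtain a b where "zc v a b ~= 0" using zc_nonzero[OF v] by blast
  then have nz: "(%r s. zc v (cyc r) (cyc s)) (cyc' a) (cyc' b) ~= 0" by (simp add: perm_invs)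
  have zv: "zc v (cyc 0) (cyc 1) = v $ Z02" "zc v (cyc 2) (cyc 3) = - v $ Z13" "zc v (cyc 0) (cyc 2) = v $ Z03" "zc v (cyc 1) (cyc 3) = - v $ Z12"
   "zc v (cyc 0) (cyc 3) = v $ Z01" "zc v (cyc 1) (cyc 2) = v $ Z23"
   by (simp_all add: zc_def cyc_def)
  have f: "v $ Z02 = 0" "- v $ Z13 = 0" "peval v P = 0" "peval v F2 = 0" using z by (simp_all add: zero2_def)
  have "sing \<beta> \<gamma> \<alpha> (%r s. zc v (cyc r) (cyc s))"
  proof (rule sing_E1[OF rot(1) sk(1) _ _ _ nz])
   show "zc v (cyc 0) (cyc 1) = 0" "zc v (cyc 2) (cyc 3) = 0" unfolding zv by (rule f)+
   show "zc v (cyc 0) (cyc 2) * zc v (cyc 1) (cyc 3) = zc v (cyc 0) (cyc 3) * zc v (cyc 1) (cyc 2)" unfolding zv using f(1,3) unfolding vals by Groebner_Basis.algebra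
   have "peval v F2 = (1 - \<gamma>) * (v $ Z23 ^ 2 + \<alpha> * v $ Z01 ^ 2) - (1 + \<alpha>) * ((- v $ Z12) ^ 2 - \<gamma> * v $ Z03 ^ 2)" by (simp add: F2_def)
   then show "(1 - \<gamma>) * (zc v (cyc 1) (cyc 2) ^ 2 + \<alpha> * zc v (cyc 0) (cyc 3) ^ 2) - (1 + \<alpha>) * (zc v (cyc 1) (cyc 3) ^ 2 - \<gamma> * zc v (cyc 0) (cyc 2) ^ 2) = 0"
    unfolding zv using f(4) by (simp only:)
  qed
  then show ?thesis by (rule sing_cyc)
 qed
 have 3: "sing \<alpha> \<beta> \<gamma> (zc v)" if z: "zero3 v" and v: "v ~= 0" for v
 proof -
  obtain a b where "zc v a b ~= 0" using zc_nonzero[OF v] by blast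
  then have nz: "(%r s. zc v (cyc (cyc r)) (cyc (cyc s))) (cyc' (cyc' a)) (cyc' (cyc' b)) ~= 0" by (simp add: perm_invs)
  have zv: "zc v (cyc (cyc 0)) (cyc (cyc 1)) = v $ Z03" "zc v (cyc (cyc 2)) (cyc (cyc 3)) = v $ Z12" "zc v (cyc (cyc 0)) (cyc (cyc 2)) = v $ Z01"
   "zc v (cyc (cyc 1)) (cyc (cyc 3)) = - v $ Z23" "zc v (cyc (cyc 0)) (cyc (cyc 3)) = v $ Z02" "zc v (cyc (cyc 1)) (cyc (cyc 2)) = - v $ Z13"
   by (simp_all add: zc_def cyc_def)
  have f: "v $ Z03 = 0" "v $ Z12 = 0" "peval v P = 0" "peval v F3 = 0" using z by (simp_all add: zero3_def)
  have "sing \<gamma> \<alpha> \<beta> (%r s. zc v (cyc (cyc r)) (cyc (cyc s)))"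
  proof (rule sing_E1[OF rot(2) sk(2) _ _ _ nz])
   show "zc v (cyc (cyc 0)) (cyc (cyc 1)) = 0" "zc v (cyc (cyc 2)) (cyc (cyc 3)) = 0" unfolding zv by (rule f)+
   show "zc v (cyc (cyc 0)) (cyc (cyc 2)) * zc v (cyc (cyc 1)) (cyc (cyc 3)) = zc v (cyc (cyc 0)) (cyc (cyc 3)) * zc v (cyc (cyc 1)) (cyc (cyc 2))"
    unfolding zv using f(1,3) unfolding vals by Groebner_Basis.algebra
   have "peval v F3 = (1 - \<alpha>) * ((- v $ Z13) ^ 2 + \<beta> * v $ Z02 ^ 2) - (1 + \<beta>) * ((- v $ Z23) ^ 2 - \<alpha> * v $ Z01 ^ 2)" by (simp add: F3_def)
   then show "(1 - \<alpha>) * (zc v (cyc (cyc 1)) (cyc (cyc 2)) ^ 2 + \<beta> * zc v (cyc (cyc 0)) (cyc (cyc 3)) ^ 2) - (1 + \<beta>) * (zc v (cyc (cyc 1)) (cyc (cyc 3)) ^ 2 - \<alpha> * zc v (cyc (cyc 0)) (cyc (cyc 2)) ^ 2) = 0"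
    unfolding zv using f(4) by (simp only:)
  qed
  then have "sing \<beta> \<gamma> \<alpha> (%r s. zc v (cyc r) (cyc s))" by (rule sing_cyc[of _ _ _ "%r s. zc v (cyc r) (cyc s)"])
  then show ?thesis by (rule sing_cyc)
 qed
 have c: "sing \<alpha> \<beta> \<gamma> (zc v)" if z: "conic.cone (Var Z01) (Var Z23) (Var Z02) (- Var Z13) (Var Z03) (Var Z12) (slope1 \<alpha> c) (slope2 \<beta> c) (slope3 \<gamma> c) v" and v: "v ~= 0" for v c
 proof -
  \<comment> \<open>The kernel vector on \<open>C_c\<close> comes from the signs that are positive
    at \<open>0\<close> and \<open>c\<close> and negative elsewhere; for \<open>C_0\<close> all
    signs are positive.\<close>
  let ?h = "%r :: 4. if c = 0 then 1 else if c = 1 then (if r = 0 | r = 1 then 1 else - 1) else if c = 2 then (if r = 0 | r = 2 then 1 else - 1) else if r = 0 | r = 3 then 1 else (- 1 :: 'k)"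
  have e: "v $ Z23 = slope1 \<alpha> c * v $ Z01" "v $ Z13 = - slope2 \<beta> c * v $ Z02" "v $ Z12 = slope3 \<gamma> c * v $ Z03"
   "slope1 \<alpha> c * v $ Z01 ^ 2 + slope2 \<beta> c * v $ Z02 ^ 2 + slope3 \<gamma> c * v $ Z03 ^ 2 = 0"
   using z unfolding conic.cone_def[OF K_conic] by (simp_all add: minus_equation_iff[of "v $ Z13"])
  obtain a b where nz: "zc v a b ~= 0" using zc_nonzero[OF v] by blast
  show ?thesis
  proof (rule sing_conic[OF zc_skew _ nz, of ?h])
   show "zc v 0 1 * zc v 2 3 - zc v 0 2 * zc v 1 3 + zc v 0 3 * zc v 1 2 = 0"
    using e(4) by (simp add: zc_def e(1-3) power2_eq_square algebra_simps)
   show "?h r ~= 0" for r by auto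
   define h where "h = ?h"
   have H: "h 0 * (1 + \<alpha>) - h 1 * (1 - \<alpha>) + 2 * h 2 * slope1 \<alpha> c = 0" "h 0 * (1 - \<alpha>) - h 1 * (1 + \<alpha>) - 2 * h 3 * slope1 \<alpha> c = 0"
    "h 0 * (1 + \<beta>) - h 2 * (1 - \<beta>) + 2 * h 3 * slope2 \<beta> c = 0" "h 0 * (1 - \<beta>) - h 2 * (1 + \<beta>) - 2 * h 1 * slope2 \<beta> c = 0"
    "h 0 * (1 + \<gamma>) - h 3 * (1 - \<gamma>) + 2 * h 1 * slope3 \<gamma> c = 0" "h 0 * (1 - \<gamma>) - h 3 * (1 + \<gamma>) - 2 * h 2 * slope3 \<gamma> c = 0"
    using exhaust_4'[of c] by (elim disjE; simp add: h_def slope_defs algebra_simps)+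
   have Z: "zc v 0 1 = v $ Z01" "zc v 1 0 = - v $ Z01" "zc v 2 3 = slope1 \<alpha> c * v $ Z01" "zc v 3 2 = - (slope1 \<alpha> c * v $ Z01)"
    "zc v 0 2 = v $ Z02" "zc v 2 0 = - v $ Z02" "zc v 3 1 = slope2 \<beta> c * v $ Z02" "zc v 1 3 = - (slope2 \<beta> c * v $ Z02)"
    "zc v 0 3 = v $ Z03" "zc v 3 0 = - v $ Z03" "zc v 1 2 = slope3 \<gamma> c * v $ Z03" "zc v 2 1 = - (slope3 \<gamma> c * v $ Z03)"
    "zc v 0 0 = 0" "zc v 1 1 = 0" "zc v 2 2 = 0" "zc v 3 3 = 0"
    by (simp_all add: zc_def e(1-3))
   have "relT \<alpha> \<beta> \<gamma> (%r j. h r * zc v r j)"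
   proof (rule relTI)
    show "h 0 * zc v 0 1 * (1 + \<alpha>) + h 1 * zc v 1 0 * (1 - \<alpha>) + 2 * (h 2 * zc v 2 3) = 0" unfolding Z using H(1) by Groebner_Basis.algebra
    show "h 0 * zc v 0 1 * (1 - \<alpha>) + h 1 * zc v 1 0 * (1 + \<alpha>) + 2 * (h 3 * zc v 3 2) = 0" unfolding Z using H(2) by Groebner_Basis.algebra
    show "h 0 * zc v 0 2 * (1 + \<beta>) + h 2 * zc v 2 0 * (1 - \<beta>) + 2 * (h 3 * zc v 3 1) = 0" unfolding Z using H(3) by Groebner_Basis.algebra
    show "h 0 * zc v 0 2 * (1 - \<beta>) + h 2 * zc v 2 0 * (1 + \<beta>) + 2 * (h 1 * zc v 1 3) = 0" unfolding Z using H(4) by Groebner_Basis.algebra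
    show "h 0 * zc v 0 3 * (1 + \<gamma>) + h 3 * zc v 3 0 * (1 - \<gamma>) + 2 * (h 1 * zc v 1 2) = 0" unfolding Z using H(5) by Groebner_Basis.algebra
    show "h 0 * zc v 0 3 * (1 - \<gamma>) + h 3 * zc v 3 0 * (1 + \<gamma>) + 2 * (h 2 * zc v 2 1) = 0" unfolding Z using H(6) by Groebner_Basis.algebra
   qed (simp_all add: Z)
   then show "relT \<alpha> \<beta> \<gamma> (%r j. ?h r * zc v r j)" by (simp only: h_def)
  qed
 qed
 have "f : K c" for c unfolding K_iff using vanish c by blast
 moreover have "f : E1" unfolding E1_iff using vanish 1 by blast
 moreover have "f : E2" unfolding E2_iff using vanish 2 by blast
 moreover have "f : E3" unfolding E3_iff using vanish 3 by blast
 ultimately show "f : JE Int JC" by (simp add: JE_def JC_def)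
qed

lemma line_scheme_eq: "line_scheme \<alpha> \<beta> \<gamma> = JE Int JC"
 using J_in_line_scheme line_scheme_in_J by blast

end

section \<open>The curves and the conics\<close>

lemma hilbert_poly_codim:
 fixes I :: "('x::finite, 'k::field) mpoly set"
 assumes "is_ideal I" "!!d. N <= d ==> codim (forms d UNIV) (forms d I) (h d)" "!!d. N <= d ==> int (h d) = a * int d + b"
 shows "hilbert_poly I = [:of_int b, of_int a:]"
proof (rule hilbert_poly_linear)
 show "int (hilbert_function I d) = a * int d + b" if "N <= d" for d
  using hilbert_function_codim[OF assms(1) assms(2)[OF that]] assms(3)[OF that] by simp
qed

lemma scheme_dim_degree:
 assumes "hilbert_poly I = [:b, a:]" "a ~= 0"
 shows "scheme_dim I = 1" "scheme_degree I = a"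
 using assms by (simp_all add: scheme_dim_def scheme_degree_def)

lemma niceI: "is_ideal I ==> graded I ==> (!!f. f : I \<longleftrightarrow> (ALL v. Z v --> v ~= 0 --> peval v f = 0)) ==> nice I"
 unfolding nice_def by blast

context curves
begin

lemma E1_nice: "nice E1"
 by (rule niceI[OF E_is_ideal(1) E1_graded E1_iff])

lemma K_nice: "nice (K c)"
 by (rule niceI[OF K_is_ideal K_graded K_iff])

lemma E1_hilbert: "hilbert_poly E1 = [:0, 4:]"
 using hilbert_poly_codim[OF E_is_ideal(1) E1_codim, of 2 4 0] by simp

lemma K_hilbert: "hilbert_poly (K c) = [:1, 2:]"
 using hilbert_poly_codim[OF K_is_ideal K_codim, of 1 2 1] by simp

lemma E1_dim: "scheme_dim E1 = 1" "scheme_degree E1 = 4"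
 using scheme_dim_degree[OF E1_hilbert] by simp_all

lemma K_dim: "scheme_dim (K c) = 1"
 using scheme_dim_degree(1)[OF K_hilbert] by simp

lemma one_notin: "1 ~: K c" "1 ~: E1"
proof -
 show "1 ~: K c" using K_u_notin(1)[of c] idealD(3)[OF K_is_ideal, of 1 c u1] by auto
 show "1 ~: E1"
 proof
  assume "1 : E1"
  then have "E1 = UNIV" using idealD(3)[OF E_is_ideal(1), of 1] by (metis UNIV_eq_I mult.right_neutral)
  \<comment> \<open>A zero Hilbert function contradicts the Hilbert polynomial
    \<open>4*d\<close>.\<close>
  then have "hilbert_function E1 d = 0" for d by (simp add: hilbert_function_def)
  then have "hilbert_poly E1 = [:of_int 0, of_int 0:]" by (intro hilbert_poly_linear[of 0]) simp
  then show False using E1_hilbert by simp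
 qed
qed

lemma E1_irreducible: "irreducible_closed (zeros E1)"
 by (rule nice_irreducible[OF E1_nice E1_prime one_notin(2)])

lemma K_irreducible: "irreducible_closed (zeros (K c))"
 by (rule nice_irreducible[OF K_nice K_prime one_notin(1)])

text \<open>A linear form is its own derivative.\<close>

lemma polar_coord: "y : {u1, v1, u2, v2, u3, v3} ==> polar w v y = peval w y"
proof -
 assume y: "y \<in> {u1, v1, u2, v2, u3, v3}"
 have l: "polar w v f = peval w f" if "homogeneous 1 f" for f :: "('x, 'k) mpoly"
 proof -
  have m: "polar w v (Poly_Mapping.single m c) = peval w (Poly_Mapping.single m c)" if d: "mdeg m = 1" for m and c :: 'k
  proof -
   obtain x where x: "x : Poly_Mapping.keys m" using d unfolding mdeg_def by (metis sum.empty zero_neq_one ex_in_conv)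
   have "Poly_Mapping.single x 1 + (m - Poly_Mapping.single x 1) = m"
    using x by (intro poly_mapping_eqI) (auto simp: lookup_add lookup_minus lookup_single when_def in_keys_iff)
   moreover from this have "mdeg (m - Poly_Mapping.single x 1) = 0" using d mdeg_add[of "Poly_Mapping.single x 1" "m - Poly_Mapping.single x 1"] by simp
   then have "m - Poly_Mapping.single x 1 = 0" by (simp add: mdeg_def in_keys_iff poly_mapping_eq_iff fun_eq_iff)
   ultimately have "m = Poly_Mapping.single x 1" by simp
   then have "Poly_Mapping.single m c = Const c * Var x" by (simp add: Const_def Var_def mult_single)
   then show ?thesis by simp
  qed
  have s: "polar w v (sum g A) = (\<Sum>a\<in>A. polar w v (g a))" for g :: "('x \<Rightarrow>\<^sub>0 nat) => ('x, 'k) mpoly" and A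
   by (induction A rule: infinite_finite_induct) simp_all
  have "polar w v (\<Sum>m\<in>Poly_Mapping.keys f. Poly_Mapping.single m (Poly_Mapping.lookup f m)) =
    peval w (\<Sum>m\<in>Poly_Mapping.keys f. Poly_Mapping.single m (Poly_Mapping.lookup f m))"
   using that by (simp add: s m homogeneous_iff)
  then show ?thesis using poly_mapping_sum_single[of f] by metis
 qed
 show ?thesis by (rule l[OF lin[OF y]])
qed

text \<open>The directions \<open>u1\<close>, \<open>v1\<close> give \<open>c1\<close> and
  \<open>c2\<close>. The pairs \<open>(u2, v2)\<close> and \<open>(u3, v3)\<close> are both nonzero
  on the curve, which yields two equations in \<open>c3^2\<close> and \<open>c4^2\<close>; their
  difference is \<open>4 * c4^2 * (\<beta> + \<gamma>) * (1 + \<beta> * \<gamma>) =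
  0\<close>.\<close>

lemma E1_gradients:
 assumes z: "zero1 v" and v: "v ~= 0"
  and c: "!!w. c1 * polar w v u1 + c2 * polar w v v1 + c3 * polar w v P + c4 * polar w v F1 = 0"
 shows "c1 = 0" "c2 = 0" "c3 = 0" "c4 = 0"
proof -
 let ?u2 = "peval v u2" and ?v2 = "peval v v2" and ?u3 = "peval v u3" and ?v3 = "peval v v3"
 have z': "peval v u1 = 0" "peval v v1 = 0" "?u2 * ?v2 + ?u3 * ?v3 = 0"
  "(1 - \<beta>) * (?v3^2 + \<gamma> * ?u3^2) - (1 + \<gamma>) * (?v2^2 - \<beta> * ?u2^2) = 0"
  using z by (auto simp: zero1_def P_def F1_def)
 have pl: "c1 * peval w u1 + c2 * peval w v1 + c3 * (?u2 * peval w v2 + peval w u2 * ?v2 + (?u3 * peval w v3 + peval w u3 * ?v3)) +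
  c4 * ((1 - \<beta>) * (2 * (?v3 * peval w v3) + \<gamma> * (2 * (?u3 * peval w u3))) - (1 + \<gamma>) * (2 * (?v2 * peval w v2) - \<beta> * (2 * (?u2 * peval w u2)))) = 0" for w
  using c[of w] by (simp add: P_def F1_def polar_coord z')
 have e: "c1 = 0" "c2 = 0" "c3 * ?v2 + 2 * c4 * \<beta> * (1 + \<gamma>) * ?u2 = 0" "c3 * ?u2 - 2 * c4 * (1 + \<gamma>) * ?v2 = 0"
  "c3 * ?v3 + 2 * c4 * (1 - \<beta>) * \<gamma> * ?u3 = 0" "c3 * ?u3 + 2 * c4 * (1 - \<beta>) * ?v3 = 0"
 proof -
  have q: "EX w. peval w u1 = a1 & peval w v1 = b1 & peval w u2 = a2 & peval w v2 = b2 & peval w u3 = a3 & peval w v3 = b3" for a1 b1 a2 b2 a3 b3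
   by (rule ev)
  obtain w where "peval w u1 = 1 & peval w v1 = 0 & peval w u2 = 0 & peval w v2 = 0 & peval w u3 = 0 & peval w v3 = 0" using q by blast
  then show "c1 = 0" using pl[of w] by simp
  obtain w where "peval w u1 = 0 & peval w v1 = 1 & peval w u2 = 0 & peval w v2 = 0 & peval w u3 = 0 & peval w v3 = 0" using q by blast
  then show "c2 = 0" using pl[of w] by simp
  obtain w where "peval w u1 = 0 & peval w v1 = 0 & peval w u2 = 1 & peval w v2 = 0 & peval w u3 = 0 & peval w v3 = 0" using q by blast
  then show "c3 * ?v2 + 2 * c4 * \<beta> * (1 + \<gamma>) * ?u2 = 0" using pl[of w] by (simp add: algebra_simps)
  obtain w where "peval w u1 = 0 & peval w v1 = 0 & peval w u2 = 0 & peval w v2 = 1 & peval w u3 = 0 & peval w v3 = 0" using q by blast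
  then show "c3 * ?u2 - 2 * c4 * (1 + \<gamma>) * ?v2 = 0" using pl[of w] by (simp add: algebra_simps)
  obtain w where "peval w u1 = 0 & peval w v1 = 0 & peval w u2 = 0 & peval w v2 = 0 & peval w u3 = 1 & peval w v3 = 0" using q by blast
  then show "c3 * ?v3 + 2 * c4 * (1 - \<beta>) * \<gamma> * ?u3 = 0" using pl[of w] by (simp add: algebra_simps)
  obtain w where "peval w u1 = 0 & peval w v1 = 0 & peval w u2 = 0 & peval w v2 = 0 & peval w u3 = 0 & peval w v3 = 1" using q by blast
  then show "c3 * ?u3 + 2 * c4 * (1 - \<beta>) * ?v3 = 0" using pl[of w] by (simp add: algebra_simps)
 qed
 have nv: "?u2 ~= 0 | ?v2 ~= 0 | ?u3 ~= 0 | ?v3 ~= 0"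
  using frame_zero[of v] v z' by auto
 have n2: "?u2 ~= 0 | ?v2 ~= 0"
 proof (rule ccontr)
  assume a: "~ ?thesis"
  then have "?u3 * ?v3 = 0" "(1 - \<beta>) * (?v3^2 + \<gamma> * ?u3^2) = 0" using z' by auto
  then have "?u3 = 0" "?v3 = 0" using nzs by auto
  then show False using nv a by blast
 qed
 have n3: "?u3 ~= 0 | ?v3 ~= 0"
 proof (rule ccontr)
  assume a: "~ ?thesis"
  then have "?u2 * ?v2 = 0" "(1 + \<gamma>) * (?v2^2 - \<beta> * ?u2^2) = 0" using z' by auto
  then have "?u2 = 0" "?v2 = 0" using nzs by auto
  then show False using nv a by blast
 qed
 have "(c3^2 + 4 * c4^2 * \<beta> * (1 + \<gamma>)^2) * ?u2 = 0" "(c3^2 + 4 * c4^2 * \<beta> * (1 + \<gamma>)^2) * ?v2 = 0"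
  "(c3^2 - 4 * c4^2 * \<gamma> * (1 - \<beta>)^2) * ?u3 = 0" "(c3^2 - 4 * c4^2 * \<gamma> * (1 - \<beta>)^2) * ?v3 = 0"
  using e(3-6) by Groebner_Basis.algebra+
 then have k: "c3^2 + 4 * c4^2 * \<beta> * (1 + \<gamma>)^2 = 0" "c3^2 - 4 * c4^2 * \<gamma> * (1 - \<beta>)^2 = 0" using n2 n3 by auto
 have "4 * c4^2 * ((\<beta> + \<gamma>) * (1 + \<beta> * \<gamma>)) = 0" using k by Groebner_Basis.algebra
 moreover have "(4 :: 'k) ~= 0" using two by (metis mult_eq_0_iff numeral_Bit0_eq_double)
 ultimately show c4: "c4 = 0" using bc by simp
 then show "c3 = 0" using k(1) by simp
 show "c1 = 0" "c2 = 0" by (rule e)+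
qed

text \<open>Four generators with independent gradients, dimension one, and one for the cone add up
  to six.\<close>

lemma E1_nonsingular:
 assumes C6: "CARD('x) = 6"
 shows "nonsingular (zeros E1)"
 unfolding nonsingular_def nice_vanishing[OF E1_nice] E1_dim
proof (intro ballI)
 fix X v assume X: "X : zeros E1" and vX: "v : X"
 obtain w where w: "X = proj_point w" "w ~= 0" using X by (auto simp: zeros_def proj_space_def)
 have v: "v ~= 0" using vX w by (auto simp: proj_point_mem)
 have zv: "peval v f = 0" if "f : E1" for f using X vX that by (auto simp: zeros_def vanishes_def)
 have z: "zero1 v" unfolding zero1_def by (intro conjI zv) (simp_all add: E1_def ideal_gen_base)
 let ?g = "%f. (\<chi> x. peval v (partial x f)) :: 'k^'x"
 have dot: "(\<Sum>x\<in>UNIV. w $ x * ?g f $ x) = polar w v f" for w f by (simp add: polar_def)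
 let ?B = "{?g u1, ?g v1, ?g P, ?g F1}"
 have rel: "c1 = 0 & c2 = 0 & c3 = 0 & c4 = 0" if r: "c1 *s ?g u1 + c2 *s ?g v1 + c3 *s ?g P + c4 *s ?g F1 = 0" for c1 c2 c3 c4
 proof -
  have "c1 * polar w v u1 + c2 * polar w v v1 + c3 * polar w v P + c4 * polar w v F1 = 0" for w
  proof -
   have "c1 * polar w v u1 + c2 * polar w v v1 + c3 * polar w v P + c4 * polar w v F1 =
     (\<Sum>x\<in>UNIV. w $ x * (c1 *s ?g u1 + c2 *s ?g v1 + c3 *s ?g P + c4 *s ?g F1) $ x)"
    by (simp add: polar_def sum_distrib_left sum.distrib algebra_simps)
   then show ?thesis unfolding r by simp
  qed
  from E1_gradients[OF z v this] show ?thesis by blast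
 qed
 have d: "distinct [?g u1, ?g v1, ?g P, ?g F1]"
  using rel[of 1 "- 1" 0 0] rel[of 1 0 "- 1" 0] rel[of 1 0 0 "- 1"] rel[of 0 1 "- 1" 0] rel[of 0 1 0 "- 1"] rel[of 0 0 1 "- 1"]
  by auto
 have ind: "vec.independent ?B"
 proof (rule vec.independent_if_scalars_zero)
  fix f x assume s: "(\<Sum>x\<in>?B. f x *s x) = 0" and x: "x : ?B"
  have "f (?g u1) *s ?g u1 + f (?g v1) *s ?g v1 + f (?g P) *s ?g P + f (?g F1) *s ?g F1 = 0"
   using s d by (simp add: add.assoc)
  from rel[OF this] show "f x = 0" using x by blast
 qed simp
 let ?S = "{?g f |f. f : E1}"
 have "vec.dim ?S = card ?B"
 proof (rule vec.dim_unique[OF _ _ ind refl])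
  show "?B \<subseteq> ?S" by (auto simp: E1_def intro: ideal_gen_base)
  show "?S \<subseteq> vec.span ?B"
  proof
   fix y assume "y : ?S"
   then obtain f where f: "f : E1" "y = ?g f" by blast
   then obtain a b c e where "f = a * u1 + b * v1 + c * P + e * F1" unfolding E1_def by (metis ideal_gen_4E)
   then have "?g f = peval v a *s ?g u1 + peval v b *s ?g v1 + peval v c *s ?g P + peval v e *s ?g F1"
    using z by (simp add: Finite_Cartesian_Product.vec_eq_iff partial_add partial_mult zero1_def)
   also have "... : vec.span ?B" by (intro vec.span_add vec.span_scale vec.span_base) auto
   finally show "y : vec.span ?B" by (simp add: f)
  qed
 qed
 also have "card ?B = 4" using d by (simp add: card_insert_if)
 finally show "vec.dim ?S + 1 + 1 = CARD('x)" using C6 by simp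
qed

lemma E1_elliptic: "CARD('x) = 6 ==> elliptic_curve (zeros E1)"
 unfolding elliptic_curve_def nice_vanishing[OF E1_nice] E1_hilbert by (simp add: E1_irreducible E1_dim E1_nonsingular)

lemmas E2_nice = curves.E1_nice[OF curves_cyc, unfolded E_cyc] and E2_dim = curves.E1_dim[OF curves_cyc, unfolded E_cyc]
 and E2_irreducible = curves.E1_irreducible[OF curves_cyc, unfolded E_cyc] and E2_elliptic = curves.E1_elliptic[OF curves_cyc, unfolded E_cyc]
lemmas E3_nice = curves.E2_nice[OF curves_cyc, unfolded E_cyc] and E3_dim = curves.E2_dim[OF curves_cyc, unfolded E_cyc]
 and E3_irreducible = curves.E2_irreducible[OF curves_cyc, unfolded E_cyc] and E3_elliptic = curves.E2_elliptic[OF curves_cyc, unfolded E_cyc]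

lemma frame_inj: "(!!y. y : {u1, v1, u2, v2, u3, v3} ==> peval v y = peval w y) ==> v = w"
proof -
 assume y: "!!y. y : {u1, v1, u2, v2, u3, v3} ==> peval v y = peval w y"
 have "v $ x = w $ x" for x
 proof -
  obtain z where z: "z : {u1, v1, u2, v2, u3, v3}" "Var x = z | Var x = - z" using vars by blast
  then have "peval v (Var x) = peval w (Var x)" using y[OF z(1)] by (metis rhom_uminus[OF peval_rhom])
  then show ?thesis by simp
 qed
 then show ?thesis by (simp add: Finite_Cartesian_Product.vec_eq_iff)
qed

text \<open>On the plane of the conic with \<open>u1 = 0\<close> both curves reduce to
  \<open>t2*u2^2 + t3*u3^2 = 0\<close>, a pair of points; they are distinct because 2 is
  nonzero.\<close>

lemma K_E1_points: "card (zeros (K c) Int zeros E1) = 2"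
proof -
 let ?x = "slope1 \<alpha> c" and ?y = "slope2 \<beta> c" and ?z = "slope3 \<gamma> c"
 have t: "?x ~= 0" "?y ~= 0" "?z ~= 0" using nzs by (auto simp: slope_defs)
 obtain s where s: "s^2 = - ?z / ?y" using nth_root_exists[of 2 "- ?z / ?y"] by auto
 have s0: "s ~= 0" using s t by auto
 have ys: "?y * s^2 = - ?z" using s t by simp
 obtain p where p: "peval p u1 = 0" "peval p v1 = 0" "peval p u2 = s" "peval p v2 = ?y * s" "peval p u3 = 1" "peval p v3 = ?z" using ev by blast
 obtain q where q: "peval q u1 = 0" "peval q v1 = 0" "peval q u2 = - s" "peval q v2 = - ?y * s" "peval q u3 = 1" "peval q v3 = ?z" using ev by blast
 have pq0: "p ~= 0" "q ~= 0"
  using p(5) q(5) peval_scale[OF lin[of u3], of 0 0] by auto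
 have inK: "(\<forall>g\<in>K c. peval v g = 0) \<longleftrightarrow> peval v (A c) = 0 & peval v (B c) = 0 & peval v (W c) = 0 & peval v P = 0" for v
  unfolding K_def using peval_ideal_gen[of _ "{A c, B c, W c, P}" v] by (auto intro: ideal_gen_base)
 have inE: "(\<forall>g\<in>E1. peval v g = 0) \<longleftrightarrow> zero1 v" for v
  unfolding E1_def zero1_def using peval_ideal_gen[of _ "{u1, v1, P, F1}" v] by (auto intro: ideal_gen_base)
 have F1z: "peval v F1 = 0" if "f1 = peval v u2" "f2 = peval v u3" "peval v v2 = ?y * f1" "peval v v3 = ?z * f2" "?y * f1^2 + ?z * f2^2 = 0" for v f1 f2
 proof -
  have "peval v F1 = (1 - \<beta>) * (?z^2 + \<gamma>) * f2^2 - (1 + \<gamma>) * (?y^2 - \<beta>) * f1^2"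
   unfolding F1_def using that by (simp add: algebra_simps power2_eq_square)
  also have "... = (if c = 0 | c = 1 then - 1 else 1) * (1 - \<beta>) * (1 + \<gamma>) * (?y * f1^2 + ?z * f2^2)"
   by (simp add: slope_defs algebra_simps power2_eq_square)
  finally show ?thesis using that by simp
 qed
 have mem: "(\<forall>g\<in>K c. peval v g = 0) & (\<forall>g\<in>E1. peval v g = 0)" if "v = p | v = q" for v
  unfolding inK inE zero1_def
  using that p q F1z[of s p 1] F1z[of "- s" q 1] ys
  by (auto simp: A_def B_def W_def P_def power2_eq_square algebra_simps)
 have "zeros (K c) Int zeros E1 = {proj_point p, proj_point q}"
 proof (intro equalityI subsetI)
  fix X assume "X \<in> {proj_point p, proj_point q}"
  then show "X \<in> zeros (K c) Int zeros E1"
   unfolding zeros_graded[OF K_graded] zeros_graded[OF E1_graded] using mem pq0 by blast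
 next
  fix X assume X: "X : zeros (K c) Int zeros E1"
  then obtain v where v: "X = proj_point v" "v ~= 0" by (auto simp: zeros_def proj_space_def)
  have K0: "\<forall>g\<in>K c. peval v g = 0" and E0: "\<forall>g\<in>E1. peval v g = 0"
   using X v proj_point_self[of v] by (auto simp: zeros_def vanishes_def)
  have e: "peval v u1 = 0" "peval v v1 = 0" "peval v v2 = ?y * peval v u2" "peval v v3 = ?z * peval v u3"
   "peval v u2 * peval v v2 + peval v u3 * peval v v3 = 0"
   using K0 E0 unfolding inK inE by (auto simp: A_def B_def W_def P_def zero1_def)
  have "?y * peval v u2 ^ 2 + ?z * peval v u3 ^ 2 = 0" using e(5) unfolding e(3,4) by (simp add: power2_eq_square algebra_simps)
  then have "?y * (peval v u2 ^ 2 - (s * peval v u3)^2) = 0" using ys by Groebner_Basis.algebra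
  then have "(peval v u2 - s * peval v u3) * (peval v u2 + s * peval v u3) = 0" using t by (simp add: power2_eq_square algebra_simps)
  then consider "peval v u2 = s * peval v u3" | "peval v u2 = - s * peval v u3" by (auto simp: eq_neg_iff_add_eq_0)
  then have "v = peval v u3 *s p | v = peval v u3 *s q"
  proof cases
   case 1
   have "v = peval v u3 *s p" by (rule frame_inj) (use 1 e p in "auto simp: peval_scale[OF lin]")
   then show ?thesis by blast
  next
   case 2
   have "v = peval v u3 *s q" by (rule frame_inj) (use 2 e q in "auto simp: peval_scale[OF lin]")
   then show ?thesis by blast
  qed
  moreover have "peval v u3 ~= 0" using calculation v(2) by auto
  ultimately have "proj_point v = proj_point p | proj_point v = proj_point q" using proj_point_scale by metis
  then show "X : {proj_point p, proj_point q}" using v by blast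
 qed
 moreover have "proj_point p ~= proj_point q"
 proof
  assume "proj_point p = proj_point q"
  then obtain a where a: "p = a *s q" using proj_point_self[of p] by (auto simp: proj_point_mem)
  have sc: "peval (a *s q) u3 = a * peval q u3" "peval (a *s q) u2 = a * peval q u2"
   using peval_scale[OF lin[of u3], of a q] peval_scale[OF lin[of u2], of a q] by simp_all
  have "a = 1" using sc(1) a p q by simp
  then have "s = - s" using sc(2) a p q by simp
  then have "2 * s = 0" by (metis add.right_inverse mult_2)
  then show False using s0 two by simp
 qed
 ultimately show ?thesis by simp
qed

lemma K_E2_points: "card (zeros (K c) Int zeros E2) = 2"
 using curves.K_E1_points[OF curves_cyc, of "rot c"] unfolding E_cyc K_cyc .

lemma K_E3_points: "card (zeros (K c) Int zeros E3) = 2"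
 using curves.K_E2_points[OF curves_cyc, of "rot c"] unfolding E_cyc K_cyc .

lemma K_plane_conic:
 assumes C6: "CARD('x) = 6"
 shows "plane_conic (K c)"
proof -
 have t: "slope1 \<alpha> c ~= 0" using nzs by (auto simp: slope_defs)
 let ?L = "{A c, B c, W c}"
 have PLK: "K c = ideal_gen (insert P ?L)" by (simp add: K_def insert_commute)
 obtain v where v: "peval v u1 = 1" "peval v v1 = slope1 \<alpha> c" "peval v u2 = 0" "peval v v2 = 0" "peval v u3 = 0" "peval v v3 = 0" using ev by blast
 have Pn: "P ~: ideal_gen ?L"
 proof
  assume "P : ideal_gen ?L"
  then have "peval v P = 0" by (rule peval_ideal_gen) (use v in "auto simp: A_def B_def W_def")
  then show False using v t by (simp add: P_def)
 qed
 obtain a b w where a: "peval a u1 = 0" "peval a v1 = 1" "peval a u2 = 0" "peval a v2 = 0" "peval a u3 = 0" "peval a v3 = 0"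
  and b: "peval b u1 = 0" "peval b v1 = 0" "peval b u2 = 0" "peval b v2 = 1" "peval b u3 = 0" "peval b v3 = 0"
  and w: "peval w u1 = 0" "peval w v1 = 0" "peval w u2 = 0" "peval w v2 = 0" "peval w u3 = 0" "peval w v3 = 1"
  using ev[of 0 1 0 0 0 0] ev[of 0 0 0 1 0 0] ev[of 0 0 0 0 0 1] by blast
 have val: "peval a (A c) = 1" "peval a (B c) = 0" "peval a (W c) = 0" "peval b (A c) = 0" "peval b (B c) = 1" "peval b (W c) = 0"
  "peval w (A c) = 0" "peval w (B c) = 0" "peval w (W c) = 1"
  using a b w by (simp_all add: A_def B_def W_def)
 have d: "A c ~= B c" "A c ~= W c" "B c ~= W c" using val by (metis zero_neq_one)+
 interpret vs: Vector_Spaces.vector_space "scale :: 'k => ('x, 'k) mpoly => ('x, 'k) mpoly" by (rule vector_space_scale)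
 have ind: "vs.independent ?L"
 proof (rule vs.independent_if_scalars_zero)
  fix f x assume s: "(\<Sum>x\<in>?L. scale (f x) x) = 0" and x: "x : ?L"
  have s': "Const (f (A c)) * A c + (Const (f (B c)) * B c + Const (f (W c)) * W c) = 0" using s d by simp
  have "f (A c) = 0" using arg_cong[OF s', of "peval a"] val by simp
  moreover have "f (B c) = 0" using arg_cong[OF s', of "peval b"] val by simp
  moreover have "f (W c) = 0" using arg_cong[OF s', of "peval w"] val by simp
  ultimately show "f x = 0" using x by blast
 qed simp
 have h1: "homogeneous 1 l" if "l : ?L" for l
  using that lin unfolding A_def B_def W_def by (elim insertE emptyE; simp only:) (intro homogeneous_diff homogeneous_Const_mult lin; blast)+
 have h2: "homogeneous 2 P"
 proof -
  have "homogeneous 2 (x * y)" if "x : {u1, v1, u2, v2, u3, v3}" "y \<in> {u1, v1, u2, v2, u3, v3}" for x y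
   using homogeneous_mult[OF lin[OF that(1)] lin[OF that(2)]] by (simp add: numeral_2_eq_2)
  then show ?thesis unfolding P_def by (intro homogeneous_add) auto
 qed
 show ?thesis unfolding plane_conic_def
 proof (intro conjI exI[of _ ?L] exI[of _ P] ballI)
  show "same_subscheme (K c) (ideal_gen (insert P ?L))" by (simp add: same_subscheme_def PLK)
  show "card ?L + 3 = CARD('x)" using d C6 by simp
  show "irreducible_closed (zeros (K c))" by (rule K_irreducible)
 qed (use h1 h2 ind Pn in auto)
qed

definition "curve j = (if j = (1 :: 4) then E1 else if j = 2 then E2 else E3)"

lemma J_nice: "nice (JE Int JC)"
 unfolding JE_def JC_def by (intro nice_Int E1_nice E2_nice E3_nice K_nice)

lemma J_degree: "scheme_degree (JE Int JC) = 20"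
proof -
 have "hilbert_poly (JE Int JC) = [:of_int (- 20), of_int 20:]"
  by (rule hilbert_poly_codim[OF niceD(1)[OF J_nice] codim_J]) auto
 from scheme_dim_degree(2)[OF this] show ?thesis by simp
qed

text \<open>Seven irreducible closed curves cover the zero set, so every irreducible component is
  one of them.\<close>

lemma J_is_curve: "is_curve (JE Int JC)"
proof -
 let ?X = "{zeros E1, zeros E2, zeros E3} Un zeros ` range K"
 have ZE: "zeros JE = zeros E1 Un zeros E2 Un zeros E3"
  unfolding JE_def using E_is_ideal E1_graded E2_graded E3_graded by (simp add: zeros_Int is_ideal_Int graded_Int)
 have ZC: "zeros JC = zeros (K 0) Un zeros (K 1) Un zeros (K 2) Un zeros (K 3)"
  unfolding JC_def using K_is_ideal K_graded by (simp add: zeros_Int is_ideal_Int graded_Int)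
 have Z: "zeros (JE Int JC) = \<Union>?X"
  unfolding zeros_Int[OF J_ideal(1,3,2,4)] ZE ZC using exhaust_4' by auto metis
 have fin: "finite ?X" by simp
 have irr: "irreducible_closed X & scheme_dim (vanishing_ideal X) = 1" if "X : ?X" for X
  using that E1_irreducible E2_irreducible E3_irreducible K_irreducible
  by (auto simp: nice_vanishing E1_nice E2_nice E3_nice K_nice E1_dim E2_dim E3_dim K_dim)
 show ?thesis unfolding is_curve_def
 proof (intro conjI allI impI)
  show "zeros (JE Int JC) ~= {}"
  proof -
   have "zeros (K 0) ~= {}" using K_irreducible[of 0] by (simp add: irreducible_closed_def)
   moreover have "zeros (K 0) \<subseteq> \<Union>?X" by (rule Union_upper) simp
   ultimately show ?thesis unfolding Z using Sup_empty mem_simps(1,2) by fastforce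
  qed
  fix Y assume Y: "irreducible_component (zeros (JE Int JC)) Y"
  then have "irreducible_closed Y" "Y \<subseteq> \<Union>?X" by (simp_all only: irreducible_component_def Z)
  then obtain X where X: "X : ?X" "Y \<subseteq> X" using irreducible_cover[OF fin] irr irreducible_closed_def by (metis (no_types, lifting))
  then have "X = Y" using Y irr[OF X(1)] unfolding irreducible_component_def Z by blast
  then show "scheme_dim (vanishing_ideal Y) = 1" using irr[OF X(1)] by simp
 qed
qed

lemma E_disjoint: "zeros E1 Int zeros E2 = {}" "zeros E2 Int zeros E3 = {}" "zeros E3 Int zeros E1 = {}"
 using thick_disjoint E_is_ideal E12_comax E23_comax E31_comax by blast+

lemma K_disjoint: "c ~= c' ==> zeros (K c) Int zeros (K c') = {}"
 using thick_disjoint K_is_ideal K_comax by blast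

end

section \<open>The secant maps\<close>

locale secants = lines \<alpha> \<beta> \<gamma> for \<alpha> \<beta> \<gamma> :: "'k::alg_closed_field" +
 fixes \<ii> :: 'k and j k l :: 4
 assumes ii: "\<ii>^2 = - 1" and jkl: "(j, k, l) : {(1, 2, 3), (2, 1, 3), (3, 1, 2)}"
begin

text \<open>The coefficients of the second quadric. The indices \<open>j\<close>, \<open>k\<close>,
  \<open>l\<close> treat the three translations together: the signs change at \<open>k\<close> and
  \<open>l\<close> only.\<close>

definition "dd r = (if r = (0 :: 4) then 1 else if r = 1 then - (\<beta> * \<gamma>) else if r = 2 then - \<gamma> else \<beta>)"

lemma jkl_cases: "j = 1 & k = 2 & l = 3 | j = 2 & k = 1 & l = 3 | j = 3 & k = 1 & l = 2"
 using jkl by auto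

lemma distinct_jkl: "j ~= 0" "k ~= 0" "l ~= 0" "j ~= k" "j ~= l" "k ~= l" "0 ~= j" "0 ~= k" "0 ~= l" "k ~= j" "l ~= j" "l ~= k"
 using jkl_cases by auto

lemma exhaust_jkl: "r = 0 | r = j | r = k | r = l"
 using jkl_cases exhaust_4'[of r] by auto

lemma sum_jkl: "(\<Sum>r\<in>UNIV. f r) = f 0 + f j + f k + f l" for f :: "4 => 'b::comm_ring_1"
 using jkl_cases by (auto simp: sum_4' add_ac)

lemma dd_distinct: "dd 0 ~= dd j" "dd k ~= dd l"
proof -
 have "1 ~= - (\<beta> * \<gamma>)" using bc(1) by (metis add.commute add.right_inverse)
 moreover have "- \<gamma> ~= \<beta>" using bc(2) by (metis add.right_inverse add.commute)
 moreover have "1 ~= - \<gamma>" "1 ~= \<beta>" using nz by (auto simp: equation_minus_iff)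
 moreover have "- (\<beta> * \<gamma>) ~= - \<gamma>" "- (\<beta> * \<gamma>) ~= \<beta>"
  using nz by (auto simp: minus_equation_iff[of "\<beta> * \<gamma>"]) (metis mult_cancel_left1 mult_minus_right mult_cancel_right1 minus_minus)+
 ultimately show "dd 0 ~= dd j" "dd k ~= dd l" using jkl_cases by (auto simp: dd_def)
qed

definition onX :: "'k^4 => bool" where
 "onX v \<longleftrightarrow> v $ 0 ^ 2 + v $ j ^ 2 + v $ k ^ 2 + v $ l ^ 2 = 0 &
  dd 0 * v $ 0 ^ 2 + dd j * v $ j ^ 2 + dd k * v $ k ^ 2 + dd l * v $ l ^ 2 = 0"

abbreviation "X \<equiv> curve_E \<beta> \<gamma>"

lemma X_eq: "X = {proj_point v |v. v ~= 0 & onX v}"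
proof -
 have e: "onX v \<longleftrightarrow> peval v (Var 0 ^ 2 + Var 1 ^ 2 + Var 2 ^ 2 + Var 3 ^ 2) = 0 &
   peval v (Var 0 ^ 2 - Const (\<beta> * \<gamma>) * Var 1 ^ 2 - Const \<gamma> * Var 2 ^ 2 + Const \<beta> * Var 3 ^ 2) = 0" for v
  using jkl_cases by (auto simp: onX_def dd_def algebra_simps)
 have s: "onX (c *s v)" if "onX v" for c v
 proof -
  have "(c * x)^2 = c^2 * x^2" for x by (simp add: power_mult_distrib)
  moreover have "c^2 * (v $ 0 ^ 2 + v $ j ^ 2 + v $ k ^ 2 + v $ l ^ 2) = 0"
   "c^2 * (dd 0 * v $ 0 ^ 2 + dd j * v $ j ^ 2 + dd k * v $ k ^ 2 + dd l * v $ l ^ 2) = 0" using that by (simp_all add: onX_def)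
  ultimately show ?thesis by (simp add: onX_def algebra_simps)
 qed
 have "proj_point v : X \<longleftrightarrow> onX v" if "v ~= 0" for v
 proof
  assume "proj_point v : X"
  then show "onX v" using proj_point_self[of v] unfolding e curve_E_def zeros_def vanishes_def by blast
 next
  assume "onX v"
  then show "proj_point v : X" using s that unfolding e curve_E_def zeros_def vanishes_def proj_space_def
   by (auto simp: proj_point_mem)
 qed
 note m = this
 have sub: "X \<subseteq> proj_space" by (auto simp: curve_E_def zeros_def)
 show ?thesis
 proof (intro equalityI subsetI)
  fix Q assume Q: "Q : X"
  then obtain v where v: "Q = proj_point v" "v ~= 0" using sub unfolding proj_space_def by blast
  then show "Q : {proj_point v |v. v ~= 0 & onX v}" using m[OF v(2)] Q by blast
 qed (use m in blast)
qed

lemma X_mem: "T : X ==> v : T ==> v ~= 0 & onX v & T = proj_point v"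
proof -
 assume T: "T : X" "v : T"
 then obtain w where w: "T = proj_point w" "w ~= 0" by (auto simp: X_eq)
 have "v ~= 0" using T w by (auto simp: proj_point_mem)
 moreover have p: "T = proj_point v" using proj_point_eq T w by metis
 moreover have "onX v"
 proof -
  have "peval v (Var 0 ^ 2 + Var 1 ^ 2 + Var 2 ^ 2 + Var 3 ^ 2) = 0"
   "peval v (Var 0 ^ 2 - Const (\<beta> * \<gamma>) * Var 1 ^ 2 - Const \<gamma> * Var 2 ^ 2 + Const \<beta> * Var 3 ^ 2) = 0"
   using T by (auto simp only: curve_E_def zeros_def vanishes_def)
  then show ?thesis using jkl_cases by (auto simp: onX_def dd_def algebra_simps)
 qed
 ultimately show ?thesis by blast
qed

definition tv :: "'k^4 => 'k^4" where "tv v = (\<chi> r. if r = 0 | r = j then v $ r else - v $ r)"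

lemma tv_simps [simp]: "tv v $ 0 = v $ 0" "tv v $ j = v $ j" "tv v $ k = - v $ k" "tv v $ l = - v $ l" "tv (tv v) = v"
 using distinct_jkl by (auto simp: tv_def Finite_Cartesian_Product.vec_eq_iff)

lemma vec_jkl: "v $ 0 = w $ 0 ==> v $ j = w $ j ==> v $ k = w $ k ==> v $ l = w $ l ==> v = (w :: 'k^4)"
 unfolding Finite_Cartesian_Product.vec_eq_iff by (metis exhaust_jkl)

lemma tv_onX [simp]: "onX (tv v) = onX v"
 by (simp add: onX_def)

lemma tv_scale: "tv (c *s v) = c *s tv v"
 by (rule vec_jkl) simp_all

lemma tv_zero [simp]: "tv v = 0 \<longleftrightarrow> v = 0"
proof
 assume "tv v = 0"
 then have "tv (tv v) = tv 0" by simp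
 then show "v = 0" by (simp add: tv_scale[of 0 0, simplified])
qed (use tv_scale[of 0 0] in simp)

lemma translate_point: "translate j (proj_point v) = proj_point (tv v)"
proof -
 have t: "translate j (proj_point v) = tv ` proj_point v" by (simp add: translate_def tv_def)
 show ?thesis unfolding t
 proof (intro equalityI subsetI)
  fix x assume "x : tv ` proj_point v"
  then obtain c where c: "c ~= 0" "x = tv (c *s v)" by (auto simp: proj_point_mem)
  then show "x : proj_point (tv v)" unfolding proj_point_mem by (intro exI[of _ c]) (simp add: tv_scale)
 next
  fix x assume "x : proj_point (tv v)"
  then obtain c where c: "c ~= 0" "x = c *s tv v" by (auto simp: proj_point_mem)
  then have "x = tv (c *s v)" by (simp add: tv_scale)
  moreover have "c *s v : proj_point v" unfolding proj_point_mem using c(1) by blast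
  ultimately show "x : tv ` proj_point v" by blast
 qed
qed

lemma translate_X: "T : X ==> translate j T : X" and translate_translate: "T : X ==> translate j (translate j T) = T"
 by (auto simp: X_eq translate_point)

lemma translate_mem: "T : X ==> v : T ==> tv v : translate j T"
 using X_mem[of T v] translate_point[of v] proj_point_self by metis

text \<open>If one pair vanished, the two quadrics would be independent diagonal equations in the
  squares of the other pair.\<close>

lemma pairs_nonzero:
 assumes "onX v" "v ~= 0"
 shows "v $ 0 ~= 0 | v $ j ~= 0" "v $ k ~= 0 | v $ l ~= 0"
proof -
 have *: "a = 0 & b = 0" if "a^2 + b^2 = 0" "c * a^2 + d * b^2 = 0" "c ~= d" for a b c d :: 'k
 proof -
  have "(c - d) * a^2 = 0" "(c - d) * b^2 = 0" using that(1,2) by Groebner_Basis.algebra+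
  then show ?thesis using that(3) by simp
 qed
 have e: "v $ 0 ^ 2 + v $ j ^ 2 + v $ k ^ 2 + v $ l ^ 2 = 0"
  "dd 0 * v $ 0 ^ 2 + dd j * v $ j ^ 2 + dd k * v $ k ^ 2 + dd l * v $ l ^ 2 = 0" using assms(1) by (simp_all add: onX_def)
 have nz: "~ (v $ 0 = 0 & v $ j = 0 & v $ k = 0 & v $ l = 0)" using vec_jkl[of v 0] assms(2) by auto
 show "v $ 0 ~= 0 | v $ j ~= 0" using e *[OF _ _ dd_distinct(2), of "v $ k" "v $ l"] nz by auto
 show "v $ k ~= 0 | v $ l ~= 0" using e *[OF _ _ dd_distinct(1), of "v $ 0" "v $ j"] nz by auto
qed

section \<open>The Pluecker vector of a secant\<close>

definition "Lv v r = (if r = 0 then - \<ii> * v $ j else if r = j then - v $ 0 else (0 :: 'k))" for v :: "'k^4"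
definition "Lv' v r = (if r = k then v $ l else if r = l then \<ii> * v $ k else (0 :: 'k))" for v :: "'k^4"
text \<open>The secant through \<open>v\<close> and \<open>tv v\<close> consists of the vectors
  \<open>(a*v_0, a*v_j, b*v_k, b*v_l)\<close>; \<open>Lv\<close> and \<open>Lv'\<close> are its two
  equations in the \<open>y\<close> coordinates, scaled by \<open>- \<ii>\<close>.\<close>

definition mm :: "'k^4 => 'k^pl" where "mm v = (\<chi> e. pluecker (Lv v) (Lv' v) e)"

definition "Lp r = (if r = 0 then Const (- \<ii>) * Var j else if r = j then - Var 0 else (0 :: (4, 'k) mpoly))"
definition "Lp' r = (if r = k then Var l else if r = l then Const \<ii> * Var k else (0 :: (4, 'k) mpoly))"
definition "Mp e = pluecker Lp Lp' e"

lemma peval_Mp: "peval v (Mp e) = mm v $ e"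
proof -
 have "peval v (Lp r) = Lv v r" "peval v (Lp' r) = Lv' v r" for r by (simp_all add: Lp_def Lv_def Lp'_def Lv'_def)
 then show ?thesis by (simp add: Mp_def mm_def pluecker_def case_prod_unfold)
qed

lemma homogeneous_Mp: "homogeneous 2 (Mp e)"
proof -
 have "homogeneous 1 (Lp r)" "homogeneous 1 (Lp' r)" for r
  unfolding Lp_def Lp'_def by (auto intro!: homogeneous_Const_mult homogeneous_uminus homogeneous_Var simp del: One_nat_def)
 then have "homogeneous 2 (Lp r * Lp' s)" "homogeneous 2 (Lp' r * Lp s)" for r s
  using homogeneous_mult[of 1 "Lp r" 1 "Lp' s"] homogeneous_mult[of 1 "Lp' r" 1 "Lp s"] by (simp_all add: numeral_2_eq_2)
 then show ?thesis unfolding Mp_def pluecker_def by (auto simp: case_prod_unfold intro!: homogeneous_diff)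
qed

lemma mm_scale: "mm (c *s v) = (c^2) *s mm v"
 by (simp add: Finite_Cartesian_Product.vec_eq_iff peval_Mp[symmetric] peval_scale[OF homogeneous_Mp])

lemma mm_tv: "mm (tv v) = (- 1) *s mm v"
proof -
 have "Lv (tv v) = Lv v" "Lv' (tv v) = (%r. - Lv' v r)" by (auto simp: Lv_def Lv'_def)
 then show ?thesis by (simp add: mm_def Finite_Cartesian_Product.vec_eq_iff pluecker_def case_prod_unfold)
qed

lemma ii2: "\<ii> * (\<ii> * x) = - x"
proof -
 have "\<ii> * (\<ii> * x) = \<ii>^2 * x" by (simp add: power2_eq_square mult.assoc)
 then show ?thesis by (simp add: ii)
qed

definition "pos e r s = (if pl_index e = (r, s) then 1 else if pl_index e = (s, r) then - 1 else (0 :: 'k))"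

lemma mm_coord: "mm v $ e = pos e 0 k * (- \<ii> * v $ j * v $ l) + pos e 0 l * (v $ j * v $ k) + pos e j k * (- v $ 0 * v $ l) + pos e j l * (- \<ii> * v $ 0 * v $ k)"
 unfolding mm_def pluecker_def Lv_def Lv'_def pos_def using jkl_cases
 by (cases e; elim disjE conjE; simp add: ii2 mult_ac)

text \<open>Each product of a coordinate from \<open>{0, j}\<close> with one from
  \<open>{k, l}\<close> occurs, up to a nonzero factor, as a coordinate of
  \<open>mm v\<close>.\<close>

lemma entries: "EX e s. s ~= 0 & (ALL v. mm v $ e = s * (v $ a * v $ b))" if "a : {0, j}" "b \<in> {k, l}"
proof -
 have i0: "\<ii> ~= 0" using ii by auto
 have ex: "EX e. pl_index e = (r, s) | pl_index e = (s, r)" if "r ~= s" for r s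
  using that exhaust_4'[of r] exhaust_4'[of s] by (elim disjE) (auto intro: exI[of _ Z01] exI[of _ Z02] exI[of _ Z03] exI[of _ Z12] exI[of _ Z13] exI[of _ Z23])
 have q: "EX e. (pos e r s = 1 | pos e r s = - 1) & (ALL r' s'. {r', s'} ~= {r, s} --> pos e r' s' = 0)" if rs: "r ~= s" for r s
 proof -
  obtain e where "pl_index e = (r, s) | pl_index e = (s, r)" using ex[OF rs] by blast
  then show ?thesis using rs by (intro exI[of _ e]) (auto simp: pos_def doubleton_eq_iff)
 qed
 have fin: ?thesis if "c ~= 0" "pos e r s = 1 | pos e r s = - 1" "!!v. mm v $ e = pos e r s * (c * (v $ a * v $ b))" for e r s and c :: 'k
  using that by (intro exI[of _ e] exI[of _ "pos e r s * c"]) (auto simp: mult_ac)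
 consider "a = 0" "b = k" | "a = 0" "b = l" | "a = j" "b = k" | "a = j" "b = l" using that using \<open>a : {0, j}\<close> \<open>b \<in> {k, l}\<close> by fastforce
 then show ?thesis
 proof cases
  case 1
  obtain e where e: "pos e j l = 1 | pos e j l = - 1" "!!r' s'. {r', s'} ~= {j, l} ==> pos e r' s' = 0" using q[of j l] distinct_jkl by blast
  have "pos e 0 k = 0" "pos e 0 l = 0" "pos e j k = 0" using distinct_jkl by (auto intro!: e(2) simp: doubleton_eq_iff)
  then show ?thesis by (intro fin[of "- \<ii>" e j l] e) (auto simp: i0 1 mm_coord)
 next
  case 2
  obtain e where e: "pos e j k = 1 | pos e j k = - 1" "!!r' s'. {r', s'} ~= {j, k} ==> pos e r' s' = 0" using q[of j k] distinct_jkl by blast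
  have "pos e 0 k = 0" "pos e 0 l = 0" "pos e j l = 0" using distinct_jkl by (auto intro!: e(2) simp: doubleton_eq_iff)
  then show ?thesis by (intro fin[of "- 1" e j k] e) (auto simp: 2 mm_coord)
 next
  case 3
  obtain e where e: "pos e 0 l = 1 | pos e 0 l = - 1" "!!r' s'. {r', s'} ~= {0, l} ==> pos e r' s' = 0" using q[of 0 l] distinct_jkl by blast
  have "pos e 0 k = 0" "pos e j k = 0" "pos e j l = 0" using distinct_jkl by (auto intro!: e(2) simp: doubleton_eq_iff)
  then show ?thesis by (intro fin[of 1 e 0 l] e) (auto simp: 3 mm_coord)
 next
  case 4
  obtain e where e: "pos e 0 k = 1 | pos e 0 k = - 1" "!!r' s'. {r', s'} ~= {0, k} ==> pos e r' s' = 0" using q[of 0 k] distinct_jkl by blast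
  have "pos e 0 l = 0" "pos e j k = 0" "pos e j l = 0" using distinct_jkl by (auto intro!: e(2) simp: doubleton_eq_iff)
  then show ?thesis by (intro fin[of "- \<ii>" e 0 k] e) (auto simp: i0 4 mm_coord)
 qed
qed

lemma mm_nonzero: "onX v ==> v ~= 0 ==> mm v ~= 0"
proof
 assume v: "onX v" "v ~= 0" and 0: "mm v = 0"
 obtain a b where ab: "a : {0, j}" "b \<in> {k, l}" "v $ a ~= 0" "v $ b ~= 0" using pairs_nonzero[OF v] by blast
 obtain e s where "s ~= 0" "mm v $ e = s * (v $ a * v $ b)" using entries[OF ab(1,2)] by blast
 then show False using 0 ab by simp
qed

lemma secant_point:
 assumes v: "onX v" "v ~= 0"
 shows "secant \<ii> j {proj_point v, translate j (proj_point v)} = proj_point (mm v)"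
proof -
 have i0: "\<ii> ~= 0" using ii by auto
 have inv: "x / \<ii> = - \<ii> * x" for x by (simp add: nonzero_divide_eq_eq[OF i0] ii2 mult_ac)
 have ident: "ident \<ii> j 0 = 1" "ident \<ii> j j = \<ii>" "ident \<ii> j k = \<ii>" "ident \<ii> j l = 1"
  using jkl_cases by (auto simp: ident_def)
 let ?S = "y_coords \<ii> j ` \<Union>{proj_point v, translate j (proj_point v)}"
 \<comment> \<open>Adding and subtracting the conditions at \<open>v\<close> and \<open>tv v\<close>
   separates the two pairs, because \<open>tv\<close> changes the sign of the second pair
   only.\<close>
 have on: "(\<forall>w\<in>?S. (\<Sum>r\<in>UNIV. n r * w $ r) = 0) \<longleftrightarrow> n 0 * v $ 0 - n j * \<ii> * v $ j = 0 & - n k * \<ii> * v $ k + n l * v $ l = 0" (is "?a \<longleftrightarrow> ?b") for n :: "4 => 'k"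
 proof -
  have y: "(\<Sum>r\<in>UNIV. n r * y_coords \<ii> j w $ r) = (n 0 * w $ 0 - n j * \<ii> * w $ j) + (- n k * \<ii> * w $ k + n l * w $ l)" for w
   by (simp add: sum_jkl y_coords_def ident inv algebra_simps)
  have S: "?S = {y_coords \<ii> j (c *s v) |c. c ~= 0} Un {y_coords \<ii> j (c *s tv v) |c. c ~= 0}"
   unfolding translate_point by (auto simp: proj_point_def)
  show ?thesis
  proof
   assume a: ?a
   have "y_coords \<ii> j (1 *s v) : ?S" "y_coords \<ii> j (1 *s tv v) : ?S" unfolding S by (auto intro!: exI[of _ 1] simp del: vector_smult_lid)
   then have "(n 0 * v $ 0 - n j * \<ii> * v $ j) + (- n k * \<ii> * v $ k + n l * v $ l) = 0"
    "(n 0 * v $ 0 - n j * \<ii> * v $ j) - (- n k * \<ii> * v $ k + n l * v $ l) = 0"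
    using a y[of "1 *s v"] y[of "1 *s tv v"] by (auto simp: algebra_simps)
   then have "2 * (n 0 * v $ 0 - n j * \<ii> * v $ j) = 0" "2 * (- n k * \<ii> * v $ k + n l * v $ l) = 0" by Groebner_Basis.algebra+
   then show ?b using char by simp
  next
   assume b: ?b
   have "(\<Sum>r\<in>UNIV. n r * y_coords \<ii> j (c *s v) $ r) = 0" "(\<Sum>r\<in>UNIV. n r * y_coords \<ii> j (c *s tv v) $ r) = 0" for c
    unfolding y by (simp_all only: vector_smult_component tv_simps) (use b in Groebner_Basis.algebra)+
   then show ?a unfolding S by auto
  qed
 qed
 have ratio: "EX s. x = s * p & y = s * q" if "x * q = y * p" "p ~= 0 | q ~= 0" for x y p q :: 'k
 proof (cases "p = 0")
  case True
  then show ?thesis using that by (intro exI[of _ "y / q"]) simp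
 next
  case False
  then show ?thesis using that by (intro exI[of _ "x / p"]) (simp add: field_simps)
 qed
 show ?thesis unfolding secant_def line_through_def
 proof (rule the_equality)
  have "mm v ~= 0" by (rule mm_nonzero[OF v])
  moreover have "(\<forall>w\<in>?S. (\<Sum>r\<in>UNIV. Lv v r * w $ r) = 0)" "(\<forall>w\<in>?S. (\<Sum>r\<in>UNIV. Lv' v r * w $ r) = 0)"
   unfolding on using distinct_jkl ii by (simp_all add: Lv_def Lv'_def power2_eq_square)
  ultimately show "EX n n'. (\<chi> e. pluecker n n' e) ~= 0 & proj_point (mm v) = proj_point (\<chi> e. pluecker n n' e) &
    (\<forall>w\<in>?S. (\<Sum>r\<in>UNIV. n r * w $ r) = 0 & (\<Sum>r\<in>UNIV. n' r * w $ r) = 0)"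
   by (intro exI[of _ "Lv v"] exI[of _ "Lv' v"]) (auto simp: mm_def)
 next
  fix z assume "EX n n'. (\<chi> e. pluecker n n' e) ~= 0 & z = proj_point (\<chi> e. pluecker n n' e) &
    (\<forall>w\<in>?S. (\<Sum>r\<in>UNIV. n r * w $ r) = 0 & (\<Sum>r\<in>UNIV. n' r * w $ r) = 0)"
  then obtain n n' where n: "(\<chi> e. pluecker n n' e) ~= 0" "z = proj_point (\<chi> e. pluecker n n' e)"
   "\<forall>w\<in>?S. (\<Sum>r\<in>UNIV. n r * w $ r) = 0" "\<forall>w\<in>?S. (\<Sum>r\<in>UNIV. n' r * w $ r) = 0" by blast
  \<comment> \<open>On each pair the condition is one linear equation in two unknowns with nonzero
    coefficients, so its solutions are the multiples of one vector.\<close>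
  have rep: "EX s t. ALL r. n r = s * Lv v r + t * Lv' v r" if "\<forall>w\<in>?S. (\<Sum>r\<in>UNIV. n r * w $ r) = 0" for n
  proof -
   have b: "n 0 * v $ 0 - n j * \<ii> * v $ j = 0" "- n k * \<ii> * v $ k + n l * v $ l = 0" using that unfolding on by auto
   have "n 0 * - v $ 0 = n j * (- \<ii> * v $ j)" "n k * (\<ii> * v $ k) = n l * v $ l" using b by Groebner_Basis.algebra+
   moreover have "- \<ii> * v $ j ~= 0 | - v $ 0 ~= 0" "v $ l ~= 0 | \<ii> * v $ k ~= 0" using pairs_nonzero[OF v] i0 by auto
   ultimately obtain s t where st: "n 0 = s * (- \<ii> * v $ j)" "n j = s * - v $ 0" "n k = t * v $ l" "n l = t * (\<ii> * v $ k)" using ratio by (smt (verit, ccfv_SIG))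
   have "n r = s * Lv v r + t * Lv' v r" for r using exhaust_jkl[of r] st distinct_jkl by (auto simp: Lv_def Lv'_def)
   then show ?thesis by blast
  qed
  obtain s t s' t' where "!!r. n r = s * Lv v r + t * Lv' v r" "!!r. n' r = s' * Lv v r + t' * Lv' v r" using rep[OF n(3)] rep[OF n(4)] by metis
  then have e: "(\<chi> e. pluecker n n' e) = (s * t' - s' * t) *s mm v"
   by (simp add: Finite_Cartesian_Product.vec_eq_iff mm_def pluecker_def case_prod_unfold algebra_simps)
  then have "s * t' - s' * t ~= 0" using n(1) by auto
  then show "z = proj_point (mm v)" unfolding n(2) e by (rule proj_point_scale)
 qed
qed

definition "Y = zeros (if j = 1 then E1 else if j = 2 then E2 else E3)"

lemma Y_mem: "w ~= 0 ==> proj_point w : Y \<longleftrightarrow> (if j = 1 then zero1 w else if j = 2 then zero2 w else zero3 w)"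
proof -
 assume w: "w ~= 0"
 have zg: "proj_point w : zeros I \<longleftrightarrow> (\<forall>g\<in>I. peval w g = 0)" if "graded I" for I :: "(pl, 'k) mpoly set"
 proof
  assume "proj_point w : zeros I"
  then show "\<forall>g\<in>I. peval w g = 0" using proj_point_self[of w] by (auto simp: zeros_def vanishes_def)
 qed (use zeros_graded[OF that] w in blast)
 have "(\<forall>g\<in>E1. peval w g = 0) \<longleftrightarrow> zero1 w"
  unfolding E1_def zero1_def using peval_ideal_gen[of _ "{Var Z01, Var Z23, P, F1}" w] using E1_def E1_iff zero1_def by blast
 moreover have "(\<forall>g\<in>E2. peval w g = 0) \<longleftrightarrow> zero2 w"
  unfolding E2_def zero2_def using peval_ideal_gen[of _ "{Var Z02, - Var Z13, P, F2}" w] using E2_def E2_iff zero2_def by blast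
 moreover have "(\<forall>g\<in>E3. peval w g = 0) \<longleftrightarrow> zero3 w"
  unfolding E3_def zero3_def using peval_ideal_gen[of _ "{Var Z03, Var Z12, P, F3}" w] using E3_def E3_iff zero3_def by blast
 ultimately show ?thesis by (simp add: Y_def zg E1_graded E2_graded E3_graded)
qed

abbreviation "qdet v \<equiv> (v $ 0 ^ 2 + v $ j ^ 2) * (dd k * v $ k ^ 2 + dd l * v $ l ^ 2) - (v $ k ^ 2 + v $ l ^ 2) * (dd 0 * v $ 0 ^ 2 + dd j * v $ j ^ 2)"

text \<open>\<open>qdet v\<close> is the determinant of the two quadrics as linear equations in
  scaling factors for the two pairs; scaling the pairs separately changes \<open>mm v\<close> by a
  scalar only. For \<open>j = 2\<close> and \<open>j = 3\<close> the constraint eliminates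
  \<alpha>.\<close>

lemma zero_mm: "(if j = 1 then zero1 (mm v) else if j = 2 then zero2 (mm v) else zero3 (mm v)) \<longleftrightarrow> qdet v = 0"
proof -
 have a: "\<alpha> * (1 + \<beta> * \<gamma>) = - (\<beta> + \<gamma>)" by (rule bc)
 have vals: "peval w P = w $ Z01 * w $ Z23 - w $ Z02 * w $ Z13 + w $ Z03 * w $ Z12" for w by (simp add: P_def)
 show ?thesis
  using jkl_cases
 proof (elim disjE conjE)
  assume c: "j = 1" "k = 2" "l = 3"
  have m: "mm v $ Z01 = 0" "mm v $ Z23 = 0" "mm v $ Z02 = - \<ii> * v $ j * v $ l" "mm v $ Z03 = v $ j * v $ k" "mm v $ Z12 = - v $ 0 * v $ l" "mm v $ Z13 = - \<ii> * v $ 0 * v $ k"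
   unfolding mm_coord pos_def by (simp_all add: c)
  have D: "dd 0 = 1" "dd j = - (\<beta> * \<gamma>)" "dd k = - \<gamma>" "dd l = \<beta>" by (simp_all add: dd_def c)
  have p: "peval (mm v) P = 0" unfolding vals m using ii by Groebner_Basis.algebra
  have "peval (mm v) F1 = (1 - \<beta>) * (mm v $ Z12 ^ 2 + \<gamma> * mm v $ Z03 ^ 2) - (1 + \<gamma>) * (mm v $ Z13 ^ 2 - \<beta> * mm v $ Z02 ^ 2)" by (simp add: F1_def)
  also have "... = - qdet v" unfolding m D using ii by Groebner_Basis.algebra
  finally have f: "peval (mm v) F1 = 0 \<longleftrightarrow> qdet v = 0" by (simp only: neg_equal_0_iff_equal)
  have "zero1 (mm v) \<longleftrightarrow> qdet v = 0" unfolding zero1_def f using p m(1,2) by simp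
  then show ?thesis unfolding if_P[OF c(1)] .
 next
  assume c: "j = 2" "k = 1" "l = 3"
  have m: "mm v $ Z02 = 0" "mm v $ Z13 = 0" "mm v $ Z01 = - \<ii> * v $ j * v $ l" "mm v $ Z03 = v $ j * v $ k" "mm v $ Z12 = v $ 0 * v $ l" "mm v $ Z23 = - \<ii> * v $ 0 * v $ k"
   unfolding mm_coord pos_def by (simp_all add: c)
  have D: "dd 0 = 1" "dd j = - \<gamma>" "dd k = - (\<beta> * \<gamma>)" "dd l = \<beta>" by (simp_all add: dd_def c)
  have p: "peval (mm v) P = 0" unfolding vals m using ii by Groebner_Basis.algebra
  have F: "peval (mm v) F2 = (1 - \<gamma>) * (mm v $ Z23 ^ 2 + \<alpha> * mm v $ Z01 ^ 2) - (1 + \<alpha>) * (mm v $ Z12 ^ 2 - \<gamma> * mm v $ Z03 ^ 2)" by (simp add: F2_def)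
  have "(1 + \<beta> * \<gamma>) * peval (mm v) F2 = (1 - \<gamma>) * qdet v" unfolding F unfolding m D using a ii by Groebner_Basis.algebra
  then have f: "peval (mm v) F2 = 0 \<longleftrightarrow> qdet v = 0" using bc(1) nzs(9) by (metis mult_eq_0_iff)
  have "zero2 (mm v) \<longleftrightarrow> qdet v = 0" unfolding zero2_def f using p m(1,2) by simp
  moreover have "~ j = 1" using c(1) by simp
  ultimately show ?thesis by (simp only: if_not_P if_P[OF c(1)] if_False)
 next
  assume c: "j = 3" "k = 1" "l = 2"
  have m: "mm v $ Z03 = 0" "mm v $ Z12 = 0" "mm v $ Z01 = - \<ii> * v $ j * v $ l" "mm v $ Z02 = v $ j * v $ k" "mm v $ Z13 = v $ 0 * v $ l" "mm v $ Z23 = \<ii> * v $ 0 * v $ k"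
   unfolding mm_coord pos_def by (simp_all add: c)
  have D: "dd 0 = 1" "dd j = \<beta>" "dd k = - (\<beta> * \<gamma>)" "dd l = - \<gamma>" by (simp_all add: dd_def c)
  have p: "peval (mm v) P = 0" unfolding vals m using ii by Groebner_Basis.algebra
  have F: "peval (mm v) F3 = (1 - \<alpha>) * (mm v $ Z13 ^ 2 + \<beta> * mm v $ Z02 ^ 2) - (1 + \<beta>) * (mm v $ Z23 ^ 2 - \<alpha> * mm v $ Z01 ^ 2)" by (simp add: F3_def)
  have "(1 + \<beta> * \<gamma>) * peval (mm v) F3 = - (1 + \<beta>) * qdet v" unfolding F unfolding m D using a ii by Groebner_Basis.algebra
  then have f: "peval (mm v) F3 = 0 \<longleftrightarrow> qdet v = 0" using bc(1) nzs(5) by (metis mult_eq_0_iff neg_equal_0_iff_equal)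
  have "zero3 (mm v) \<longleftrightarrow> qdet v = 0" unfolding zero3_def f using p m(1,2) by simp
  moreover have "~ j = 1" "~ j = 2" using c(1) by simp_all
  ultimately show ?thesis by (simp only: if_False)
 qed
qed

lemma mm_in_Y: "onX v ==> v ~= 0 ==> proj_point (mm v) : Y"
proof -
 assume v: "onX v" "v ~= 0"
 have "qdet v = 0" using v(1) unfolding onX_def by Groebner_Basis.algebra
 then show ?thesis using Y_mem[OF mm_nonzero[OF v]] zero_mm[of v] by simp
qed

text \<open>Factoring a matrix of rank one gives \<open>p\<close> with \<open>mm p = w\<close>. As
  \<open>qdet p = 0\<close>, both quadrics vanish after rescaling the second pair by a suitable
  \<open>c\<close>, which moves \<open>mm p\<close> only by a scalar.\<close>

lemma mm_onto:
 assumes w: "w ~= 0" "proj_point w : Y"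
 obtains v where "onX v" "v ~= 0" "proj_point (mm v) = proj_point w"
proof -
 have i0: "\<ii> ~= 0" using ii by auto
 have z: "if j = 1 then zero1 w else if j = 2 then zero2 w else zero3 w" using Y_mem[OF w(1)] w(2) by simp
 obtain p :: "'k^4" where p: "mm p = w"
 proof -
  have fac: "\<exists>p :: 'k^4. - \<ii> * p $ j * p $ l = a & p $ j * p $ k = b & - p $ 0 * p $ l = c & - \<ii> * p $ 0 * p $ k = d" if "a * d = b * c" for a b c d
  proof -
   have h: "(\<ii> * a) * (\<ii> * d) = b * (- c)" using that ii by Groebner_Basis.algebra
   obtain x y r s where f: "\<ii> * a = x * r" "b = x * s" "- c = y * r" "\<ii> * d = y * s" by (rule rank_one[OF h])
   let ?p = "(\<chi> q. if q = j then x else if q = l then r else if q = k then s else y) :: 'k^4"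
   have "a = - \<ii> * (\<ii> * a)" "d = - \<ii> * (\<ii> * d)" using ii by Groebner_Basis.algebra+
   note aa = this
   have "a = - \<ii> * (x * r)" using aa(1) unfolding f(1) .
   moreover have "d = - \<ii> * (y * s)" using aa(2) unfolding f(4) .
   moreover have "c = - (y * r)" using f(3) by (metis minus_minus)
   ultimately have "a = - \<ii> * (x * r)" "d = - \<ii> * (y * s)" "c = - (y * r)" .
   then show ?thesis using distinct_jkl f by (intro exI[of _ ?p]) (simp add: mult.assoc)
  qed
  have "EX p. mm p = w"
   using jkl_cases
  proof (elim disjE conjE)
   assume c: "j = 1" "k = 2" "l = 3"
   have w0: "w $ Z02 * w $ Z13 = w $ Z03 * w $ Z12" "w $ Z01 = 0" "w $ Z23 = 0" using z by (auto simp: c zero1_def P_def)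
   from fac[OF w0(1)] obtain p :: "'k^4" where p: "- \<ii> * p $ 1 * p $ 3 = w $ Z02" "p $ 1 * p $ 2 = w $ Z03" "- p $ 0 * p $ 3 = w $ Z12" "- \<ii> * p $ 0 * p $ 2 = w $ Z13"
    unfolding c by blast
   have "mm p $ e = w $ e" for e unfolding mm_coord pos_def using p w0(2,3) by (cases e) (simp_all add: c)
   then show ?thesis by (auto simp: Finite_Cartesian_Product.vec_eq_iff)
  next
   assume c: "j = 2" "k = 1" "l = 3"
   have "w $ Z01 * w $ Z23 = w $ Z03 * (- w $ Z12)" "w $ Z02 = 0" "w $ Z13 = 0" using z by (auto simp: c zero2_def P_def eq_neg_iff_add_eq_0)
   from fac[OF this(1)] obtain p :: "'k^4" where p: "- \<ii> * p $ 2 * p $ 3 = w $ Z01" "p $ 2 * p $ 1 = w $ Z03" "- p $ 0 * p $ 3 = - w $ Z12" "- \<ii> * p $ 0 * p $ 1 = w $ Z23"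
    unfolding c by blast
   have "mm p $ e = w $ e" for e unfolding mm_coord pos_def using p \<open>w $ Z02 = 0\<close> \<open>w $ Z13 = 0\<close> by (cases e) (simp_all add: c)
   then show ?thesis by (auto simp: Finite_Cartesian_Product.vec_eq_iff)
  next
   assume c: "j = 3" "k = 1" "l = 2"
   have "w $ Z01 * (- w $ Z23) = w $ Z02 * (- w $ Z13)" "w $ Z03 = 0" "w $ Z12 = 0" using z by (auto simp: c zero3_def P_def)
   from fac[OF this(1)] obtain p :: "'k^4" where p: "- \<ii> * p $ 3 * p $ 2 = w $ Z01" "p $ 3 * p $ 1 = w $ Z02" "- p $ 0 * p $ 2 = - w $ Z13" "- \<ii> * p $ 0 * p $ 1 = - w $ Z23"
    unfolding c by blast
   have "mm p $ e = w $ e" for e unfolding mm_coord pos_def using p \<open>w $ Z03 = 0\<close> \<open>w $ Z12 = 0\<close> by (cases e) (simp_all add: c)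
   then show ?thesis by (auto simp: Finite_Cartesian_Product.vec_eq_iff)
  qed
  then show ?thesis using that by blast
 qed
 have q0: "qdet p = 0" by (rule iffD1[OF zero_mm]) (use z in "simp only: p")
 have pn: "p $ 0 ~= 0 | p $ j ~= 0" "p $ k ~= 0 | p $ l ~= 0"
  using w(1) unfolding p[symmetric] by (auto simp: Finite_Cartesian_Product.vec_eq_iff mm_coord)
 have nzp: "a^2 + b^2 ~= 0 | x * a^2 + y * b^2 ~= 0" if "x ~= y" "a ~= 0 | b ~= 0" for a b x y :: 'k
 proof (rule ccontr)
  assume "~ ?thesis"
  then have "a^2 + b^2 = 0" "x * a^2 + y * b^2 = 0" by auto
  then have "(x - y) * a^2 = 0" "(x - y) * b^2 = 0" by Groebner_Basis.algebra+
  then show False using that by auto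
 qed
 have V: "p $ 0 ^ 2 + p $ j ^ 2 ~= 0 | dd 0 * p $ 0 ^ 2 + dd j * p $ j ^ 2 ~= 0" "p $ k ^ 2 + p $ l ^ 2 ~= 0 | dd k * p $ k ^ 2 + dd l * p $ l ^ 2 ~= 0"
  using nzp dd_distinct pn by blast+
 obtain t where t: "t ~= 0" "p $ 0 ^ 2 + p $ j ^ 2 + t * (p $ k ^ 2 + p $ l ^ 2) = 0" "dd 0 * p $ 0 ^ 2 + dd j * p $ j ^ 2 + t * (dd k * p $ k ^ 2 + dd l * p $ l ^ 2) = 0"
 proof -
  have "EX t. t ~= 0 & x + t * x' = 0 & y + t * y' = 0" if "x * y' = x' * y" "x ~= 0 | y ~= 0" "x' ~= 0 | y' ~= 0" for x y x' y' :: 'k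
  proof (cases "x' = 0")
   case True
   then have "x = 0" "y' ~= 0" "y ~= 0" using that by auto
   then show ?thesis using True by (intro exI[of _ "- y / y'"]) simp
  next
   case False
   have "x ~= 0" using that False by auto
   then show ?thesis using that False by (intro exI[of _ "- x / x'"]) (simp add: field_simps)
  qed
  from this[OF _ V] q0 that show ?thesis by auto
 qed
 obtain c where c: "c^2 = t" using nth_root_exists[of 2 t] by auto
 have c0: "c ~= 0" using c t by auto
 let ?v = "(\<chi> q. if q = 0 | q = j then p $ q else c * p $ q) :: 'k^4"
 have vv: "?v $ 0 = p $ 0" "?v $ j = p $ j" "?v $ k = c * p $ k" "?v $ l = c * p $ l" using distinct_jkl by auto
 have "onX ?v" unfolding onX_def vv using t(2,3) unfolding c[symmetric] by (simp add: power_mult_distrib algebra_simps)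
 moreover have "mm ?v = c *s mm p" unfolding Finite_Cartesian_Product.vec_eq_iff vector_smult_component mm_coord vv by (simp add: algebra_simps)
 moreover have "?v ~= 0" using pn(1) vv(1,2) by (metis zero_index)
 ultimately show ?thesis using that[of ?v] proj_point_scale[OF c0, of "mm p"] p by metis
qed

text \<open>The coordinates of \<open>mm\<close> show that \<open>w\<close> is \<open>v\<close>
  scaled by \<open>x\<close> on the first pair and by \<open>y\<close> on the second; the quadrics
  force \<open>x^2 = y^2\<close>, and the two signs correspond to \<open>v\<close> and
  \<open>tv v\<close>.\<close>

lemma mm_inj:
 assumes v: "onX v" "v ~= 0" and w: "onX w" "w ~= 0" and e: "proj_point (mm v) = proj_point (mm w)"
 shows "proj_point w = proj_point v | proj_point w = proj_point (tv v)"
proof -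
 obtain t where t: "t ~= 0" "mm w = t *s mm v" using proj_point_self[of "mm w"] e by (metis proj_point_mem)
 have pr: "w $ a * w $ b = t * (v $ a * v $ b)" if ab': "a : {0, j}" "b \<in> {k, l}" for a b
 proof -
  obtain e s where s: "s ~= 0" "!!v. mm v $ e = s * (v $ a * v $ b)" using entries[OF ab'] by blast
  have "s * (w $ a * w $ b) = t * (s * (v $ a * v $ b))" using arg_cong[OF t(2), of "%x. x $ e"] by (simp add: s)
  then have "s * (w $ a * w $ b) = s * (t * (v $ a * v $ b))" by (simp add: mult_ac)
  then show ?thesis using s(1) by simp
 qed
 obtain a b where ab: "a : {0, j}" "b \<in> {k, l}" "v $ a ~= 0" "v $ b ~= 0" using pairs_nonzero[OF v] by blast
 have wab: "w $ a ~= 0" "w $ b ~= 0" using pr[OF ab(1,2)] ab t by auto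
 define x y where "x = w $ a / v $ a" and "y = w $ b / v $ b"
 have xy: "x ~= 0" "y ~= 0" "x * y = t" using wab ab pr[OF ab(1,2)] by (auto simp: x_def y_def field_simps)
 have 1: "w $ r = x * v $ r" if "r : {0, j}" for r
 proof -
  have "w $ r * w $ b = t * (v $ r * v $ b)" by (rule pr[OF that ab(2)])
  moreover have "w $ b = y * v $ b" using ab by (simp add: y_def)
  ultimately have "(w $ r - x * v $ r) * (y * v $ b) = 0" using xy(3) by Groebner_Basis.algebra
  then show ?thesis using xy ab by simp
 qed
 have 2: "w $ r = y * v $ r" if "r : {k, l}" for r
 proof -
  have "w $ a * w $ r = t * (v $ a * v $ r)" by (rule pr[OF ab(1) that])
  moreover have "w $ a = x * v $ a" using ab by (simp add: x_def)
  ultimately have "(w $ r - y * v $ r) * (x * v $ a) = 0" using xy(3) by Groebner_Basis.algebra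
  then show ?thesis using xy ab by simp
 qed
 have w4: "w $ 0 = x * v $ 0" "w $ j = x * v $ j" "w $ k = y * v $ k" "w $ l = y * v $ l" using 1 2 by auto
 have "(x^2 - y^2) * (v $ 0 ^ 2 + v $ j ^ 2) = 0" "(x^2 - y^2) * (dd 0 * v $ 0 ^ 2 + dd j * v $ j ^ 2) = 0"
  using v(1) w(1) unfolding onX_def w4 by Groebner_Basis.algebra+
 moreover have "~ (v $ 0 ^ 2 + v $ j ^ 2 = 0 & dd 0 * v $ 0 ^ 2 + dd j * v $ j ^ 2 = 0)"
 proof
  assume "v $ 0 ^ 2 + v $ j ^ 2 = 0 & dd 0 * v $ 0 ^ 2 + dd j * v $ j ^ 2 = 0"
  then have "(dd 0 - dd j) * v $ 0 ^ 2 = 0" "(dd 0 - dd j) * v $ j ^ 2 = 0" by Groebner_Basis.algebra+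
  then show False using dd_distinct(1) pairs_nonzero(1)[OF v] by simp
 qed
 ultimately have "x^2 - y^2 = 0" by auto
 then have "(x - y) * (x + y) = 0" by (simp add: power2_eq_square algebra_simps)
 then consider "y = x" | "y = - x" by (auto simp: eq_neg_iff_add_eq_0 add.commute)
 then show ?thesis
 proof cases
  case 1
  then have "w = x *s v" by (intro vec_jkl) (simp_all add: w4)
  then show ?thesis using proj_point_scale[OF xy(1)] by blast
 next
  case 2
  then have "w = x *s tv v" by (intro vec_jkl) (simp_all add: w4)
  then show ?thesis using proj_point_scale[OF xy(1)] by blast
 qed
qed

text \<open>Even monomials descend: the quadrics express \<open>x\<^sub>0\<^sup>2, x\<^sub>j\<^sup>2\<close> through \<open>x\<^sub>k\<^sup>2, x\<^sub>l\<^sup>2\<close> and conversely, so that the degrees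
 in the two pairs of variables can be made equal.\<close>

definition desc :: "nat => ('k^4 => 'k) => bool" where
 "desc n f \<longleftrightarrow> (EX G. homogeneous n G & (ALL v. onX v --> f v = peval (mm v) G))"

lemma desc_add: "desc n f ==> desc n g ==> desc n (%v. f v + g v)"
 unfolding desc_def by (metis homogeneous_add peval_simps(3))

lemma desc_mult: "desc n f ==> desc m g ==> desc (n + m) (%v. f v * g v)"
 unfolding desc_def by (metis homogeneous_mult peval_simps(4))

lemma desc_scale: "desc n f ==> desc n (%v. c * f v)"
proof -
 assume "desc n f"
 then obtain G where "homogeneous n G" "ALL v. onX v --> f v = peval (mm v) G" by (auto simp: desc_def)
 then show ?thesis unfolding desc_def by (intro exI[of _ "Const c * G"]) (simp add: homogeneous_Const_mult)
qed

lemma desc_cong: "desc n f ==> (!!v. onX v ==> g v = f v) ==> desc n g"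
 unfolding desc_def by auto

lemma desc_0: "desc n (%v. 0)"
 unfolding desc_def by (rule exI[of _ 0]) (simp add: homogeneous_def)

lemma desc_sum: "(!!x. x : S1 ==> desc n (f x)) ==> desc n (%v. \<Sum>x\<in>S1. f x v)"
 by (induction S1 rule: infinite_finite_induct) (auto simp: desc_0 intro: desc_add)

lemma desc_pair: "a : {0, j} ==> b \<in> {k, l} ==> desc 1 (%v. v $ a * v $ b)"
proof -
 assume "a : {0, j}" "b \<in> {k, l}"
 then obtain e s where s: "s ~= 0" "!!v. mm v $ e = s * (v $ a * v $ b)" using entries by meson
 show ?thesis unfolding desc_def
  by (rule exI[of _ "Const (1 / s) * Var e"]) (use s in "auto intro: homogeneous_Const_mult homogeneous_Var simp del: One_nat_def")
qed

lemma desc_quad: "a : {0, j} ==> b \<in> {0, j} ==> c \<in> {k, l} ==> d \<in> {k, l} ==> desc 2 (%v. v $ a * v $ b * (v $ c * v $ d))"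
proof -
 assume "a : {0, j}" "b \<in> {0, j}" "c \<in> {k, l}" "d \<in> {k, l}"
 then have "desc (1 + 1) (%v. (v $ a * v $ c) * (v $ b * v $ d))" by (intro desc_mult desc_pair)
 then show ?thesis unfolding one_add_one by (rule desc_cong) (simp add: mult_ac)
qed

text \<open>The two quadrics can be solved for the squares at \<open>0\<close> and \<open>j\<close>
  since \<open>dd 0 ~= dd j\<close>.\<close>

lemma squares:
 assumes "a : {0, j}"
 shows "EX s t. ALL v. onX v --> v $ a ^ 2 = s * v $ k ^ 2 + t * v $ l ^ 2"
proof -
 define e where "e = dd 0 - dd j"
 have e: "e ~= 0" using dd_distinct by (simp add: e_def)
 have dv: "x = (a / e) * y + (b / e) * z" if "e * x = a * y + b * z" for x y z a b
 proof -
  have "(a / e) * y + (b / e) * z = (a * y + b * z) / e" by (simp add: add_divide_distrib)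
  also have "... = x" unfolding that[symmetric] using e by simp
  finally show ?thesis by (rule sym)
 qed
 have "v $ 0 ^ 2 = ((dd j - dd k) / e) * v $ k ^ 2 + ((dd j - dd l) / e) * v $ l ^ 2"
  "v $ j ^ 2 = ((dd k - dd 0) / e) * v $ k ^ 2 + ((dd l - dd 0) / e) * v $ l ^ 2" if "onX v" for v
 proof -
  have q: "e * v $ 0 ^ 2 = (dd j - dd k) * v $ k ^ 2 + (dd j - dd l) * v $ l ^ 2" "e * v $ j ^ 2 = (dd k - dd 0) * v $ k ^ 2 + (dd l - dd 0) * v $ l ^ 2"
   using that unfolding onX_def e_def by Groebner_Basis.algebra+
  show "v $ 0 ^ 2 = ((dd j - dd k) / e) * v $ k ^ 2 + ((dd j - dd l) / e) * v $ l ^ 2"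
   "v $ j ^ 2 = ((dd k - dd 0) / e) * v $ k ^ 2 + ((dd l - dd 0) / e) * v $ l ^ 2"
   by (rule dv[OF q(1)] dv[OF q(2)])+
 qed
 then show ?thesis using assms by blast
qed

lemma squares':
 assumes "a : {k, l}"
 shows "EX s t. ALL v. onX v --> v $ a ^ 2 = s * v $ 0 ^ 2 + t * v $ j ^ 2"
proof -
 define e where "e = dd k - dd l"
 have e: "e ~= 0" using dd_distinct by (simp add: e_def)
 have dv: "x = (a / e) * y + (b / e) * z" if "e * x = a * y + b * z" for x y z a b
 proof -
  have "(a / e) * y + (b / e) * z = (a * y + b * z) / e" by (simp add: add_divide_distrib)
  also have "... = x" unfolding that[symmetric] using e by simp
  finally show ?thesis by (rule sym)
 qed
 have "v $ k ^ 2 = ((dd l - dd 0) / e) * v $ 0 ^ 2 + ((dd l - dd j) / e) * v $ j ^ 2"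
  "v $ l ^ 2 = ((dd 0 - dd k) / e) * v $ 0 ^ 2 + ((dd j - dd k) / e) * v $ j ^ 2" if "onX v" for v
 proof -
  have q: "e * v $ k ^ 2 = (dd l - dd 0) * v $ 0 ^ 2 + (dd l - dd j) * v $ j ^ 2" "e * v $ l ^ 2 = (dd 0 - dd k) * v $ 0 ^ 2 + (dd j - dd k) * v $ j ^ 2"
   using that unfolding onX_def e_def by Groebner_Basis.algebra+
  show "v $ k ^ 2 = ((dd l - dd 0) / e) * v $ 0 ^ 2 + ((dd l - dd j) / e) * v $ j ^ 2"
   "v $ l ^ 2 = ((dd 0 - dd k) / e) * v $ 0 ^ 2 + ((dd j - dd k) / e) * v $ j ^ 2"
   by (rule dv[OF q(1)] dv[OF q(2)])+
 qed
 then show ?thesis using assms by blast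
qed

text \<open>Among three indices from one pair two coincide; their square is traded for squares from
  the other pair, which leaves two factors from each pair.\<close>

lemma desc_four:
 assumes "{a, b, c, d} \<subseteq> {0, j} | {a, b, c, d} \<subseteq> {k, l}"
 shows "desc 2 (%v. v $ a * v $ b * (v $ c * v $ d))"
proof -
 have *: "EX x y z. {x, y, z} \<subseteq> {a, b, c, d} & (\<forall>v :: 'k^4. v $ a * v $ b * (v $ c * v $ d) = v $ x ^ 2 * (v $ y * v $ z))"
 proof -
  have "a = b | a = c | b = c" using assms by auto
  then show ?thesis
  proof (elim disjE)
   assume "a = b" then show ?thesis by (metis insert_absorb2 power2_eq_square subsetI)
  next
   assume e: "a = c" show ?thesis by (rule exI[of _ a], rule exI[of _ b], rule exI[of _ d]) (use e in "auto simp: power2_eq_square mult_ac")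
  next
   assume e: "b = c" show ?thesis by (rule exI[of _ b], rule exI[of _ a], rule exI[of _ d]) (use e in "auto simp: power2_eq_square mult_ac")
  qed
 qed
 then obtain x y z where xyz: "{x, y, z} \<subseteq> {a, b, c, d}" "!!v :: 'k^4. v $ a * v $ b * (v $ c * v $ d) = v $ x ^ 2 * (v $ y * v $ z)" by blast
 consider "x : {0, j}" "y \<in> {0, j}" "z \<in> {0, j}" | "x : {k, l}" "y \<in> {k, l}" "z \<in> {k, l}" using assms xyz(1) by blast
 then show ?thesis
 proof cases
  case 1
  obtain s t where st: "!!v. onX v ==> v $ x ^ 2 = s * v $ k ^ 2 + t * v $ l ^ 2" using squares[OF 1(1)] by blast
  have "desc 2 (%v. s * (v $ y * v $ z * (v $ k * v $ k)) + t * (v $ y * v $ z * (v $ l * v $ l)))"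
   using 1 by (intro desc_add desc_scale desc_quad) auto
  then show ?thesis by (rule desc_cong) (simp only: xyz st, simp add: algebra_simps power2_eq_square)
 next
  case 2
  obtain s t where st: "!!v. onX v ==> v $ x ^ 2 = s * v $ 0 ^ 2 + t * v $ j ^ 2" using squares'[OF 2(1)] by blast
  have "desc 2 (%v. s * (v $ 0 * v $ 0 * (v $ y * v $ z)) + t * (v $ j * v $ j * (v $ y * v $ z)))"
   using 2 by (intro desc_add desc_scale desc_quad) auto
  then show ?thesis by (rule desc_cong) (simp only: xyz st, simp add: algebra_simps power2_eq_square)
 qed
qed

lemma desc_one: "desc 0 (%v. 1)"
 unfolding desc_def by (rule exI[of _ "Const 1"]) (simp add: homogeneous_iff Const_def)

text \<open>Four factors from one pair are removed at a time; if neither list has four, the parity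
  assumption leaves two and two.\<close>

lemma desc_lists:
 assumes "length us + length ws = 4 * n" "even (length ws)" "set us \<subseteq> {0, j}" "set ws \<subseteq> {k, l}"
 shows "desc (2 * n) (%v. prod_list (map (($) v) us) * prod_list (map (($) v) ws))"
 using assms
proof (induction n arbitrary: us ws)
 case 0
 then show ?case by (simp add: desc_one)
next
 case (Suc n)
 have four: "EX a b c d xs. ys = a # b # c # d # xs" if "4 <= length ys" for ys :: "4 list"
  using that by (auto simp: Suc_le_length_iff numeral_eq_Suc)
 consider "4 <= length us" | "4 <= length ws" | "length us < 4" "length ws < 4" by linarith
 then show ?case
 proof cases
  case 1
  then obtain a b c d xs where u: "us = a # b # c # d # xs" using four by blast
  have "desc (2 + 2 * n) (%v. v $ a * v $ b * (v $ c * v $ d) * (prod_list (map (($) v) xs) * prod_list (map (($) v) ws)))"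
   using Suc.prems by (intro desc_mult desc_four Suc.IH) (auto simp: u)
  then show ?thesis by (simp add: u mult_ac)
 next
  case 2
  then obtain a b c d xs where w: "ws = a # b # c # d # xs" using four by blast
  have "desc (2 + 2 * n) (%v. v $ a * v $ b * (v $ c * v $ d) * (prod_list (map (($) v) us) * prod_list (map (($) v) xs)))"
   using Suc.prems by (intro desc_mult desc_four Suc.IH) (auto simp: w)
  then show ?thesis by (simp add: w mult_ac)
 next
  case 3
  then have l: "length ws = 2 & length us = 2 & n = 0" using Suc.prems(1,2) by presburger
  then obtain a b c d where w: "us = [a, b]" "ws = [c, d]" by (auto simp: numeral_2_eq_2 length_Suc_conv)
  then show ?thesis using Suc.prems desc_quad[of a b c d] l by simp
 qed
qed

text \<open>Symmetrisation doubles the monomials that are even in the second pair and kills the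
  others; in a degree divisible by four the even ones can be balanced between the pairs.\<close>

lemma desc_invariant:
 assumes f: "homogeneous (4 * n) f"
 shows "desc (2 * n) (%v. peval v f + peval (tv v) f)"
proof -
 have mono: "desc (2 * n) (%v. mval (($) v) m + mval (($) (tv v)) m)" if m: "mdeg m = 4 * n" for m
 proof -
  let ?m = "Poly_Mapping.lookup m"
  let ?us = "replicate (?m 0) 0 @ replicate (?m j) j" and ?ws = "replicate (?m k) k @ replicate (?m l) l"
  have d: "mdeg m = ?m 0 + ?m j + ?m k + ?m l"
  proof -
   have "mdeg m = (\<Sum>r\<in>UNIV. ?m r)" by (rule mdeg_superset) auto
   also have "... = (\<Sum>r\<in>{0, j, k, l}. ?m r)" using exhaust_jkl by (intro sum.cong) auto
   finally show ?thesis using distinct_jkl by simp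
  qed
  have v: "mval (($) v) m = v $ 0 ^ ?m 0 * v $ j ^ ?m j * (v $ k ^ ?m k * v $ l ^ ?m l)" for v :: "'k^4"
  proof -
   have "mval (($) v) m = (\<Prod>r\<in>UNIV. v $ r ^ ?m r)" by (rule mval_superset) auto
   also have "... = (\<Prod>r\<in>{0, j, k, l}. v $ r ^ ?m r)" using exhaust_jkl by (intro prod.cong) auto
   finally show ?thesis using distinct_jkl by (simp add: mult_ac)
  qed
  have l: "mval (($) v) m = prod_list (map (($) v) ?us) * prod_list (map (($) v) ?ws)" for v :: "'k^4" by (simp add: v prod_list_replicate)
  have t: "mval (($) (tv v)) m = (- 1) ^ (?m k + ?m l) * mval (($) v) m" for v
   unfolding v tv_simps power_minus[of "v $ k"] power_minus[of "v $ l"] by (simp add: power_add mult_ac)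
  show ?thesis
  proof (cases "even (?m k + ?m l)")
   case True
   have "desc (2 * n) (%v. 2 * (prod_list (map (($) v) ?us) * prod_list (map (($) v) ?ws)))"
    using m d True by (intro desc_scale desc_lists) auto
   then show ?thesis by (rule desc_cong) (use True in "simp only: t l[symmetric]; simp")
  next
   case False
   show ?thesis by (rule desc_cong[OF desc_0]) (use False in "simp only: t; simp")
  qed
 qed
 have "desc (2 * n) (%v. \<Sum>m\<in>Poly_Mapping.keys f. Poly_Mapping.lookup f m * (mval (($) v) m + mval (($) (tv v)) m))"
  using f by (intro desc_sum desc_scale mono) (simp add: homogeneous_iff)
 then show ?thesis by (rule desc_cong) (simp add: peval_sum_keys distrib_left sum.distrib)
qed

text \<open>A linear form vanishing at \<open>\<tau> T\<close> but not at \<open>T\<close>.\<close>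

lemma separating_form:
 assumes "onX v" "v ~= 0"
 obtains t where "homogeneous 1 t" "peval v t ~= 0" "peval (tv v) t = 0"
proof -
 obtain a b where ab: "a : {0, j}" "b \<in> {k, l}" "v $ a ~= 0" "v $ b ~= 0" using pairs_nonzero[OF assms] by blast
 have tab: "tv v $ a = v $ a" "tv v $ b = - v $ b" using ab(1,2) by auto
 show ?thesis
 proof (rule that[of "Const (v $ b) * Var a + Const (v $ a) * Var b"])
  show "homogeneous 1 (Const (v $ b) * Var a + Const (v $ a) * Var b)" by (intro homogeneous_add homogeneous_Const_mult homogeneous_Var)
  have "peval v (Const (v $ b) * Var a + Const (v $ a) * Var b) = 2 * (v $ a * v $ b)" by (simp add: mult_ac)
  then show "peval v (Const (v $ b) * Var a + Const (v $ a) * Var b) ~= 0" using ab char by simp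
  show "peval (tv v) (Const (v $ b) * Var a + Const (v $ a) * Var b) = 0" by (simp add: tab mult_ac)
 qed
qed

lemma closed_form:
 fixes Z :: "('k^'y::finite) set set"
 assumes "zariski_closed Z" "proj_point v ~: Z" "v ~= 0"
 obtains d s where "homogeneous d s" "peval v s ~= 0" "!!Q w. Q : Z ==> w : Q ==> peval w s = 0"
proof -
 have g: "graded (vanishing_ideal Z)" using vanishing_graded zariski_closed_sub assms(1) by blast
 have "~ (\<forall>f\<in>vanishing_ideal Z. peval v f = 0)"
 proof
  assume "\<forall>f\<in>vanishing_ideal Z. peval v f = 0"
  then have "proj_point v : zeros (vanishing_ideal Z)" unfolding zeros_graded[OF g] using assms(3) by blast
  then show False using zeros_vanishing[OF assms(1)] assms(2) by simp
 qed
 then obtain f where f: "f : vanishing_ideal Z" "peval v f ~= 0" by blast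
 obtain D where D: "f = (\<Sum>d<D. hcomp d f)" using hcomp_decomp by blast
 have "EX d. peval v (hcomp d f) ~= 0"
 proof (rule ccontr)
  assume "~ ?thesis"
  then have "peval v (\<Sum>d<D. hcomp d f) = 0" by simp
  then show False using f(2) D by simp
 qed
 then obtain d where d: "peval v (hcomp d f) ~= 0" by blast
 have "hcomp d f : vanishing_ideal Z" using g f(1) by (auto simp: graded_def)
 then show ?thesis using that[OF hcomp_homogeneous d] by (auto simp: vanishing_ideal_def vanishes_def)
qed

section \<open>The secant map as an isomorphism of spaces with functions\<close>

abbreviation "hh T \<equiv> secant \<ii> j {T, translate j T}"

lemma hh_point: "T \<in> X ==> v \<in> T ==> hh T = proj_point (mm v)"
 using X_mem[of T v] secant_point by auto

lemma hh_translate: "T : X ==> hh (translate j T) = hh T"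
 using translate_translate[of T] by (simp add: insert_commute)

lemma hh_eq: "T : X ==> Q : X ==> hh T = hh Q ==> Q = T | Q = translate j T"
proof -
 assume PQ: "T : X" "Q : X" "hh T = hh Q"
 obtain v w where v: "T = proj_point v" "v ~= 0" "onX v" "Q = proj_point w" "w ~= 0" "onX w" using PQ by (auto simp: X_eq)
 then show ?thesis using mm_inj[of v w] PQ(3) hh_point[OF PQ(1)] hh_point[OF PQ(2)] proj_point_self translate_point by metis
qed

lemma hh_image: "hh ` X = Y"
proof
 show "hh ` X \<subseteq> Y"
 proof
  fix Q assume "Q : hh ` X"
  then obtain T where T: "T : X" "Q = hh T" by blast
  obtain v where v: "T = proj_point v" "v ~= 0" "onX v" using T by (auto simp: X_eq)
  then show "Q : Y" using mm_in_Y hh_point[OF T(1)] T(2) proj_point_self by metis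
 qed
 show "Y \<subseteq> hh ` X"
 proof
  fix Q assume Q: "Q : Y"
  then obtain w where w: "Q = proj_point w" "w ~= 0" by (auto simp: Y_def zeros_def proj_space_def split: if_splits)
  obtain v where v: "onX v" "v ~= 0" "proj_point (mm v) = proj_point w" using mm_onto w Q by metis
  then have "proj_point v : X" by (auto simp: X_eq)
  then show "Q : hh ` X" using hh_point[of "proj_point v" v] proj_point_self v(3) w(1) by (intro image_eqI[of _ _ "proj_point v"]) auto
 qed
qed

lemma pull_back: "peval v (psubst Mp f) = peval (mm v) f"
proof -
 have "(\<chi> e. peval v (Mp e)) = mm v" by (simp add: peval_Mp)
 then show ?thesis by (simp only: peval_psubst)
qed

lemma homogeneous_pull: "homogeneous d f ==> homogeneous (2 * d) (psubst Mp f)"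
proof -
 assume f: "homogeneous d f"
 have pr: "homogeneous (\<Sum>x\<in>S1. 2 * Poly_Mapping.lookup m x) (\<Prod>x\<in>S1. Mp x ^ Poly_Mapping.lookup m x)" if "finite S1" for S1 m
  using that
 proof induction
  case (insert x S1)
  have "homogeneous (2 * Poly_Mapping.lookup m x) (Mp x ^ Poly_Mapping.lookup m x)" using homogeneous_power[OF homogeneous_Mp, of "Poly_Mapping.lookup m x" x] by (simp add: mult.commute)
  then show ?case using homogeneous_mult[OF _ insert.IH] insert by simp
 qed (simp add: homogeneous_iff)
 have "homogeneous (2 * d) (Const (Poly_Mapping.lookup f m) * mval Mp m)" if "m : Poly_Mapping.keys f" for m
 proof -
  have h: "homogeneous (\<Sum>x\<in>Poly_Mapping.keys m. 2 * Poly_Mapping.lookup m x) (mval Mp m)" unfolding mval_def by (rule pr) simp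
  have "(\<Sum>x\<in>Poly_Mapping.keys m. 2 * Poly_Mapping.lookup m x) = 2 * d"
   using f that by (simp add: homogeneous_iff mdeg_def sum_distrib_left[symmetric])
  then show ?thesis using homogeneous_Const_mult[OF h] by simp
 qed
 then show ?thesis unfolding psubst_def aeval_def mval_def[symmetric] by (intro homogeneous_sum) (simp add: mval_def)
qed

lemma open_pull:
 assumes "zariski_open_in Y D"
 shows "zariski_open_in X {T \<in> X. hh T : D}"
proof -
 obtain Z where Z: "zariski_closed Z" "D = Y - Z" using assms by (auto simp: zariski_open_in_def)
 then obtain F where F: "Z = zeros F" by (auto simp: zariski_closed_def)
 have "hh T : Z \<longleftrightarrow> T : zeros (psubst Mp ` vanishing_ideal Z)" if T: "T : X" for T
 proof -
  obtain v where v: "T = proj_point v" "v ~= 0" "onX v" using T by (auto simp: X_eq)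
  have h: "hh T = proj_point (mm v)" using hh_point[OF T] v proj_point_self by metis
  have m0: "mm v ~= 0" using mm_nonzero v by blast
  have g: "graded (vanishing_ideal Z)" using vanishing_graded zariski_closed_sub Z(1) by blast
  have "hh T : Z \<longleftrightarrow> (\<forall>f\<in>vanishing_ideal Z. peval (mm v) f = 0)"
  proof
   assume "hh T : Z"
   then show "\<forall>f\<in>vanishing_ideal Z. peval (mm v) f = 0" using h proj_point_self[of "mm v"] by (auto simp: vanishing_ideal_def vanishes_def)
  next
   assume "\<forall>f\<in>vanishing_ideal Z. peval (mm v) f = 0"
   then have "hh T : zeros (vanishing_ideal Z)" unfolding zeros_graded[OF g] h using m0 by blast
   then show "hh T : Z" using zeros_vanishing[OF Z(1)] by simp
  qed
  moreover have "T : zeros (psubst Mp ` vanishing_ideal Z) \<longleftrightarrow> (\<forall>f\<in>vanishing_ideal Z. peval (mm v) f = 0)"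
  proof
   assume "T : zeros (psubst Mp ` vanishing_ideal Z)"
   then show "\<forall>f\<in>vanishing_ideal Z. peval (mm v) f = 0" using v proj_point_self[of v] by (auto simp: zeros_def vanishes_def pull_back)
  next
   assume a: "\<forall>f\<in>vanishing_ideal Z. peval (mm v) f = 0"
   have "peval (mm (c *s v)) f = 0" if "f : vanishing_ideal Z" for c f
    unfolding mm_scale using graded_scale[OF g, of "mm v" f "c^2"] a that by blast
   then show "T : zeros (psubst Mp ` vanishing_ideal Z)" using v T by (auto simp: zeros_def vanishes_def pull_back proj_point_mem proj_space_def)
  qed
  ultimately show ?thesis by blast
 qed
 then have "{T \<in> X. hh T : D} = X - zeros (psubst Mp ` vanishing_ideal Z)"
  unfolding Z(2) using hh_image by blast
 then show ?thesis using zariski_closed_zeros unfolding zariski_open_in_def by blast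
qed

text \<open>\<open>t\<close> vanishes at the translate of \<open>v\<close>, so symmetrising
  \<open>s*t\<close> cannot cancel its value at \<open>v\<close>; its degree fills up to a multiple
  of four.\<close>

lemma descend_at:
 assumes v: "onX v" "v ~= 0" and s: "homogeneous d s" "peval v s ~= 0"
 obtains n t S where "homogeneous (4 * n) (s * t)" "peval v (s * t) ~= 0" "peval (tv v) (s * t) = 0"
  "homogeneous (4 * n - d) t" "d <= 4 * n"
proof -
 obtain t where t: "homogeneous 1 t" "peval v t ~= 0" "peval (tv v) t = 0" using separating_form[OF v] by blast
 define e where "e = 4 * (d + 1) - d"
 have e: "e > 0" "d + e = 4 * (d + 1)" by (simp_all add: e_def)
 have te: "homogeneous e (t ^ e)" using homogeneous_power[OF t(1), of e] by simp
 show ?thesis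
 proof (rule that[of "d + 1" "t ^ e"])
  show "homogeneous (4 * (d + 1)) (s * t ^ e)" using homogeneous_mult[OF s(1) te] e by simp
  show "peval v (s * t ^ e) ~= 0" "peval (tv v) (s * t ^ e) = 0" using s t e by simp_all
  show "homogeneous (4 * (d + 1) - d) (t ^ e)" using te by (simp add: e_def)
 qed simp
qed

text \<open>The complement of the image is cut out by the forms vanishing on the image of the
  complement. A point of the image is separated by a form that vanishes on the complement,
  multiplied by \<open>t\<close> and symmetrised.\<close>

lemma open_push:
 assumes V: "zariski_open_in X V" and inv: "!!T. T : V ==> translate j T : V"
 shows "zariski_open_in Y (hh ` V)"
proof -
 obtain Z where Z: "zariski_closed Z" "V = X - Z" using V by (auto simp: zariski_open_in_def)
 have invC: "translate j T : X - V" if "T : X - V" for T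
  using that inv[of "translate j T"] translate_translate[of T] translate_X[of T] by auto
 let ?G = "{G. \<forall>T\<in>X - V. \<forall>v\<in>T. peval (mm v) G = 0}"
 have "hh ` V = Y - zeros ?G"
 proof (intro equalityI subsetI)
  fix Q assume "Q : hh ` V"
  then obtain T where T: "T : V" "Q = hh T" by blast
  have PX: "T : X" using T Z by blast
  obtain v where v: "T = proj_point v" "v ~= 0" "onX v" using PX by (auto simp: X_eq)
  obtain d s where s: "homogeneous d s" "peval v s ~= 0" "!!Q w. Q : Z ==> w : Q ==> peval w s = 0"
   using closed_form[OF Z(1), of v] T Z v by blast
  obtain n t where t: "homogeneous (4 * n) (s * t)" "peval v (s * t) ~= 0" "peval (tv v) (s * t) = 0" using descend_at[OF v(3,2) s(1,2)] by metis
  obtain G where G: "homogeneous (2 * n) G" "!!v. onX v ==> peval v (s * t) + peval (tv v) (s * t) = peval (mm v) G"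
   using desc_invariant[OF t(1)] unfolding desc_def by blast
  have "G : ?G"
  proof (intro CollectI ballI)
   fix T w assume T: "T : X - V" "w : T"
   then have w: "onX w" using X_mem by blast
   have "T : Z" "translate j T : Z" using T invC[of T] Z(2) by auto
   then have "peval w s = 0" "peval (tv w) s = 0" using s(3) T translate_mem by auto
   then show "peval (mm w) G = 0" using G(2)[OF w] by simp
  qed
  moreover have "peval (mm v) G ~= 0" using G(2)[OF v(3)] t(2,3) by (metis add.right_neutral)
  moreover have "mm v : Q" using hh_point[OF PX] v(1) T(2) proj_point_self by metis
  ultimately have "Q ~: zeros ?G" by (auto simp: zeros_def vanishes_def)
  then show "Q : Y - zeros ?G" using hh_image PX T(2) by blast
 next
  fix Q assume Q: "Q : Y - zeros ?G"
  then obtain T where T: "T : X" "Q = hh T" using hh_image by blast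
  show "Q : hh ` V"
  proof (rule ccontr)
   assume "Q ~: hh ` V"
   then have PV: "T : X - V" using T by blast
   obtain v where v: "T = proj_point v" "v ~= 0" "onX v" using T by (auto simp: X_eq)
   have "peval w G = 0" if Gw: "G : ?G" "w : Q" for G w
   proof -
    have "v : T" using v(1) proj_point_self by simp
    then have "hh T = proj_point (mm v)" by (rule hh_point[OF T(1)])
    then have "w : proj_point (mm v)" using Gw(2) T(2) by simp
    then obtain c where c: "c ~= 0" "w = c *s mm v" unfolding proj_point_mem by blast
    \<comment> \<open>\<open>mm\<close> is quadratic, so the scalar \<open>c\<close> is realised by
      scaling \<open>v\<close> with a square root of it.\<close>
    obtain b where b: "b^2 = c" using nth_root_exists[of 2 c] by auto
    then have "b *s v : T" using v c by (auto simp: proj_point_mem)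
    then have "peval (mm (b *s v)) G = 0" using Gw(1) PV by blast
    then show ?thesis by (simp add: mm_scale b c)
   qed
   moreover have "Q : proj_space" using Q by (auto simp: Y_def zeros_def split: if_splits)
   ultimately show False using Q by (auto simp: zeros_def vanishes_def)
  qed
 qed
 then show ?thesis using zariski_closed_zeros unfolding zariski_open_in_def by blast
qed

text \<open>Upwards, representations are composed with \<open>Mp\<close>. Downwards, numerator and
  denominator are multiplied by a form that vanishes outside the local neighbourhood and then
  symmetrised; the resulting identity between \<open>f * H\<close> and \<open>G\<close> therefore
  holds on all of \<open>V\<close>.\<close>

lemma regular_iff:
 assumes V: "zariski_open_in X V" and inv: "!!T. T : V ==> translate j T : V"
 shows "f : regular (variety Y) (hh ` V) \<longleftrightarrow> (%T. f (hh T)) : regular (variety X) V"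
proof
 have VX: "V \<subseteq> X" using V by (auto simp: zariski_open_in_def)
 assume f: "f : regular (variety Y) (hh ` V)"
 show "(%T. f (hh T)) : regular (variety X) V"
  unfolding variety_def fspace.simps mem_Collect_eq
 proof
  fix T assume T: "T : V"
  then have "hh T : hh ` V" by blast
  then obtain D g h d where D: "zariski_open_in Y D" "hh T : D" "D \<subseteq> hh ` V" "homogeneous d g" "homogeneous d h"
   "\<forall>Q\<in>D. \<forall>v\<in>Q. peval v h ~= 0 & f Q = peval v g / peval v h"
   using f unfolding variety_def fspace.simps mem_Collect_eq by meson
  let ?V = "{T \<in> X. hh T : D}"
  have "?V \<subseteq> V"
  proof
   fix Q assume Q: "Q : ?V"
   then obtain T' where T': "T' : V" "hh T' = hh Q" using D(3) by (metis (no_types, lifting) imageE mem_Collect_eq subsetD)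
   then have "Q = T' | Q = translate j T'" using hh_eq[of T' Q] VX Q by auto
   then show "Q : V" using inv T' by auto
  qed
  moreover have "\<forall>Q\<in>?V. \<forall>v\<in>Q. peval v (psubst Mp h) ~= 0 & f (hh Q) = peval v (psubst Mp g) / peval v (psubst Mp h)"
  proof (intro ballI)
   fix Q v assume Q: "Q : ?V" "v : Q"
   then have "hh Q = proj_point (mm v)" using hh_point by blast
   then have "mm v : hh Q" using proj_point_self by metis
   then show "peval v (psubst Mp h) ~= 0 & f (hh Q) = peval v (psubst Mp g) / peval v (psubst Mp h)"
    unfolding pull_back using D(6) Q by blast
  qed
  ultimately show "EX V' g h d. zariski_open_in X V' & T : V' & V' \<subseteq> V & homogeneous d g & homogeneous d h &
   (\<forall>Q\<in>V'. \<forall>v\<in>Q. peval v h ~= 0 & f (hh Q) = peval v g / peval v h)"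
   using open_pull[OF D(1)] T VX D(2) homogeneous_pull[OF D(4)] homogeneous_pull[OF D(5)]
   by (intro exI[of _ ?V] exI[of _ "psubst Mp g"] exI[of _ "psubst Mp h"] exI[of _ "2 * d"]) auto
 qed
next
 have VX: "V \<subseteq> X" using V by (auto simp: zariski_open_in_def)
 assume f: "(%T. f (hh T)) : regular (variety X) V"
 show "f : regular (variety Y) (hh ` V)"
  unfolding variety_def fspace.simps mem_Collect_eq
 proof
  fix Q assume "Q : hh ` V"
  then obtain T where T: "T : V" "Q = hh T" by blast
  then have PX: "T : X" using VX by blast
  obtain v where v: "T = proj_point v" "v ~= 0" "onX v" using PX by (auto simp: X_eq)
  have vP: "v : T" using v proj_point_self by simp
  obtain V' g h d where D: "zariski_open_in X V'" "T : V'" "V' \<subseteq> V" "homogeneous d g" "homogeneous d h"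
   "\<forall>Q\<in>V'. \<forall>v\<in>Q. peval v h ~= 0 & f (hh Q) = peval v g / peval v h"
   using f T(1) unfolding variety_def fspace.simps mem_Collect_eq by blast
  obtain Z where Z: "zariski_closed Z" "V' = X - Z" using D(1) by (auto simp: zariski_open_in_def)
  obtain e s where s: "homogeneous e s" "peval v s ~= 0" "!!Q w. Q : Z ==> w : Q ==> peval w s = 0"
   using closed_form[OF Z(1), of v] D(2) Z(2) v by blast
  have sh: "homogeneous (e + d) (s * h)" "homogeneous (e + d) (s * g)" using homogeneous_mult s(1) D(4,5) by blast+
  have "peval v (s * h) ~= 0" using s(2) D(2,6) vP by auto
  then obtain n t where t: "homogeneous (4 * n) (s * h * t)" "peval v (s * h * t) ~= 0" "peval (tv v) (s * h * t) = 0" "homogeneous (4 * n - (e + d)) t" "e + d <= 4 * n"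
   using descend_at[OF v(3,2) sh(1)] by metis
  have tg: "homogeneous (4 * n) (s * g * t)" using homogeneous_mult[OF sh(2) t(4)] t(5) by simp
  obtain H where H: "homogeneous (2 * n) H" "!!v. onX v ==> peval v (s * h * t) + peval (tv v) (s * h * t) = peval (mm v) H"
   using desc_invariant[OF t(1)] unfolding desc_def by blast
  obtain G where G: "homogeneous (2 * n) G" "!!v. onX v ==> peval v (s * g * t) + peval (tv v) (s * g * t) = peval (mm v) G"
   using desc_invariant[OF tg] unfolding desc_def by blast
  have one: "f (hh R) * peval w (s * h * t) = peval w (s * g * t)" if R: "R : V" "w : R" for R w
  proof (cases "R : V'")
   case True
   then have "peval w h ~= 0" "f (hh R) = peval w g / peval w h" using D(6) R by blast+
   then show ?thesis by simp
  next
   case False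
   then have "R : Z" using Z(2) R VX by blast
   then have "peval w s = 0" using s(3) R by blast
   then show ?thesis by simp
  qed
  have both: "f (hh R) * peval (mm w) H = peval (mm w) G" if R: "R : V" "w : R" for R w
  proof -
   have RX: "R : X" "onX w" using R VX X_mem by blast+
   have "f (hh R) * peval (tv w) (s * h * t) = peval (tv w) (s * g * t)"
    using one[OF inv[OF R(1)] translate_mem[OF RX(1) R(2)]] hh_translate[OF RX(1)] by simp
   then show ?thesis using one[OF R] unfolding H(2)[OF RX(2), symmetric] G(2)[OF RX(2), symmetric] by (simp only: distrib_left)
  qed
  \<comment> \<open>The image of \<open>V\<close> is open by \<open>open_push\<close>; removing the
    zeros of \<open>H\<close> keeps it open and makes the denominator nonzero.\<close>
  let ?D = "hh ` V Int (Y - zeros {H})"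
  have vH: "peval (mm v) H ~= 0" using H(2)[OF v(3)] t(2,3) by (metis add_cancel_left_left)
  have "zariski_open_in Y ?D"
  proof -
   obtain Z' where "zariski_closed Z'" "hh ` V = Y - Z'" using open_push[OF V inv] by (auto simp: zariski_open_in_def)
   then have "?D = Y - (Z' Un zeros {H})" "zariski_closed (Z' Un zeros {H})" using zariski_closed_Un[OF _ zariski_closed_zeros] by auto
   then show ?thesis unfolding zariski_open_in_def by blast
  qed
  moreover have "Q : ?D"
  proof -
   have "mm v : Q" using hh_point[OF PX vP] T(2) proj_point_self by metis
   then have "Q ~: zeros {H}" using vH by (auto simp: zeros_def vanishes_def)
   then show ?thesis using T hh_image VX by blast
  qed
  moreover have "peval x H ~= 0 & f R = peval x G / peval x H" if R: "R : ?D" "x : R" for R x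
  proof -
   obtain S where S: "S : V" "R = hh S" using R by blast
   have SX: "S : X" using S VX by blast
   obtain w where w: "S = proj_point w" "w ~= 0" "onX w" using SX by (auto simp: X_eq)
   have Rw: "R = proj_point (mm w)" using hh_point[OF SX] w(1) S(2) proj_point_self by metis
   obtain c where c: "c ~= 0" "x = c *s mm w" using R(2) Rw by (auto simp: proj_point_mem)
   have "peval (mm w) H ~= 0"
   proof
    assume "peval (mm w) H = 0"
    then have "R : zeros {H}" using mm_nonzero[OF w(3,2)] by (auto simp: zeros_def vanishes_def Rw proj_space_def proj_point_mem peval_scale[OF H(1)])
    then show False using R by blast
   qed
   moreover have "f R * peval (mm w) H = peval (mm w) G" using both[OF S(1)] w(1) proj_point_self S(2) by blast
   ultimately show ?thesis unfolding c(2) peval_scale[OF H(1)] peval_scale[OF G(1)] using c(1) by (simp add: field_simps)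
  qed
  ultimately show "EX D g h d. zariski_open_in Y D & Q : D & D \<subseteq> hh ` V & homogeneous d g & homogeneous d h &
   (\<forall>R\<in>D. \<forall>v\<in>R. peval v h ~= 0 & f R = peval v g / peval v h)"
   using H(1) G(1) by (intro exI[of _ ?D] exI[of _ G] exI[of _ H] exI[of _ "2 * n"]) auto
 qed
qed

lemma points_E_mod: "points (E_mod \<beta> \<gamma> j) = (%T. {T, translate j T}) ` X"
 by (simp add: E_mod_def quotient_def variety_def)

lemma E_curve_eq: "E_curve \<beta> \<gamma> \<ii> j = Y"
 unfolding E_curve_def points_E_mod image_image by (rule hh_image)

lemma secant_iso: "fspace_iso (E_mod \<beta> \<gamma> j) (variety (E_curve \<beta> \<gamma> \<ii> j)) (secant \<ii> j)"
proof -
 let ?o = "%T. {T, translate j T}"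
 have inv: "translate j T \<in> \<Union>U" "T \<in> X" if U: "U \<subseteq> ?o ` X" "T \<in> \<Union>U" for U T
 proof -
  obtain R where R: "R \<in> X" "?o R \<in> U" "T \<in> ?o R" using U by blast
  then show "translate j T : \<Union>U" "T \<in> X" using translate_translate[of R] translate_X[of R] by auto
 qed
 have im: "secant \<ii> j ` U = hh ` \<Union>U" if U: "U \<subseteq> ?o ` X" for U
 proof (intro equalityI subsetI)
  fix Q assume "Q : secant \<ii> j ` U"
  then obtain R where "R : X" "?o R : U" "Q = hh R" using U by blast
  then show "Q : hh ` \<Union>U" by blast
 next
  fix Q assume "Q \<in> hh ` \<Union>U"
  then obtain T O' where T: "Q = hh T" "T \<in> O'" "O' \<in> U" by blast
  obtain R where R: "R : X" "O' = ?o R" using T U by blast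
  then have "hh T = hh R" using T hh_translate[OF R(1)] by auto
  then show "Q : secant \<ii> j ` U" using T R by blast
 qed
 have bij: "bij_betw (secant \<ii> j) (?o ` X) Y"
 proof (rule bij_betwI')
  show "secant \<ii> j S1 = secant \<ii> j S2 \<longleftrightarrow> S1 = S2" if S12: "S1 : ?o ` X" "S2 : ?o ` X" for S1 S2
  proof
   assume e: "secant \<ii> j S1 = secant \<ii> j S2"
   obtain T Q where PQ: "T : X" "Q : X" "S1 = ?o T" "S2 = ?o Q" using S12 by blast
   then have "Q = T | Q = translate j T" using hh_eq e by blast
   then show "S1 = S2" using PQ translate_translate[of T] by auto
  qed simp
  show "secant \<ii> j S1 : Y" if "S1 : ?o ` X" for S1 using that hh_image by blast
  show "\<exists>S1\<in>?o ` X. Q = secant \<ii> j S1" if QY: "Q : Y" for Q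
  proof -
   have "Q : hh ` X" using QY hh_image by simp
   then obtain T where "T : X" "Q = hh T" by (rule imageE)
   then show ?thesis by blast
  qed
 qed
 \<comment> \<open>Unions of orbits are full preimages, so openness can be transported in both
   directions.\<close>
 have fib: "\<Union>U = {T \<in> X. hh T : hh ` \<Union>U}" if U: "U \<subseteq> ?o ` X" for U
 proof (intro equalityI subsetI)
  fix T assume "T : \<Union>U"
  then show "T \<in> {T \<in> X. hh T : hh ` \<Union>U}" using inv[OF U] by blast
 next
  fix T assume T: "T \<in> {T \<in> X. hh T : hh ` \<Union>U}"
  then obtain R where R: "R \<in> \<Union>U" "hh R = hh T" by auto
  then have "T = R | T = translate j R" using hh_eq[of R T] inv[OF U R(1)] T by blast
  then show "T : \<Union>U" using R inv[OF U R(1)] by blast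
 qed
 have op: "zariski_open_in X (\<Union>U) \<longleftrightarrow> zariski_open_in Y (secant \<ii> j ` U)" if U: "U \<subseteq> ?o ` X" for U
 proof
  assume "zariski_open_in X (\<Union>U)"
  then show "zariski_open_in Y (secant \<ii> j ` U)" unfolding im[OF U] by (rule open_push) (rule inv(1)[OF U])
 next
  assume "zariski_open_in Y (secant \<ii> j ` U)"
  from open_pull[OF this] show "zariski_open_in X (\<Union>U)" unfolding im[OF U] fib[OF U, symmetric] .
 qed
 show ?thesis unfolding E_curve_eq fspace_iso_def points_E_mod
 proof (intro conjI allI impI ballI)
  show "bij_betw (secant \<ii> j) (?o ` X) (points (variety Y))" using bij by (simp add: variety_def)
  show "U : opens (E_mod \<beta> \<gamma> j) \<longleftrightarrow> secant \<ii> j ` U : opens (variety Y)" if U: "U \<subseteq> ?o ` X" for U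
   using op[OF U] U by (simp add: E_mod_def quotient_def variety_def)
  fix U f assume "U : opens (E_mod \<beta> \<gamma> j)"
  then have U: "U \<subseteq> ?o ` X" "zariski_open_in X (\<Union>U)" by (simp_all add: E_mod_def quotient_def variety_def)
  have "f \<in> regular (variety Y) (hh ` \<Union>U) \<longleftrightarrow> (%T. f (hh T)) : regular (variety X) (\<Union>U)"
   by (rule regular_iff[OF U(2)]) (rule inv(1)[OF U(1)])
  then show "f : regular (variety Y) (secant \<ii> j ` U) \<longleftrightarrow> f \<circ> secant \<ii> j : regular (E_mod \<beta> \<gamma> j) U"
   unfolding im[OF U(1)] by (simp add: E_mod_def quotient_def)
 qed
qed

end

section \<open>The theorem\<close>

context lines
begin

text \<open>With \<open>v2 = - z13\<close> the second equation of the plane changes sign, which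
  leaves the ideal unchanged.\<close>

lemma C_conic_eq: "c : {0, 1, 2, 3} ==> C_conic \<alpha> \<beta> \<gamma> c = K c"
proof -
 let ?g = "Var Z01 * Var Z23 - Var Z02 * Var Z13 + Var Z03 * Var Z12 :: (pl, 'k) mpoly"
 have P: "P = ?g" by (simp add: P_def)
 have u: "ideal_gen (ideal_gen {?g} Un S) = ideal_gen (insert ?g S)" for S
 proof
  show "ideal_gen (ideal_gen {?g} Un S) \<subseteq> ideal_gen (insert ?g S)"
   using ideal_gen_minimal[of "ideal_gen (insert ?g S)" "{?g}"] by (intro ideal_gen_minimal) (auto intro: ideal_gen_base)
  show "ideal_gen (insert ?g S) \<subseteq> ideal_gen (ideal_gen {?g} Un S)"
   by (intro ideal_gen_minimal) (auto intro: ideal_gen_base)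
 qed
 have p: "ideal_gen (insert ?g (plane a b e)) = ideal_gen {Var Z23 - Const a * Var Z01, - Var Z13 - Const (- b) * Var Z02, Var Z12 - Const e * Var Z03, P}" for a b e
 proof
  let ?L = "ideal_gen (insert ?g (plane a b e))" and ?R = "ideal_gen {Var Z23 - Const a * Var Z01, - Var Z13 - Const (- b) * Var Z02, Var Z12 - Const e * Var Z03, P}"
  have m: "- Var Z13 - Const (- b) * Var Z02 = - (Var Z13 - Const b * Var Z02 :: (pl, 'k) mpoly)" by (simp add: Const_simps)
  have gL: "?g : ?L" "Var Z23 - Const a * Var Z01 : ?L" "Var Z13 - Const b * Var Z02 : ?L" "Var Z12 - Const e * Var Z03 : ?L"
   by (simp_all add: plane_def ideal_gen_base)
  have gR: "P : ?R" "Var Z23 - Const a * Var Z01 : ?R" "- Var Z13 - Const (- b) * Var Z02 : ?R" "Var Z12 - Const e * Var Z03 : ?R"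
   by (simp_all add: ideal_gen_base)
  have "Var Z13 - Const b * Var Z02 : ?R" using ideal_genD(5)[OF gR(3)] unfolding m minus_minus .
  then show "?L \<subseteq> ?R" using gR P unfolding plane_def by (intro ideal_gen_minimal is_ideal_ideal_gen) auto
  have "- Var Z13 - Const (- b) * Var Z02 : ?L" unfolding m by (rule ideal_genD(5)[OF gL(3)])
  then show "?R \<subseteq> ?L" using gL unfolding P by (intro ideal_gen_minimal is_ideal_ideal_gen) auto
 qed
 assume "c : {0, 1, 2, 3}"
 then show ?thesis
  unfolding C_conic_def grassmannian_def u K_def A_def B_def W_def by (auto simp: p slope_defs)
qed

lemma E_curve_zeros:
 assumes "\<ii>^2 = - 1" "j : {1, 2, 3}"
 shows "E_curve \<beta> \<gamma> \<ii> j = zeros (if j = 1 then E1 else if j = 2 then E2 else E3)"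
  "fspace_iso (E_mod \<beta> \<gamma> j) (variety (E_curve \<beta> \<gamma> \<ii> j)) (secant \<ii> j)"
proof -
 obtain k l :: 4 where "(j, k, l) : {(1, 2, 3), (2, 1, 3), (3, 1, 2)}" using assms(2) by auto
 then interpret secants \<alpha> \<beta> \<gamma> \<ii> j k l using assms(1) by unfold_locales auto
 show "E_curve \<beta> \<gamma> \<ii> j = zeros (if j = 1 then E1 else if j = 2 then E2 else E3)" using E_curve_eq by (simp add: Y_def)
 show "fspace_iso (E_mod \<beta> \<gamma> j) (variety (E_curve \<beta> \<gamma> \<ii> j)) (secant \<ii> j)" by (rule secant_iso)
qed

lemma grassmannian_J: "grassmannian \<subseteq> JE Int JC"
proof -
 let ?g = "Var Z01 * Var Z23 - Var Z02 * Var Z13 + Var Z03 * Var Z12 :: (pl, 'k) mpoly"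
 have P: "P = ?g" by (simp add: P_def)
 have "P : JE Int JC" by (simp add: JE_def JC_def E1_def E2_def E3_def K_def ideal_gen_base)
 then show ?thesis unfolding grassmannian_def P[symmetric] by (intro ideal_gen_minimal niceD(1)[OF J_nice]) simp
qed

lemma main:
 assumes ii: "\<ii>\<^sup>2 = -1"
 shows
  "subscheme (line_scheme \<alpha> \<beta> \<gamma>) grassmannian &
  reduced_scheme (line_scheme \<alpha> \<beta> \<gamma>) &
  is_curve (line_scheme \<alpha> \<beta> \<gamma>) &
  scheme_degree (line_scheme \<alpha> \<beta> \<gamma>) = 20 &
  same_subscheme (line_scheme \<alpha> \<beta> \<gamma>)
   ((\<Inter>j\<in>{1, 2, 3}. vanishing_ideal (E_curve \<beta> \<gamma> \<ii> j)) Int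
    (\<Inter>i\<in>{0, 1, 2, 3}. C_conic \<alpha> \<beta> \<gamma> i)) &
  (\<forall>j\<in>{1, 2, 3}.
    elliptic_curve (E_curve \<beta> \<gamma> \<ii> j) &
    scheme_degree (vanishing_ideal (E_curve \<beta> \<gamma> \<ii> j)) = 4 &
    fspace_iso (E_mod \<beta> \<gamma> j) (variety (E_curve \<beta> \<gamma> \<ii> j)) (secant \<ii> j)) &
  disjoint_family_on (E_curve \<beta> \<gamma> \<ii>) {1, 2, 3} &
  (\<forall>i\<in>{0, 1, 2, 3}. plane_conic (C_conic \<alpha> \<beta> \<gamma> i)) &
  disjoint_family_on (%i. zeros (C_conic \<alpha> \<beta> \<gamma> i)) {0, 1, 2, 3} &
  (\<forall>i\<in>{0, 1, 2, 3}. \<forall>j\<in>{1, 2, 3}.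
    card (zeros (C_conic \<alpha> \<beta> \<gamma> i) Int E_curve \<beta> \<gamma> \<ii> j) = 2)"
proof -
 have C6: "CARD(pl) = 6" by (simp add: UNIV_pl)
 have E: "E_curve \<beta> \<gamma> \<ii> 1 = zeros E1" "E_curve \<beta> \<gamma> \<ii> 2 = zeros E2" "E_curve \<beta> \<gamma> \<ii> 3 = zeros E3"
  using E_curve_zeros(1)[OF ii] by simp_all
 have iso: "fspace_iso (E_mod \<beta> \<gamma> j) (variety (E_curve \<beta> \<gamma> \<ii> j)) (secant \<ii> j)" if "j : {1, 2, 3}" for j
  by (rule E_curve_zeros(2)[OF ii that])
 have C: "C_conic \<alpha> \<beta> \<gamma> 0 = K 0" "C_conic \<alpha> \<beta> \<gamma> 1 = K 1" "C_conic \<alpha> \<beta> \<gamma> 2 = K 2" "C_conic \<alpha> \<beta> \<gamma> 3 = K 3"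
  by (simp_all add: C_conic_eq)
 have V: "vanishing_ideal (zeros E1) = E1" "vanishing_ideal (zeros E2) = E2" "vanishing_ideal (zeros E3) = E3"
  using nice_vanishing E1_nice E2_nice E3_nice by blast+
 have J: "(\<Inter>j\<in>{1, 2, 3}. vanishing_ideal (E_curve \<beta> \<gamma> \<ii> j)) Int (\<Inter>i\<in>{0, 1, 2, 3}. C_conic \<alpha> \<beta> \<gamma> i) = JE Int JC"
  by (simp add: E C V JE_def JC_def) blast
 have "saturation grassmannian \<subseteq> saturation (JE Int JC)" using grassmannian_J unfolding saturation_def by blast
 then have 1: "subscheme (JE Int JC) grassmannian" by (simp add: subscheme_def)
 have 2: "disjoint_family_on (E_curve \<beta> \<gamma> \<ii>) {1, 2, 3}"
  unfolding disjoint_family_on_def using E_disjoint by (auto simp: E)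
 have 3: "disjoint_family_on (%i. zeros (C_conic \<alpha> \<beta> \<gamma> i)) {0, 1, 2, 3}"
  unfolding disjoint_family_on_def using K_disjoint C_conic_eq by metis
 have 4: "elliptic_curve (E_curve \<beta> \<gamma> \<ii> j) & scheme_degree (vanishing_ideal (E_curve \<beta> \<gamma> \<ii> j)) = 4" if "j : {1, 2, 3}" for j
  using that E1_elliptic[OF C6] E2_elliptic[OF C6] E3_elliptic[OF C6] E1_dim(2) E2_dim(2) E3_dim(2) by (auto simp: E V)
 have 5: "plane_conic (C_conic \<alpha> \<beta> \<gamma> i)" if "i : {0, 1, 2, 3}" for i
  using K_plane_conic[OF C6] C_conic_eq[OF that] by simp
 have 7: "same_subscheme (JE Int JC) (JE Int JC)" by (simp add: same_subscheme_def)
 have 6: "card (zeros (C_conic \<alpha> \<beta> \<gamma> i) Int E_curve \<beta> \<gamma> \<ii> j) = 2" if "i : {0, 1, 2, 3}" "j \<in> {1, 2, 3}" for i j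
  using that(2) K_E1_points K_E2_points K_E3_points unfolding C_conic_eq[OF that(1)] by (auto simp: E)
 show ?thesis
  unfolding J line_scheme_eq
  by (intro conjI ballI 1 nice_reduced[OF J_nice] J_is_curve J_degree 7 2 3 5 6 iso conjunct1[OF 4] conjunct2[OF 4])
qed

end

theorem theorem1p1:
  fixes \<alpha> \<beta> \<gamma> \<ii> :: "'k::alg_closed_field"
  assumes "CHAR('k) \<noteq> 2" and "CHAR('k) \<noteq> 3"
    and "\<alpha> \<notin> {0, 1, -1}" and "\<beta> \<notin> {0, 1, -1}" and "\<gamma> \<notin> {0, 1, -1}"
    and "\<alpha> + \<beta> + \<gamma> + \<alpha> * \<beta> * \<gamma> = 0"
    and "\<ii>\<^sup>2 = -1"
  shows
    "subscheme (line_scheme \<alpha> \<beta> \<gamma>) grassmannian \<and>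
     reduced_scheme (line_scheme \<alpha> \<beta> \<gamma>) \<and>
     is_curve (line_scheme \<alpha> \<beta> \<gamma>) \<and>
     scheme_degree (line_scheme \<alpha> \<beta> \<gamma>) = 20 \<and>
     same_subscheme (line_scheme \<alpha> \<beta> \<gamma>)
       ((\<Inter>j\<in>{1, 2, 3}. vanishing_ideal (E_curve \<beta> \<gamma> \<ii> j)) \<inter>
        (\<Inter>i\<in>{0, 1, 2, 3}. C_conic \<alpha> \<beta> \<gamma> i)) \<and>
     (\<forall>j\<in>{1, 2, 3}.
        elliptic_curve (E_curve \<beta> \<gamma> \<ii> j) \<and>
        scheme_degree (vanishing_ideal (E_curve \<beta> \<gamma> \<ii> j)) = 4 \<and>
        fspace_iso (E_mod \<beta> \<gamma> j) (variety (E_curve \<beta> \<gamma> \<ii> j)) (secant \<ii> j)) \<and>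
     disjoint_family_on (E_curve \<beta> \<gamma> \<ii>) {1, 2, 3} \<and>
     (\<forall>i\<in>{0, 1, 2, 3}. plane_conic (C_conic \<alpha> \<beta> \<gamma> i)) \<and>
     disjoint_family_on (\<lambda>i. zeros (C_conic \<alpha> \<beta> \<gamma> i)) {0, 1, 2, 3} \<and>
     (\<forall>i\<in>{0, 1, 2, 3}. \<forall>j\<in>{1, 2, 3}.
        card (zeros (C_conic \<alpha> \<beta> \<gamma> i) \<inter> E_curve \<beta> \<gamma> \<ii> j) = 2)"
proof -
  have "(2 :: 'k) \<noteq> 0"
  proof
    assume "(2 :: 'k) = 0"
    then have "of_nat 2 = (0 :: 'k)" by simp
    then have "CHAR('k) dvd 2" by (simp only: of_nat_eq_0_iff_char_dvd)
    then have "CHAR('k) = 1 \<or> CHAR('k) = 2" using prime_nat_iff two_is_prime_nat by blast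
    then show False using assms(1) CHAR_not_1' by auto
  qed
  then interpret lines \<alpha> \<beta> \<gamma> using assms by unfold_locales auto
  show ?thesis by (rule main[OF assms(7)])
qed

end
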